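(* Let $k>0$ be the wavenumber, $\theta\in(-\pi/2,\pi/2)$, $\alpha=k\sin\theta$, $\beta=k\cos\theta$, $\Lambda>0$, $\alpha_n=\alpha+\frac{2\pi n}{\Lambda}$ for $n\in\mathbb{Z}$, and assume there exists $\varepsilon>0$ such that $|k-\alpha_n|\ge\varepsilon$ for all $n\in\mathbb{Z}$. Fix one sample $\omega_0$, so that the scattering surface is the graph $S$ of the single $\Lambda$-periodic Lipschitz function $f=f(\omega_0;\cdot)$, and let $\tilde u=u(\omega_0)\in H^1_{S,qp}(D)$ be the solution of the deterministic scattering problem $$\Delta\tilde u+k^2\tilde u=0 \text{ in } D,\qquad \tilde u=0\text{ on } S,\qquad \partial_\nu\tilde u=T\tilde u+g\text{ on }\Gamma .$$ Then there exists a constant $C$ independent of $b>1$ and of large $k$ such that $$\|\nabla\tilde u\|_{L^2(D)}+k\|\tilde u\|_{L^2(D)}\le C\max\left\{\frac{b^2k^2}{\sqrt{\varepsilon}},\ b^3k^{5/2}\right\}\|g\|_{L^2(\Gamma)} .$$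
   Context: Geometry: $S=\{x_2=f(x_1),\ x_1\in[0,\Lambda]\}$; $\Gamma=\{x_2=b,\ x_1\in[0,\Lambda]\}$ with $b>\max f$ (and $b>1$); $D=\{f(x_1)<x_2<b,\ x_1\in[0,\Lambda]\}$; $\nu$ is the upward unit normal on $\Gamma$, so $\partial_\nu=\partial_{x_2}$ there. The incident wave is $u^i=e^{i\alpha x_1-i\beta x_2}$ and $\tilde u$ is the total field. Let $\beta_n$ be defined by $\beta_n^2=k^2-\alpha_n^2$, $\operatorname{Im}\beta_n\ge0$ (nonnegative real root if $k>|\alpha_n|$). The transparent boundary operator $T:H^{1/2}(\Gamma)\to H^{-1/2}(\Gamma)$ is $(Tv)(x_1)=\sum_{n\in\mathbb{Z}}i\beta_n v_n e^{i\alpha_n x_1}$ with $v_n=\frac1\Lambda\int_0^\Lambda v(x_1,b)e^{-i\alpha_n x_1}\,dx_1$, and $g(x_1)=\partial_\nu u^i-Tu^i=-2i\beta e^{i\alpha x_1-i\beta b}$. $H^1_{S,qp}(D)$ is the space of $v\in H^1(D)$ with zero trace on $S$ and $v(0,y)=v(\Lambda,y)e^{-i\alpha\Lambda}$. The boundary value problem is understood in the weak sense: $\int_D\nabla \tilde u\cdot\nabla\bar v-k^2\int_D \tilde u\bar v-\int_\Gamma T\tilde u\,\bar v=\int_\Gamma g\bar v$ for all $v\in H^1_{S,qp}(D)$. The number $\varepsilon$ is independent of $k$ and $b$. "Independent of $b>1$ and of large $k$" means that the same $C$ works for all admissible $b>1$ and all sufficiently large $k$ satisfying the condition on $\varepsilon$.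 *)

theory Defs
  imports "HOL-Analysis.Analysis"
begin

section \<open>Square-integrable functions\<close>

text \<open>
  Functions are total and complex valued; only their values on the set \<open>A\<close> matter. A Borel
  representative is used for every \<open>L\<^sup>2\<close> class.
\<close>

definition L2 :: "'a::euclidean_space set \<Rightarrow> ('a \<Rightarrow> complex) \<Rightarrow> bool" where
  "L2 A u \<longleftrightarrow> set_borel_measurable lborel A u \<and> set_integrable lborel A (\<lambda>x. (cmod (u x))\<^sup>2)"

definition L2norm :: "'a::euclidean_space set \<Rightarrow> ('a \<Rightarrow> complex) \<Rightarrow> real" where
  "L2norm A u = sqrt (LINT x:A|lborel. (cmod (u x))\<^sup>2)"

section \<open>The Sobolev space \<open>H\<^sup>1\<close> of an open set in the plane\<close>

definition C1 :: "(real \<times> real \<Rightarrow> complex) \<Rightarrow> bool" where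
  "C1 \<phi> \<longleftrightarrow> (\<forall>x. \<phi> differentiable (at x)) \<and>
             (\<forall>h. continuous_on UNIV (\<lambda>x. frechet_derivative \<phi> (at x) h))"

definition test_fun :: "(real \<times> real) set \<Rightarrow> (real \<times> real \<Rightarrow> complex) \<Rightarrow> bool" where
  "test_fun \<Omega> \<phi> \<longleftrightarrow> C1 \<phi> \<and> compact (closure {x. \<phi> x \<noteq> 0}) \<and> closure {x. \<phi> x \<noteq> 0} \<subseteq> \<Omega>"

text \<open>
  Weak derivative in direction \<open>h\<close>, tested against \<open>C\<^sup>1\<close> functions of compact support in \<open>\<Omega>\<close>
  (as in Gilbarg and Trudinger, Section 7.3).
\<close>

definition has_weak_deriv ::
    "(real \<times> real) set \<Rightarrow> real \<times> real \<Rightarrow> (real \<times> real \<Rightarrow> complex) \<Rightarrow> (real \<times> real \<Rightarrow> complex) \<Rightarrow> bool"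
  where "has_weak_deriv \<Omega> h u w \<longleftrightarrow>
    (\<forall>\<phi>. test_fun \<Omega> \<phi> \<longrightarrow>
      (LINT x:\<Omega>|lborel. u x * frechet_derivative \<phi> (at x) h) = - (LINT x:\<Omega>|lborel. w x * \<phi> x))"

definition H1 :: "(real \<times> real) set \<Rightarrow> (real \<times> real \<Rightarrow> complex) set" where
  "H1 \<Omega> = {u. L2 \<Omega> u \<and> (\<forall>h\<in>{(1, 0), (0, 1)}. \<exists>w. L2 \<Omega> w \<and> has_weak_deriv \<Omega> h u w)}"

text \<open>A representative of the weak derivative, which is unique up to null sets.\<close>

definition weak_deriv ::
    "(real \<times> real) set \<Rightarrow> real \<times> real \<Rightarrow> (real \<times> real \<Rightarrow> complex) \<Rightarrow> real \<times> real \<Rightarrow> complex"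
  where "weak_deriv \<Omega> h u = (SOME w. L2 \<Omega> w \<and> has_weak_deriv \<Omega> h u w)"

definition grad_L2norm :: "(real \<times> real) set \<Rightarrow> (real \<times> real \<Rightarrow> complex) \<Rightarrow> real" where
  "grad_L2norm \<Omega> u =
     sqrt ((L2norm \<Omega> (weak_deriv \<Omega> (1, 0) u))\<^sup>2 + (L2norm \<Omega> (weak_deriv \<Omega> (0, 1) u))\<^sup>2)"

section \<open>Traces\<close>

text \<open>
  The trace operator is the continuous extension to \<open>H\<^sup>1(\<Omega>)\<close> of the restriction of \<open>C\<^sup>1\<close>
  functions to the boundary. So \<open>w\<close> is the trace of \<open>u\<close> on the boundary piece
  \<open>t \<mapsto> \<gamma> t\<close>, \<open>t \<in> I\<close>, if \<open>C\<^sup>1\<close> functions converge to \<open>u\<close> in \<open>H\<^sup>1(\<Omega>)\<close> while their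
  restrictions converge to \<open>w\<close> in \<open>L\<^sup>2\<close> of that piece. The piece carries the measure \<open>dt\<close>: this is
  arc length on straight pieces, and comparable to arc length on a Lipschitz graph
  \<open>\<gamma> t = (t, f t)\<close>.
\<close>

definition has_trace ::
    "(real \<times> real) set \<Rightarrow> (real \<Rightarrow> real \<times> real) \<Rightarrow> real set \<Rightarrow>
     (real \<times> real \<Rightarrow> complex) \<Rightarrow> (real \<Rightarrow> complex) \<Rightarrow> bool"
  where "has_trace \<Omega> \<gamma> I u w \<longleftrightarrow> L2 I w \<and>
    (\<exists>\<phi> :: nat \<Rightarrow> real \<times> real \<Rightarrow> complex. (\<forall>j. C1 (\<phi> j)) \<and>
      (\<lambda>j. L2norm \<Omega> (\<lambda>x. \<phi> j x - u x)) \<longlonglongrightarrow> 0 \<and>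
      (\<forall>h\<in>{(1, 0), (0, 1)}.
        (\<lambda>j. L2norm \<Omega> (\<lambda>x. frechet_derivative (\<phi> j) (at x) h - weak_deriv \<Omega> h u x)) \<longlonglongrightarrow> 0) \<and>
      (\<lambda>j. L2norm I (\<lambda>t. \<phi> j (\<gamma> t) - w t)) \<longlonglongrightarrow> 0)"

definition trace_on ::
    "(real \<times> real) set \<Rightarrow> (real \<Rightarrow> real \<times> real) \<Rightarrow> real set \<Rightarrow>
     (real \<times> real \<Rightarrow> complex) \<Rightarrow> real \<Rightarrow> complex"
  where "trace_on \<Omega> \<gamma> I u = (SOME w. has_trace \<Omega> \<gamma> I u w)"

section \<open>The scattering problem\<close>

text \<open>\<open>H1_S_qp \<Lambda> f b \<alpha>\<close> below is the space \<open>H\<^sup>1\<^sub>S\<^sub>,\<^sub>q\<^sub>p(D)\<close>; \<open>\<Gamma>\<close> is parametrised by \<open>x\<^sub>1\<close>.\<close>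

definition domD :: "real \<Rightarrow> (real \<Rightarrow> real) \<Rightarrow> real \<Rightarrow> (real \<times> real) set" where
  "domD \<Lambda> f b = {(x1, x2). 0 < x1 \<and> x1 < \<Lambda> \<and> f x1 < x2 \<and> x2 < b}"

definition H1_S_qp ::
    "real \<Rightarrow> (real \<Rightarrow> real) \<Rightarrow> real \<Rightarrow> real \<Rightarrow> (real \<times> real \<Rightarrow> complex) set"
  where "H1_S_qp \<Lambda> f b \<alpha> = {v \<in> H1 (domD \<Lambda> f b).
     has_trace (domD \<Lambda> f b) (\<lambda>t. (t, f t)) {0..\<Lambda>} v (\<lambda>_. 0) \<and>
     (\<exists>w. has_trace (domD \<Lambda> f b) (\<lambda>y. (\<Lambda>, y)) {f 0..b} v w \<and>
          has_trace (domD \<Lambda> f b) (\<lambda>y. (0, y)) {f 0..b} v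
            (\<lambda>y. w y * exp (- \<i> * of_real (\<alpha> * \<Lambda>))))}"

definition trace_Gamma ::
    "real \<Rightarrow> (real \<Rightarrow> real) \<Rightarrow> real \<Rightarrow> (real \<times> real \<Rightarrow> complex) \<Rightarrow> real \<Rightarrow> complex"
  where "trace_Gamma \<Lambda> f b = trace_on (domD \<Lambda> f b) (\<lambda>t. (t, b)) {0..\<Lambda>}"

definition alpha_n :: "real \<Rightarrow> real \<Rightarrow> int \<Rightarrow> real" where
  "alpha_n \<Lambda> \<alpha> n = \<alpha> + 2 * pi * of_int n / \<Lambda>"

text \<open>On a negative real, \<^const>\<open>csqrt\<close> is the root with positive imaginary part.\<close>

definition beta_n :: "real \<Rightarrow> real \<Rightarrow> real \<Rightarrow> int \<Rightarrow> complex" where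
  "beta_n k \<Lambda> \<alpha> n = csqrt (of_real (k\<^sup>2 - (alpha_n \<Lambda> \<alpha> n)\<^sup>2))"

definition fourier_coeff :: "real \<Rightarrow> real \<Rightarrow> (real \<Rightarrow> complex) \<Rightarrow> int \<Rightarrow> complex" where
  "fourier_coeff \<Lambda> \<alpha> v n =
     1 / of_real \<Lambda> * (LINT t:{0..\<Lambda>}|lborel. v t * exp (- \<i> * of_real (alpha_n \<Lambda> \<alpha> n * t)))"

text \<open>
  In general \<open>T v\<close> is only an element of \<open>H\<^sup>-\<^sup>1\<^sup>/\<^sup>2(\<Gamma>)\<close>, so a series
  \<open>\<Sum>n. w n * exp (\<i> * \<alpha>\<^sub>n * x\<^sub>1)\<close> in this space is represented by its coefficients \<open>w\<close>. Its duality
  pairing with \<open>v \<in> H\<^sup>1\<^sup>/\<^sup>2(\<Gamma>)\<close>, written \<open>\<integral>\<^sub>\<Gamma> w cnj(v)\<close>, is then given by Parseval's formula.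
\<close>

definition T_op :: "real \<Rightarrow> real \<Rightarrow> real \<Rightarrow> (real \<Rightarrow> complex) \<Rightarrow> int \<Rightarrow> complex" where
  "T_op k \<Lambda> \<alpha> v n = \<i> * beta_n k \<Lambda> \<alpha> n * fourier_coeff \<Lambda> \<alpha> v n"

definition pairing_Gamma ::
    "real \<Rightarrow> real \<Rightarrow> (int \<Rightarrow> complex) \<Rightarrow> (real \<Rightarrow> complex) \<Rightarrow> complex"
  where "pairing_Gamma \<Lambda> \<alpha> w v =
    of_real \<Lambda> * (\<Sum>\<^sub>\<infinity>n\<in>UNIV. w n * cnj (fourier_coeff \<Lambda> \<alpha> v n))"

text \<open>
  This is \<open>\<partial>\<^sub>\<nu>u\<^sup>i - T u\<^sup>i\<close> on \<open>\<Gamma>\<close> for the incident wave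
  \<open>u\<^sup>i = exp (\<i> * \<alpha> * x\<^sub>1 - \<i> * \<beta> * x\<^sub>2)\<close>: the normal derivative is \<open>- \<i> * \<beta> * u\<^sup>i\<close>, and \<open>T u\<^sup>i = \<i> * \<beta> * u\<^sup>i\<close>
  since \<open>\<beta>\<^sub>0 = \<beta>\<close>.
\<close>

definition g_data :: "real \<Rightarrow> real \<Rightarrow> real \<Rightarrow> real \<Rightarrow> complex" where
  "g_data \<alpha> \<beta> b x1 = - 2 * \<i> * of_real \<beta> * exp (\<i> * of_real (\<alpha> * x1) - \<i> * of_real (\<beta> * b))"

definition scattering_solution ::
    "real \<Rightarrow> real \<Rightarrow> real \<Rightarrow> (real \<Rightarrow> real) \<Rightarrow> real \<Rightarrow> (real \<times> real \<Rightarrow> complex) \<Rightarrow> bool"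
  where "scattering_solution k \<theta> \<Lambda> f b u \<longleftrightarrow>
    (let \<alpha> = k * sin \<theta>; \<beta> = k * cos \<theta>; D = domD \<Lambda> f b; tr = trace_Gamma \<Lambda> f b in
     u \<in> H1_S_qp \<Lambda> f b \<alpha> \<and>
     (\<forall>v\<in>H1_S_qp \<Lambda> f b \<alpha>.
        (LINT x:D|lborel. weak_deriv D (1, 0) u x * cnj (weak_deriv D (1, 0) v x)
                        + weak_deriv D (0, 1) u x * cnj (weak_deriv D (0, 1) v x))
        - of_real (k\<^sup>2) * (LINT x:D|lborel. u x * cnj (v x))
        - pairing_Gamma \<Lambda> \<alpha> (T_op k \<Lambda> \<alpha> (tr u)) (tr v)
        = (LINT t:{0..\<Lambda>}|lborel. g_data \<alpha> \<beta> b t * cnj (tr v t))))"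

end

theory Submission
  imports Defs
begin

text \<open>
  Let \<open>U\<close> be the solution \<open>u\<close> extended by zero, \<open>U1\<close> and \<open>U2\<close> its weak derivatives extended by zero,
  \<open>c \<le> 0\<close> a lower bound of \<open>f\<close> and \<open>m < b\<close> an upper bound. The surface is only Lipschitz, so second
  derivatives of \<open>u\<close> near \<open>S\<close> are avoided. Instead, the variational equation is tested with
  \<open>v(x) = p(x\<^sub>2) U(x\<^sub>1, x\<^sub>2 - h)\<close>, where \<open>h \<ge> 0\<close> and \<open>p(b) = 0\<close>. As \<open>S\<close> is a graph and \<open>u\<close> vanishes on it,
  shifting upwards keeps \<open>v\<close> in the test space (\<open>shifted_test_function\<close>), and \<open>v = 0\<close> on \<open>\<Gamma>\<close> removes \<open>T\<close>
  and \<open>g\<close> from the equation.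

  Write \<open>E = |U1|\<^sup>2 + |U2|\<^sup>2 - k\<^sup>2 |U|\<^sup>2\<close>. For \<open>h = 0\<close> one obtains the energy identity
  \<open>\<integral> p E + \<integral> p' U2 cnj(U) = 0\<close>. Comparing the identity for \<open>h > 0\<close> with the one for \<open>h = 0\<close> and dividing by
  \<open>h \<rightarrow> 0\<close> gives the Rellich inequality \<open>2 \<integral> p' |U2|\<^sup>2 \<le> \<integral> p' E\<close> for \<open>p \<ge> 0\<close> with \<open>p(b) = 0\<close>:
  the squared differences of the gradient that appear have a favourable sign, and those of \<open>U\<close> are of order \<open>h\<^sup>2\<close>. It is the
  Rellich identity for the vertical vector field, without its boundary term on \<open>S\<close>, which has a sign
  because \<open>S\<close> is a graph.

  In the rectangle \<open>m < x\<^sub>2 < b\<close> the equation decouples into Fourier modes in \<open>x\<^sub>1\<close>. Testing with single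
  modes shows that each mode satisfies the first order equation \<open>u\<^sub>n' = \<i> \<beta>\<^sub>n u\<^sub>n\<close>, with an extra term
  of modulus \<open>2 \<beta>\<close> for \<open>n = 0\<close> that carries the incident wave (\<open>modes_radiate\<close>). By Parseval this yields,
  for almost every height \<open>y\<close> and with \<open>K(y) = \<integral> U2 cnj(U) dx\<^sub>1\<close>, the inequalities \<open>Im K \<ge> - 2 \<Lambda> \<beta>\<close>,
  \<open>Re K \<le> Im K + 4 \<Lambda> \<beta>\<close> and
  \<open>\<integral> |U2|\<^sup>2 - |U1|\<^sup>2 + k\<^sup>2 |U|\<^sup>2 dx\<^sub>1 \<le> 6 k (Im K + 2 \<Lambda> \<beta>) + 8 \<Lambda> k\<^sup>2\<close> (\<open>strip_inequalities\<close>).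

  Now let \<open>p\<close> decrease from 1 to 0 on \<open>[t, b]\<close> with \<open>t \<ge> m\<close>, so that \<open>q = - p' \<ge> 0\<close> has integral 1. The
  imaginary part of the energy identity says \<open>\<integral> q Im K = 0\<close>: averaged with \<open>q\<close>, the right-hand sides above
  contain nothing but data. The real part then gives \<open>\<integral> p E \<le> 4 \<Lambda> \<beta>\<close>, and the Rellich inequality with
  multiplier \<open>(y - c) p(y)\<close> gives \<open>2 \<integral> p |U2|\<^sup>2 \<le> 4 \<Lambda> \<beta> + 20 \<Lambda> k\<^sup>2 (b - c)\<close> (\<open>ramp_estimates\<close>). Let \<open>t \<rightarrow> b\<close>.
  The Poincare inequality bounds \<open>U\<close> by \<open>U2\<close>, the energy bounds the full gradient, and altogether the
  left-hand side of the theorem is at most a constant times \<open>k\<^sup>2 b\<^sup>3\<close> if \<open>k \<ge> 1\<close>. Since \<open>g\<close> has norm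
  \<open>2 k cos \<theta> sqrt \<Lambda>\<close>, this is at most a constant times \<open>b\<^sup>3 k\<^sup>5\<^sup>/\<^sup>2\<close> times that norm.
\<close>

section \<open>Square-integrable functions and convergence in mean\<close>

text \<open>
  Membership in \<open>L\<^sup>2\<close> of an arbitrary measure space, for genuine functions. All estimates use the squared
  norm, which is additive over disjoint supports and compatible with Fubini.
\<close>

definition sq_int :: "'a measure \<Rightarrow> ('a \<Rightarrow> complex) \<Rightarrow> bool" where
  "sq_int M f \<longleftrightarrow> f \<in> borel_measurable M \<and> integrable M (\<lambda>x. (cmod (f x))\<^sup>2)"

definition sq_norm :: "'a measure \<Rightarrow> ('a \<Rightarrow> complex) \<Rightarrow> real" where
  "sq_norm M f = (LINT x|M. (cmod (f x))\<^sup>2)"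

definition L2_lim :: "'a measure \<Rightarrow> (nat \<Rightarrow> 'a \<Rightarrow> complex) \<Rightarrow> ('a \<Rightarrow> complex) \<Rightarrow> bool" where
  "L2_lim M F f \<longleftrightarrow> (\<forall>j. sq_int M (F j)) \<and> sq_int M f \<and>
     (\<lambda>j. sq_norm M (\<lambda>x. F j x - f x)) \<longlonglongrightarrow> 0"

lemma sq_int_measurable [measurable_dest]: "sq_int M f \<Longrightarrow> f \<in> borel_measurable M"
  by (simp add: sq_int_def)

lemma sq_int_integrable: "sq_int M f \<Longrightarrow> integrable M (\<lambda>x. (cmod (f x))\<^sup>2)"
  by (simp add: sq_int_def)

lemma sq_norm_nonneg [simp]: "sq_norm M f \<ge> 0"
  by (simp add: sq_norm_def)

lemma sq_int_bound:
  assumes [measurable]: "f \<in> borel_measurable M" and "sq_int M g"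
    and "\<And>x. x \<in> space M \<Longrightarrow> cmod (f x) \<le> B * cmod (g x)"
  shows "sq_int M f" "sq_norm M f \<le> B\<^sup>2 * sq_norm M g"
proof -
  have le: "(cmod (f x))\<^sup>2 \<le> B\<^sup>2 * (cmod (g x))\<^sup>2" if "x \<in> space M" for x
    using power_mono[OF assms(3)[OF that], of 2] by (simp add: power_mult_distrib)
  have int: "integrable M (\<lambda>x. B\<^sup>2 * (cmod (g x))\<^sup>2)"
    using sq_int_integrable[OF assms(2)] by simp
  show "sq_int M f" unfolding sq_int_def
    using le by (auto intro!: Bochner_Integration.integrable_bound[OF int])
  then show "sq_norm M f \<le> B\<^sup>2 * sq_norm M g"
    unfolding sq_norm_def using le int
    by (subst Bochner_Integration.integral_mult_right_zero[symmetric])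
      (intro integral_mono, auto simp: sq_int_integrable)
qed

text \<open>
  The elementary substitute for the triangle inequality when only squared norms are used.
\<close>

lemma cmod_add_sq_le: "(cmod (a + b))\<^sup>2 \<le> 2 * (cmod a)\<^sup>2 + 2 * (cmod b)\<^sup>2"
proof -
  have "(cmod (a + b))\<^sup>2 \<le> (cmod a + cmod b)\<^sup>2"
    by (intro power_mono norm_triangle_ineq) auto
  also have "\<dots> \<le> 2 * (cmod a)\<^sup>2 + 2 * (cmod b)\<^sup>2"
    using sum_squares_bound[of "cmod a" "cmod b"] by (simp add: power2_sum)
  finally show ?thesis .
qed

lemma sq_int_add:
  assumes f: "sq_int M f" and g: "sq_int M g"
  shows "sq_int M (\<lambda>x. f x + g x)"
    and "sq_norm M (\<lambda>x. f x + g x) \<le> 2 * sq_norm M f + 2 * sq_norm M g"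
proof -
  note [measurable] = sq_int_measurable[OF f] sq_int_measurable[OF g]
  have int: "integrable M (\<lambda>x. 2 * (cmod (f x))\<^sup>2 + 2 * (cmod (g x))\<^sup>2)"
    using f g by (auto simp: sq_int_def)
  show S: "sq_int M (\<lambda>x. f x + g x)" unfolding sq_int_def
    using cmod_add_sq_le by (auto intro!: Bochner_Integration.integrable_bound[OF int])
  have "sq_norm M (\<lambda>x. f x + g x) \<le> (LINT x|M. 2 * (cmod (f x))\<^sup>2 + 2 * (cmod (g x))\<^sup>2)"
    unfolding sq_norm_def using S int by (intro integral_mono cmod_add_sq_le) (auto simp: sq_int_def)
  also have "\<dots> = 2 * sq_norm M f + 2 * sq_norm M g"
    using f g by (simp add: sq_norm_def sq_int_def)
  finally show "sq_norm M (\<lambda>x. f x + g x) \<le> 2 * sq_norm M f + 2 * sq_norm M g" .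
qed

lemma sq_int_cmult: "sq_int M f \<Longrightarrow> sq_int M (\<lambda>x. c * f x)"
  by (auto simp: sq_int_def norm_mult power_mult_distrib)

lemma sq_norm_cmult: "sq_norm M (\<lambda>x. c * f x) = (cmod c)\<^sup>2 * sq_norm M f"
  by (auto simp: sq_norm_def norm_mult power_mult_distrib)

lemma sq_int_diff:
  assumes f: "sq_int M f" and g: "sq_int M g"
  shows "sq_int M (\<lambda>x. f x - g x)"
    and "sq_norm M (\<lambda>x. f x - g x) \<le> 2 * sq_norm M f + 2 * sq_norm M g"
  using sq_int_add[OF f sq_int_cmult[OF g, of "-1"]] sq_norm_cmult[of M "-1" g] by auto

lemma sq_int_zero [simp]: "sq_int M (\<lambda>x. 0)" by (simp add: sq_int_def)

lemma borel_measurable_cnj [measurable (raw)]: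
  "f \<in> borel_measurable M \<Longrightarrow> (\<lambda>x. cnj (f x)) \<in> borel_measurable M"
  by (rule measurable_compose[where g=cnj]) (auto intro: borel_measurable_continuous_onI continuous_intros)

lemma sq_int_cnj: "sq_int M f \<Longrightarrow> sq_int M (\<lambda>x. cnj (f x))"
  by (auto simp: sq_int_def)

lemma sq_int_mult_bounded:
  assumes f: "sq_int M f" and [measurable]: "g \<in> borel_measurable M"
    and B: "\<And>x. x \<in> space M \<Longrightarrow> cmod (g x) \<le> B"
  shows "sq_int M (\<lambda>x. g x * f x)" "sq_norm M (\<lambda>x. g x * f x) \<le> B\<^sup>2 * sq_norm M f"
  using sq_int_bound[of "\<lambda>x. g x * f x" M f B] sq_int_measurable[OF f] f B
  by (auto simp: norm_mult mult_right_mono)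

lemma sq_int_mult_integrable:
  assumes f: "sq_int M f" and g: "sq_int M g"
  shows "integrable M (\<lambda>x. f x * g x)"
proof -
  note [measurable] = sq_int_measurable[OF f] sq_int_measurable[OF g]
  have int: "integrable M (\<lambda>x. (cmod (f x))\<^sup>2 + (cmod (g x))\<^sup>2)"
    using f g by (auto simp: sq_int_def)
  have "cmod (f x) * cmod (g x) \<le> (cmod (f x))\<^sup>2 + (cmod (g x))\<^sup>2" for x
    using sum_squares_bound[of "cmod (f x)" "cmod (g x)"]
      mult_nonneg_nonneg[OF norm_ge_zero norm_ge_zero, of "f x" "g x"] by linarith
  then show ?thesis
    by (auto intro!: Bochner_Integration.integrable_bound[OF int] simp: norm_mult)
qed

lemma Cauchy_Schwarz_integral:
  assumes f: "sq_int M f" and g: "sq_int M g"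
  shows "(cmod (LINT x|M. f x * g x))\<^sup>2 \<le> sq_norm M f * sq_norm M g"
proof -
  note [measurable] = sq_int_measurable[OF f] sq_int_measurable[OF g]
  have int: "integrable M (\<lambda>x. cmod (f x) * cmod (g x))"
    using sq_int_mult_integrable[OF f g] by (simp add: integrable_norm_iff flip: norm_mult)
  have "ennreal ((LINT x|M. cmod (f x) * cmod (g x))\<^sup>2)
      = (\<integral>\<^sup>+x. ennreal (cmod (f x)) * ennreal (cmod (g x)) \<partial>M)\<^sup>2"
    using int by (simp add: nn_integral_eq_integral flip: ennreal_mult ennreal_power)
  also have "\<dots> \<le> (\<integral>\<^sup>+x. ennreal (cmod (f x)) ^ 2 \<partial>M) * (\<integral>\<^sup>+x. ennreal (cmod (g x)) ^ 2 \<partial>M)"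
    by (rule Cauchy_Schwarz_nn_integral) auto
  also have "\<dots> = ennreal (sq_norm M f * sq_norm M g)"
    using f g by (simp add: sq_norm_def sq_int_def ennreal_power nn_integral_eq_integral ennreal_mult)
  finally have "(LINT x|M. cmod (f x) * cmod (g x))\<^sup>2 \<le> sq_norm M f * sq_norm M g"
    by (subst (asm) ennreal_le_iff) auto
  moreover have "cmod (LINT x|M. f x * g x) \<le> (LINT x|M. cmod (f x) * cmod (g x))"
    using integral_norm_bound[of M "\<lambda>x. f x * g x"] by (simp add: norm_mult)
  ultimately show ?thesis
    by (meson order_trans power_mono norm_ge_zero)
qed

lemma L2_limD:
  assumes "L2_lim M F f"
  shows "sq_int M (F j)" "sq_int M f" "(\<lambda>j. sq_norm M (\<lambda>x. F j x - f x)) \<longlonglongrightarrow> 0"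
  using assms by (auto simp: L2_lim_def)

text \<open>
  The usual way to prove convergence below: a majorant of the squared distances that tends to zero.
\<close>

lemma L2_limI_le:
  assumes "\<And>j. sq_int M (F j)" "sq_int M f"
    and "\<And>j. sq_norm M (\<lambda>x. F j x - f x) \<le> e j" and "e \<longlonglongrightarrow> 0"
  shows "L2_lim M F f"
proof -
  have "(\<lambda>j. sq_norm M (\<lambda>x. F j x - f x)) \<longlonglongrightarrow> 0"
    by (rule tendsto_0_le[OF assms(4), where K=1])
      (use assms(3) in \<open>auto intro!: always_eventually order_trans[OF assms(3)]\<close>)
  then show ?thesis using assms(1,2) by (simp add: L2_lim_def)
qed

lemma L2_lim_const: "sq_int M f \<Longrightarrow> L2_lim M (\<lambda>j. f) f"
  by (simp add: L2_lim_def sq_norm_def)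

lemma L2_lim_add:
  assumes F: "L2_lim M F f" and G: "L2_lim M G g"
  shows "L2_lim M (\<lambda>j x. F j x + G j x) (\<lambda>x. f x + g x)"
proof (rule L2_limI_le)
  show "sq_norm M (\<lambda>x. F j x + G j x - (f x + g x)) \<le>
      2 * sq_norm M (\<lambda>x. F j x - f x) + 2 * sq_norm M (\<lambda>x. G j x - g x)" for j
    using sq_int_add(2)[OF sq_int_diff(1)[OF L2_limD(1,2)[OF F]] sq_int_diff(1)[OF L2_limD(1,2)[OF G]], of j j]
    by (simp add: algebra_simps)
  show "(\<lambda>j. 2 * sq_norm M (\<lambda>x. F j x - f x) + 2 * sq_norm M (\<lambda>x. G j x - g x)) \<longlonglongrightarrow> 0"
    using tendsto_add[OF tendsto_mult_left[OF L2_limD(3)[OF F], of 2] tendsto_mult_left[OF L2_limD(3)[OF G], of 2]]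
    by simp
qed (intro sq_int_add L2_limD[OF F] L2_limD[OF G])+

lemma L2_lim_mult_bounded:
  assumes F: "L2_lim M F f" and [measurable]: "g \<in> borel_measurable M"
    and B: "\<And>x. x \<in> space M \<Longrightarrow> cmod (g x) \<le> B"
  shows "L2_lim M (\<lambda>j x. g x * F j x) (\<lambda>x. g x * f x)"
proof (rule L2_limI_le)
  show "sq_norm M (\<lambda>x. g x * F j x - g x * f x) \<le> B\<^sup>2 * sq_norm M (\<lambda>x. F j x - f x)" for j
    using sq_int_mult_bounded(2)[OF sq_int_diff(1)[OF L2_limD(1,2)[OF F]], of g B j] B
    by (simp add: algebra_simps)
  show "(\<lambda>j. B\<^sup>2 * sq_norm M (\<lambda>x. F j x - f x)) \<longlonglongrightarrow> 0"
    using tendsto_mult_left[OF L2_limD(3)[OF F], of "B\<^sup>2"] by simp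
qed (use sq_int_mult_bounded(1)[OF L2_limD(1)[OF F] assms(2) B] sq_int_mult_bounded(1)[OF L2_limD(2)[OF F] assms(2) B] in auto)

lemma L2_lim_cmult: "L2_lim M F f \<Longrightarrow> L2_lim M (\<lambda>j x. c * F j x) (\<lambda>x. c * f x)"
  by (rule L2_lim_mult_bounded[where B="cmod c"]) auto

lemma L2_lim_diff:
  assumes F: "L2_lim M F f" and G: "L2_lim M G g"
  shows "L2_lim M (\<lambda>j x. F j x - G j x) (\<lambda>x. f x - g x)"
  using L2_lim_add[OF F L2_lim_cmult[OF G, of "-1"]] by simp

lemma L2_lim_inner:
  assumes F: "L2_lim M F f" and g: "sq_int M g"
  shows "(\<lambda>j. LINT x|M. F j x * g x) \<longlonglongrightarrow> (LINT x|M. f x * g x)"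
proof (rule Lim_null[THEN iffD2], rule tendsto_norm_zero_cancel)
  have "(cmod ((LINT x|M. F j x * g x) - (LINT x|M. f x * g x)))\<^sup>2
      \<le> sq_norm M (\<lambda>x. F j x - f x) * sq_norm M g" for j
    using Cauchy_Schwarz_integral[OF sq_int_diff(1)[OF L2_limD(1,2)[OF F]] g, of j]
      sq_int_mult_integrable[OF L2_limD(1)[OF F] g, of j] sq_int_mult_integrable[OF L2_limD(2)[OF F] g]
    by (simp add: left_diff_distrib)
  then have "cmod ((LINT x|M. F j x * g x) - (LINT x|M. f x * g x))
      \<le> sqrt (sq_norm M (\<lambda>x. F j x - f x) * sq_norm M g)" for j
    by (rule real_le_rsqrt)
  note le = this
  have "(\<lambda>j. sqrt (sq_norm M (\<lambda>x. F j x - f x) * sq_norm M g)) \<longlonglongrightarrow> 0"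
    using tendsto_real_sqrt[OF tendsto_mult_right[OF L2_limD(3)[OF F], of "sq_norm M g"]] by simp
  then show "(\<lambda>j. cmod ((LINT x|M. F j x * g x) - (LINT x|M. f x * g x))) \<longlonglongrightarrow> 0"
    by (rule tendsto_0_le[where K=1]) (use le in \<open>auto simp: sq_norm_def\<close>)
qed

lemma sq_norm_triangle:
  assumes f: "sq_int M f" and g: "sq_int M g"
  shows "sqrt (sq_norm M (\<lambda>x. f x + g x)) \<le> sqrt (sq_norm M f) + sqrt (sq_norm M g)"
proof (rule real_le_lsqrt)
  let ?a = "sq_norm M f" and ?b = "sq_norm M g"
  have i: "integrable M (\<lambda>x. f x * cnj (g x))" "integrable M (\<lambda>x. Re (f x * cnj (g x)))"
    using sq_int_mult_integrable[OF f sq_int_cnj[OF g]] by (auto intro: integrable_Re simp del: times_complex.sel)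
  have eq: "(cmod (f x + g x))\<^sup>2 = (cmod (f x))\<^sup>2 + (cmod (g x))\<^sup>2 + 2 * Re (f x * cnj (g x))" for x
    by (simp only: cmod_power2) (simp add: power2_eq_square algebra_simps)
  have "sq_norm M (\<lambda>x. f x + g x) = ?a + ?b + 2 * (LINT x|M. Re (f x * cnj (g x)))"
    unfolding sq_norm_def eq using f g i by (simp add: sq_int_def del: times_complex.sel)
  also have "(LINT x|M. Re (f x * cnj (g x))) = Re (LINT x|M. f x * cnj (g x))"
    using i by (simp del: times_complex.sel)
  also have "\<dots> \<le> cmod (LINT x|M. f x * cnj (g x))" by (rule complex_Re_le_cmod)
  also have "\<dots> \<le> sqrt ?a * sqrt ?b"
    using Cauchy_Schwarz_integral[OF f sq_int_cnj[OF g]]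
    by (simp add: real_le_rsqrt sq_norm_def flip: real_sqrt_mult)
  finally show "sq_norm M (\<lambda>x. f x + g x) \<le> (sqrt ?a + sqrt ?b)\<^sup>2"
    by (simp add: power2_sum algebra_simps)
qed auto

lemma L2_lim_sq_norm:
  assumes F: "L2_lim M F f"
  shows "(\<lambda>j. sq_norm M (F j)) \<longlonglongrightarrow> sq_norm M f"
proof -
  have le: "\<bar>sqrt (sq_norm M (F j)) - sqrt (sq_norm M f)\<bar> \<le> sqrt (sq_norm M (\<lambda>x. F j x - f x))" for j
  proof -
    note d = sq_int_diff(1)[OF L2_limD(1,2)[OF F], of j]
    note d' = sq_int_diff(1)[OF L2_limD(2,1)[OF F], of j]
    have "sqrt (sq_norm M (F j)) \<le> sqrt (sq_norm M (\<lambda>x. F j x - f x)) + sqrt (sq_norm M f)"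
      using sq_norm_triangle[OF d L2_limD(2)[OF F]] by simp
    moreover have "sqrt (sq_norm M f) \<le> sqrt (sq_norm M (\<lambda>x. F j x - f x)) + sqrt (sq_norm M (F j))"
      using sq_norm_triangle[OF d' L2_limD(1)[OF F, of j]] by (simp add: sq_norm_def norm_minus_commute)
    ultimately show ?thesis by linarith
  qed
  have "(\<lambda>j. sqrt (sq_norm M (\<lambda>x. F j x - f x))) \<longlonglongrightarrow> 0"
    using tendsto_real_sqrt[OF L2_limD(3)[OF F]] by simp
  then have "(\<lambda>j. sqrt (sq_norm M (F j)) - sqrt (sq_norm M f)) \<longlonglongrightarrow> 0"
    by (rule tendsto_0_le[where K=1]) (use le in auto)
  then have "(\<lambda>j. sqrt (sq_norm M (F j))) \<longlonglongrightarrow> sqrt (sq_norm M f)"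
    by (simp add: LIM_zero_iff)
  from tendsto_power[OF this, of 2] show ?thesis by simp
qed

lemma L2_lim_unique:
  assumes F: "L2_lim M F f" and G: "L2_lim M F g"
  shows "AE x in M. f x = g x"
proof -
  have "L2_lim M (\<lambda>j x. 0) (\<lambda>x. f x - g x)"
    using L2_lim_diff[OF F G] L2_lim_diff[OF G F] L2_lim_diff[OF F G] by simp
  from L2_lim_sq_norm[OF this] have "sq_norm M (\<lambda>x. f x - g x) = 0"
    by (simp add: sq_norm_def LIMSEQ_const_iff)
  moreover have "sq_int M (\<lambda>x. f x - g x)"
    by (intro sq_int_diff L2_limD(2)[OF F] L2_limD(2)[OF G])
  ultimately have "AE x in M. (cmod (f x - g x))\<^sup>2 = 0"
    unfolding sq_norm_def sq_int_def by (subst (asm) integral_nonneg_eq_0_iff_AE) auto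
  then show ?thesis by eventually_elim simp
qed

lemma sq_int_cong_AE:
  assumes "sq_int M f" "AE x in M. f x = g x" "g \<in> borel_measurable M"
  shows "sq_int M g"
proof -
  note [measurable] = sq_int_measurable[OF assms(1)] assms(3)
  have "integrable M (\<lambda>x. (cmod (g x))\<^sup>2)"
    by (rule integrable_cong_AE_imp[OF sq_int_integrable[OF assms(1)]]) (use assms(2) in auto)
  then show ?thesis by (simp add: sq_int_def assms(3))
qed

lemma sq_norm_cong_AE:
  assumes "AE x in M. f x = g x" "f \<in> borel_measurable M" "g \<in> borel_measurable M"
  shows "sq_norm M f = sq_norm M g"
  unfolding sq_norm_def using assms by (intro integral_cong_AE) auto

lemma L2_lim_cong_AE:
  assumes F: "L2_lim M F f" and "AE x in M. f x = g x" "g \<in> borel_measurable M"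
  shows "L2_lim M F g"
proof -
  note [measurable] = assms(3) sq_int_measurable[OF L2_limD(2)[OF F]] sq_int_measurable[OF L2_limD(1)[OF F]]
  have "sq_norm M (\<lambda>x. F j x - f x) = sq_norm M (\<lambda>x. F j x - g x)" for j
    using assms(2) by (intro sq_norm_cong_AE) auto
  then show ?thesis
    using F sq_int_cong_AE[OF L2_limD(2)[OF F] assms(2,3)] by (simp add: L2_lim_def)
qed

text \<open>
  Lebesgue's dominated convergence theorem, applied to the squared distance.
\<close>

lemma L2_lim_dominated:
  assumes f: "sq_int M f" and [measurable]: "\<And>j. F j \<in> borel_measurable M"
    and lim: "\<And>x. x \<in> space M \<Longrightarrow> (\<lambda>j. F j x) \<longlonglongrightarrow> f x"
    and bd: "\<And>j x. x \<in> space M \<Longrightarrow> cmod (F j x) \<le> B * cmod (g x)" and g: "sq_int M g"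
  shows "L2_lim M F f"
proof -
  note [measurable] = sq_int_measurable[OF f] sq_int_measurable[OF g]
  have S: "sq_int M (F j)" for j by (rule sq_int_bound[OF _ g bd]) auto
  have "(\<lambda>j. LINT x|M. (cmod (F j x - f x))\<^sup>2) \<longlonglongrightarrow> (LINT x|M. 0)"
  proof (rule integral_dominated_convergence[where w="\<lambda>x. 2 * (B\<^sup>2 * (cmod (g x))\<^sup>2) + 2 * (cmod (f x))\<^sup>2"])
    show "integrable M (\<lambda>x. 2 * (B\<^sup>2 * (cmod (g x))\<^sup>2) + 2 * (cmod (f x))\<^sup>2)"
      using f g by (simp add: sq_int_def)
    have "(\<lambda>j. (cmod (F j x - f x))\<^sup>2) \<longlonglongrightarrow> (cmod (f x - f x))\<^sup>2" if "x \<in> space M" for x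
      by (intro tendsto_intros lim that)
    then show "AE x in M. (\<lambda>j. (cmod (F j x - f x))\<^sup>2) \<longlonglongrightarrow> 0" by auto
    have "(cmod (F j x - f x))\<^sup>2 \<le> 2 * (B\<^sup>2 * (cmod (g x))\<^sup>2) + 2 * (cmod (f x))\<^sup>2"
      if "x \<in> space M" for j x
    proof -
      have "(cmod (F j x))\<^sup>2 \<le> (B * cmod (g x))\<^sup>2" by (intro power_mono bd that) auto
      then show ?thesis using cmod_add_sq_le[of "F j x" "- f x"] by (simp add: power_mult_distrib)
    qed
    then show "AE x in M. norm ((cmod (F j x - f x))\<^sup>2) \<le> 2 * (B\<^sup>2 * (cmod (g x))\<^sup>2) + 2 * (cmod (f x))\<^sup>2" for j
      by auto
  qed auto
  then show ?thesis using S f by (simp add: L2_lim_def sq_norm_def)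
qed

section \<open>Extension by zero\<close>

text \<open>
  Functions on a domain are replaced by their extensions by zero, so that they can be translated and
  sliced without leaving the whole space.
\<close>

definition zext :: "'a set \<Rightarrow> ('a \<Rightarrow> complex) \<Rightarrow> 'a \<Rightarrow> complex" where
  "zext A u = (\<lambda>x. indicator A x *\<^sub>R u x)"

lemma zext_in [simp]: "x \<in> A \<Longrightarrow> zext A u x = u x"
  and zext_out [simp]: "x \<notin> A \<Longrightarrow> zext A u x = 0"
  by (auto simp: zext_def)

lemma set_integral_zext: "(LINT x:A|M. u x * v x) = (LINT x|M. zext A u x * v x)"
  by (simp add: set_lebesgue_integral_def zext_def)

lemma L2_zext: "L2 A u \<longleftrightarrow> sq_int lborel (zext A u)"
proof -
  have "(\<lambda>x. indicator A x *\<^sub>R (cmod (u x))\<^sup>2) = (\<lambda>x. (cmod (zext A u x))\<^sup>2)"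
    by (auto simp: zext_def indicator_def)
  then show ?thesis
    unfolding L2_def sq_int_def set_borel_measurable_def set_integrable_def by (simp add: zext_def)
qed

lemma L2norm_zext: "(L2norm A u)\<^sup>2 = sq_norm lborel (zext A u)"
proof -
  have "(\<lambda>x. indicator A x *\<^sub>R (cmod (u x))\<^sup>2) = (\<lambda>x. (cmod (zext A u x))\<^sup>2)"
    by (auto simp: zext_def indicator_def)
  then have "(LINT x:A|lborel. (cmod (u x))\<^sup>2) = sq_norm lborel (zext A u)"
    unfolding set_lebesgue_integral_def sq_norm_def by simp
  then show ?thesis unfolding L2norm_def by simp
qed

lemma L2norm_nonneg: "L2norm A u \<ge> 0"
  by (auto simp: L2norm_def set_lebesgue_integral_def intro!: integral_nonneg)

lemma L2norm_tendsto_iff: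
  "(\<lambda>j. L2norm A (u j)) \<longlonglongrightarrow> 0 \<longleftrightarrow> (\<lambda>j. sq_norm lborel (zext A (u j))) \<longlonglongrightarrow> 0"
proof
  assume "(\<lambda>j. L2norm A (u j)) \<longlonglongrightarrow> 0"
  from tendsto_power[OF this, of 2] show "(\<lambda>j. sq_norm lborel (zext A (u j))) \<longlonglongrightarrow> 0"
    by (simp add: L2norm_zext)
next
  assume "(\<lambda>j. sq_norm lborel (zext A (u j))) \<longlonglongrightarrow> 0"
  from tendsto_real_sqrt[OF this] show "(\<lambda>j. L2norm A (u j)) \<longlonglongrightarrow> 0"
    by (simp add: L2norm_nonneg flip: L2norm_zext)
qed

lemma zext_diff: "zext A (\<lambda>x. u x - v x) = (\<lambda>x. zext A u x - zext A v x)"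
  by (auto simp: zext_def algebra_simps)

lemma L2_lim_zext_iff:
  assumes "\<And>j. L2 A (u j)" "L2 A v"
  shows "L2_lim lborel (\<lambda>j. zext A (u j)) (zext A v) \<longleftrightarrow> (\<lambda>j. L2norm A (\<lambda>x. u j x - v x)) \<longlonglongrightarrow> 0"
  using assms by (simp add: L2_lim_def L2norm_tendsto_iff zext_diff L2_zext)

lemma sq_int_zext_continuous:
  fixes f :: "'a::euclidean_space \<Rightarrow> complex"
  assumes f: "continuous_on UNIV f" and A: "bounded A" "A \<in> sets borel"
  shows "sq_int lborel (zext A f)"
proof -
  have fm [measurable]: "f \<in> borel_measurable borel"
    using f by (rule borel_measurable_continuous_onI)
  have cl: "compact (closure A)" using A(1) by (simp add: compact_closure)
  have "bounded (f ` closure A)"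
    by (intro compact_imp_bounded compact_continuous_image cl continuous_on_subset[OF f]) auto
  then obtain B where B: "\<And>x. x \<in> closure A \<Longrightarrow> cmod (f x) \<le> B"
    unfolding bounded_iff by auto
  have fin: "emeasure lborel A < \<infinity>" using A(1) by (rule emeasure_bounded_finite)
  have int: "integrable lborel (\<lambda>x. indicator A x *\<^sub>R B\<^sup>2)"
    using fin A(2) by (intro integrable_scaleR_left integrable_real_indicator) auto
  have "(cmod (zext A f x))\<^sup>2 \<le> indicator A x *\<^sub>R B\<^sup>2" for x
    using B[of x] closure_subset[of A] by (cases "x \<in> A") (auto intro!: power_mono)
  then have "integrable lborel (\<lambda>x. (cmod (zext A f x))\<^sup>2)"
    using A(2) by (intro Bochner_Integration.integrable_bound[OF int]) (auto simp: zext_def)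
  then show ?thesis using A(2) by (simp add: sq_int_def zext_def)
qed

lemma sq_int_zext_integrable:
  fixes u :: "'a::euclidean_space \<Rightarrow> complex"
  assumes "sq_int lborel (zext A u)" "bounded A" "A \<in> sets borel"
  shows "integrable lborel (zext A u)"
proof -
  have "sq_int lborel (zext A (\<lambda>x. 1))"
    by (rule sq_int_zext_continuous) (use assms in auto)
  from sq_int_mult_integrable[OF assms(1) this] show ?thesis
    by (rule back_subst[where P="integrable lborel"]) (auto simp: zext_def indicator_def)
qed

section \<open>Continuously differentiable functions on the plane\<close>

abbreviation d1 :: "(real \<times> real \<Rightarrow> complex) \<Rightarrow> real \<times> real \<Rightarrow> complex" where
  "d1 \<phi> x \<equiv> frechet_derivative \<phi> (at x) (1, 0)"

abbreviation d2 :: "(real \<times> real \<Rightarrow> complex) \<Rightarrow> real \<times> real \<Rightarrow> complex" where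
  "d2 \<phi> x \<equiv> frechet_derivative \<phi> (at x) (0, 1)"

text \<open>
  The partial derivatives determine the Frechet derivative; this is how all concrete functions below are
  recognised as \<open>C\<^sup>1\<close>, together with their partial derivatives.
\<close>

lemma C1_I:
  assumes d: "\<And>x. (\<phi> has_derivative (\<lambda>h. fst h *\<^sub>R a x + snd h *\<^sub>R b x)) (at x)"
    and a: "continuous_on UNIV a" and b: "continuous_on UNIV b"
  shows "C1 \<phi>" "d1 \<phi> = a" "d2 \<phi> = b"
proof -
  have *: "frechet_derivative \<phi> (at x) = (\<lambda>h. fst h *\<^sub>R a x + snd h *\<^sub>R b x)" for x
    using frechet_derivative_at[OF d] by simp
  show "C1 \<phi>" unfolding C1_def *
    using d a b by (auto intro!: continuous_intros simp: differentiable_def)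
  show "d1 \<phi> = a" "d2 \<phi> = b" by (auto simp: *)
qed

lemma C1_has_derivative:
  assumes "C1 \<phi>"
  shows "(\<phi> has_derivative (\<lambda>h. fst h *\<^sub>R d1 \<phi> x + snd h *\<^sub>R d2 \<phi> x)) (at x)"
proof -
  have d: "(\<phi> has_derivative frechet_derivative \<phi> (at x)) (at x)"
    using assms frechet_derivative_works[of \<phi> "at x"] unfolding C1_def by blast
  interpret L: linear "frechet_derivative \<phi> (at x)"
    using has_derivative_linear[OF d] .
  have "frechet_derivative \<phi> (at x) h = fst h *\<^sub>R d1 \<phi> x + snd h *\<^sub>R d2 \<phi> x" for h
  proof -
    have "frechet_derivative \<phi> (at x) (fst h *\<^sub>R (1, 0) + snd h *\<^sub>R (0, 1)) = fst h *\<^sub>R d1 \<phi> x + snd h *\<^sub>R d2 \<phi> x"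
      by (simp only: L.add L.scaleR)
    then show ?thesis by (cases h) simp
  qed
  then have "frechet_derivative \<phi> (at x) = (\<lambda>h. fst h *\<^sub>R d1 \<phi> x + snd h *\<^sub>R d2 \<phi> x)" by (rule ext)
  from has_derivative_eq_rhs[OF d this] show ?thesis .
qed

lemma C1_continuous:
  assumes "C1 \<phi>"
  shows "continuous_on UNIV \<phi>" "continuous_on UNIV (d1 \<phi>)" "continuous_on UNIV (d2 \<phi>)"
proof -
  show "continuous_on UNIV \<phi>"
    by (rule has_derivative_continuous_on[OF has_derivative_at_withinI[OF C1_has_derivative[OF assms]]])
  show "continuous_on UNIV (d1 \<phi>)" "continuous_on UNIV (d2 \<phi>)"
    using assms unfolding C1_def by blast+
qed

lemma C1_continuous_deriv: "C1 \<phi> \<Longrightarrow> continuous_on UNIV (\<lambda>x. frechet_derivative \<phi> (at x) h)"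
  unfolding C1_def by (erule conjunct2[THEN spec])

lemma C1_mult:
  assumes "C1 \<phi>" "C1 \<psi>"
  shows "C1 (\<lambda>x. \<phi> x * \<psi> x)"
    "d1 (\<lambda>x. \<phi> x * \<psi> x) = (\<lambda>x. d1 \<phi> x * \<psi> x + \<phi> x * d1 \<psi> x)"
    "d2 (\<lambda>x. \<phi> x * \<psi> x) = (\<lambda>x. d2 \<phi> x * \<psi> x + \<phi> x * d2 \<psi> x)"
proof -
  note c = C1_continuous[OF assms(1)] C1_continuous[OF assms(2)]
  have d: "((\<lambda>x. \<phi> x * \<psi> x) has_derivative (\<lambda>h. fst h *\<^sub>R (d1 \<phi> x * \<psi> x + \<phi> x * d1 \<psi> x) +
      snd h *\<^sub>R (d2 \<phi> x * \<psi> x + \<phi> x * d2 \<psi> x))) (at x)" for x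
    by (rule has_derivative_eq_rhs[OF has_derivative_mult[OF C1_has_derivative[OF assms(1)] C1_has_derivative[OF assms(2)]]])
      (auto simp: algebra_simps)
  have ca: "continuous_on UNIV (\<lambda>x. d1 \<phi> x * \<psi> x + \<phi> x * d1 \<psi> x)" and cb: "continuous_on UNIV (\<lambda>x. d2 \<phi> x * \<psi> x + \<phi> x * d2 \<psi> x)"
    by (intro continuous_intros c)+
  show "C1 (\<lambda>x. \<phi> x * \<psi> x)"
    "d1 (\<lambda>x. \<phi> x * \<psi> x) = (\<lambda>x. d1 \<phi> x * \<psi> x + \<phi> x * d1 \<psi> x)"
    "d2 (\<lambda>x. \<phi> x * \<psi> x) = (\<lambda>x. d2 \<phi> x * \<psi> x + \<phi> x * d2 \<psi> x)"
    by (fact C1_I[OF d ca cb])+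
qed

lemma C1_diff:
  assumes "C1 \<phi>" "C1 \<psi>"
  shows "C1 (\<lambda>x. \<phi> x - \<psi> x)"
    "d1 (\<lambda>x. \<phi> x - \<psi> x) = (\<lambda>x. d1 \<phi> x - d1 \<psi> x)"
    "d2 (\<lambda>x. \<phi> x - \<psi> x) = (\<lambda>x. d2 \<phi> x - d2 \<psi> x)"
proof -
  note c = C1_continuous[OF assms(1)] C1_continuous[OF assms(2)]
  have d: "((\<lambda>x. \<phi> x - \<psi> x) has_derivative (\<lambda>h. fst h *\<^sub>R (d1 \<phi> x - d1 \<psi> x) +
      snd h *\<^sub>R (d2 \<phi> x - d2 \<psi> x))) (at x)" for x
    by (rule has_derivative_eq_rhs[OF has_derivative_diff[OF C1_has_derivative[OF assms(1)] C1_has_derivative[OF assms(2)]]])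
      (auto simp: algebra_simps)
  have ca: "continuous_on UNIV (\<lambda>x. d1 \<phi> x - d1 \<psi> x)" and cb: "continuous_on UNIV (\<lambda>x. d2 \<phi> x - d2 \<psi> x)"
    by (intro continuous_intros c)+
  show "C1 (\<lambda>x. \<phi> x - \<psi> x)"
    "d1 (\<lambda>x. \<phi> x - \<psi> x) = (\<lambda>x. d1 \<phi> x - d1 \<psi> x)"
    "d2 (\<lambda>x. \<phi> x - \<psi> x) = (\<lambda>x. d2 \<phi> x - d2 \<psi> x)"
    by (fact C1_I[OF d ca cb])+
qed

lemma C1_compose_real:
  assumes g: "\<And>t. (g has_vector_derivative g' t) (at t)" "continuous_on UNIV g'"
    and r: "\<And>x. (r has_derivative (\<lambda>h. fst h * r1 x + snd h * r2 x)) (at x)"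
      "continuous_on UNIV r1" "continuous_on UNIV r2"
  shows "C1 (\<lambda>x::real\<times>real. g (r x))" "d1 (\<lambda>x. g (r x)) = (\<lambda>x. r1 x *\<^sub>R g' (r x))"
    "d2 (\<lambda>x. g (r x)) = (\<lambda>x. r2 x *\<^sub>R g' (r x))"
proof -
  have rc: "continuous_on UNIV r"
    by (rule has_derivative_continuous_on[OF has_derivative_at_withinI[OF r(1)]])
  have gc: "continuous_on UNIV (\<lambda>x. g' (r x))"
    using continuous_on_compose2[OF g(2) rc] by auto
  have d: "((\<lambda>x. g (r x)) has_derivative (\<lambda>h. fst h *\<^sub>R (r1 x *\<^sub>R g' (r x)) + snd h *\<^sub>R (r2 x *\<^sub>R g' (r x)))) (at x)" for x
    by (rule has_derivative_eq_rhs[OF has_derivative_compose[OF r(1) g(1)[unfolded has_vector_derivative_def]]])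
      (auto simp: algebra_simps)
  have ca: "continuous_on UNIV (\<lambda>x. r1 x *\<^sub>R g' (r x))" and cb: "continuous_on UNIV (\<lambda>x. r2 x *\<^sub>R g' (r x))"
    by (intro continuous_intros gc r)+
  show "C1 (\<lambda>x::real\<times>real. g (r x))" "d1 (\<lambda>x. g (r x)) = (\<lambda>x. r1 x *\<^sub>R g' (r x))"
    "d2 (\<lambda>x. g (r x)) = (\<lambda>x. r2 x *\<^sub>R g' (r x))"
    by (fact C1_I[OF d ca cb])+
qed

lemma C1_fst:
  assumes g: "\<And>t. (g has_vector_derivative g' t) (at t)" "continuous_on UNIV g'"
  shows "C1 (\<lambda>x::real\<times>real. g (fst x))" "d1 (\<lambda>x. g (fst x)) = (\<lambda>x. g' (fst x))" "d2 (\<lambda>x. g (fst x)) = (\<lambda>x. 0)"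
  using C1_compose_real[OF g, of fst "\<lambda>_. 1" "\<lambda>_. 0"]
  by (auto intro: bounded_linear_imp_has_derivative bounded_linear_fst)

lemma C1_snd:
  assumes g: "\<And>t. (g has_vector_derivative g' t) (at t)" "continuous_on UNIV g'"
  shows "C1 (\<lambda>x::real\<times>real. g (snd x))" "d1 (\<lambda>x. g (snd x)) = (\<lambda>x. 0)" "d2 (\<lambda>x. g (snd x)) = (\<lambda>x. g' (snd x))"
  using C1_compose_real[OF g, of snd "\<lambda>_. 0" "\<lambda>_. 1"]
  by (auto intro: bounded_linear_imp_has_derivative bounded_linear_snd)

lemma C1_shift:
  assumes "C1 \<phi>"
  shows "C1 (\<lambda>x. \<phi> (x - v))" "d1 (\<lambda>x. \<phi> (x - v)) = (\<lambda>x. d1 \<phi> (x - v))"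
    "d2 (\<lambda>x. \<phi> (x - v)) = (\<lambda>x. d2 \<phi> (x - v))"
proof -
  have d: "((\<lambda>x. \<phi> (x - v)) has_derivative (\<lambda>h. fst h *\<^sub>R d1 \<phi> (x - v) + snd h *\<^sub>R d2 \<phi> (x - v))) (at x)" for x
    by (rule has_derivative_eq_rhs[OF has_derivative_compose[OF _ C1_has_derivative[OF assms], where f'="\<lambda>h. h"]])
      (auto intro!: derivative_eq_intros)
  have c: "continuous_on UNIV (\<lambda>x. d1 \<phi> (x - v))" "continuous_on UNIV (\<lambda>x. d2 \<phi> (x - v))"
    by (auto intro!: continuous_on_compose2[OF C1_continuous(2)[OF assms]]
        continuous_on_compose2[OF C1_continuous(3)[OF assms]] continuous_intros)
  show "C1 (\<lambda>x. \<phi> (x - v))" "d1 (\<lambda>x. \<phi> (x - v)) = (\<lambda>x. d1 \<phi> (x - v))"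
    "d2 (\<lambda>x. \<phi> (x - v)) = (\<lambda>x. d2 \<phi> (x - v))"
    by (fact C1_I[OF d c])+
qed

lemma C1_line1:
  assumes "C1 \<phi>" shows "((\<lambda>t. \<phi> (t, y)) has_vector_derivative d1 \<phi> (t, y)) (at t within S)"
proof -
  have "((\<lambda>t. \<phi> (t, y)) has_derivative (\<lambda>h. fst (h, 0::real) *\<^sub>R d1 \<phi> (t, y) + snd (h, 0::real) *\<^sub>R d2 \<phi> (t, y))) (at t within S)"
    by (rule has_derivative_compose[OF _ C1_has_derivative[OF assms], where f'="\<lambda>h. (h, 0)"])
      (auto intro!: derivative_eq_intros)
  then show ?thesis by (simp add: has_vector_derivative_def)
qed

lemma C1_line2:
  assumes "C1 \<phi>" shows "((\<lambda>t. \<phi> (x, t)) has_vector_derivative d2 \<phi> (x, t)) (at t within S)"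
proof -
  have "((\<lambda>t. \<phi> (x, t)) has_derivative (\<lambda>h. fst (0::real, h) *\<^sub>R d1 \<phi> (x, t) + snd (0::real, h) *\<^sub>R d2 \<phi> (x, t))) (at t within S)"
    by (rule has_derivative_compose[OF _ C1_has_derivative[OF assms], where f'="\<lambda>h. (0, h)"])
      (auto intro!: derivative_eq_intros)
  then show ?thesis by (simp add: has_vector_derivative_def)
qed

lemma continuous_slice:
  assumes "continuous_on UNIV (f :: real \<times> real \<Rightarrow> 'a::topological_space)"
  shows "continuous_on S (\<lambda>t. f (t, y))" "continuous_on S (\<lambda>t. f (x, t))"
  by (auto intro!: continuous_on_compose2[OF assms] continuous_intros)

lemma C1_FTC1:
  assumes "C1 \<phi>" "a \<le> b"
  shows "(LINT t|lborel. indicator {a..b} t *\<^sub>R d1 \<phi> (t, y)) = \<phi> (b, y) - \<phi> (a, y)"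
  using integral_FTC_Icc[OF assms(2), of "\<lambda>t. \<phi> (t, y)" "\<lambda>t. d1 \<phi> (t, y)"]
    C1_line1[OF assms(1)] continuous_slice(1)[OF C1_continuous(2)[OF assms(1)]] by blast

lemma C1_FTC2:
  assumes "C1 \<phi>" "a \<le> b"
  shows "(LINT t|lborel. indicator {a..b} t *\<^sub>R d2 \<phi> (x, t)) = \<phi> (x, b) - \<phi> (x, a)"
  using integral_FTC_Icc[OF assms(2), of "\<lambda>t. \<phi> (x, t)" "\<lambda>t. d2 \<phi> (x, t)"]
    C1_line2[OF assms(1)] continuous_slice(2)[OF C1_continuous(3)[OF assms(1)]] by blast

section \<open>Integration over the plane and integration by parts\<close>

lemma integral_plane_fst:
  fixes f :: "real \<times> real \<Rightarrow> 'a::{banach, second_countable_topology}"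
  assumes "integrable lborel f"
  shows "(LINT z|lborel. f z) = (LINT x|lborel. LINT y|lborel. f (x, y))"
    "integrable lborel (\<lambda>x. LINT y|lborel. f (x, y))"
    "AE x in lborel. integrable lborel (\<lambda>y. f (x, y))"
proof -
  have f: "integrable (lborel \<Otimes>\<^sub>M lborel) f" using assms unfolding lborel_prod .
  show "(LINT z|lborel. f z) = (LINT x|lborel. LINT y|lborel. f (x, y))"
    using lborel_pair.integral_fst'[OF f] unfolding lborel_prod by (rule sym)
  show "integrable lborel (\<lambda>x. LINT y|lborel. f (x, y))"
    by (rule lborel_pair.integrable_fst'[OF f])
  show "AE x in lborel. integrable lborel (\<lambda>y. f (x, y))"
    by (rule lborel_pair.AE_integrable_fst'[OF f])
qed

lemma integral_plane_snd:
  fixes f :: "real \<times> real \<Rightarrow> 'a::{banach, second_countable_topology}"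
  assumes "integrable lborel f"
  shows "(LINT z|lborel. f z) = (LINT y|lborel. LINT x|lborel. f (x, y))"
    "integrable lborel (\<lambda>y. LINT x|lborel. f (x, y))"
    "AE y in lborel. integrable lborel (\<lambda>x. f (x, y))"
proof -
  have eta: "(\<lambda>(x, y). f (x, y)) = f" by auto
  have f: "integrable (lborel \<Otimes>\<^sub>M lborel) (case_prod (\<lambda>x y. f (x, y)))"
    using assms unfolding lborel_prod eta .
  show "(LINT z|lborel. f z) = (LINT y|lborel. LINT x|lborel. f (x, y))"
    using lborel_pair.integral_snd[OF f] unfolding lborel_prod eta by (rule sym)
  show "integrable lborel (\<lambda>y. LINT x|lborel. f (x, y))"
    by (rule lborel_pair.integrable_snd[OF f])
  show "AE y in lborel. integrable lborel (\<lambda>x. f (x, y))"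
    by (rule lborel_pair.AE_integrable_snd[OF f])
qed

lemma derivative_zero_outside_support:
  assumes "x \<notin> closure {x. \<phi> x \<noteq> (0::complex)}"
  shows "\<phi> x = 0" "d1 \<phi> x = 0" "d2 \<phi> x = 0"
proof -
  show "\<phi> x = 0" using assms closure_subset[of "{x. \<phi> x \<noteq> 0}"] by auto
  have "open (- closure {x. \<phi> x \<noteq> 0})" by (intro open_Compl closed_closure)
  then have "(\<phi> has_derivative (\<lambda>h. 0)) (at x)"
    using assms closure_subset[of "{x. \<phi> x \<noteq> 0}"]
    by (intro has_derivative_transform_within_open[OF has_derivative_const[of 0]]) auto
  then have eq: "frechet_derivative \<phi> (at x) = (\<lambda>h. 0)" by (rule frechet_derivative_at[symmetric])
  show "d1 \<phi> x = 0" "d2 \<phi> x = 0" by (simp_all only: eq)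
qed

lemma integrable_compact_support:
  fixes f :: "real \<times> real \<Rightarrow> complex"
  assumes f: "continuous_on UNIV f" and K: "compact K" and 0: "\<And>x. x \<notin> K \<Longrightarrow> f x = 0"
  shows "integrable lborel f"
proof -
  have "integrable lborel (\<lambda>x. indicator K x *\<^sub>R f x)"
    by (rule borel_integrable_compact[OF K continuous_on_subset[OF f]]) auto
  then show ?thesis
    by (rule back_subst[where P="integrable lborel"]) (use 0 in \<open>auto simp: indicator_def\<close>)
qed

text \<open>
  By Fubini and the fundamental theorem of calculus along the lines parallel to an axis.
\<close>

lemma C1_compact_support_integral:
  assumes \<rho>: "C1 \<rho>" and K: "compact (closure {x. \<rho> x \<noteq> 0})"
  shows "(LINT x|lborel. d1 \<rho> x) = 0" "(LINT x|lborel. d2 \<rho> x) = 0"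
proof -
  obtain R where R: "R > 0" "closure {x. \<rho> x \<noteq> 0} \<subseteq> ball 0 R"
    using compact_imp_bounded[OF K] bounded_subset_ballD by blast
  have out: "\<rho> (x, y) = 0" "d1 \<rho> (x, y) = 0" "d2 \<rho> (x, y) = 0" if "\<bar>x\<bar> \<ge> R \<or> \<bar>y\<bar> \<ge> R" for x y
  proof -
    have "norm (x, y) \<ge> R" using that norm_fst_le[of x y] norm_snd_le[of y x] by auto
    then have "(x, y) \<notin> closure {x. \<rho> x \<noteq> 0}" using subsetD[OF R(2), of "(x, y)"] by auto
    then show "\<rho> (x, y) = 0" "d1 \<rho> (x, y) = 0" "d2 \<rho> (x, y) = 0"
      using derivative_zero_outside_support by blast+
  qed
  have i: "integrable lborel (d1 \<rho>)" "integrable lborel (d2 \<rho>)"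
    using integrable_compact_support[OF C1_continuous(2)[OF \<rho>] K derivative_zero_outside_support(2)]
      integrable_compact_support[OF C1_continuous(3)[OF \<rho>] K derivative_zero_outside_support(3)] by blast+
  have "(LINT x|lborel. d1 \<rho> (x, y)) = 0" for y
  proof -
    have "(LINT x|lborel. d1 \<rho> (x, y)) = (LINT x|lborel. indicator {-R..R} x *\<^sub>R d1 \<rho> (x, y))"
      by (intro Bochner_Integration.integral_cong refl) (auto simp: indicator_def intro!: out)
    also have "\<dots> = 0" using C1_FTC1[OF \<rho>, of "-R" R y] out R(1) by simp
    finally show ?thesis .
  qed
  then show "(LINT x|lborel. d1 \<rho> x) = 0" by (simp add: integral_plane_snd(1)[OF i(1)])
  have "(LINT y|lborel. d2 \<rho> (x, y)) = 0" for x
  proof -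
    have "(LINT y|lborel. d2 \<rho> (x, y)) = (LINT y|lborel. indicator {-R..R} y *\<^sub>R d2 \<rho> (x, y))"
      by (intro Bochner_Integration.integral_cong refl) (auto simp: indicator_def intro!: out)
    also have "\<dots> = 0" using C1_FTC2[OF \<rho>, of "-R" R x] out R(1) by simp
    finally show ?thesis .
  qed
  then show "(LINT x|lborel. d2 \<rho> x) = 0" by (simp add: integral_plane_fst(1)[OF i(2)])
qed

text \<open>
  The product with a test function has compact support, so the integral of its derivative vanishes. Hence a
  \<open>C\<^sup>1\<close> function has its classical derivatives as weak derivatives.
\<close>

lemma C1_integration_by_parts:
  assumes \<psi>: "C1 \<psi>" and \<phi>: "test_fun \<Omega> \<phi>" and h: "h \<in> {(1, 0), (0, 1)}"
  shows "(LINT x:\<Omega>|lborel. \<psi> x * frechet_derivative \<phi> (at x) h)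
    = - (LINT x:\<Omega>|lborel. frechet_derivative \<psi> (at x) h * \<phi> x)"
proof -
  let ?K = "closure {x. \<phi> x \<noteq> 0}"
  have \<phi>': "C1 \<phi>" "compact ?K" "?K \<subseteq> \<Omega>" using \<phi> by (auto simp: test_fun_def)
  have sub: "closure {x. \<psi> x * \<phi> x \<noteq> 0} \<subseteq> ?K" by (rule closure_mono) auto
  have K: "compact (closure {x. \<psi> x * \<phi> x \<noteq> 0})"
    using compact_Int_closed[OF \<phi>'(2) closed_closure[of "{x. \<psi> x * \<phi> x \<noteq> 0}"]] sub by (simp add: Int_absorb1)
  note m = C1_mult[OF \<psi> \<phi>'(1)]
  have z: "\<phi> x = 0" "frechet_derivative \<phi> (at x) h = 0" if "x \<notin> ?K" for x
    using derivative_zero_outside_support[OF that] h by auto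
  have c: "continuous_on UNIV (\<lambda>x. frechet_derivative \<phi> (at x) h)" "continuous_on UNIV (\<lambda>x. frechet_derivative \<psi> (at x) h)"
    by (intro C1_continuous_deriv \<phi>'(1) \<psi>)+
  have i1: "integrable lborel (\<lambda>x. \<psi> x * frechet_derivative \<phi> (at x) h)"
    by (rule integrable_compact_support[OF continuous_on_mult[OF C1_continuous(1)[OF \<psi>] c(1)] \<phi>'(2)])
      (subst z(2), assumption, simp)
  have i2: "integrable lborel (\<lambda>x. frechet_derivative \<psi> (at x) h * \<phi> x)"
    by (rule integrable_compact_support[OF continuous_on_mult[OF c(2) C1_continuous(1)[OF \<phi>'(1)]] \<phi>'(2)])
      (subst z(1), assumption, simp)
  have z': "\<phi> x = 0" "frechet_derivative \<phi> (at x) h = 0" if "x \<notin> \<Omega>" for x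
    using z(1)[of x] z(2)[of x] \<phi>'(3) that by blast+
  have "(LINT x|lborel. frechet_derivative \<psi> (at x) h * \<phi> x + \<psi> x * frechet_derivative \<phi> (at x) h) = 0"
  proof -
    consider "h = (1, 0)" | "h = (0, 1)" using h by blast
    then show ?thesis
    proof cases
      case 1
      show ?thesis unfolding 1 using C1_compact_support_integral(1)[OF m(1) K] by (simp only: m(2))
    next
      case 2
      show ?thesis unfolding 2 using C1_compact_support_integral(2)[OF m(1) K] by (simp only: m(3))
    qed
  qed
  then have "0 = (LINT x|lborel. frechet_derivative \<psi> (at x) h * \<phi> x + \<psi> x * frechet_derivative \<phi> (at x) h)" by simp
  also have "\<dots> = (LINT x|lborel. frechet_derivative \<psi> (at x) h * \<phi> x) + (LINT x|lborel. \<psi> x * frechet_derivative \<phi> (at x) h)"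
    using i1 i2 by simp
  also have "(LINT x|lborel. frechet_derivative \<psi> (at x) h * \<phi> x) = (LINT x:\<Omega>|lborel. frechet_derivative \<psi> (at x) h * \<phi> x)"
    unfolding set_lebesgue_integral_def
    by (intro Bochner_Integration.integral_cong refl) (auto simp: indicator_def intro!: z')
  also have "(LINT x|lborel. \<psi> x * frechet_derivative \<phi> (at x) h) = (LINT x:\<Omega>|lborel. \<psi> x * frechet_derivative \<phi> (at x) h)"
    unfolding set_lebesgue_integral_def
    by (intro Bochner_Integration.integral_cong refl) (auto simp: indicator_def intro!: z')
  finally show ?thesis by (simp add: eq_neg_iff_add_eq_0 add.commute)
qed

section \<open>The fundamental lemma of the calculus of variations\<close>

text \<open>
  Boxes are stable under intersection and generate the Borel sets; by Dynkin's theorem the integrals over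
  all Borel sets vanish.
\<close>

lemma AE_zero_if_box_integrals_zero:
  fixes Z :: "'a::euclidean_space \<Rightarrow> complex"
  assumes Z: "integrable lborel Z"
    and box: "\<And>a b. (LINT x:box a b|lborel. Z x) = 0"
  shows "AE x in lborel. Z x = 0"
proof (rule sigma_finite_measure.density_zero[OF sigma_finite_lborel Z])
  let ?E = "range (\<lambda>(a, b). box a b::'a set)"
  have si: "set_integrable lborel A Z" if "A \<in> sets borel" for A
    using integrable_mult_indicator[of A lborel Z] that Z by (simp add: set_integrable_def)
  have eq: "sets borel = sigma_sets UNIV ?E" by (simp add: borel_eq_box)
  have UNIV0: "(LINT x|lborel. Z x) = 0"
  proof -
    let ?A = "\<lambda>n::nat. box (- (real n *\<^sub>R One)) (real n *\<^sub>R One) :: 'a set"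
    have inc: "incseq ?A"
      by (force simp: incseq_def subset_box)
    have "(\<lambda>n. LINT x:?A n|lborel. Z x) \<longlonglongrightarrow> (LINT x:(\<Union>n. ?A n)|lborel. Z x)"
      by (rule set_integral_cont_up) (use inc si in auto)
    then have "(\<lambda>n::nat. 0::complex) \<longlonglongrightarrow> (LINT x:(\<Union>n. ?A n)|lborel. Z x)"
      by (simp only: box)
    moreover have "(\<Union>n. ?A n) = UNIV" by (rule UN_box_eq_UNIV)
    ultimately show ?thesis
      by (simp add: LIMSEQ_const_iff set_lebesgue_integral_def)
  qed
  fix A :: "'a set" assume "A \<in> sets lborel"
  then have A: "A \<in> sigma_sets UNIV ?E" using eq by simp
  have "Int_stable ?E" "?E \<subseteq> Pow UNIV" by (auto simp: Int_stable_def box_Int_box)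
  from this A show "(LINT x:A|lborel. Z x) = 0"
  proof (induction rule: sigma_sets_induct_disjoint)
    case (basic A)
    then show ?case using box by auto
  next
    case (compl A)
    have "(LINT x:UNIV|lborel. Z x) = (LINT x:A|lborel. Z x) + (LINT x:UNIV - A|lborel. Z x)"
    proof -
      have Am: "A \<in> sets borel" "UNIV - A \<in> sets borel"
        using compl(1) eq sets.compl_sets[of A borel] by (auto simp only: space_borel)
      show ?thesis
        using set_integral_Un[of A "UNIV - A" lborel Z, OF _ si[OF Am(1)] si[OF Am(2)]] by simp
    qed
    then show ?case using UNIV0 compl by (simp add: set_lebesgue_integral_def)
  next
    case (union A)
    have m: "A i \<in> sets lborel" for i using union(2) eq by auto
    have "(LINT x:(\<Union>i. A i)|lborel. Z x) = (\<Sum>i. LINT x:A i|lborel. Z x)"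
      by (rule lebesgue_integral_countable_add) (use union(1) m si in \<open>auto simp: disjoint_family_on_def\<close>)
    then show ?case using union by simp
  next
    case empty
    show ?case by (simp add: set_lebesgue_integral_def)
  qed
qed

text \<open>
  The simplest \<open>C\<^sup>1\<close> function that vanishes exactly on the nonpositive half line. All cutoffs are built from it.
\<close>

definition pos2 :: "real \<Rightarrow> real" where "pos2 t = (max 0 t)\<^sup>2"

lemma pos2_deriv: "(pos2 has_real_derivative 2 * max 0 t) (at t)"
proof -
  consider "t > 0" | "t < 0" | "t = 0" by linarith
  then show ?thesis
  proof cases
    case 1
    have "((\<lambda>t. t\<^sup>2) has_real_derivative 2 * t) (at t)" by (auto intro!: derivative_eq_intros)
    then have "(pos2 has_real_derivative 2 * t) (at t)"
      by (rule DERIV_cong_ev[THEN iffD1, rotated -1, OF _ refl _ refl])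
        (auto simp: pos2_def max_def intro!: eventually_mono[OF eventually_nhds_in_open[of "{0<..}" t]] 1)
    then show ?thesis using 1 by simp
  next
    case 2
    have "((\<lambda>t. 0) has_real_derivative 0) (at t)" by simp
    then have "(pos2 has_real_derivative 0) (at t)"
      by (rule DERIV_cong_ev[THEN iffD1, rotated -1, OF _ refl _ refl])
        (auto simp: pos2_def max_def intro!: eventually_mono[OF eventually_nhds_in_open[of "{..<0}" t]] 2)
    then show ?thesis using 2 by simp
  next
    case 3
    have "((\<lambda>h. pos2 h / h) \<longlongrightarrow> 0) (at 0)"
    proof (rule tendsto_0_le[where K=1 and f="\<lambda>h. h"])
      show "\<forall>\<^sub>F h in at 0. norm (pos2 h / h) \<le> norm h * 1"
        by (intro always_eventually) (auto simp: pos2_def max_def power2_eq_square)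
    qed (rule tendsto_ident_at)
    then show ?thesis using 3 by (simp add: DERIV_def pos2_def)
  qed
qed

lemma pos2_deriv_chain [derivative_intros]:
  assumes "(g has_real_derivative g') (at x within S)"
  shows "((\<lambda>x. pos2 (g x)) has_real_derivative 2 * max 0 (g x) * g') (at x within S)"
  using DERIV_chain2[OF pos2_deriv assms] by simp

lemma continuous_on_pos2 [continuous_intros]:
  "continuous_on S g \<Longrightarrow> continuous_on S (\<lambda>x. pos2 (g x))"
  unfolding pos2_def by (intro continuous_intros)

lemma pos2_simps [simp]: "t \<le> 0 \<Longrightarrow> pos2 t = 0" "0 \<le> t \<Longrightarrow> pos2 t = t\<^sup>2" "0 \<le> pos2 t"
  by (auto simp: pos2_def)

text \<open>
  A \<open>C\<^sup>1\<close> step that rises from 0 to 1 on the unit interval: the derivative vanishes at 0 because of the inner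
  square, at 1 because of the outer one.
\<close>

definition sstep :: "real \<Rightarrow> real" where "sstep t = 1 - pos2 (1 - pos2 t)"

definition sstep' :: "real \<Rightarrow> real" where "sstep' t = 4 * max 0 (1 - pos2 t) * max 0 t"

lemma sstep_deriv: "(sstep has_real_derivative sstep' t) (at t)"
  unfolding sstep_def sstep'_def by (auto intro!: derivative_eq_intros)

lemma sstep'_continuous: "continuous_on S sstep'"
  unfolding sstep'_def by (intro continuous_intros)

lemma sstep_zero [simp]: "t \<le> 0 \<Longrightarrow> sstep t = 0"
  by (simp add: sstep_def)

lemma sstep_one [simp]: "t \<ge> 1 \<Longrightarrow> sstep t = 1"
  using one_le_power[of t 2] by (simp add: sstep_def pos2_def max_absorb2 max_absorb1)

lemma sstep_bounds [simp]: "0 \<le> sstep t" "sstep t \<le> 1"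
  by (auto simp: sstep_def pos2_def max_def power_le_one_iff abs_square_le_1)

lemma sstep'_zero [simp]: "t \<le> 0 \<Longrightarrow> sstep' t = 0" "t \<ge> 1 \<Longrightarrow> sstep' t = 0"
proof -
  show "sstep' t = 0" if "t \<le> 0" using that by (simp add: sstep'_def)
  show "sstep' t = 0" if "t \<ge> 1"
    using one_le_power[OF that, of 2] by (use that in \<open>simp add: sstep'_def pos2_def max_absorb1 max_absorb2\<close>)
qed

lemma sstep'_bounds [simp]: "0 \<le> sstep' t" "sstep' t \<le> 4"
proof -
  show "0 \<le> sstep' t" by (simp add: sstep'_def)
  have "sstep' t \<le> 4 * 1 * 1" if "0 \<le> t" "t \<le> 1"
    unfolding sstep'_def using that by (intro mult_mono) (auto simp: max_def)
  then show "sstep' t \<le> 4"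
    using sstep'_zero[of t] by (cases "t \<le> 0"; cases "t \<ge> 1") auto
qed

text \<open>
  \<open>C\<^sup>1\<close> approximation of the indicator function of \<open>{a<..<b}\<close>, supported at distance at least \<open>1 / n\<close> from
  the end points, so that products of two bumps are test functions on a box.
\<close>

definition bump :: "real \<Rightarrow> real \<Rightarrow> nat \<Rightarrow> real \<Rightarrow> real" where
  "bump a b n t = sstep (real n * (t - a) - 1) * sstep (real n * (b - t) - 1)"

lemma bump_bounds: "0 \<le> bump a b n t" "bump a b n t \<le> 1"
  by (auto simp: bump_def intro!: mult_le_one)

lemma bump_outside:
  assumes "n > 0" "t < a + 1 / real n \<or> t > b - 1 / real n"
  shows "bump a b n t = 0"
proof -
  have "real n * (t - a) \<le> 1 \<or> real n * (b - t) \<le> 1"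
    using assms by (auto simp: field_simps)
  then show ?thesis by (auto simp: bump_def)
qed

lemma bump_tendsto: "(\<lambda>n. bump a b n t) \<longlonglongrightarrow> indicator {a<..<b} t"
proof (cases "a < t \<and> t < b")
  case True
  have ev: "\<forall>\<^sub>F n in sequentially. real n * c \<ge> 2" if "c > 0" for c
  proof -
    obtain N where N: "2 / c < real N" using reals_Archimedean2 by blast
    have "real n * c \<ge> 2" if "n \<ge> N" for n
      using N that \<open>c > 0\<close> by (simp add: field_simps) (meson less_imp_le mult_left_mono of_nat_le_iff order_trans less_le_trans)
    then show ?thesis using eventually_sequentially by blast
  qed
  have "\<forall>\<^sub>F n in sequentially. real n * (t - a) \<ge> 2" "\<forall>\<^sub>F n in sequentially. real n * (b - t) \<ge> 2"
    using True by (auto intro!: ev)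
  then have "\<forall>\<^sub>F n in sequentially. bump a b n t = 1"
    by eventually_elim (simp add: bump_def)
  then show ?thesis using True by (auto intro: tendsto_eventually)
next
  case False
  have "\<forall>\<^sub>F n in sequentially. bump a b n t = 0"
    using eventually_gt_at_top[of 0]
  proof eventually_elim
    case (elim n)
    have "1 / real n > 0" using elim by simp
    then show ?case using False elim by (intro bump_outside) linarith+
  qed
  then show ?thesis using False by (auto intro: tendsto_eventually)
qed

lemma bump_C1: "\<exists>g'. (\<forall>t. ((\<lambda>t. complex_of_real (bump a b n t)) has_vector_derivative g' t) (at t)) \<and> continuous_on UNIV g'"
proof -
  let ?g = "\<lambda>t. sstep' (real n * (t - a) - 1) * real n * sstep (real n * (b - t) - 1)
     + sstep (real n * (t - a) - 1) * (- sstep' (real n * (b - t) - 1) * real n)"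
  have d: "(bump a b n has_real_derivative ?g t) (at t)" for t
    unfolding bump_def
    by (auto intro!: derivative_eq_intros DERIV_chain2[OF sstep_deriv])
  have "((\<lambda>t. complex_of_real (bump a b n t)) has_vector_derivative complex_of_real (?g t)) (at t)" for t
    by (rule has_vector_derivative_of_real) (rule d)
  moreover have "continuous_on UNIV sstep"
    using sstep_deriv by (auto intro!: continuous_at_imp_continuous_on DERIV_isCont)
  then have "continuous_on UNIV (\<lambda>t. complex_of_real (?g t))"
    by (auto intro!: continuous_intros continuous_on_compose2[OF sstep'_continuous]
        continuous_on_compose2[of UNIV sstep])
  ultimately show ?thesis by (intro exI[of _ "\<lambda>t. complex_of_real (?g t)"] conjI allI)
qed

lemma real2_box: "box (a::real\<times>real) b = {x. fst a < fst x \<and> fst x < fst b \<and> snd a < snd x \<and> snd x < snd b}"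
  by (cases a; cases b) (auto simp: box_def Basis_prod_def)

lemma box_bump:
  obtains \<phi> where "\<And>n. n > 0 \<Longrightarrow> test_fun (box a b) (\<phi> n)" "\<And>n x. cmod (\<phi> n x) \<le> 1"
    "\<And>x. (\<lambda>n. \<phi> n x) \<longlonglongrightarrow> indicator (box a b) (x :: real \<times> real)" "\<And>n x. n > 0 \<Longrightarrow> x \<notin> box a b \<Longrightarrow> \<phi> n x = 0"
    "\<And>n. n > 0 \<Longrightarrow> C1 (\<phi> n)"
proof
  let ?\<phi> = "\<lambda>(n::nat) x. complex_of_real (bump (fst a) (fst b) n (fst x)) * complex_of_real (bump (snd a) (snd b) n (snd x))"
  show "cmod (?\<phi> n x) \<le> 1" for n x
    using bump_bounds by (auto simp: norm_mult intro!: mult_le_one)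
  have "(\<lambda>n. ?\<phi> n x) \<longlonglongrightarrow> complex_of_real (indicator {fst a<..<fst b} (fst x)) * complex_of_real (indicator {snd a<..<snd b} (snd x))" for x
    by (intro tendsto_intros bump_tendsto)
  moreover have "complex_of_real (indicator {fst a<..<fst b} (fst x)) * complex_of_real (indicator {snd a<..<snd b} (snd x))
      = indicator (box a b) x" for x
    by (auto simp: indicator_def real2_box)
  ultimately show "(\<lambda>n. ?\<phi> n x) \<longlonglongrightarrow> indicator (box a b) x" for x by simp
  show C: "C1 (?\<phi> n)" for n
  proof -
    obtain g' where g: "\<And>t. ((\<lambda>t. complex_of_real (bump (fst a) (fst b) n t)) has_vector_derivative g' t) (at t)" "continuous_on UNIV g'"
      using bump_C1 by metis
    obtain h' where h: "\<And>t. ((\<lambda>t. complex_of_real (bump (snd a) (snd b) n t)) has_vector_derivative h' t) (at t)" "continuous_on UNIV h'"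
      using bump_C1 by metis
    show ?thesis by (rule C1_mult(1)[OF C1_fst(1)[OF g] C1_snd(1)[OF h]])
  qed
  have sub: "{x. ?\<phi> n x \<noteq> 0} \<subseteq> cbox (fst a + 1 / n, snd a + 1 / n) (fst b - 1 / n, snd b - 1 / n)" if "n > 0" for n
  proof
    fix x assume "x \<in> {x. ?\<phi> n x \<noteq> 0}"
    then have "bump (fst a) (fst b) n (fst x) \<noteq> 0" "bump (snd a) (snd b) n (snd x) \<noteq> 0" by auto
    then show "x \<in> cbox (fst a + 1 / n, snd a + 1 / n) (fst b - 1 / n, snd b - 1 / n)"
      using bump_outside[OF that, of "fst x" "fst a" "fst b"] bump_outside[OF that, of "snd x" "snd a" "snd b"]
      by (cases x) (fastforce simp: not_less)
  qed
  have cb: "cbox (fst a + 1 / n, snd a + 1 / n) (fst b - 1 / n, snd b - 1 / n) \<subseteq> box a b" if "n > 0" for n :: nat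
  proof -
    have "1 / real n > 0" using that by simp
    then have "fst a < u" if "fst a + 1 / real n \<le> u" for u using that by linarith
    moreover have "snd a < u" if "snd a + 1 / real n \<le> u" for u using that \<open>1 / real n > 0\<close> by linarith
    moreover have "u < fst b" if "u \<le> fst b - 1 / real n" for u using that \<open>1 / real n > 0\<close> by linarith
    moreover have "u < snd b" if "u \<le> snd b - 1 / real n" for u using that \<open>1 / real n > 0\<close> by linarith
    ultimately show ?thesis by (auto simp: real2_box)
  qed
  show "?\<phi> n x = 0" if "n > 0" "x \<notin> box a b" for n x
    using sub[OF that(1)] cb[OF that(1)] that(2) by blast
  show "test_fun (box a b) (?\<phi> n)" if "n > 0" for n
  proof -
    have cl: "closure {x. ?\<phi> n x \<noteq> 0} \<subseteq> cbox (fst a + 1 / n, snd a + 1 / n) (fst b - 1 / n, snd b - 1 / n)"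
      by (intro closure_minimal sub that) auto
    then have "compact (closure {x. ?\<phi> n x \<noteq> 0})"
      using cl compact_Int_closed[OF compact_cbox closed_closure[of "{x. ?\<phi> n x \<noteq> 0}"],
          of "(fst a + 1 / n, snd a + 1 / n)" "(fst b - 1 / n, snd b - 1 / n)"] by (simp only: Int_absorb1)
    then show ?thesis using C cl cb[OF that] by (auto simp: test_fun_def)
  qed
qed

lemma test_fun_mono: "test_fun A \<phi> \<Longrightarrow> A \<subseteq> B \<Longrightarrow> test_fun B \<phi>"
  by (auto simp: test_fun_def)

text \<open>
  Products of bumps approximate the indicator functions of boxes inside \<open>\<Omega>\<close> boundedly, hence the integrals
  of \<open>w\<close> over these boxes vanish; countably many of them cover \<open>\<Omega>\<close>.
\<close>

lemma fundamental_lemma: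
  fixes w :: "real \<times> real \<Rightarrow> complex"
  assumes \<Omega>: "open \<Omega>" "bounded \<Omega>" and w: "L2 \<Omega> w"
    and 0: "\<And>\<phi>. test_fun \<Omega> \<phi> \<Longrightarrow> (LINT x:\<Omega>|lborel. w x * \<phi> x) = 0"
  shows "AE x in lborel. zext \<Omega> w x = 0"
proof -
  have m: "\<Omega> \<in> sets borel" using \<Omega> by simp
  have iw: "integrable lborel (zext \<Omega> w)"
    by (rule sq_int_zext_integrable) (use w \<Omega> m L2_zext in auto)
  have zero: "(LINT x:box a b|lborel. zext \<Omega> w x) = 0" if sub: "box a b \<subseteq> \<Omega>" for a b
  proof -
    obtain \<phi> where \<phi>: "\<And>n. n > 0 \<Longrightarrow> test_fun (box a b) (\<phi> n)" "\<And>n x. cmod (\<phi> n x) \<le> 1"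
      "\<And>x. (\<lambda>n. \<phi> n x) \<longlonglongrightarrow> indicator (box a b) x" "\<And>n x. n > 0 \<Longrightarrow> x \<notin> box a b \<Longrightarrow> \<phi> n x = 0"
      "\<And>n. n > 0 \<Longrightarrow> C1 (\<phi> n)"
      using box_bump by blast
    have pm [measurable]: "\<phi> (Suc n) \<in> borel_measurable borel" for n
      using C1_continuous(1)[OF \<phi>(5)] by (auto intro: borel_measurable_continuous_onI)
    note [measurable] = borel_measurable_integrable[OF iw]
    have "(\<lambda>n. LINT x|lborel. zext \<Omega> w x * \<phi> (Suc n) x) \<longlonglongrightarrow> (LINT x|lborel. zext \<Omega> w x * indicator (box a b) x)"
    proof (rule integral_dominated_convergence[where w="\<lambda>x. cmod (zext \<Omega> w x)"])
      show "AE x in lborel. (\<lambda>n. zext \<Omega> w x * \<phi> (Suc n) x) \<longlonglongrightarrow> zext \<Omega> w x * indicator (box a b) x"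
        by (intro AE_I2 tendsto_intros LIMSEQ_Suc[OF \<phi>(3)])
      show "AE x in lborel. norm (zext \<Omega> w x * \<phi> (Suc n) x) \<le> cmod (zext \<Omega> w x)" for n
        using \<phi>(2) by (auto simp: norm_mult mult_left_le)
    qed (use iw in \<open>auto intro: integrable_norm\<close>)
    moreover have "(LINT x|lborel. zext \<Omega> w x * \<phi> (Suc n) x) = 0" for n
      using 0[OF test_fun_mono[OF \<phi>(1) sub], of "Suc n"] by (simp add: set_integral_zext)
    ultimately have "(LINT x|lborel. zext \<Omega> w x * indicator (box a b) x) = 0"
      by (simp add: LIMSEQ_const_iff)
    then show ?thesis
      by (simp add: set_lebesgue_integral_def scaleR_conv_of_real mult.commute of_real_indicator)
  qed
  obtain \<D> where \<D>: "countable \<D>" "\<And>X. X \<in> \<D> \<Longrightarrow> \<exists>a b. X = box a b" "\<Union>\<D> = \<Omega>"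
    using open_countable_Union_open_box[OF \<Omega>(1)] by metis
  have "AE x in lborel. x \<in> X \<longrightarrow> zext \<Omega> w x = 0" if X: "X \<in> \<D>" for X
  proof -
    obtain a b where ab: "X = box a b" using \<D>(2)[OF X] by auto
    have "AE x in lborel. indicator X x *\<^sub>R zext \<Omega> w x = 0"
    proof (rule AE_zero_if_box_integrals_zero)
      show "integrable lborel (\<lambda>x. indicator X x *\<^sub>R zext \<Omega> w x)"
        using iw by (intro integrable_mult_indicator) (auto simp: ab)
      fix c d
      obtain c' d' where cd: "box a b \<inter> box c d = box c' d'" using box_Int_box by blast
      have "(LINT x:box c d|lborel. indicator X x *\<^sub>R zext \<Omega> w x) = (LINT x:box c' d'|lborel. zext \<Omega> w x)"
        unfolding cd[symmetric] ab set_lebesgue_integral_def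
        by (intro Bochner_Integration.integral_cong) (auto simp: indicator_def)
      also have "\<dots> = 0" using cd ab X \<D>(3) by (intro zero) blast
      finally show "(LINT x:box c d|lborel. indicator X x *\<^sub>R zext \<Omega> w x) = 0" .
    qed
    then show ?thesis by eventually_elim (auto simp: indicator_def)
  qed
  then have "AE x in lborel. \<forall>X\<in>\<D>. x \<in> X \<longrightarrow> zext \<Omega> w x = 0"
    using \<D>(1) by (subst AE_ball_countable) auto
  then show ?thesis
  proof eventually_elim
    case (elim x)
    then show ?case using \<D>(3) by (cases "x \<in> \<Omega>") auto
  qed
qed

section \<open>Sobolev functions as limits of continuously differentiable ones\<close>

text \<open>
  The form in which Sobolev functions are handled: an approximating sequence of \<open>C\<^sup>1\<close> functions together
  with the limits of its values and of its gradients. Each identity below is proved for \<open>C\<^sup>1\<close> functions and then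
  passed to the limit.
\<close>

definition H1_lim :: "(real \<times> real) set \<Rightarrow> (nat \<Rightarrow> real \<times> real \<Rightarrow> complex) \<Rightarrow>
    (real \<times> real \<Rightarrow> complex) \<Rightarrow> (real \<times> real \<Rightarrow> complex) \<Rightarrow> (real \<times> real \<Rightarrow> complex) \<Rightarrow> bool" where
  "H1_lim \<Omega> \<phi> v V1 V2 \<longleftrightarrow> (\<forall>j. C1 (\<phi> j)) \<and>
    L2_lim lborel (\<lambda>j. zext \<Omega> (\<phi> j)) (zext \<Omega> v) \<and>
    L2_lim lborel (\<lambda>j. zext \<Omega> (d1 (\<phi> j))) (zext \<Omega> V1) \<and>
    L2_lim lborel (\<lambda>j. zext \<Omega> (d2 (\<phi> j))) (zext \<Omega> V2)"

lemma H1_lim_weak_deriv: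
  assumes \<Omega>: "open \<Omega>" "bounded \<Omega>" and l: "H1_lim \<Omega> \<phi> v V1 V2"
  shows "has_weak_deriv \<Omega> (1, 0) v V1" "has_weak_deriv \<Omega> (0, 1) v V2"
proof -
  have *: "has_weak_deriv \<Omega> h v V"
    if h: "h \<in> {(1, 0), (0, 1)}" and V: "L2_lim lborel (\<lambda>j. zext \<Omega> (\<lambda>x. frechet_derivative (\<phi> j) (at x) h)) (zext \<Omega> V)" for h V
    unfolding has_weak_deriv_def
  proof (intro allI impI)
    fix \<rho> assume \<rho>: "test_fun \<Omega> \<rho>"
    then have K: "compact (closure {x. \<rho> x \<noteq> 0})" "closure {x. \<rho> x \<noteq> 0} \<subseteq> \<Omega>" "C1 \<rho>" by (auto simp: test_fun_def)
    have c: "continuous_on UNIV (\<lambda>x. frechet_derivative \<rho> (at x) h)" by (rule C1_continuous_deriv[OF K(3)])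
    have z: "(LINT x:\<Omega>|lborel. u x * g x) = (LINT x|lborel. zext \<Omega> u x * zext \<Omega> g x)" for u g
      unfolding set_integral_zext by (intro Bochner_Integration.integral_cong) (auto simp: zext_def indicator_def)
    have s: "sq_int lborel (zext \<Omega> \<rho>)" "sq_int lborel (zext \<Omega> (\<lambda>x. frechet_derivative \<rho> (at x) h))"
      using \<Omega> by (auto intro!: sq_int_zext_continuous C1_continuous(1)[OF K(3)] c)
    have "(\<lambda>j. LINT x:\<Omega>|lborel. \<phi> j x * frechet_derivative \<rho> (at x) h) \<longlonglongrightarrow> (LINT x:\<Omega>|lborel. v x * frechet_derivative \<rho> (at x) h)"
      unfolding z using l s by (intro L2_lim_inner) (auto simp: H1_lim_def)
    moreover have "(\<lambda>j. LINT x:\<Omega>|lborel. frechet_derivative (\<phi> j) (at x) h * \<rho> x) \<longlonglongrightarrow> (LINT x:\<Omega>|lborel. V x * \<rho> x)"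
      unfolding z using V s by (intro L2_lim_inner)
    moreover have "(LINT x:\<Omega>|lborel. \<phi> j x * frechet_derivative \<rho> (at x) h) = - (LINT x:\<Omega>|lborel. frechet_derivative (\<phi> j) (at x) h * \<rho> x)" for j
      using l by (intro C1_integration_by_parts[OF _ \<rho> h]) (auto simp: H1_lim_def)
    ultimately show "(LINT x:\<Omega>|lborel. v x * frechet_derivative \<rho> (at x) h) = - (LINT x:\<Omega>|lborel. V x * \<rho> x)"
      by (metis (no_types, lifting) LIMSEQ_unique tendsto_minus ext)
  qed
  show "has_weak_deriv \<Omega> (1, 0) v V1" "has_weak_deriv \<Omega> (0, 1) v V2"
    using l by (auto intro!: * simp: H1_lim_def)
qed

lemma weak_deriv_unique:
  assumes \<Omega>: "open \<Omega>" "bounded \<Omega>" and V: "L2 \<Omega> V" "has_weak_deriv \<Omega> h v V"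
  shows "L2 \<Omega> (weak_deriv \<Omega> h v)" "has_weak_deriv \<Omega> h v (weak_deriv \<Omega> h v)"
    "AE x in lborel. zext \<Omega> (weak_deriv \<Omega> h v) x = zext \<Omega> V x"
proof -
  have ex: "L2 \<Omega> (weak_deriv \<Omega> h v) \<and> has_weak_deriv \<Omega> h v (weak_deriv \<Omega> h v)"
    unfolding weak_deriv_def by (rule someI[where x=V]) (use V in auto)
  then show W: "L2 \<Omega> (weak_deriv \<Omega> h v)" "has_weak_deriv \<Omega> h v (weak_deriv \<Omega> h v)" by auto
  let ?d = "\<lambda>x. weak_deriv \<Omega> h v x - V x"
  have sub: "AE x in lborel. zext \<Omega> ?d x = 0"
  proof (rule fundamental_lemma[OF \<Omega>])
    show "L2 \<Omega> ?d" using W V by (simp add: L2_zext zext_diff sq_int_diff)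
    fix \<phi> assume \<phi>: "test_fun \<Omega> \<phi>"
    have s: "sq_int lborel (zext \<Omega> \<phi>)"
      using \<phi> \<Omega> by (intro sq_int_zext_continuous C1_continuous(1)) (auto simp: test_fun_def)
    have z: "(LINT x:\<Omega>|lborel. u x * \<phi> x) = (LINT x|lborel. zext \<Omega> u x * zext \<Omega> \<phi> x)" for u
      unfolding set_integral_zext by (intro Bochner_Integration.integral_cong) (auto simp: zext_def indicator_def)
    have "(LINT x:\<Omega>|lborel. ?d x * \<phi> x) = (LINT x:\<Omega>|lborel. weak_deriv \<Omega> h v x * \<phi> x) - (LINT x:\<Omega>|lborel. V x * \<phi> x)"
      unfolding z[of ?d] z[of V] z[of "weak_deriv \<Omega> h v"] unfolding zext_diff left_diff_distrib
      by (intro Bochner_Integration.integral_diff sq_int_mult_integrable s) (use W V L2_zext in auto)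
    also have "\<dots> = 0" using W(2)[unfolded has_weak_deriv_def, rule_format, OF \<phi>] V(2)[unfolded has_weak_deriv_def, rule_format, OF \<phi>]
      by simp
    finally show "(LINT x:\<Omega>|lborel. ?d x * \<phi> x) = 0" .
  qed
  then show "AE x in lborel. zext \<Omega> (weak_deriv \<Omega> h v) x = zext \<Omega> V x"
    by eventually_elim (auto simp: zext_diff)
qed

text \<open>
  Integration by parts survives the limit, so \<open>V1\<close> and \<open>V2\<close> are weak derivatives; by uniqueness they agree
  almost everywhere with the chosen representatives.
\<close>

lemma H1_lim_imp_H1:
  assumes \<Omega>: "open \<Omega>" "bounded \<Omega>" and l: "H1_lim \<Omega> \<phi> v V1 V2"
  shows "v \<in> H1 \<Omega>"
    and "AE x in lborel. zext \<Omega> (weak_deriv \<Omega> (1, 0) v) x = zext \<Omega> V1 x"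
    and "AE x in lborel. zext \<Omega> (weak_deriv \<Omega> (0, 1) v) x = zext \<Omega> V2 x"
    and "H1_lim \<Omega> \<phi> v (weak_deriv \<Omega> (1, 0) v) (weak_deriv \<Omega> (0, 1) v)"
proof -
  note wd = H1_lim_weak_deriv[OF \<Omega> l]
  have lim: "\<And>j. C1 (\<phi> j)" "L2_lim lborel (\<lambda>j. zext \<Omega> (\<phi> j)) (zext \<Omega> v)"
    "L2_lim lborel (\<lambda>j. zext \<Omega> (d1 (\<phi> j))) (zext \<Omega> V1)"
    "L2_lim lborel (\<lambda>j. zext \<Omega> (d2 (\<phi> j))) (zext \<Omega> V2)"
    using l unfolding H1_lim_def by blast+
  have L: "L2 \<Omega> v" "L2 \<Omega> V1" "L2 \<Omega> V2"
    unfolding L2_zext by (fact L2_limD(2)[OF lim(2)] L2_limD(2)[OF lim(3)] L2_limD(2)[OF lim(4)])+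
  show "v \<in> H1 \<Omega>" unfolding H1_def using wd L by blast
  note u = weak_deriv_unique[OF \<Omega> L(2) wd(1)] weak_deriv_unique[OF \<Omega> L(3) wd(2)]
  show ae: "AE x in lborel. zext \<Omega> (weak_deriv \<Omega> (1, 0) v) x = zext \<Omega> V1 x"
    "AE x in lborel. zext \<Omega> (weak_deriv \<Omega> (0, 1) v) x = zext \<Omega> V2 x"
    by (fact u)+
  have m: "zext \<Omega> (weak_deriv \<Omega> (1, 0) v) \<in> borel_measurable lborel"
    "zext \<Omega> (weak_deriv \<Omega> (0, 1) v) \<in> borel_measurable lborel"
    using u(1,4) unfolding L2_zext sq_int_def by blast+
  have "AE x in lborel. zext \<Omega> V1 x = zext \<Omega> (weak_deriv \<Omega> (1, 0) v) x"
    "AE x in lborel. zext \<Omega> V2 x = zext \<Omega> (weak_deriv \<Omega> (0, 1) v) x"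
    using ae by (eventually_elim, simp)+
  from L2_lim_cong_AE[OF lim(3) this(1) m(1)] L2_lim_cong_AE[OF lim(4) this(2) m(2)]
  show "H1_lim \<Omega> \<phi> v (weak_deriv \<Omega> (1, 0) v) (weak_deriv \<Omega> (0, 1) v)"
    using lim(1,2) by (simp add: H1_lim_def)
qed

lemma H1_D:
  assumes "v \<in> H1 \<Omega>"
  shows "L2 \<Omega> v" "L2 \<Omega> (weak_deriv \<Omega> (1, 0) v)" "L2 \<Omega> (weak_deriv \<Omega> (0, 1) v)"
proof -
  show "L2 \<Omega> v" using assms by (simp add: H1_def)
  have "L2 \<Omega> (weak_deriv \<Omega> h v) \<and> has_weak_deriv \<Omega> h v (weak_deriv \<Omega> h v)" if "h \<in> {(1, 0), (0, 1)}" for h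
  proof -
    have "\<exists>w. L2 \<Omega> w \<and> has_weak_deriv \<Omega> h v w" using assms that unfolding H1_def by blast
    then show ?thesis unfolding weak_deriv_def by (rule someI_ex)
  qed
  then show "L2 \<Omega> (weak_deriv \<Omega> (1, 0) v)" "L2 \<Omega> (weak_deriv \<Omega> (0, 1) v)" by auto
qed

text \<open>
  A trace is thus the limit of the restrictions along some approximating sequence. Different boundary
  pieces may need different sequences.
\<close>

lemma has_trace_iff_H1_lim:
  assumes \<Omega>: "open \<Omega>" "bounded \<Omega>" and v: "v \<in> H1 \<Omega>"
    and \<gamma>: "continuous_on UNIV \<gamma>" and I: "bounded I" "I \<in> sets borel"
  shows "has_trace \<Omega> \<gamma> I v w \<longleftrightarrow>
    (\<exists>\<phi>. H1_lim \<Omega> \<phi> v (weak_deriv \<Omega> (1, 0) v) (weak_deriv \<Omega> (0, 1) v) \<and>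
       L2_lim lborel (\<lambda>j. zext I (\<lambda>t. \<phi> j (\<gamma> t))) (zext I w))"
proof -
  have m: "\<Omega> \<in> sets borel" using \<Omega> by simp
  have cI: "L2 I (\<lambda>t. \<phi> (\<gamma> t))" if "C1 \<phi>" for \<phi>
    unfolding L2_zext by (intro sq_int_zext_continuous I continuous_on_compose2[OF C1_continuous(1)[OF that] \<gamma>]) auto
  have c\<Omega>: "L2 \<Omega> \<phi>" "L2 \<Omega> (d1 \<phi>)" "L2 \<Omega> (d2 \<phi>)" if "C1 \<phi>" for \<phi>
    unfolding L2_zext by (intro sq_int_zext_continuous \<Omega> m C1_continuous[OF that])+
  note H = H1_D[OF v]
  show ?thesis
  proof
    assume "has_trace \<Omega> \<gamma> I v w"
    then obtain \<phi> where \<phi>: "L2 I w" "\<And>j. C1 (\<phi> j)" "(\<lambda>j. L2norm \<Omega> (\<lambda>x. \<phi> j x - v x)) \<longlonglongrightarrow> 0"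
      "(\<lambda>j. L2norm \<Omega> (\<lambda>x. d1 (\<phi> j) x - weak_deriv \<Omega> (1, 0) v x)) \<longlonglongrightarrow> 0"
      "(\<lambda>j. L2norm \<Omega> (\<lambda>x. d2 (\<phi> j) x - weak_deriv \<Omega> (0, 1) v x)) \<longlonglongrightarrow> 0"
      "(\<lambda>j. L2norm I (\<lambda>t. \<phi> j (\<gamma> t) - w t)) \<longlonglongrightarrow> 0"
      unfolding has_trace_def by auto
    show "\<exists>\<phi>. H1_lim \<Omega> \<phi> v (weak_deriv \<Omega> (1, 0) v) (weak_deriv \<Omega> (0, 1) v) \<and>
       L2_lim lborel (\<lambda>j. zext I (\<lambda>t. \<phi> j (\<gamma> t))) (zext I w)"
      unfolding H1_lim_def using \<phi> H
      by (intro exI[of _ \<phi>] conjI allI) (auto simp: L2_lim_zext_iff c\<Omega> cI)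
  next
    assume "\<exists>\<phi>. H1_lim \<Omega> \<phi> v (weak_deriv \<Omega> (1, 0) v) (weak_deriv \<Omega> (0, 1) v) \<and>
       L2_lim lborel (\<lambda>j. zext I (\<lambda>t. \<phi> j (\<gamma> t))) (zext I w)"
    then obtain \<phi> where \<phi>: "\<And>j. C1 (\<phi> j)" "L2_lim lborel (\<lambda>j. zext \<Omega> (\<phi> j)) (zext \<Omega> v)"
      "L2_lim lborel (\<lambda>j. zext \<Omega> (d1 (\<phi> j))) (zext \<Omega> (weak_deriv \<Omega> (1, 0) v))"
      "L2_lim lborel (\<lambda>j. zext \<Omega> (d2 (\<phi> j))) (zext \<Omega> (weak_deriv \<Omega> (0, 1) v))"
      "L2_lim lborel (\<lambda>j. zext I (\<lambda>t. \<phi> j (\<gamma> t))) (zext I w)"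
      unfolding H1_lim_def by auto
    have w: "L2 I w" using L2_limD(2)[OF \<phi>(5)] by (simp add: L2_zext)
    show "has_trace \<Omega> \<gamma> I v w"
      unfolding has_trace_def using \<phi> w H
      by (intro conjI exI[of _ \<phi>]) (auto simp: L2_lim_zext_iff c\<Omega> cI)
  qed
qed

section \<open>Translations and restrictions\<close>

lemma integral_translate:
  fixes g :: "'a::euclidean_space \<Rightarrow> 'b::{banach, second_countable_topology}"
  assumes [measurable]: "g \<in> borel_measurable borel"
  shows "(LINT x|lborel. g (x - c)) = (LINT x|lborel. g x)"
    "integrable lborel (\<lambda>x. g (x - c)) \<longleftrightarrow> integrable lborel g"
proof -
  have d: "distr lborel borel ((+) (- c)) = (lborel :: 'a measure)" by (rule lborel_distr_plus)
  have "(LINT x|lborel. g x) = (LINT x|distr lborel borel ((+) (- c)). g x)" using d by simp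
  also have "\<dots> = (LINT x|lborel. g (- c + x))" by (rule integral_distr) auto
  finally show "(LINT x|lborel. g (x - c)) = (LINT x|lborel. g x)" by simp
  have "integrable lborel g \<longleftrightarrow> integrable (distr lborel borel ((+) (- c))) g" using d by simp
  also have "\<dots> \<longleftrightarrow> integrable lborel (\<lambda>x. g (- c + x))" by (rule integrable_distr_eq) auto
  finally show "integrable lborel (\<lambda>x. g (x - c)) \<longleftrightarrow> integrable lborel g" by simp
qed

lemma sq_int_translate:
  fixes g :: "'a::euclidean_space \<Rightarrow> complex"
  assumes "sq_int lborel g"
  shows "sq_int lborel (\<lambda>x. g (x - c))" "sq_norm lborel (\<lambda>x. g (x - c)) = sq_norm lborel g"
proof -
  have [measurable]: "g \<in> borel_measurable borel" using sq_int_measurable[OF assms] by simp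
  have "integrable lborel (\<lambda>x. (cmod (g (x - c)))\<^sup>2)"
    using integral_translate(2)[of "\<lambda>x. (cmod (g x))\<^sup>2" c] assms by (simp add: sq_int_def)
  then show "sq_int lborel (\<lambda>x. g (x - c))" by (simp add: sq_int_def)
  show "sq_norm lborel (\<lambda>x. g (x - c)) = sq_norm lborel g"
    unfolding sq_norm_def using integral_translate(1)[of "\<lambda>x. (cmod (g x))\<^sup>2" c] by simp
qed

lemma L2_lim_translate:
  fixes F :: "nat \<Rightarrow> 'a::euclidean_space \<Rightarrow> complex"
  assumes F: "L2_lim lborel F f"
  shows "L2_lim lborel (\<lambda>j x. F j (x - c)) (\<lambda>x. f (x - c))"
  using sq_int_translate(2)[OF sq_int_diff(1)[OF L2_limD(1,2)[OF F]], of _ c]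
  unfolding L2_lim_def by (simp add: sq_int_translate L2_limD[OF F])

lemma zext_zext: "zext A (zext B u) = zext (A \<inter> B) u"
  by (auto simp: zext_def indicator_def)

lemma zext_add: "zext A (\<lambda>x. u x + v x) = (\<lambda>x. zext A u x + zext A v x)"
  by (auto simp: zext_def algebra_simps)

lemma L2_lim_zext:
  assumes F: "L2_lim lborel F f" and A: "A \<in> sets borel"
  shows "L2_lim lborel (\<lambda>j. zext A (F j)) (zext A f)"
proof -
  have "L2_lim lborel (\<lambda>j x. indicator A x * F j x) (\<lambda>x. indicator A x * f x)"
    using A by (intro L2_lim_mult_bounded[OF F, where B=1]) (auto simp: indicator_def)
  moreover have "(\<lambda>x. indicator A x * g x) = zext A g" for g by (auto simp: zext_def indicator_def)
  ultimately show ?thesis by simp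
qed

lemma sq_int_zext:
  assumes F: "sq_int lborel f" and A: "A \<in> sets borel"
  shows "sq_int lborel (zext A f)"
  using L2_limD(2)[OF L2_lim_zext[OF L2_lim_const[OF F] A]] .

section \<open>Smoothing a Lipschitz function\<close>

text \<open>
  The average of \<open>f\<close> over an interval of length \<open>\<delta>\<close> is \<open>C\<^sup>1\<close>; the difference quotient of \<open>f\<close> that is its
  derivative is bounded by \<open>L\<close>.
\<close>

lemma lipschitz_smoothing:
  fixes f :: "real \<Rightarrow> real"
  assumes lip: "L-lipschitz_on UNIV f" and \<delta>: "\<delta> > 0"
  obtains F F' where "\<And>x. (F has_real_derivative F' x) (at x)" "continuous_on UNIV F'"
    "\<And>x. \<bar>F' x\<bar> \<le> L" "\<And>x. \<bar>F x - f x\<bar> \<le> L * \<delta>"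
proof -
  have fc: "continuous_on S f" for S
    using lipschitz_on_continuous_on[OF lip] continuous_on_subset by blast
  have L: "\<bar>f x - f y\<bar> \<le> L * \<bar>x - y\<bar>" for x y
    using lipschitz_onD[OF lip, of x y] by (simp add: dist_real_def)
  have L0: "L \<ge> 0" using lipschitz_on_nonneg[OF lip] .
  define P where "P u = (LBINT y=0..u. f y)" for u :: real
  have P: "(P has_real_derivative f x) (at x)" for x
  proof -
    have "((\<lambda>u. LBINT y=0..u. f y) has_vector_derivative f x) (at x within {-\<bar>x\<bar> - 1..\<bar>x\<bar> + 1})"
      using interval_integral_FTC2[of "-\<bar>x\<bar> - 1" 0 "\<bar>x\<bar> + 1" f x] fc by (auto simp: zero_ereal_def)
    then show ?thesis
      unfolding P_def has_real_derivative_iff_has_vector_derivative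
      by (subst (asm) at_within_interior) auto
  qed
  define F where "F x = (P (x + \<delta>) - P x) / \<delta>" for x
  define F' where "F' x = (f (x + \<delta>) - f x) / \<delta>" for x
  show ?thesis
  proof
    show "(F has_real_derivative F' x) (at x)" for x
      unfolding F_def F'_def using \<delta>
      by (auto intro!: derivative_eq_intros DERIV_chain2[OF P])
    show "continuous_on UNIV F'" unfolding F'_def
      by (intro continuous_intros continuous_on_compose2[OF fc]) (use \<delta> in auto)
    show "\<bar>F' x\<bar> \<le> L" for x
      using L[of "x + \<delta>" x] \<delta> by (simp add: F'_def field_simps)
    show "\<bar>F x - f x\<bar> \<le> L * \<delta>" for x
    proof -
      obtain z where z: "x < z" "z < x + \<delta>" "P (x + \<delta>) - P x = (x + \<delta> - x) * f z"
        using MVT2[of x "x + \<delta>" P f] P \<delta> by auto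
      have "F x = f z" using z \<delta> by (simp add: F_def)
      moreover have "L * \<bar>z - x\<bar> \<le> L * \<delta>" using z L0 by (intro mult_left_mono) auto
      ultimately show ?thesis using L[of z x] by simp
    qed
  qed
qed

section \<open>The domain above a Lipschitz graph\<close>

locale graph_domain =
  fixes \<Lambda> b L :: real and f :: "real \<Rightarrow> real"
  assumes \<Lambda>: "0 < \<Lambda>" and lip: "L-lipschitz_on UNIV f" and per: "f \<Lambda> = f 0"
    and below: "\<And>x. x \<in> {0..\<Lambda>} \<Longrightarrow> f x < b"
begin

abbreviation "\<Omega> \<equiv> domD \<Lambda> f b"

lemma f_cont: "continuous_on S f"
  using lipschitz_on_continuous_on[OF lip] continuous_on_subset by blast

lemma L_nonneg: "0 \<le> L" using lipschitz_on_nonneg[OF lip] .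

lemma \<Omega>_iff: "x \<in> \<Omega> \<longleftrightarrow> 0 < fst x \<and> fst x < \<Lambda> \<and> f (fst x) < snd x \<and> snd x < b"
  by (auto simp: domD_def)

lemma \<Omega>_open: "open \<Omega>"
proof -
  have "\<Omega> = {x. 0 < fst x} \<inter> {x. fst x < \<Lambda>} \<inter> {x. f (fst x) < snd x} \<inter> {x. snd x < b}"
    by (auto simp: \<Omega>_iff)
  moreover have "continuous_on UNIV (\<lambda>x::real\<times>real. f (fst x))"
    by (intro continuous_on_compose2[OF f_cont] continuous_intros) auto
  ultimately show ?thesis by (auto intro!: open_Int open_Collect_less continuous_intros)
qed

lemma f_lower: "\<exists>c. \<forall>x\<in>{0..\<Lambda>}. c < f x"
proof -
  obtain x where "x \<in> {0..\<Lambda>}" "\<And>y. y \<in> {0..\<Lambda>} \<Longrightarrow> f x \<le> f y"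
    using continuous_attains_inf[of "{0..\<Lambda>}" f] f_cont \<Lambda> by auto
  then have "f x - 1 < f y" if "y \<in> {0..\<Lambda>}" for y using that by force
  then show ?thesis by blast
qed

lemma f_upper: "\<exists>m<b. \<forall>x\<in>{0..\<Lambda>}. f x < m"
proof -
  obtain x where x: "x \<in> {0..\<Lambda>}" "\<And>y. y \<in> {0..\<Lambda>} \<Longrightarrow> f y \<le> f x"
    using continuous_attains_sup[of "{0..\<Lambda>}" f] f_cont \<Lambda> by auto
  have "f y < (f x + b) / 2" if "y \<in> {0..\<Lambda>}" for y using x(2)[OF that] below[OF x(1)] by simp
  moreover have "(f x + b) / 2 < b" using below[OF x(1)] by simp
  ultimately show ?thesis by blast
qed

lemma \<Omega>_bounded: "bounded \<Omega>"
proof -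
  obtain c where c: "\<And>x. x \<in> {0..\<Lambda>} \<Longrightarrow> c < f x" using f_lower by blast
  have "\<Omega> \<subseteq> cbox (0, c) (\<Lambda>, b)"
  proof
    fix x assume "x \<in> \<Omega>"
    then show "x \<in> cbox (0, c) (\<Lambda>, b)" using c[of "fst x"] by (cases x) (auto simp: \<Omega>_iff)
  qed
  then show ?thesis by (rule bounded_subset[OF bounded_cbox])
qed

lemma \<Omega>_sets [measurable, simp]: "\<Omega> \<in> sets borel"
  using \<Omega>_open by simp

section \<open>Poincare inequality and cutoffs near the graph\<close>

text \<open>
  The part of the domain at vertical distance less than \<open>s\<close> from the graph.
\<close>

definition layer :: "real \<Rightarrow> (real \<times> real) set" where
  "layer s = {x \<in> \<Omega>. snd x < f (fst x) + s}"

lemma layer_sets [measurable, simp]: "layer s \<in> sets borel"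
proof -
  have "layer s = \<Omega> \<inter> {x. snd x < f (fst x) + s}" by (auto simp: layer_def)
  moreover have "continuous_on UNIV (\<lambda>x::real\<times>real. f (fst x))"
    by (intro continuous_on_compose2[OF f_cont] continuous_intros) auto
  ultimately have "open (layer s)" using \<Omega>_open by (auto intro!: open_Int open_Collect_less continuous_intros)
  then show ?thesis by simp
qed

lemma layer_subset: "layer s \<subseteq> \<Omega>" by (auto simp: layer_def)

lemma layer_bounded: "bounded (layer s)"
  using bounded_subset[OF \<Omega>_bounded layer_subset] .

lemma line_Cauchy_Schwarz:
  fixes g :: "real \<Rightarrow> complex"
  assumes g: "continuous_on UNIV g" and cy: "c \<le> y" "y \<le> c + s" and J: "{c<..<y} \<subseteq> J" "J \<in> sets borel" "bounded J"
  shows "(cmod (LINT t|lborel. indicator {c..y} t *\<^sub>R g t))\<^sup>2 \<le> s * sq_norm lborel (zext J g)"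
proof -
  have s: "sq_int lborel (zext {c<..<y} (\<lambda>t. 1))" "sq_int lborel (zext J g)"
    using J g by (auto intro!: sq_int_zext_continuous)
  have ae: "AE t in lborel. t \<noteq> c \<and> t \<noteq> y"
    using AE_lborel_singleton[of c] AE_lborel_singleton[of y] by eventually_elim auto
  have [measurable]: "g \<in> borel_measurable borel" using g by (rule borel_measurable_continuous_onI)
  have "(LINT t|lborel. indicator {c..y} t *\<^sub>R g t) = (LINT t|lborel. zext {c<..<y} (\<lambda>t. 1) t * zext J g t)"
  proof (rule integral_cong_AE)
    show "AE t in lborel. indicator {c..y} t *\<^sub>R g t = zext {c<..<y} (\<lambda>t. 1) t * zext J g t"
      using ae by eventually_elim (use J(1) in \<open>auto simp: zext_def indicator_def\<close>)
  qed (use s in \<open>auto simp: sq_int_def\<close>)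
  moreover have "sq_norm lborel (zext {c<..<y} (\<lambda>t. 1)) = y - c"
  proof -
    have "sq_norm lborel (zext {c<..<y} (\<lambda>t. 1)) = (LINT t|lborel. indicator {c<..<y} t)"
      unfolding sq_norm_def by (intro Bochner_Integration.integral_cong) (auto simp: zext_def indicator_def)
    then show ?thesis using cy by simp
  qed
  moreover have "(y - c) * sq_norm lborel (zext J g) \<le> s * sq_norm lborel (zext J g)"
    using cy by (intro mult_right_mono) auto
  ultimately show ?thesis using Cauchy_Schwarz_integral[OF s] by simp
qed

text \<open>
  Along each vertical line, \<open>\<phi>\<close> is its value on the graph plus the integral of \<open>d2 \<phi>\<close>, and the
  Cauchy-Schwarz inequality bounds the latter. The layer has height \<open>s\<close>, which yields the second factor \<open>s\<close>.
\<close>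

lemma layer_Poincare_C1:
  assumes \<phi>: "C1 \<phi>" and s: "s > 0"
  shows "sq_norm lborel (zext (layer s) \<phi>) \<le>
    2 * s * sq_norm lborel (zext {0..\<Lambda>} (\<lambda>t. \<phi> (t, f t))) + 2 * s\<^sup>2 * sq_norm lborel (zext (layer s) (d2 \<phi>))"
proof -
  define J where "J x = {y. f x < y \<and> y < b \<and> y < f x + s}" for x
  have J: "J x \<in> sets borel" "bounded (J x)" for x
    unfolding J_def by measurable (auto intro: bounded_subset[of "{f x..b}"])
  define I where "I x = sq_norm lborel (zext (J x) (\<lambda>y. d2 \<phi> (x, y)))" for x
  have lay: "zext (layer s) g (x, y) = zext {0<..<\<Lambda>} (\<lambda>x. zext (J x) (\<lambda>y. g (x, y)) y) x" for g x y
    by (auto simp: zext_def layer_def J_def \<Omega>_iff indicator_def)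
  have fib: "sq_norm lborel (zext (layer s) g) = (LINT x|lborel. indicator {0<..<\<Lambda>} x * sq_norm lborel (zext (J x) (\<lambda>y. g (x, y))))"
    and fibi: "integrable lborel (\<lambda>x. indicator {0<..<\<Lambda>} x * sq_norm lborel (zext (J x) (\<lambda>y. g (x, y))))"
    if g: "continuous_on UNIV g" for g
  proof -
    have "integrable lborel (\<lambda>z. (cmod (zext (layer s) g z))\<^sup>2)"
      using sq_int_zext_continuous[OF g layer_bounded layer_sets] by (simp add: sq_int_def)
    from integral_plane_fst[OF this]
    have 1: "sq_norm lborel (zext (layer s) g) = (LINT x|lborel. LINT y|lborel. (cmod (zext (layer s) g (x, y)))\<^sup>2)"
      and 2: "integrable lborel (\<lambda>x. LINT y|lborel. (cmod (zext (layer s) g (x, y)))\<^sup>2)"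
      unfolding sq_norm_def by auto
    have 3: "(LINT y|lborel. (cmod (zext (layer s) g (x, y)))\<^sup>2) = indicator {0<..<\<Lambda>} x * sq_norm lborel (zext (J x) (\<lambda>y. g (x, y)))" for x
      unfolding lay sq_norm_def by (cases "x \<in> {0<..<\<Lambda>}") auto
    show "sq_norm lborel (zext (layer s) g) = (LINT x|lborel. indicator {0<..<\<Lambda>} x * sq_norm lborel (zext (J x) (\<lambda>y. g (x, y))))"
      "integrable lborel (\<lambda>x. indicator {0<..<\<Lambda>} x * sq_norm lborel (zext (J x) (\<lambda>y. g (x, y))))"
      using 1 2 unfolding 3 by auto
  qed
  note cont = C1_continuous[OF \<phi>]
  have St: "sq_int lborel (zext {0..\<Lambda>} (\<lambda>t. \<phi> (t, f t)))"
    by (intro sq_int_zext_continuous continuous_on_compose2[OF cont(1)] continuous_intros f_cont) auto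
  have slice: "sq_norm lborel (zext (J x) (\<lambda>y. \<phi> (x, y))) \<le> 2 * s * (cmod (\<phi> (x, f x)))\<^sup>2 + 2 * s\<^sup>2 * I x" for x
  proof -
    let ?K = "2 * (cmod (\<phi> (x, f x)))\<^sup>2 + 2 * s * I x"
    have K0: "?K \<ge> 0" using s by (auto simp: I_def)
    have pt: "(cmod (\<phi> (x, y)))\<^sup>2 \<le> ?K" if y: "y \<in> J x" for y
    proof -
      have "\<phi> (x, y) = \<phi> (x, f x) + (LINT t|lborel. indicator {f x..y} t *\<^sub>R d2 \<phi> (x, t))"
        using C1_FTC2[OF \<phi>, of "f x" y x] y by (simp add: J_def)
      then have "(cmod (\<phi> (x, y)))\<^sup>2 \<le> 2 * (cmod (\<phi> (x, f x)))\<^sup>2 + 2 * (cmod (LINT t|lborel. indicator {f x..y} t *\<^sub>R d2 \<phi> (x, t)))\<^sup>2"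
        using cmod_add_sq_le by metis
      moreover have "(cmod (LINT t|lborel. indicator {f x..y} t *\<^sub>R d2 \<phi> (x, t)))\<^sup>2 \<le> s * I x"
        unfolding I_def
        by (rule line_Cauchy_Schwarz[OF continuous_slice(2)[OF cont(3)] _ _ _ J]) (use y in \<open>auto simp: J_def\<close>)
      ultimately show ?thesis by simp
    qed
    have fin: "emeasure lborel (J x) < \<infinity>" using J(2) by (rule emeasure_bounded_finite)
    have "sq_norm lborel (zext (J x) (\<lambda>y. \<phi> (x, y))) \<le> (LINT y|lborel. ?K * indicator (J x) y)"
      unfolding sq_norm_def
    proof (rule integral_mono)
      show "integrable lborel (\<lambda>y. (cmod (zext (J x) (\<lambda>y. \<phi> (x, y)) y))\<^sup>2)"
        using sq_int_zext_continuous[OF continuous_slice(2)[OF cont(1)] J(2,1)] by (simp add: sq_int_def)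
      show "integrable lborel (\<lambda>y. ?K * indicator (J x) y)"
        using fin J by (intro integrable_mult_right integrable_real_indicator) auto
      show "(cmod (zext (J x) (\<lambda>y. \<phi> (x, y)) y))\<^sup>2 \<le> ?K * indicator (J x) y" for y
        using pt[of y] by (cases "y \<in> J x") auto
    qed
    also have "\<dots> = ?K * measure lborel (J x)" using J by simp
    also have "\<dots> \<le> ?K * s"
    proof (rule mult_left_mono[OF _ K0])
      have "measure lborel (J x) \<le> measure lborel {f x..f x + s}"
        using J(1) s by (intro measure_mono_fmeasurable) (auto simp: J_def fmeasurable_def)
      then show "measure lborel (J x) \<le> s" using s by simp
    qed
    finally show ?thesis by (simp add: power2_eq_square algebra_simps)
  qed
  have "sq_norm lborel (zext (layer s) \<phi>) = (LINT x|lborel. indicator {0<..<\<Lambda>} x * sq_norm lborel (zext (J x) (\<lambda>y. \<phi> (x, y))))"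
    by (rule fib[OF cont(1)])
  also have "\<dots> \<le> (LINT x|lborel. 2 * s * (cmod (zext {0..\<Lambda>} (\<lambda>t. \<phi> (t, f t)) x))\<^sup>2 + 2 * s\<^sup>2 * (indicator {0<..<\<Lambda>} x * I x))"
  proof (rule integral_mono)
    show "integrable lborel (\<lambda>x. indicator {0<..<\<Lambda>} x * sq_norm lborel (zext (J x) (\<lambda>y. \<phi> (x, y))))"
      by (rule fibi[OF cont(1)])
    show "integrable lborel (\<lambda>x. 2 * s * (cmod (zext {0..\<Lambda>} (\<lambda>t. \<phi> (t, f t)) x))\<^sup>2 + 2 * s\<^sup>2 * (indicator {0<..<\<Lambda>} x * I x))"
      using St fibi[OF cont(3)] unfolding I_def sq_int_def by (intro Bochner_Integration.integrable_add integrable_mult_right) auto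
    show "indicator {0<..<\<Lambda>} x * sq_norm lborel (zext (J x) (\<lambda>y. \<phi> (x, y)))
      \<le> 2 * s * (cmod (zext {0..\<Lambda>} (\<lambda>t. \<phi> (t, f t)) x))\<^sup>2 + 2 * s\<^sup>2 * (indicator {0<..<\<Lambda>} x * I x)" for x
      using slice[of x] s by (cases "x \<in> {0<..<\<Lambda>}") auto
  qed
  also have "\<dots> = 2 * s * sq_norm lborel (zext {0..\<Lambda>} (\<lambda>t. \<phi> (t, f t))) + 2 * s\<^sup>2 * sq_norm lborel (zext (layer s) (d2 \<phi>))"
  proof -
    have "integrable lborel (\<lambda>x. indicator {0<..<\<Lambda>} x * I x)" using fibi[OF cont(3)] by (simp add: I_def)
    moreover have "integrable lborel (\<lambda>x. (cmod (zext {0..\<Lambda>} (\<lambda>t. \<phi> (t, f t)) x))\<^sup>2)" using St by (simp add: sq_int_def)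
    ultimately show ?thesis
      unfolding fib[OF cont(3)] I_def[symmetric] by (simp add: sq_norm_def)
  qed
  finally show ?thesis .
qed

text \<open>
  With zero trace on the graph only the derivative term remains in the limit. For thin layers the
  factor \<open>s\<^sup>2\<close> compensates the square of the gradient of a cutoff that lives on the layer.
\<close>

lemma layer_Poincare:
  assumes l: "H1_lim \<Omega> \<phi> u W1 W2" and S: "L2_lim lborel (\<lambda>j. zext {0..\<Lambda>} (\<lambda>t. \<phi> j (t, f t))) (\<lambda>_. 0)"
    and s: "s > 0"
  shows "sq_norm lborel (zext (layer s) u) \<le> 2 * s\<^sup>2 * sq_norm lborel (zext (layer s) W2)"
proof (rule LIMSEQ_le)
  have *: "L2_lim lborel (\<lambda>j. zext (layer s) (g j)) (zext (layer s) h)" if "L2_lim lborel (\<lambda>j. zext \<Omega> (g j)) (zext \<Omega> h)" for g h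
    using L2_lim_zext[OF that layer_sets[of s]] layer_subset[of s] by (simp add: zext_zext Int_absorb2)
  show "(\<lambda>j. sq_norm lborel (zext (layer s) (\<phi> j))) \<longlonglongrightarrow> sq_norm lborel (zext (layer s) u)"
    using l by (intro L2_lim_sq_norm *) (simp add: H1_lim_def)
  have "(\<lambda>j. sq_norm lborel (zext (layer s) (d2 (\<phi> j)))) \<longlonglongrightarrow> sq_norm lborel (zext (layer s) W2)"
    using l by (intro L2_lim_sq_norm *) (simp add: H1_lim_def)
  moreover have "(\<lambda>j. sq_norm lborel (zext {0..\<Lambda>} (\<lambda>t. \<phi> j (t, f t)))) \<longlonglongrightarrow> sq_norm lborel (\<lambda>_::real. 0::complex)"
    using L2_lim_sq_norm[OF S] by simp
  ultimately have "(\<lambda>j. 2 * s * sq_norm lborel (zext {0..\<Lambda>} (\<lambda>t. \<phi> j (t, f t))) + 2 * s\<^sup>2 * sq_norm lborel (zext (layer s) (d2 (\<phi> j))))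
    \<longlonglongrightarrow> 2 * s * sq_norm lborel (\<lambda>_::real. 0::complex) + 2 * s\<^sup>2 * sq_norm lborel (zext (layer s) W2)"
    by (intro tendsto_intros)
  then show "(\<lambda>j. 2 * s * sq_norm lborel (zext {0..\<Lambda>} (\<lambda>t. \<phi> j (t, f t))) + 2 * s\<^sup>2 * sq_norm lborel (zext (layer s) (d2 (\<phi> j))))
    \<longlonglongrightarrow> 2 * s\<^sup>2 * sq_norm lborel (zext (layer s) W2)"
    by (simp add: sq_norm_def)
  show "\<exists>N. \<forall>n\<ge>N. sq_norm lborel (zext (layer s) (\<phi> n)) \<le> 2 * s * sq_norm lborel (zext {0..\<Lambda>} (\<lambda>t. \<phi> n (t, f t))) + 2 * s\<^sup>2 * sq_norm lborel (zext (layer s) (d2 (\<phi> n)))"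
    using l s by (auto simp: H1_lim_def intro!: layer_Poincare_C1)
qed

text \<open>
  A step function of the vertical distance to a smoothed graph, rescaled to the width \<open>\<delta>\<close>.
\<close>

lemma cutoff_exists:
  assumes \<delta>: "\<delta> > 0"
  shows "\<exists>\<eta>. C1 \<eta> \<and> (\<forall>x. cmod (\<eta> x) \<le> 1 \<and> cmod (d1 \<eta> x) \<le> (4 * L + 4) / \<delta> \<and> cmod (d2 \<eta> x) \<le> (4 * L + 4) / \<delta> \<and>
     (snd x \<le> f (fst x) + \<delta> \<longrightarrow> \<eta> x = 0) \<and>
     (snd x \<ge> f (fst x) + (2 * L + 2) * \<delta> \<longrightarrow> \<eta> x = 1 \<and> d1 \<eta> x = 0 \<and> d2 \<eta> x = 0))"
proof -
  obtain F F' where F: "\<And>x. (F has_real_derivative F' x) (at x)" "continuous_on UNIV F'"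
    "\<And>x. \<bar>F' x\<bar> \<le> L" "\<And>x. \<bar>F x - f x\<bar> \<le> L * \<delta>"
    using lipschitz_smoothing[OF lip \<delta>] by blast
  \<comment> \<open>The shift by \<open>L + 1\<close> absorbs the smoothing error \<open>L * \<delta>\<close> and leaves a margin \<open>\<delta>\<close> above the graph.\<close>
  define r where "r x = (snd x - F (fst x)) / \<delta> - (L + 1)" for x :: "real \<times> real"
  have r: "(r has_derivative (\<lambda>h. fst h * (- F' (fst x) / \<delta>) + snd h * (1 / \<delta>))) (at x)" for x
    unfolding r_def
    by (rule has_derivative_eq_rhs, (rule derivative_intros F(1)[THEN DERIV_compose_FDERIV] has_derivative_ident bounded_linear_imp_has_derivative bounded_linear_fst bounded_linear_snd)+)
      (use \<delta> in \<open>auto simp: field_simps\<close>)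
  have rc: "continuous_on UNIV (\<lambda>x::real\<times>real. - F' (fst x) / \<delta>)"
    by (intro continuous_intros continuous_on_compose2[OF F(2)]) (use \<delta> in auto)
  have g: "((\<lambda>t. complex_of_real (sstep t)) has_vector_derivative complex_of_real (sstep' t)) (at t)" for t
    by (rule has_vector_derivative_of_real) (rule sstep_deriv)
  have gc: "continuous_on UNIV (\<lambda>t. complex_of_real (sstep' t))"
    by (intro continuous_intros sstep'_continuous)
  note C = C1_compose_real[OF g gc r rc continuous_on_const]
  let ?\<eta> = "\<lambda>x. complex_of_real (sstep (r x))"
  have s4: "\<bar>sstep' t\<bar> \<le> 4" for t by simp
  have b1: "cmod (d1 ?\<eta> x) \<le> (4 * L + 4) / \<delta>" for x
  proof -
    have "cmod (d1 ?\<eta> x) = (\<bar>F' (fst x)\<bar> * \<bar>sstep' (r x)\<bar>) / \<delta>" using \<delta> fun_cong[OF C(2), of x] by (simp add: abs_mult norm_divide)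
    also have "\<dots> \<le> (L * 4) / \<delta>" using F(3)[of "fst x"] s4[of "r x"] \<delta> L_nonneg
      by (intro divide_right_mono mult_mono) auto
    also have "\<dots> \<le> (4 * L + 4) / \<delta>" using \<delta> by (intro divide_right_mono) auto
    finally show ?thesis .
  qed
  have b2: "cmod (d2 ?\<eta> x) \<le> (4 * L + 4) / \<delta>" for x
  proof -
    have "cmod (d2 ?\<eta> x) = \<bar>sstep' (r x)\<bar> / \<delta>" using \<delta> fun_cong[OF C(3), of x] by (simp add: abs_mult norm_divide)
    also have "\<bar>sstep' (r x)\<bar> \<le> 4 * L + 4" using s4[of "r x"] L_nonneg by linarith
    finally show ?thesis using \<delta> by (simp add: divide_right_mono)
  qed
  have z: "?\<eta> x = 0" if "snd x \<le> f (fst x) + \<delta>" for x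
  proof -
    have "snd x - F (fst x) \<le> (L + 1) * \<delta>" using F(4)[of "fst x"] that by (simp add: algebra_simps)
    then have "r x \<le> 0" using \<delta> by (simp add: r_def field_simps)
    then show ?thesis by simp
  qed
  have o: "?\<eta> x = 1 \<and> d1 ?\<eta> x = 0 \<and> d2 ?\<eta> x = 0" if "snd x \<ge> f (fst x) + (2 * L + 2) * \<delta>" for x
  proof -
    have "snd x - F (fst x) \<ge> (L + 2) * \<delta>" using F(4)[of "fst x"] that by (simp add: algebra_simps)
    then have "r x \<ge> 1" using \<delta> by (simp add: r_def field_simps)
    then show ?thesis using fun_cong[OF C(2), of x] fun_cong[OF C(3), of x] by simp
  qed
  show ?thesis
    by (rule exI[of _ ?\<eta>]) (intro conjI allI impI C(1) b1 b2 z, simp_all add: o)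
qed

lemma layer_norm_tendsto_0:
  assumes W: "sq_int lborel (zext \<Omega> W)" and s: "s \<longlonglongrightarrow> 0"
  shows "(\<lambda>j. sq_norm lborel (zext (layer (s j)) W)) \<longlonglongrightarrow> 0"
proof -
  have "L2_lim lborel (\<lambda>j. zext (layer (s j)) W) (\<lambda>_. 0)"
  proof (rule L2_lim_dominated[where B=1 and g="zext \<Omega> W"])
    show "zext (layer (s j)) W \<in> borel_measurable lborel" for j
      using sq_int_zext[OF W layer_sets[of "s j"]] layer_subset[of "s j"]
      by (simp add: zext_zext Int_absorb2 sq_int_def)
    show "cmod (zext (layer (s j)) W x) \<le> 1 * cmod (zext \<Omega> W x)" for j x
      using layer_subset[of "s j"] by (auto simp: zext_def indicator_def)
    show "(\<lambda>j. zext (layer (s j)) W x) \<longlonglongrightarrow> 0" for x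
    proof (cases "x \<in> \<Omega>")
      case True
      then have "snd x - f (fst x) > 0" by (simp add: \<Omega>_iff)
      from order_tendstoD(2)[OF s this] have "\<forall>\<^sub>F j in sequentially. zext (layer (s j)) W x = 0"
        by eventually_elim (auto simp: zext_def layer_def indicator_def)
      then show ?thesis by (rule tendsto_eventually)
    next
      case False
      then have "zext (layer (s j)) W x = 0" for j using layer_subset[of "s j"] by (auto simp: zext_def indicator_def)
      then show ?thesis by simp
    qed
  qed (use W in auto)
  from L2_lim_sq_norm[OF this] show ?thesis by (simp add: sq_norm_def)
qed

end

lemma L2_lim_mult_seq:
  assumes F: "L2_lim M F f" and e: "\<And>j. e j \<in> borel_measurable M"
    and B: "\<And>j x. x \<in> space M \<Longrightarrow> cmod (e j x) \<le> B" and l: "L2_lim M (\<lambda>j x. e j x * f x) g"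
  shows "L2_lim M (\<lambda>j x. e j x * F j x) g"
proof (rule L2_limI_le)
  note d = sq_int_diff(1)[OF L2_limD(1,2)[OF F]]
  show "sq_int M (\<lambda>x. e j x * F j x)" for j
    by (rule sq_int_mult_bounded(1)[OF L2_limD(1)[OF F] e B])
  show "sq_int M g" using L2_limD(2)[OF l] .
  show "sq_norm M (\<lambda>x. e j x * F j x - g x) \<le> 2 * (B\<^sup>2 * sq_norm M (\<lambda>x. F j x - f x)) + 2 * sq_norm M (\<lambda>x. e j x * f x - g x)" for j
  proof -
    have "sq_norm M (\<lambda>x. e j x * (F j x - f x) + (e j x * f x - g x))
      \<le> 2 * sq_norm M (\<lambda>x. e j x * (F j x - f x)) + 2 * sq_norm M (\<lambda>x. e j x * f x - g x)"
      by (intro sq_int_add sq_int_mult_bounded(1)[OF d e B] sq_int_diff L2_limD[OF l])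
    moreover have "sq_norm M (\<lambda>x. e j x * (F j x - f x)) \<le> B\<^sup>2 * sq_norm M (\<lambda>x. F j x - f x)"
      by (rule sq_int_mult_bounded(2)[OF d e B])
    ultimately show ?thesis by (simp add: algebra_simps)
  qed
  show "(\<lambda>j. 2 * (B\<^sup>2 * sq_norm M (\<lambda>x. F j x - f x)) + 2 * sq_norm M (\<lambda>x. e j x * f x - g x)) \<longlonglongrightarrow> 0"
    using tendsto_add[OF tendsto_mult_left[OF L2_limD(3)[OF F], of "2 * B\<^sup>2"] tendsto_mult_left[OF L2_limD(3)[OF l], of 2]]
    by (simp add: mult.assoc)
qed

context graph_domain
begin

text \<open>
  The margin \<open>\<delta>\<close> makes the derivatives vanish on and below the graph as well, so that the extension by zero
  of the restriction to \<open>\<Omega>\<close> behaves like a \<open>C\<^sup>1\<close> function when it is shifted upwards.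
\<close>

definition vanishes_near_S :: "(real \<times> real \<Rightarrow> complex) \<Rightarrow> bool" where
  "vanishes_near_S \<psi> \<longleftrightarrow> (\<exists>\<delta>>0. \<forall>x. snd x \<le> f (fst x) + \<delta> \<longrightarrow> \<psi> x = 0)"

lemma vanishes_near_S_D:
  assumes "vanishes_near_S \<psi>" "snd x \<le> f (fst x)"
  shows "\<psi> x = 0" "d1 \<psi> x = 0" "d2 \<psi> x = 0"
proof -
  obtain \<delta> where \<delta>: "\<delta> > 0" "\<And>x. snd x \<le> f (fst x) + \<delta> \<Longrightarrow> \<psi> x = 0"
    using assms(1) by (auto simp: vanishes_near_S_def)
  have "closed {x. f (fst x) + \<delta> \<le> snd x}"
    by (intro closed_Collect_le continuous_intros continuous_on_compose2[OF f_cont]) auto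
  moreover have "{x. \<psi> x \<noteq> 0} \<subseteq> {x. f (fst x) + \<delta> \<le> snd x}"
  proof
    fix x assume "x \<in> {x. \<psi> x \<noteq> 0}"
    then show "x \<in> {x. f (fst x) + \<delta> \<le> snd x}" using \<delta>(2)[of x] by (cases "snd x \<le> f (fst x) + \<delta>") auto
  qed
  ultimately have "closure {x. \<psi> x \<noteq> 0} \<subseteq> {x. f (fst x) + \<delta> \<le> snd x}"
    by (intro closure_minimal)
  then have "x \<notin> closure {x. \<psi> x \<noteq> 0}" using assms(2) \<delta>(1) by auto
  from derivative_zero_outside_support[OF this] show "\<psi> x = 0" "d1 \<psi> x = 0" "d2 \<psi> x = 0" .
qed

text \<open>
  The assumption on layers holds for functions with zero trace on the graph; such a function is thus a limit of
  functions that vanish near the graph. The dangerous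
  term is \<open>\<phi>\<^sub>j\<close> times the gradient of the cutoff, which is of size \<open>1 / \<delta>\<^sub>j\<close> on a layer of width comparable to \<open>\<delta>\<^sub>j\<close>.
  Splitting \<open>\<phi>\<^sub>j = (\<phi>\<^sub>j - u) + u\<close>, the first part is small if \<open>\<delta>\<^sub>j\<close> tends to zero slowly, and the second one by the
  Poincare inequality on the layer. Any approximating sequence can be cut off in this way, which matters
  because the sequences for the traces on the lateral sides are given in advance.
\<close>

lemma cutoff_lim:
  assumes l: "H1_lim \<Omega> \<phi> u W1 W2"
    and P: "\<And>s. s > 0 \<Longrightarrow> sq_norm lborel (zext (layer s) u) \<le> 2 * s\<^sup>2 * sq_norm lborel (zext (layer s) W2)"
  shows "\<exists>\<eta>. (\<forall>j. C1 (\<eta> j)) \<and> (\<forall>j x. cmod (\<eta> j x) \<le> 1) \<and>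
    (\<forall>j. vanishes_near_S (\<eta> j)) \<and>
    (\<forall>x. snd x > f (fst x) \<longrightarrow> (\<lambda>j. \<eta> j x) \<longlonglongrightarrow> 1) \<and>
    H1_lim \<Omega> (\<lambda>j x. \<eta> j x * \<phi> j x) u W1 W2"
proof -
  have \<phi>: "\<And>j. C1 (\<phi> j)" and lu: "L2_lim lborel (\<lambda>j. zext \<Omega> (\<phi> j)) (zext \<Omega> u)"
    and l1: "L2_lim lborel (\<lambda>j. zext \<Omega> (d1 (\<phi> j))) (zext \<Omega> W1)"
    and l2: "L2_lim lborel (\<lambda>j. zext \<Omega> (d2 (\<phi> j))) (zext \<Omega> W2)"
    using l unfolding H1_lim_def by blast+
  define e where "e j = sq_norm lborel (\<lambda>x. zext \<Omega> (\<phi> j) x - zext \<Omega> u x)" for j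
  have e0: "e j \<ge> 0" for j by (simp add: e_def)
  have e: "e \<longlonglongrightarrow> 0" unfolding e_def by (rule L2_limD(3)[OF lu])
  \<comment> \<open>Slow enough for \<open>e j / (\<delta> j)\<^sup>2 \<le> sqrt (e j)\<close>; the second summand keeps the width positive when \<open>e j = 0\<close>.\<close>
  define \<delta> where "\<delta> j = sqrt (sqrt (e j)) + 1 / real (Suc j)" for j
  have \<delta>0: "\<delta> j > 0" for j using e0[of j] by (simp add: \<delta>_def add_nonneg_pos)
  have se: "(\<lambda>j. sqrt (e j)) \<longlonglongrightarrow> 0" using tendsto_real_sqrt[OF e] by simp
  have \<delta>: "\<delta> \<longlonglongrightarrow> 0"
    unfolding \<delta>_def using tendsto_add[OF tendsto_real_sqrt[OF se] LIMSEQ_inverse_real_of_nat] by (simp add: inverse_eq_divide)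
  have e\<delta>: "e j / (\<delta> j)\<^sup>2 \<le> sqrt (e j)" for j
  proof -
    have "sqrt (e j) = (sqrt (sqrt (e j)))\<^sup>2" using e0[of j] by simp
    also have "\<dots> \<le> (\<delta> j)\<^sup>2" using e0[of j] by (intro power_mono) (auto simp: \<delta>_def)
    finally have "sqrt (e j) * sqrt (e j) \<le> sqrt (e j) * (\<delta> j)\<^sup>2" using e0[of j] by (intro mult_left_mono) auto
    then show ?thesis using \<delta>0[of j] e0[of j] by (simp add: field_simps)
  qed
  define A where "A = 4 * L + 4"
  define K where "K = 2 * L + 2"
  have AK: "A > 0" "K > 0" using L_nonneg by (auto simp: A_def K_def)
  obtain \<eta> where \<eta>: "\<And>j. C1 (\<eta> j)" "\<And>j x. cmod (\<eta> j x) \<le> 1" "\<And>j x. cmod (d1 (\<eta> j) x) \<le> A / \<delta> j"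
    "\<And>j x. cmod (d2 (\<eta> j) x) \<le> A / \<delta> j" "\<And>j x. snd x \<le> f (fst x) + \<delta> j \<Longrightarrow> \<eta> j x = 0"
    "\<And>j x. snd x \<ge> f (fst x) + K * \<delta> j \<Longrightarrow> \<eta> j x = 1 \<and> d1 (\<eta> j) x = 0 \<and> d2 (\<eta> j) x = 0"
    using cutoff_exists[OF \<delta>0] unfolding A_def K_def by metis
  have one: "(\<lambda>j. \<eta> j x) \<longlonglongrightarrow> 1" if x: "snd x > f (fst x)" for x
  proof -
    have "(\<lambda>j. K * \<delta> j) \<longlonglongrightarrow> 0" using tendsto_mult_left[OF \<delta>, of K] by simp
    from order_tendstoD(2)[OF this, of "snd x - f (fst x)"] x
    have "\<forall>\<^sub>F j in sequentially. K * \<delta> j < snd x - f (fst x)" by simp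
    then have "\<forall>\<^sub>F j in sequentially. \<eta> j x = 1"
      by eventually_elim (use \<eta>(6)[of x] in force)
    then show ?thesis by (rule tendsto_eventually)
  qed
  have \<eta>m: "\<eta> j \<in> borel_measurable lborel" "d1 (\<eta> j) \<in> borel_measurable lborel" "d2 (\<eta> j) \<in> borel_measurable lborel" for j
    using C1_continuous[OF \<eta>(1)[of j]] by (auto intro!: borel_measurable_continuous_onI)
  have mult: "L2_lim lborel (\<lambda>j. zext \<Omega> (\<lambda>x. \<eta> j x * F j x)) (zext \<Omega> G)"
    if F: "L2_lim lborel (\<lambda>j. zext \<Omega> (F j)) (zext \<Omega> G)" for F G
  proof -
    have "L2_lim lborel (\<lambda>j x. \<eta> j x * zext \<Omega> (F j) x) (zext \<Omega> G)"
    proof (rule L2_lim_mult_seq[OF F \<eta>m(1) \<eta>(2)], rule L2_lim_dominated[where B=1 and g="zext \<Omega> G"])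
      note m = sq_int_measurable[OF L2_limD(2)[OF F]]
      show "(\<lambda>x. \<eta> j x * zext \<Omega> G x) \<in> borel_measurable lborel" for j
        using \<eta>m(1) m by (rule borel_measurable_times)
      show "cmod (\<eta> j x * zext \<Omega> G x) \<le> 1 * cmod (zext \<Omega> G x)" for j x
        using \<eta>(2)[of j x] by (simp add: norm_mult mult_left_le_one_le)
      show "(\<lambda>j. \<eta> j x * zext \<Omega> G x) \<longlonglongrightarrow> zext \<Omega> G x" for x
      proof (cases "x \<in> \<Omega>")
        case True
        then have "(\<lambda>j. \<eta> j x) \<longlonglongrightarrow> 1" by (intro one) (simp add: \<Omega>_iff)
        from tendsto_mult_right[OF this, of "zext \<Omega> G x"] show ?thesis by simp
      qed simp
    qed (use L2_limD(2)[OF F] in auto)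
    moreover have "(\<lambda>x. \<eta> j x * zext \<Omega> (F j) x) = zext \<Omega> (\<lambda>x. \<eta> j x * F j x)" for j
      by (auto simp: zext_def)
    ultimately show ?thesis by simp
  qed
  have grad: "L2_lim lborel (\<lambda>j. zext \<Omega> (\<lambda>x. g j x * \<phi> j x)) (\<lambda>_. 0)"
    if g: "\<And>j. g j \<in> borel_measurable lborel" "\<And>j x. cmod (g j x) \<le> A / \<delta> j"
      "\<And>j x. snd x \<ge> f (fst x) + K * \<delta> j \<Longrightarrow> g j x = 0" for g
  proof -
    let ?N = "\<lambda>j. sq_norm lborel (zext (layer (K * \<delta> j)) W2)"
    have eq: "zext \<Omega> (\<lambda>x. g j x * \<phi> j x) = (\<lambda>x. g j x * (zext \<Omega> (\<phi> j) x - zext \<Omega> u x) + g j x * zext (layer (K * \<delta> j)) u x)" for j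
    proof
      fix x show "zext \<Omega> (\<lambda>x. g j x * \<phi> j x) x = g j x * (zext \<Omega> (\<phi> j) x - zext \<Omega> u x) + g j x * zext (layer (K * \<delta> j)) u x"
        using g(3)[where j=j and x=x] layer_subset[of "K * \<delta> j"]
        by (cases "x \<in> \<Omega>"; cases "x \<in> layer (K * \<delta> j)") (auto simp: layer_def algebra_simps not_less)
    qed
    have d: "sq_int lborel (\<lambda>x. zext \<Omega> (\<phi> j) x - zext \<Omega> u x)" for j
      by (rule sq_int_diff(1)[OF L2_limD(1,2)[OF lu]])
    have lay: "sq_int lborel (zext (layer (K * \<delta> j)) u)" for j
      using sq_int_zext[OF L2_limD(2)[OF lu] layer_sets] layer_subset by (simp add: zext_zext Int_absorb2)
    show ?thesis
    proof (rule L2_limI_le)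
      show "sq_int lborel (zext \<Omega> (\<lambda>x. g j x * \<phi> j x))" for j
        unfolding eq by (intro sq_int_add sq_int_mult_bounded(1)[OF d g(1,2)] sq_int_mult_bounded(1)[OF lay g(1,2)])
      show "sq_norm lborel (\<lambda>x. zext \<Omega> (\<lambda>x. g j x * \<phi> j x) x - 0) \<le> 2 * (A\<^sup>2 * sqrt (e j)) + 2 * (A\<^sup>2 * (2 * K\<^sup>2 * ?N j))" for j
      proof -
        have "sq_norm lborel (\<lambda>x. zext \<Omega> (\<lambda>x. g j x * \<phi> j x) x - 0) \<le> 2 * sq_norm lborel (\<lambda>x. g j x * (zext \<Omega> (\<phi> j) x - zext \<Omega> u x))
           + 2 * sq_norm lborel (\<lambda>x. g j x * zext (layer (K * \<delta> j)) u x)"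
          unfolding eq diff_0_right
          by (intro sq_int_add sq_int_mult_bounded(1)[OF d g(1,2)] sq_int_mult_bounded(1)[OF lay g(1,2)])
        also have "sq_norm lborel (\<lambda>x. g j x * (zext \<Omega> (\<phi> j) x - zext \<Omega> u x)) \<le> (A / \<delta> j)\<^sup>2 * e j"
          unfolding e_def by (rule sq_int_mult_bounded(2)[OF d g(1,2)])
        also have "(A / \<delta> j)\<^sup>2 * e j \<le> A\<^sup>2 * sqrt (e j)"
          using mult_left_mono[OF e\<delta>[of j], of "A\<^sup>2"] by (simp add: power_divide)
        also have "sq_norm lborel (\<lambda>x. g j x * zext (layer (K * \<delta> j)) u x) \<le> (A / \<delta> j)\<^sup>2 * sq_norm lborel (zext (layer (K * \<delta> j)) u)"
          by (rule sq_int_mult_bounded(2)[OF lay g(1,2)])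
        also have "\<dots> \<le> (A / \<delta> j)\<^sup>2 * (2 * (K * \<delta> j)\<^sup>2 * ?N j)"
          using AK \<delta>0 by (intro mult_left_mono P) auto
        also have "\<dots> = A\<^sup>2 * (2 * K\<^sup>2 * ?N j)" using \<delta>0[of j] by (simp add: power_divide power_mult_distrib)
        finally show ?thesis by simp
      qed
      have "(\<lambda>j. K * \<delta> j) \<longlonglongrightarrow> 0" using tendsto_mult_left[OF \<delta>, of K] by simp
      from layer_norm_tendsto_0[OF L2_limD(2)[OF l2] this] have "?N \<longlonglongrightarrow> 0" .
      then have "(\<lambda>j. 2 * (A\<^sup>2 * sqrt (e j)) + 2 * (A\<^sup>2 * (2 * K\<^sup>2 * ?N j))) \<longlonglongrightarrow> 2 * (A\<^sup>2 * 0) + 2 * (A\<^sup>2 * (2 * K\<^sup>2 * 0))"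
        by (intro tendsto_intros se)
      then show "(\<lambda>j. 2 * (A\<^sup>2 * sqrt (e j)) + 2 * (A\<^sup>2 * (2 * K\<^sup>2 * ?N j))) \<longlonglongrightarrow> 0" by simp
    qed simp
  qed
  have "H1_lim \<Omega> (\<lambda>j x. \<eta> j x * \<phi> j x) u W1 W2"
    unfolding H1_lim_def
  proof (intro conjI allI)
    show "C1 (\<lambda>x. \<eta> j x * \<phi> j x)" for j by (rule C1_mult(1)[OF \<eta>(1) \<phi>])
    show "L2_lim lborel (\<lambda>j. zext \<Omega> (\<lambda>x. \<eta> j x * \<phi> j x)) (zext \<Omega> u)" by (rule mult[OF lu])
    have "L2_lim lborel (\<lambda>j x. zext \<Omega> (\<lambda>x. d1 (\<eta> j) x * \<phi> j x) x + zext \<Omega> (\<lambda>x. \<eta> j x * d1 (\<phi> j) x) x) (\<lambda>x. 0 + zext \<Omega> W1 x)"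
      by (intro L2_lim_add mult[OF l1] grad \<eta>m \<eta>(3)) (use \<eta>(6) in blast)
    then show "L2_lim lborel (\<lambda>j. zext \<Omega> (d1 (\<lambda>x. \<eta> j x * \<phi> j x))) (zext \<Omega> W1)"
      by (simp add: C1_mult(2)[OF \<eta>(1) \<phi>] zext_add)
    have "L2_lim lborel (\<lambda>j x. zext \<Omega> (\<lambda>x. d2 (\<eta> j) x * \<phi> j x) x + zext \<Omega> (\<lambda>x. \<eta> j x * d2 (\<phi> j) x) x) (\<lambda>x. 0 + zext \<Omega> W2 x)"
      by (intro L2_lim_add mult[OF l2] grad \<eta>m \<eta>(4)) (use \<eta>(6) in blast)
    then show "L2_lim lborel (\<lambda>j. zext \<Omega> (d2 (\<lambda>x. \<eta> j x * \<phi> j x))) (zext \<Omega> W2)"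
      by (simp add: C1_mult(3)[OF \<eta>(1) \<phi>] zext_add)
  qed
  moreover have "vanishes_near_S (\<eta> j)" for j
    unfolding vanishes_near_S_def using \<eta>(5)[where j=j] \<delta>0[of j] by blast
  ultimately show ?thesis using \<eta>(1,2) one by (intro exI[of _ \<eta>]) blast
qed

end

lemma zext_zero [simp]: "zext A (\<lambda>_. 0) = (\<lambda>_. 0)"
  by (auto simp: zext_def)

lemma L2_lim_continuous_mult:
  fixes g :: "'a::euclidean_space \<Rightarrow> complex"
  assumes F: "L2_lim lborel F v" and g: "continuous_on UNIV g" and A: "bounded A" "A \<in> sets borel"
  shows "L2_lim lborel (\<lambda>j. zext A (\<lambda>x. g x * F j x)) (zext A (\<lambda>x. g x * v x))"
proof -
  have "bounded (g ` closure A)"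
    by (intro compact_imp_bounded compact_continuous_image continuous_on_subset[OF g]) (use A in \<open>auto simp: compact_closure\<close>)
  then obtain B where B: "\<And>x. x \<in> closure A \<Longrightarrow> cmod (g x) \<le> B"
    unfolding bounded_iff by auto
  have [measurable]: "g \<in> borel_measurable borel" using g by (rule borel_measurable_continuous_onI)
  have "L2_lim lborel (\<lambda>j x. zext A g x * F j x) (\<lambda>x. zext A g x * v x)"
  proof (rule L2_lim_mult_bounded[OF F])
    show "zext A g \<in> borel_measurable lborel" using A by (simp add: zext_def)
    show "cmod (zext A g x) \<le> \<bar>B\<bar>" for x
      using B[of x] closure_subset[of A] by (cases "x \<in> A") auto
  qed
  moreover have "(\<lambda>x. zext A g x * u x) = zext A (\<lambda>x. g x * u x)" for u by (auto simp: zext_def)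
  ultimately show ?thesis by simp
qed

lemma L2_lim_cong_seq:
  assumes F: "L2_lim M F f" and "\<And>j. AE x in M. F j x = G j x" "\<And>j. G j \<in> borel_measurable M"
  shows "L2_lim M G f"
proof -
  have G: "sq_int M (G j)" for j by (rule sq_int_cong_AE[OF L2_limD(1)[OF F] assms(2,3)])
  have "sq_norm M (\<lambda>x. F j x - f x) = sq_norm M (\<lambda>x. G j x - f x)" for j
  proof (rule sq_norm_cong_AE)
    show "AE x in M. F j x - f x = G j x - f x" using assms(2)[of j] by eventually_elim simp
  qed (intro sq_int_measurable[OF sq_int_diff(1)] L2_limD[OF F] G)+
  then show ?thesis using G L2_limD(2,3)[OF F] by (simp add: L2_lim_def)
qed

section \<open>Integration along one coordinate\<close>

text \<open>
  Integration over a bounded interval of one variable maps \<open>L\<^sup>2\<close> of the plane boundedly into \<open>L\<^sup>2\<close> of the line.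
\<close>

lemma slice_fst:
  fixes G :: "real \<times> real \<Rightarrow> complex"
  assumes G: "sq_int lborel G" and ab: "a \<le> b" and supp: "\<And>x y. y \<notin> {a..b} \<Longrightarrow> G (x, y) = 0"
  shows "sq_int lborel (\<lambda>x. LINT y|lborel. G (x, y))"
    "sq_norm lborel (\<lambda>x. LINT y|lborel. G (x, y)) \<le> (b - a) * sq_norm lborel G"
    "AE x in lborel. sq_int lborel (\<lambda>y. G (x, y)) \<and> integrable lborel (\<lambda>y. G (x, y))"
proof -
  have Gm: "G \<in> borel_measurable (lborel \<Otimes>\<^sub>M lborel)" unfolding lborel_prod using sq_int_measurable[OF G] .
  note fub = integral_plane_fst[OF sq_int_integrable[OF G]]
  have sec: "(\<lambda>y. G (x, y)) \<in> borel_measurable lborel" for x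
    using measurable_Pair2[OF Gm, of x] by simp
  have gm: "(\<lambda>x. LINT y|lborel. G (x, y)) \<in> borel_measurable lborel"
    using Gm by (intro lborel.borel_measurable_lebesgue_integral) simp
  have one: "sq_int lborel (zext {a..b} (\<lambda>_. 1))"
    by (rule sq_int_zext_continuous) auto
  have none: "sq_norm lborel (zext {a..b} (\<lambda>_. 1)) = b - a"
  proof -
    have "sq_norm lborel (zext {a..b} (\<lambda>_. 1)) = (LINT t|lborel. indicator {a..b} t)"
      unfolding sq_norm_def by (intro Bochner_Integration.integral_cong) (auto simp: zext_def indicator_def)
    then show ?thesis using ab by simp
  qed
  have eq: "G (x, y) = zext {a..b} (\<lambda>_. 1) y * G (x, y)" for x y
    using supp[of y x] by (cases "y \<in> {a..b}") auto
  show ae: "AE x in lborel. sq_int lborel (\<lambda>y. G (x, y)) \<and> integrable lborel (\<lambda>y. G (x, y))"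
    using fub(3)
  proof eventually_elim
    case (elim x)
    then have S: "sq_int lborel (\<lambda>y. G (x, y))" using sec by (simp add: sq_int_def)
    have "integrable lborel (\<lambda>y. zext {a..b} (\<lambda>_. 1) y * G (x, y))" by (rule sq_int_mult_integrable[OF one S])
    then show ?case using S eq by simp
  qed
  have le: "AE x in lborel. (cmod (LINT y|lborel. G (x, y)))\<^sup>2 \<le> (b - a) * (LINT y|lborel. (cmod (G (x, y)))\<^sup>2)"
    using ae
  proof eventually_elim
    case (elim x)
    have "(LINT y|lborel. G (x, y)) = (LINT y|lborel. zext {a..b} (\<lambda>_. 1) y * G (x, y))"
      by (intro Bochner_Integration.integral_cong refl) (rule eq)
    then show ?case using Cauchy_Schwarz_integral[OF one conjunct1[OF elim]] none by (simp add: sq_norm_def)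
  qed
  have i: "integrable lborel (\<lambda>x. (b - a) * (LINT y|lborel. (cmod (G (x, y)))\<^sup>2))"
    using fub(2) by simp
  have i2: "integrable lborel (\<lambda>x. (cmod (LINT y|lborel. G (x, y)))\<^sup>2)"
  proof (rule Bochner_Integration.integrable_bound[OF i])
    show "(\<lambda>x. (cmod (LINT y|lborel. G (x, y)))\<^sup>2) \<in> borel_measurable lborel" using gm by measurable
    show "AE x in lborel. norm ((cmod (LINT y|lborel. G (x, y)))\<^sup>2) \<le> norm ((b - a) * (LINT y|lborel. (cmod (G (x, y)))\<^sup>2))"
      using le by eventually_elim (use ab in auto)
  qed
  show "sq_int lborel (\<lambda>x. LINT y|lborel. G (x, y))" using gm i2 by (simp add: sq_int_def)
  have "sq_norm lborel (\<lambda>x. LINT y|lborel. G (x, y)) \<le> (LINT x|lborel. (b - a) * (LINT y|lborel. (cmod (G (x, y)))\<^sup>2))"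
    unfolding sq_norm_def by (rule integral_mono_AE[OF i2 i le])
  then show "sq_norm lborel (\<lambda>x. LINT y|lborel. G (x, y)) \<le> (b - a) * sq_norm lborel G"
    using fub(1) by (simp add: sq_norm_def)
qed

lemma sq_int_swap:
  fixes G :: "real \<times> real \<Rightarrow> complex"
  assumes G: "sq_int lborel G"
  shows "sq_int lborel (\<lambda>z. G (snd z, fst z))" "sq_norm lborel (\<lambda>z. G (snd z, fst z)) = sq_norm lborel G"
proof -
  have Gm: "G \<in> borel_measurable (lborel \<Otimes>\<^sub>M lborel)" unfolding lborel_prod using sq_int_measurable[OF G] .
  have i: "integrable (lborel \<Otimes>\<^sub>M lborel) (\<lambda>z. (cmod (G z))\<^sup>2)" unfolding lborel_prod using sq_int_integrable[OF G] .
  have "integrable (lborel \<Otimes>\<^sub>M lborel) (\<lambda>(x, y). (cmod (G (y, x)))\<^sup>2)"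
    using lborel_pair.integrable_product_swap[OF i] .
  moreover have "(\<lambda>z. G (snd z, fst z)) \<in> borel_measurable (lborel \<Otimes>\<^sub>M lborel)"
    using measurable_compose[OF measurable_pair_swap' Gm] by (simp add: case_prod_unfold)
  ultimately show "sq_int lborel (\<lambda>z. G (snd z, fst z))"
    unfolding sq_int_def lborel_prod[symmetric] by (simp add: case_prod_unfold)
  show "sq_norm lborel (\<lambda>z. G (snd z, fst z)) = sq_norm lborel G"
    unfolding sq_norm_def lborel_prod[symmetric]
    using lborel_pair.integral_product_swap[of "\<lambda>z. (cmod (G z))\<^sup>2"] Gm by (simp add: case_prod_unfold)
qed

lemma slice_snd:
  fixes G :: "real \<times> real \<Rightarrow> complex"
  assumes G: "sq_int lborel G" and ab: "a \<le> b" and supp: "\<And>x y. x \<notin> {a..b} \<Longrightarrow> G (x, y) = 0"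
  shows "sq_int lborel (\<lambda>y. LINT x|lborel. G (x, y))"
    "sq_norm lborel (\<lambda>y. LINT x|lborel. G (x, y)) \<le> (b - a) * sq_norm lborel G"
    "AE y in lborel. sq_int lborel (\<lambda>x. G (x, y)) \<and> integrable lborel (\<lambda>x. G (x, y))"
  using slice_fst[OF sq_int_swap(1)[OF G] ab] supp by (simp_all add: sq_int_swap(2)[OF G])

lemma L2_lim_slice_fst:
  fixes G :: "nat \<Rightarrow> real \<times> real \<Rightarrow> complex"
  assumes G: "L2_lim lborel G H" and ab: "a \<le> b" and supp: "\<And>j x y. y \<notin> {a..b} \<Longrightarrow> G j (x, y) = 0"
    "\<And>x y. y \<notin> {a..b} \<Longrightarrow> H (x, y) = 0"
  shows "L2_lim lborel (\<lambda>j x. LINT y|lborel. G j (x, y)) (\<lambda>x. LINT y|lborel. H (x, y))"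
proof (rule L2_limI_le)
  have GS: "sq_int lborel (\<lambda>x. LINT y|lborel. G j (x, y))"
    "AE x in lborel. sq_int lborel (\<lambda>y. G j (x, y)) \<and> integrable lborel (\<lambda>y. G j (x, y))" for j
    using slice_fst(1,3)[OF L2_limD(1)[OF G] ab, of j] supp(1)[where j=j] by blast+
  have HS: "sq_int lborel (\<lambda>x. LINT y|lborel. H (x, y))"
    "AE x in lborel. sq_int lborel (\<lambda>y. H (x, y)) \<and> integrable lborel (\<lambda>y. H (x, y))"
    using slice_fst(1,3)[OF L2_limD(2)[OF G] ab] supp(2) by blast+
  show "sq_int lborel (\<lambda>x. LINT y|lborel. G j (x, y))" for j by (rule GS(1))
  show "sq_int lborel (\<lambda>x. LINT y|lborel. H (x, y))" by (rule HS(1))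
  show "sq_norm lborel (\<lambda>x. (LINT y|lborel. G j (x, y)) - (LINT y|lborel. H (x, y)))
      \<le> (b - a) * sq_norm lborel (\<lambda>z. G j z - H z)" for j
  proof -
    have D: "sq_int lborel (\<lambda>z. G j z - H z)" by (rule sq_int_diff(1)[OF L2_limD(1,2)[OF G]])
    have s: "G j (x, y) - H (x, y) = 0" if "y \<notin> {a..b}" for x y using supp[OF that] by simp
    have "sq_norm lborel (\<lambda>x. (LINT y|lborel. G j (x, y)) - (LINT y|lborel. H (x, y)))
      = sq_norm lborel (\<lambda>x. LINT y|lborel. G j (x, y) - H (x, y))"
    proof (rule sq_norm_cong_AE)
      show "AE x in lborel. (LINT y|lborel. G j (x, y)) - (LINT y|lborel. H (x, y)) = (LINT y|lborel. G j (x, y) - H (x, y))"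
        using GS(2)[of j] HS(2) by eventually_elim simp
      show "(\<lambda>x. (LINT y|lborel. G j (x, y)) - (LINT y|lborel. H (x, y))) \<in> borel_measurable lborel"
        by (intro borel_measurable_diff sq_int_measurable[OF GS(1)] sq_int_measurable[OF HS(1)])
      show "(\<lambda>x. LINT y|lborel. G j (x, y) - H (x, y)) \<in> borel_measurable lborel"
        by (rule sq_int_measurable[OF slice_fst(1)[OF D ab s]])
    qed
    then show ?thesis using slice_fst(2)[OF D ab s] by simp
  qed
  show "(\<lambda>j. (b - a) * sq_norm lborel (\<lambda>z. G j z - H z)) \<longlonglongrightarrow> 0"
    using tendsto_mult_left[OF L2_limD(3)[OF G], of "b - a"] by simp
qed

lemma L2_lim_swap:
  assumes "L2_lim lborel G (H :: real \<times> real \<Rightarrow> complex)"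
  shows "L2_lim lborel (\<lambda>j z. G j (snd z, fst z)) (\<lambda>z. H (snd z, fst z))"
  using sq_int_swap(2)[OF sq_int_diff(1)[OF L2_limD(1,2)[OF assms]]]
  unfolding L2_lim_def by (simp add: sq_int_swap(1) L2_limD[OF assms])

lemma L2_lim_slice_snd:
  fixes G :: "nat \<Rightarrow> real \<times> real \<Rightarrow> complex"
  assumes G: "L2_lim lborel G H" and ab: "a \<le> b" and supp: "\<And>j x y. x \<notin> {a..b} \<Longrightarrow> G j (x, y) = 0"
    "\<And>x y. x \<notin> {a..b} \<Longrightarrow> H (x, y) = 0"
  shows "L2_lim lborel (\<lambda>j y. LINT x|lborel. G j (x, y)) (\<lambda>y. LINT x|lborel. H (x, y))"
  using L2_lim_slice_fst[OF L2_lim_swap[OF G] ab] supp by simp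

context graph_domain
begin

section \<open>Test functions obtained by shifting the solution upwards\<close>

text \<open>
  Points of \<open>\<Omega>\<close> whose downward translate has left \<open>\<Omega>\<close> correspond to points on or below the graph, where the
  approximating functions vanish; hence extension by zero commutes with the shift.
\<close>

lemma shifted_test_lim:
  assumes l: "H1_lim \<Omega> \<psi> u W1 W2" and v: "\<And>j. vanishes_near_S (\<psi> j)"
    and p: "\<And>t. (p has_real_derivative p' t) (at t)" "continuous_on UNIV p'" and h: "h \<ge> 0"
  shows "H1_lim \<Omega> (\<lambda>j x. complex_of_real (p (snd x)) * \<psi> j (x - (0, h)))
    (\<lambda>x. complex_of_real (p (snd x)) * zext \<Omega> u (x - (0, h)))
    (\<lambda>x. complex_of_real (p (snd x)) * zext \<Omega> W1 (x - (0, h)))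
    (\<lambda>x. complex_of_real (p' (snd x)) * zext \<Omega> u (x - (0, h)) + complex_of_real (p (snd x)) * zext \<Omega> W2 (x - (0, h)))"
proof -
  have \<psi>: "\<And>j. C1 (\<psi> j)" and lu: "L2_lim lborel (\<lambda>j. zext \<Omega> (\<psi> j)) (zext \<Omega> u)"
    and l1: "L2_lim lborel (\<lambda>j. zext \<Omega> (d1 (\<psi> j))) (zext \<Omega> W1)"
    and l2: "L2_lim lborel (\<lambda>j. zext \<Omega> (d2 (\<psi> j))) (zext \<Omega> W2)"
    using l unfolding H1_lim_def by blast+
  have g: "((\<lambda>t. complex_of_real (p t)) has_vector_derivative complex_of_real (p' t)) (at t)" for t
    by (rule has_vector_derivative_of_real) (rule p)
  have gc: "continuous_on UNIV (\<lambda>t. complex_of_real (p' t))" by (intro continuous_intros p)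
  note P = C1_snd[OF g gc]
  note Sh = C1_shift[OF \<psi>, where v="(0, h)"]
  note M = C1_mult[OF P(1) Sh(1)]
  have pc: "continuous_on UNIV (\<lambda>x::real\<times>real. complex_of_real (p (snd x)))"
    "continuous_on UNIV (\<lambda>x::real\<times>real. complex_of_real (p' (snd x)))"
    using C1_continuous(1,3)[OF P(1)] unfolding P(3) by auto
  have key: "zext \<Omega> (\<lambda>x. q x * zext \<Omega> G (x - (0, h))) = zext \<Omega> (\<lambda>x. q x * G (x - (0, h)))"
    if G: "\<And>x. snd x \<le> f (fst x) \<Longrightarrow> G x = 0" for G q
  proof
    fix x show "zext \<Omega> (\<lambda>x. q x * zext \<Omega> G (x - (0, h))) x = zext \<Omega> (\<lambda>x. q x * G (x - (0, h))) x"
    proof (cases "x \<in> \<Omega> \<and> x - (0, h) \<notin> \<Omega>")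
      case True
      then have "snd (x - (0, h)) \<le> f (fst (x - (0, h)))" using h by (auto simp: \<Omega>_iff)
      from G[OF this] show ?thesis using True by simp
    qed (auto simp: zext_def)
  qed
  have lim: "L2_lim lborel (\<lambda>j. zext \<Omega> (\<lambda>x. q x * G j (x - (0, h)))) (zext \<Omega> (\<lambda>x. q x * zext \<Omega> W (x - (0, h))))"
    if "L2_lim lborel (\<lambda>j. zext \<Omega> (G j)) (zext \<Omega> W)" "\<And>j x. snd x \<le> f (fst x) \<Longrightarrow> G j x = 0" "continuous_on UNIV q" for G W q
  proof -
    have k: "zext \<Omega> (\<lambda>x. q x * zext \<Omega> (G j) (x - (0, h))) = zext \<Omega> (\<lambda>x. q x * G j (x - (0, h)))" for j
      by (rule key) (rule that(2))
    show ?thesis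
      using L2_lim_continuous_mult[OF L2_lim_translate[OF that(1), of "(0, h)"] that(3) \<Omega>_bounded \<Omega>_sets]
      unfolding k .
  qed
  note z = vanishes_near_S_D[OF v]
  have e: "d1 (\<lambda>x. complex_of_real (p (snd x)) * \<psi> j (x - (0, h))) = (\<lambda>x. complex_of_real (p (snd x)) * d1 (\<psi> j) (x - (0, h)))"
    "d2 (\<lambda>x. complex_of_real (p (snd x)) * \<psi> j (x - (0, h))) =
      (\<lambda>x. complex_of_real (p' (snd x)) * \<psi> j (x - (0, h)) + complex_of_real (p (snd x)) * d2 (\<psi> j) (x - (0, h)))" for j
    unfolding M(2,3)[of j] P(2,3)[THEN fun_cong] Sh(2,3)[of j, THEN fun_cong] by simp_all
  show ?thesis
    unfolding H1_lim_def
  proof (intro conjI allI)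
    show "C1 (\<lambda>x. complex_of_real (p (snd x)) * \<psi> j (x - (0, h)))" for j by (rule M)
    show "L2_lim lborel (\<lambda>j. zext \<Omega> (\<lambda>x. complex_of_real (p (snd x)) * \<psi> j (x - (0, h))))
      (zext \<Omega> (\<lambda>x. complex_of_real (p (snd x)) * zext \<Omega> u (x - (0, h))))"
      by (rule lim[OF lu z(1) pc(1)])
    show "L2_lim lborel (\<lambda>j. zext \<Omega> (d1 (\<lambda>x. complex_of_real (p (snd x)) * \<psi> j (x - (0, h)))))
      (zext \<Omega> (\<lambda>x. complex_of_real (p (snd x)) * zext \<Omega> W1 (x - (0, h))))"
      unfolding e(1) by (rule lim[OF l1 z(2) pc(1)])
    show "L2_lim lborel (\<lambda>j. zext \<Omega> (d2 (\<lambda>x. complex_of_real (p (snd x)) * \<psi> j (x - (0, h)))))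
      (zext \<Omega> (\<lambda>x. complex_of_real (p' (snd x)) * zext \<Omega> u (x - (0, h)) + complex_of_real (p (snd x)) * zext \<Omega> W2 (x - (0, h))))"
      unfolding e(2) zext_add
      by (rule L2_lim_add[OF lim[OF lu z(1) pc(2)] lim[OF l2 z(3) pc(1)]])
  qed
qed

text \<open>
  Cutting off and shifting also acts on the traces along a lateral side. The shifted trace lives on the half-open
  interval because the cutoff is zero at the corner on the graph.
\<close>

lemma side_lim:
  assumes l: "L2_lim lborel (\<lambda>j. zext {f 0..b} (\<lambda>y. \<phi> j (x0, y))) (zext {f 0..b} w)" and x0: "f x0 = f 0"
    and \<eta>: "\<And>j. C1 (\<eta> j)" "\<And>j x. cmod (\<eta> j x) \<le> 1" "\<And>j. vanishes_near_S (\<eta> j)"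
      "\<And>x. snd x > f (fst x) \<Longrightarrow> (\<lambda>j. \<eta> j x) \<longlonglongrightarrow> 1"
    and p: "continuous_on UNIV p" and h: "h \<ge> 0"
  shows "L2_lim lborel (\<lambda>j. zext {f 0..b} (\<lambda>y. complex_of_real (p y) * (\<eta> j (x0, y - h) * \<phi> j (x0, y - h))))
     (zext {f 0..b} (\<lambda>y. complex_of_real (p y) * zext {f 0<..b} w (y - h)))"
proof -
  let ?J = "{f 0..b}"
  have z: "\<eta> j (x0, y) = 0" if "y \<le> f 0" for j y
    using vanishes_near_S_D(1)[OF \<eta>(3), of "(x0, y)" j] that x0 by simp
  have m: "(\<lambda>y. \<eta> j (x0, y)) \<in> borel_measurable lborel" for j
    using continuous_slice(2)[OF C1_continuous(1)[OF \<eta>(1)]] by (auto intro!: borel_measurable_continuous_onI)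
  have wm: "zext ?J w \<in> borel_measurable lborel" using sq_int_measurable[OF L2_limD(2)[OF l]] .
  have "sq_int lborel (zext {f 0<..b} (zext ?J w))" by (rule sq_int_zext[OF L2_limD(2)[OF l]]) simp
  then have w': "sq_int lborel (zext {f 0<..b} w)" by (simp add: zext_zext Int_absorb2 greaterThanAtMost_subseteq_atLeastAtMost_iff)
  have "L2_lim lborel (\<lambda>j y. \<eta> j (x0, y) * zext ?J (\<lambda>y. \<phi> j (x0, y)) y) (zext {f 0<..b} w)"
  proof (rule L2_lim_mult_seq[OF l m \<eta>(2)], rule L2_lim_dominated[where B=1 and g="zext ?J w"])
    show "(\<lambda>y. \<eta> j (x0, y) * zext ?J w y) \<in> borel_measurable lborel" for j
      using m wm by (rule borel_measurable_times)
    show "cmod (\<eta> j (x0, y) * zext ?J w y) \<le> 1 * cmod (zext ?J w y)" for j y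
      using \<eta>(2)[of j] by (simp add: norm_mult mult_left_le_one_le)
    show "(\<lambda>j. \<eta> j (x0, y) * zext ?J w y) \<longlonglongrightarrow> zext {f 0<..b} w y" for y
    proof (cases "y \<in> {f 0<..b}")
      case True
      then have "(\<lambda>j. \<eta> j (x0, y)) \<longlonglongrightarrow> 1" using x0 by (intro \<eta>(4)) auto
      from tendsto_mult_right[OF this, of "zext ?J w y"] True show ?thesis by simp
    next
      case False
      then have 0: "(\<lambda>j. \<eta> j (x0, y) * zext ?J w y) = (\<lambda>j. 0)" using z[of y] by (intro ext) (auto simp: zext_def indicator_def)
      show ?thesis unfolding 0 using False by simp
    qed
  qed (use w' L2_limD(2)[OF l] in auto)
  from L2_lim_translate[OF this, of h]
  have "L2_lim lborel (\<lambda>j. zext ?J (\<lambda>y. complex_of_real (p y) * (\<eta> j (x0, y - h) * zext ?J (\<lambda>y. \<phi> j (x0, y)) (y - h))))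
     (zext ?J (\<lambda>y. complex_of_real (p y) * zext {f 0<..b} w (y - h)))"
    by (rule L2_lim_continuous_mult) (auto intro!: continuous_intros p)
  moreover have "zext ?J (\<lambda>y. complex_of_real (p y) * (\<eta> j (x0, y - h) * zext ?J (\<lambda>y. \<phi> j (x0, y)) (y - h)))
    = zext ?J (\<lambda>y. complex_of_real (p y) * (\<eta> j (x0, y - h) * \<phi> j (x0, y - h)))" for j
  proof
    fix y
    show "zext ?J (\<lambda>y. complex_of_real (p y) * (\<eta> j (x0, y - h) * zext ?J (\<lambda>y. \<phi> j (x0, y)) (y - h))) y
      = zext ?J (\<lambda>y. complex_of_real (p y) * (\<eta> j (x0, y - h) * \<phi> j (x0, y - h))) y"
      using z[of "y - h" j] h by (cases "y \<in> ?J"; cases "y - h \<in> ?J") (auto simp: not_le)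
  qed
  ultimately show ?thesis by simp
qed

text \<open>
  Three approximating sequences of \<open>v\<close> are needed, since the traces of \<open>u\<close> on the graph and on the two lateral
  sides come with a sequence each. Quasi-periodicity is inherited because both sides are cut off and shifted
  in the same way, and the factor \<open>p b = 0\<close> makes the trace on the artificial boundary vanish.
\<close>

lemma shifted_test_function:
  assumes u: "u \<in> H1_S_qp \<Lambda> f b \<alpha>"
    and p: "\<And>t. (p has_real_derivative p' t) (at t)" "continuous_on UNIV p'" "p b = 0" and h: "h \<ge> 0"
  defines "v \<equiv> \<lambda>x. complex_of_real (p (snd x)) * zext \<Omega> u (x - (0, h))"
  shows "v \<in> H1_S_qp \<Lambda> f b \<alpha>"
    and "has_trace \<Omega> (\<lambda>t. (t, b)) {0..\<Lambda>} v (\<lambda>_. 0)"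
    and "AE x in lborel. zext \<Omega> (weak_deriv \<Omega> (1, 0) v) x =
      zext \<Omega> (\<lambda>x. complex_of_real (p (snd x)) * zext \<Omega> (weak_deriv \<Omega> (1, 0) u) (x - (0, h))) x"
    and "AE x in lborel. zext \<Omega> (weak_deriv \<Omega> (0, 1) v) x =
      zext \<Omega> (\<lambda>x. complex_of_real (p' (snd x)) * zext \<Omega> u (x - (0, h))
        + complex_of_real (p (snd x)) * zext \<Omega> (weak_deriv \<Omega> (0, 1) u) (x - (0, h))) x"
proof -
  let ?W1 = "weak_deriv \<Omega> (1, 0) u" and ?W2 = "weak_deriv \<Omega> (0, 1) u"
  let ?J = "{f 0..b}"
  note ti = has_trace_iff_H1_lim[OF \<Omega>_open \<Omega>_bounded]
  have uH: "u \<in> H1 \<Omega>" and "has_trace \<Omega> (\<lambda>t. (t, f t)) {0..\<Lambda>} u (\<lambda>_. 0)"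
    using u by (auto simp: H1_S_qp_def)
  then obtain \<phi>S where S: "H1_lim \<Omega> \<phi>S u ?W1 ?W2" "L2_lim lborel (\<lambda>j. zext {0..\<Lambda>} (\<lambda>t. \<phi>S j (t, f t))) (\<lambda>_. 0)"
    by (subst (asm) ti) (auto intro!: continuous_intros f_cont)
  obtain w where w: "has_trace \<Omega> (\<lambda>y. (\<Lambda>, y)) ?J u w"
    "has_trace \<Omega> (\<lambda>y. (0, y)) ?J u (\<lambda>y. w y * exp (- \<i> * of_real (\<alpha> * \<Lambda>)))"
    using u by (auto simp: H1_S_qp_def)
  obtain \<phi>R where R: "H1_lim \<Omega> \<phi>R u ?W1 ?W2" "L2_lim lborel (\<lambda>j. zext ?J (\<lambda>y. \<phi>R j (\<Lambda>, y))) (zext ?J w)"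
    using w(1) uH by (subst (asm) ti) (auto intro!: continuous_intros)
  obtain \<phi>L where Lf: "H1_lim \<Omega> \<phi>L u ?W1 ?W2"
    "L2_lim lborel (\<lambda>j. zext ?J (\<lambda>y. \<phi>L j (0, y))) (zext ?J (\<lambda>y. w y * exp (- \<i> * of_real (\<alpha> * \<Lambda>))))"
    using w(2) uH by (subst (asm) ti) (auto intro!: continuous_intros)
  note P = layer_Poincare[OF S]
  have pc: "continuous_on UNIV p" by (auto intro!: continuous_at_imp_continuous_on DERIV_isCont p(1))
  let ?V1 = "\<lambda>x. complex_of_real (p (snd x)) * zext \<Omega> ?W1 (x - (0, h))"
  let ?V2 = "\<lambda>x. complex_of_real (p' (snd x)) * zext \<Omega> u (x - (0, h)) + complex_of_real (p (snd x)) * zext \<Omega> ?W2 (x - (0, h))"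
  have test: "\<exists>\<eta>. (\<forall>j. C1 (\<eta> j)) \<and> (\<forall>j x. cmod (\<eta> j x) \<le> 1) \<and> (\<forall>j. vanishes_near_S (\<eta> j)) \<and>
     (\<forall>x. snd x > f (fst x) \<longrightarrow> (\<lambda>j. \<eta> j x) \<longlonglongrightarrow> 1) \<and>
     H1_lim \<Omega> (\<lambda>j x. complex_of_real (p (snd x)) * (\<eta> j (x - (0, h)) * \<phi> j (x - (0, h)))) v ?V1 ?V2"
    if l: "H1_lim \<Omega> \<phi> u ?W1 ?W2" for \<phi>
  proof -
    obtain \<eta> where \<eta>: "\<forall>j. C1 (\<eta> j)" "\<forall>j x. cmod (\<eta> j x) \<le> 1" "\<forall>j. vanishes_near_S (\<eta> j)"
      "\<forall>x. snd x > f (fst x) \<longrightarrow> (\<lambda>j. \<eta> j x) \<longlonglongrightarrow> 1" "H1_lim \<Omega> (\<lambda>j x. \<eta> j x * \<phi> j x) u ?W1 ?W2"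
      using cutoff_lim[OF l P] by blast
    have "vanishes_near_S (\<lambda>x. \<eta> j x * \<phi> j x)" for j
      using \<eta>(3) unfolding vanishes_near_S_def by (metis mult_zero_left)
    from shifted_test_lim[OF \<eta>(5) this p(1,2) h] \<eta> show ?thesis unfolding v_def by blast
  qed
  obtain \<eta>S where \<eta>S: "\<forall>j. vanishes_near_S (\<eta>S j)"
    "H1_lim \<Omega> (\<lambda>j x. complex_of_real (p (snd x)) * (\<eta>S j (x - (0, h)) * \<phi>S j (x - (0, h)))) v ?V1 ?V2"
    using test[OF S(1)] by blast
  obtain \<eta>R where \<eta>R: "\<And>j. C1 (\<eta>R j)" "\<And>j x. cmod (\<eta>R j x) \<le> 1" "\<And>j. vanishes_near_S (\<eta>R j)"
     "\<And>x. snd x > f (fst x) \<Longrightarrow> (\<lambda>j. \<eta>R j x) \<longlonglongrightarrow> 1"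
    "H1_lim \<Omega> (\<lambda>j x. complex_of_real (p (snd x)) * (\<eta>R j (x - (0, h)) * \<phi>R j (x - (0, h)))) v ?V1 ?V2"
    using test[OF R(1)] by blast
  obtain \<eta>L where \<eta>L: "\<And>j. C1 (\<eta>L j)" "\<And>j x. cmod (\<eta>L j x) \<le> 1" "\<And>j. vanishes_near_S (\<eta>L j)"
     "\<And>x. snd x > f (fst x) \<Longrightarrow> (\<lambda>j. \<eta>L j x) \<longlonglongrightarrow> 1"
    "H1_lim \<Omega> (\<lambda>j x. complex_of_real (p (snd x)) * (\<eta>L j (x - (0, h)) * \<phi>L j (x - (0, h)))) v ?V1 ?V2"
    using test[OF Lf(1)] by blast
  note H = H1_lim_imp_H1[OF \<Omega>_open \<Omega>_bounded]
  show ae: "AE x in lborel. zext \<Omega> (weak_deriv \<Omega> (1, 0) v) x = zext \<Omega> ?V1 x"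
    "AE x in lborel. zext \<Omega> (weak_deriv \<Omega> (0, 1) v) x = zext \<Omega> ?V2 x"
    using H(2,3)[OF \<eta>S(2)] by auto
  have vH: "v \<in> H1 \<Omega>" by (rule H(1)[OF \<eta>S(2)])
  note ti' = ti[OF vH]
  have zS: "zext {0..\<Lambda>} (\<lambda>t. complex_of_real (p (snd (t, f t))) * (\<eta>S j ((t, f t) - (0, h)) * \<phi>S j ((t, f t) - (0, h)))) = (\<lambda>_. 0)" for j
  proof
    fix t
    have "\<eta>S j ((t, f t) - (0, h)) = 0" using h by (intro vanishes_near_S_D(1)) (use \<eta>S(1) in auto)
    then show "zext {0..\<Lambda>} (\<lambda>t. complex_of_real (p (snd (t, f t))) * (\<eta>S j ((t, f t) - (0, h)) * \<phi>S j ((t, f t) - (0, h)))) t = 0"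
      by (cases "t \<in> {0..\<Lambda>}") auto
  qed
  have tS: "has_trace \<Omega> (\<lambda>t. (t, f t)) {0..\<Lambda>} v (\<lambda>_. 0)"
    by (subst ti') (use H(4)[OF \<eta>S(2)] zS in \<open>auto intro!: continuous_intros f_cont exI L2_lim_const simp del: diff_Pair\<close>)
  have zG: "zext {0..\<Lambda>} (\<lambda>t. complex_of_real (p (snd (t, b))) * (\<eta>S j ((t, b) - (0, h)) * \<phi>S j ((t, b) - (0, h)))) = (\<lambda>_. 0)" for j
    using p(3) by simp
  show "has_trace \<Omega> (\<lambda>t. (t, b)) {0..\<Lambda>} v (\<lambda>_. 0)"
    by (subst ti') (use H(4)[OF \<eta>S(2)] zG in \<open>auto intro!: continuous_intros exI L2_lim_const simp del: diff_Pair\<close>)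
  define \<omega> where "\<omega> = (\<lambda>y. complex_of_real (p y) * zext {f 0<..b} w (y - h))"
  have tR: "has_trace \<Omega> (\<lambda>y. (\<Lambda>, y)) ?J v \<omega>"
  proof (subst ti')
    show "\<exists>\<phi>. H1_lim \<Omega> \<phi> v (weak_deriv \<Omega> (1, 0) v) (weak_deriv \<Omega> (0, 1) v) \<and>
      L2_lim lborel (\<lambda>j. zext ?J (\<lambda>t. \<phi> j (\<Lambda>, t))) (zext ?J \<omega>)"
      using H(4)[OF \<eta>R(5)] side_lim[OF R(2) per \<eta>R(1-4) pc h] unfolding \<omega>_def
      by (intro exI[of _ "\<lambda>j x. complex_of_real (p (snd x)) * (\<eta>R j (x - (0, h)) * \<phi>R j (x - (0, h)))"]) auto
  qed (auto intro!: continuous_intros)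
  have tL: "has_trace \<Omega> (\<lambda>y. (0, y)) ?J v (\<lambda>y. \<omega> y * exp (- \<i> * of_real (\<alpha> * \<Lambda>)))"
  proof (subst ti')
    have e: "(\<lambda>y. \<omega> y * exp (- \<i> * of_real (\<alpha> * \<Lambda>))) = (\<lambda>y. complex_of_real (p y) * zext {f 0<..b} (\<lambda>y. w y * exp (- \<i> * of_real (\<alpha> * \<Lambda>))) (y - h))"
      by (auto simp: \<omega>_def zext_def)
    show "\<exists>\<phi>. H1_lim \<Omega> \<phi> v (weak_deriv \<Omega> (1, 0) v) (weak_deriv \<Omega> (0, 1) v) \<and>
      L2_lim lborel (\<lambda>j. zext ?J (\<lambda>t. \<phi> j (0, t))) (zext ?J (\<lambda>y. \<omega> y * exp (- \<i> * of_real (\<alpha> * \<Lambda>))))"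
      unfolding e using H(4)[OF \<eta>L(5)] side_lim[OF Lf(2) refl \<eta>L(1-4) pc h]
      by (intro exI[of _ "\<lambda>j x. complex_of_real (p (snd x)) * (\<eta>L j (x - (0, h)) * \<phi>L j (x - (0, h)))"]) auto
  qed (auto intro!: continuous_intros)
  show "v \<in> H1_S_qp \<Lambda> f b \<alpha>"
    unfolding H1_S_qp_def using vH tS tR tL by blast
qed

end

section \<open>Vertical difference quotients\<close>

lemma integral_window:
  fixes G :: "real \<Rightarrow> real"
  assumes G: "integrable lborel G" and h: "h \<ge> 0"
  shows "integrable lborel (\<lambda>y. LINT t|lborel. indicator {y - h..y} t * G t)"
    "(LINT y|lborel. LINT t|lborel. indicator {y - h..y} t * G t) = h * (LINT t|lborel. G t)"
proof -
  have [measurable]: "G \<in> borel_measurable borel" using G by auto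
  let ?F = "\<lambda>z :: real \<times> real. indicator {fst z..fst z + h} (snd z) * G (fst z)"
  have Fm: "?F \<in> borel_measurable (lborel \<Otimes>\<^sub>M lborel)"
  proof -
    let ?A = "{z :: real \<times> real. fst z \<le> snd z} \<inter> {z. snd z \<le> fst z + h}"
    have F: "?F = (\<lambda>z. indicator ?A z * G (fst z))" by (auto simp: indicator_def)
    have A: "?A \<in> sets borel" by (intro sets.Int borel_closed closed_Collect_le continuous_intros)
    have Gf: "(\<lambda>z :: real \<times> real. G (fst z)) \<in> borel_measurable borel"
      by (rule measurable_compose[of fst borel borel G]) (auto intro!: borel_measurable_continuous_onI continuous_intros)
    show ?thesis unfolding F lborel_prod
      using borel_measurable_times[OF borel_measurable_indicator[OF A] Gf] by simp
  qed
  have inner: "(LINT y|lborel. norm (?F (t, y))) = h * norm (G t)" for t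
    using h by (simp add: abs_mult)
  have "integrable (lborel \<Otimes>\<^sub>M lborel) ?F"
  proof (rule lborel_pair.Fubini_integrable[OF Fm])
    show "integrable lborel (\<lambda>x. LINT y|lborel. norm (?F (x, y)))"
      unfolding inner using G by simp
    show "AE x in lborel. integrable lborel (\<lambda>y. ?F (x, y))"
      using h by (intro AE_I2) (auto intro!: integrable_mult_left)
  qed
  then have i: "integrable lborel ?F" unfolding lborel_prod .
  have s: "indicator {y - h..y} t * G t = ?F (t, y)" for y t by (auto simp: indicator_def)
  show "integrable lborel (\<lambda>y. LINT t|lborel. indicator {y - h..y} t * G t)"
    unfolding s by (rule integral_plane_snd(2)[OF i])
  have "(LINT y|lborel. LINT t|lborel. indicator {y - h..y} t * G t) = (LINT z|lborel. ?F z)"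
    unfolding s by (rule integral_plane_snd(1)[OF i, symmetric])
  also have "\<dots> = (LINT t|lborel. LINT y|lborel. ?F (t, y))" by (rule integral_plane_fst(1)[OF i])
  also have "\<dots> = (LINT t|lborel. h * G t)" using h by simp
  finally show "(LINT y|lborel. LINT t|lborel. indicator {y - h..y} t * G t) = h * (LINT t|lborel. G t)" by simp
qed

context graph_domain
begin

text \<open>
  The difference is the integral of \<open>d2 \<psi>\<close> over a vertical segment of length \<open>h\<close>; Cauchy-Schwarz and Fubini give
  the two factors \<open>h\<close>.
\<close>

lemma difference_C1:
  assumes \<psi>: "C1 \<psi>" "vanishes_near_S \<psi>" and h: "h \<ge> 0"
  shows "sq_norm lborel (zext \<Omega> (\<lambda>x. \<psi> x - \<psi> (x - (0, h)))) \<le> h\<^sup>2 * sq_norm lborel (zext \<Omega> (d2 \<psi>))"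
proof -
  let ?g = "zext \<Omega> (d2 \<psi>)"
  let ?D = "zext \<Omega> (\<lambda>x. \<psi> x - \<psi> (x - (0, h)))"
  note cont = C1_continuous[OF \<psi>(1)]
  have sg: "sq_int lborel ?g" by (rule sq_int_zext_continuous[OF cont(3) \<Omega>_bounded \<Omega>_sets])
  have cD: "continuous_on UNIV (\<lambda>x. \<psi> x - \<psi> (x - (0, h)))"
    by (intro continuous_intros cont(1) continuous_on_compose2[OF cont(1)]) auto
  have sD: "sq_int lborel ?D" by (rule sq_int_zext_continuous[OF cD \<Omega>_bounded \<Omega>_sets])
  note Fg = integral_plane_fst[OF sq_int_integrable[OF sg]]
  note FD = integral_plane_fst[OF sq_int_integrable[OF sD]]
  have cov: "{y. (x, y) \<in> \<Omega>} \<in> sets borel" "bounded {y. (x, y) \<in> \<Omega>}" for x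
  proof -
    have "{y. (x, y) \<in> \<Omega>} = (if 0 < x \<and> x < \<Lambda> then {f x<..<b} else {})" by (auto simp: \<Omega>_iff)
    then show "{y. (x, y) \<in> \<Omega>} \<in> sets borel" "bounded {y. (x, y) \<in> \<Omega>}" by auto
  qed
  have gx: "?g (x, t) = zext {y. (x, y) \<in> \<Omega>} (\<lambda>y. d2 \<psi> (x, y)) t" for x t by (auto simp: zext_def indicator_def)
  have ig: "integrable lborel (\<lambda>t. (cmod (?g (x, t)))\<^sup>2)" for x
    unfolding gx using sq_int_zext_continuous[OF continuous_slice(2)[OF cont(3)] cov(2,1)] by (simp add: sq_int_def)
  have Dx: "?D (x, t) = zext {y. (x, y) \<in> \<Omega>} (\<lambda>y. \<psi> (x, y) - \<psi> (x, y - h)) t" for x t by (auto simp: zext_def indicator_def)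
  have cDs: "continuous_on UNIV (\<lambda>y. \<psi> (x, y) - \<psi> (x, y - h))" for x
    using continuous_slice(2)[OF cD, of UNIV x] by simp
  have iD: "integrable lborel (\<lambda>t. (cmod (?D (x, t)))\<^sup>2)" for x
    unfolding Dx using sq_int_zext_continuous[OF cDs cov(2,1)] by (simp add: sq_int_def)
  have pt: "(cmod (?D (x, y)))\<^sup>2 \<le> h * (LINT t|lborel. indicator {y - h..y} t * (cmod (?g (x, t)))\<^sup>2)" for x y
  proof (cases "(x, y) \<in> \<Omega>")
    case True
    let ?J = "{t. (x, t) \<in> \<Omega>}"
    have "?D (x, y) = (LINT t|lborel. indicator {y - h..y} t *\<^sub>R d2 \<psi> (x, t))"
      using C1_FTC2[OF \<psi>(1), of "y - h" y x] h True by simp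
    also have "\<dots> = (LINT t|lborel. zext {y - h..y} (\<lambda>t. 1) t * zext {y - h..y} (\<lambda>t. ?g (x, t)) t)"
    proof (intro Bochner_Integration.integral_cong refl)
      fix t
      have "d2 \<psi> (x, t) = ?g (x, t)" if "t \<le> y"
      proof (cases "(x, t) \<in> \<Omega>")
        case False
        then have "d2 \<psi> (x, t) = 0" using that True by (intro vanishes_near_S_D(3)[OF \<psi>(2)]) (auto simp: \<Omega>_iff)
        then show ?thesis using False by simp
      qed simp
      then show "indicator {y - h..y} t *\<^sub>R d2 \<psi> (x, t) = zext {y - h..y} (\<lambda>t. 1) t * zext {y - h..y} (\<lambda>t. ?g (x, t)) t"
        by (cases "t \<in> {y - h..y}") auto
    qed
    finally have eq: "?D (x, y) = (LINT t|lborel. zext {y - h..y} (\<lambda>t. 1) t * zext {y - h..y} (\<lambda>t. ?g (x, t)) t)" .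
    have s1: "sq_int lborel (zext {y - h..y} (\<lambda>t. 1))" by (rule sq_int_zext_continuous) auto
    have "sq_int lborel (zext {y - h..y} (zext ?J (\<lambda>t. d2 \<psi> (x, t))))"
      by (intro sq_int_zext sq_int_zext_continuous[OF continuous_slice(2)[OF cont(3)] cov(2,1)]) auto
    then have s2: "sq_int lborel (zext {y - h..y} (\<lambda>t. ?g (x, t)))" by (simp add: gx)
    have n1: "sq_norm lborel (zext {y - h..y} (\<lambda>t. 1)) = h"
    proof -
      have "sq_norm lborel (zext {y - h..y} (\<lambda>t. 1)) = (LINT t|lborel. indicator {y - h..y} t)"
        unfolding sq_norm_def by (intro Bochner_Integration.integral_cong) (auto simp: zext_def indicator_def)
      then show ?thesis using h by simp
    qed
    have n2: "sq_norm lborel (zext {y - h..y} (\<lambda>t. ?g (x, t))) = (LINT t|lborel. indicator {y - h..y} t * (cmod (?g (x, t)))\<^sup>2)"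
      unfolding sq_norm_def by (intro Bochner_Integration.integral_cong) (auto simp: zext_def indicator_def)
    show ?thesis using Cauchy_Schwarz_integral[OF s1 s2] unfolding n1 n2 eq .
  next
    case False
    have "0 \<le> (LINT t|lborel. indicator {y - h..y} t * (cmod (?g (x, t)))\<^sup>2)" by (intro Bochner_Integration.integral_nonneg) auto
    then show ?thesis using False h by simp
  qed
  have line: "(LINT y|lborel. (cmod (?D (x, y)))\<^sup>2) \<le> h\<^sup>2 * (LINT t|lborel. (cmod (?g (x, t)))\<^sup>2)" for x
  proof -
    note w = integral_window[OF ig h, of x]
    have "(LINT y|lborel. (cmod (?D (x, y)))\<^sup>2) \<le> (LINT y|lborel. h * (LINT t|lborel. indicator {y - h..y} t * (cmod (?g (x, t)))\<^sup>2))"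
      using w(1) by (intro integral_mono iD pt) simp
    then show ?thesis using w(2) by (simp add: power2_eq_square)
  qed
  have "sq_norm lborel ?D = (LINT x|lborel. LINT y|lborel. (cmod (?D (x, y)))\<^sup>2)"
    unfolding sq_norm_def by (rule FD)
  also have "\<dots> \<le> (LINT x|lborel. h\<^sup>2 * (LINT t|lborel. (cmod (?g (x, t)))\<^sup>2))"
    using FD(2) Fg(2) by (intro integral_mono line) auto
  also have "\<dots> = h\<^sup>2 * sq_norm lborel ?g"
    unfolding sq_norm_def Fg(1) by simp
  finally show ?thesis .
qed

lemma zext_shift:
  assumes h: "h \<ge> 0" and G: "\<And>x. snd x \<le> f (fst x) \<Longrightarrow> G x = 0"
  shows "zext \<Omega> (\<lambda>x. zext \<Omega> G (x - (0, h))) = zext \<Omega> (\<lambda>x. G (x - (0, h)))"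
proof
  fix x show "zext \<Omega> (\<lambda>x. zext \<Omega> G (x - (0, h))) x = zext \<Omega> (\<lambda>x. G (x - (0, h))) x"
  proof (cases "x \<in> \<Omega> \<and> x - (0, h) \<notin> \<Omega>")
    case True
    then have "snd (x - (0, h)) \<le> f (fst (x - (0, h)))" using h by (auto simp: \<Omega>_iff)
    from G[OF this] show ?thesis using True by simp
  qed (auto simp: zext_def)
qed

lemma difference_bound:
  assumes l: "H1_lim \<Omega> \<psi> u W1 W2" and v: "\<And>j. vanishes_near_S (\<psi> j)" and h: "h \<ge> 0"
  shows "sq_int lborel (zext \<Omega> (\<lambda>x. zext \<Omega> u x - zext \<Omega> u (x - (0, h))))"
    and "sq_norm lborel (zext \<Omega> (\<lambda>x. zext \<Omega> u x - zext \<Omega> u (x - (0, h)))) \<le> h\<^sup>2 * sq_norm lborel (zext \<Omega> W2)"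
proof -
  have \<psi>: "\<And>j. C1 (\<psi> j)" and lu: "L2_lim lborel (\<lambda>j. zext \<Omega> (\<psi> j)) (zext \<Omega> u)"
    and l2: "L2_lim lborel (\<lambda>j. zext \<Omega> (d2 (\<psi> j))) (zext \<Omega> W2)"
    using l unfolding H1_lim_def by blast+
  have lim: "L2_lim lborel (\<lambda>j. zext \<Omega> (\<lambda>x. zext \<Omega> (\<psi> j) x - zext \<Omega> (\<psi> j) (x - (0, h)))) (zext \<Omega> (\<lambda>x. zext \<Omega> u x - zext \<Omega> u (x - (0, h))))"
    by (intro L2_lim_zext L2_lim_diff lu L2_lim_translate) simp
  show "sq_int lborel (zext \<Omega> (\<lambda>x. zext \<Omega> u x - zext \<Omega> u (x - (0, h))))" by (rule L2_limD(2)[OF lim])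
  have eq: "zext \<Omega> (\<lambda>x. zext \<Omega> (\<psi> j) x - zext \<Omega> (\<psi> j) (x - (0, h))) = zext \<Omega> (\<lambda>x. \<psi> j x - \<psi> j (x - (0, h)))" for j
  proof -
    have "zext \<Omega> (\<lambda>x. zext \<Omega> (\<psi> j) (x - (0, h))) = zext \<Omega> (\<lambda>x. \<psi> j (x - (0, h)))"
      by (rule zext_shift[OF h]) (rule vanishes_near_S_D(1)[OF v])
    then show ?thesis by (simp add: zext_diff zext_zext)
  qed
  show "sq_norm lborel (zext \<Omega> (\<lambda>x. zext \<Omega> u x - zext \<Omega> u (x - (0, h)))) \<le> h\<^sup>2 * sq_norm lborel (zext \<Omega> W2)"
  proof (rule LIMSEQ_le)
    show "(\<lambda>j. sq_norm lborel (zext \<Omega> (\<lambda>x. \<psi> j x - \<psi> j (x - (0, h))))) \<longlonglongrightarrow> sq_norm lborel (zext \<Omega> (\<lambda>x. zext \<Omega> u x - zext \<Omega> u (x - (0, h))))"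
      using L2_lim_sq_norm[OF lim] unfolding eq .
    show "(\<lambda>j. h\<^sup>2 * sq_norm lborel (zext \<Omega> (d2 (\<psi> j)))) \<longlonglongrightarrow> h\<^sup>2 * sq_norm lborel (zext \<Omega> W2)"
      by (intro tendsto_intros L2_lim_sq_norm[OF l2])
    show "\<exists>N. \<forall>n\<ge>N. sq_norm lborel (zext \<Omega> (\<lambda>x. \<psi> n x - \<psi> n (x - (0, h)))) \<le> h\<^sup>2 * sq_norm lborel (zext \<Omega> (d2 (\<psi> n)))"
      using difference_C1[OF \<psi> v h] by blast
  qed
qed

text \<open>
  Pointwise convergence is the definition of the derivative, and the mean value inequality on a compact set
  that contains the shifted domain provides the majorant.
\<close>

lemma difference_quotient_C1:
  assumes \<psi>: "C1 \<psi>" and s: "s \<longlonglongrightarrow> 0" "\<And>n. 0 < s n" "\<And>n. s n \<le> 1"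
  shows "L2_lim lborel (\<lambda>n. zext \<Omega> (\<lambda>x. (\<psi> x - \<psi> (x - (0, s n))) / s n)) (zext \<Omega> (d2 \<psi>))"
proof -
  note cont = C1_continuous[OF \<psi>]
  obtain c where c: "\<And>x. x \<in> {0..\<Lambda>} \<Longrightarrow> c < f x" using f_lower by blast
  let ?K = "cbox (0, c - 1) (\<Lambda>, b)"
  have "bounded (d2 \<psi> ` ?K)"
    by (intro compact_imp_bounded compact_continuous_image continuous_on_subset[OF cont(3)]) auto
  then obtain B where B: "\<And>x. x \<in> ?K \<Longrightarrow> cmod (d2 \<psi> x) \<le> B" unfolding bounded_iff by auto
  have bd: "cmod (\<psi> x - \<psi> (x - (0, h))) \<le> B * h" if x: "x \<in> \<Omega>" and h: "0 < h" "h \<le> 1" for x h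
  proof -
    obtain x1 y where xy: "x = (x1, y)" by (cases x)
    have c': "c < f x1" using x c[of x1] by (auto simp: \<Omega>_iff xy)
    have "norm (\<psi> (x1, y) - \<psi> (x1, y - h)) \<le> B * norm (y - (y - h))"
    proof (rule differentiable_bound[of "{y - h..y}" "\<lambda>t. \<psi> (x1, t)" "\<lambda>t v. v *\<^sub>R d2 \<psi> (x1, t)"])
      show "((\<lambda>t. \<psi> (x1, t)) has_derivative (\<lambda>v. v *\<^sub>R d2 \<psi> (x1, t))) (at t within {y - h..y})" for t
        using C1_line2[OF \<psi>] by (simp add: has_vector_derivative_def)
      show "onorm (\<lambda>v. v *\<^sub>R d2 \<psi> (x1, t)) \<le> B" if t: "t \<in> {y - h..y}" for t
      proof (rule onorm_le)
        fix v :: real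
        have "(x1, t) \<in> ?K" using t x c' h by (auto simp: \<Omega>_iff xy)
        from mult_left_mono[OF B[OF this], of "\<bar>v\<bar>"] show "norm (v *\<^sub>R d2 \<psi> (x1, t)) \<le> B * norm v" by (simp add: mult.commute)
      qed
    qed (use h in auto)
    then show ?thesis using h by (simp add: xy)
  qed
  have one: "sq_int lborel (zext \<Omega> (\<lambda>x. 1))" by (rule sq_int_zext_continuous) (auto simp: \<Omega>_bounded)
  show ?thesis
  proof (rule L2_lim_dominated[where B="\<bar>B\<bar>" and g="zext \<Omega> (\<lambda>x. 1)"])
    show "sq_int lborel (zext \<Omega> (d2 \<psi>))" by (rule sq_int_zext_continuous[OF cont(3) \<Omega>_bounded \<Omega>_sets])
    show "zext \<Omega> (\<lambda>x. (\<psi> x - \<psi> (x - (0, s n))) / s n) \<in> borel_measurable lborel" for n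
    proof -
      have "continuous_on UNIV (\<lambda>x. (\<psi> x - \<psi> (x - (0, s n))) / s n)"
        using s(2)[of n] by (intro continuous_intros cont(1) continuous_on_compose2[OF cont(1)]) auto
      from sq_int_measurable[OF sq_int_zext_continuous[OF this \<Omega>_bounded \<Omega>_sets]] show ?thesis .
    qed
    show "cmod (zext \<Omega> (\<lambda>x. (\<psi> x - \<psi> (x - (0, s n))) / s n) x) \<le> \<bar>B\<bar> * cmod (zext \<Omega> (\<lambda>x. 1) x)" for n x
    proof (cases "x \<in> \<Omega>")
      case True
      have "cmod (\<psi> x - \<psi> (x - (0, s n))) \<le> \<bar>B\<bar> * s n"
        using bd[OF True s(2,3), of n] s(2)[of n] by (smt (verit) mult_right_mono)
      then show ?thesis using True s(2)[of n] by (simp add: norm_divide field_simps)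
    qed simp
    show "(\<lambda>n. zext \<Omega> (\<lambda>x. (\<psi> x - \<psi> (x - (0, s n))) / s n) x) \<longlonglongrightarrow> zext \<Omega> (d2 \<psi>) x" for x
    proof (cases "x \<in> \<Omega>")
      case True
      obtain x1 y where xy: "x = (x1, y)" by (cases x)
      have "((\<lambda>t. \<psi> (x1, t)) has_derivative (\<lambda>h. h *\<^sub>R d2 \<psi> (x1, y))) (at y)"
        using C1_line2[OF \<psi>] by (simp add: has_vector_derivative_def)
      then have lim: "((\<lambda>h. norm (\<psi> (x1, y + h) - \<psi> (x1, y) - h *\<^sub>R d2 \<psi> (x1, y)) / norm h) \<longlongrightarrow> 0) (at 0)"
        by (simp only: has_derivative_at)
      have "(\<lambda>n. - s n) \<longlonglongrightarrow> 0" using tendsto_minus[OF s(1)] by simp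
      moreover have "- s n \<noteq> 0" for n using s(2)[of n] by simp
      ultimately have "filterlim (\<lambda>n. - s n) (at 0) sequentially"
        unfolding filterlim_at by (auto intro!: always_eventually)
      from filterlim_compose[OF lim this]
      have "(\<lambda>n. norm (\<psi> (x1, y + - s n) - \<psi> (x1, y) - (- s n) *\<^sub>R d2 \<psi> (x1, y)) / norm (- s n)) \<longlonglongrightarrow> 0" .
      moreover have "norm (\<psi> (x1, y + - s n) - \<psi> (x1, y) - (- s n) *\<^sub>R d2 \<psi> (x1, y)) / norm (- s n)
        = norm ((\<psi> x - \<psi> (x - (0, s n))) / s n - d2 \<psi> x)" for n
      proof -
        have "(\<psi> x - \<psi> (x - (0, s n))) / s n - d2 \<psi> x
          = - (\<psi> (x1, y + - s n) - \<psi> (x1, y) - (- s n) *\<^sub>R d2 \<psi> (x1, y)) / s n"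
          using s(2)[of n] by (simp add: xy scaleR_conv_of_real field_simps)
        then show ?thesis using s(2)[of n] by (simp only: norm_divide norm_minus_cancel) simp
      qed
      ultimately have "(\<lambda>n. norm ((\<psi> x - \<psi> (x - (0, s n))) / s n - d2 \<psi> x)) \<longlonglongrightarrow> 0" by simp
      then have "(\<lambda>n. (\<psi> x - \<psi> (x - (0, s n))) / s n) \<longlonglongrightarrow> d2 \<psi> x"
        by (rule LIM_zero_cancel[OF tendsto_norm_zero_cancel])
      then show ?thesis using True by simp
    qed simp
  qed (rule one)
qed

text \<open>
  The difference quotients are bounded operators uniformly in the step, by the bound above, and they
  converge for each of the approximating \<open>C\<^sup>1\<close> functions.
\<close>

lemma difference_quotient:
  assumes l: "H1_lim \<Omega> \<psi> u W1 W2" and v: "\<And>j. vanishes_near_S (\<psi> j)"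
    and s: "s \<longlonglongrightarrow> 0" "\<And>n. 0 < s n" "\<And>n. s n \<le> 1"
  shows "L2_lim lborel (\<lambda>n. zext \<Omega> (\<lambda>x. (zext \<Omega> u x - zext \<Omega> u (x - (0, s n))) / s n)) (zext \<Omega> W2)"
proof -
  have \<psi>: "\<And>j. C1 (\<psi> j)" and lu: "L2_lim lborel (\<lambda>j. zext \<Omega> (\<psi> j)) (zext \<Omega> u)"
    and l1: "L2_lim lborel (\<lambda>j. zext \<Omega> (d1 (\<psi> j))) (zext \<Omega> W1)"
    and l2: "L2_lim lborel (\<lambda>j. zext \<Omega> (d2 (\<psi> j))) (zext \<Omega> W2)"
    using l unfolding H1_lim_def by blast+
  have s0: "s n \<ge> 0" for n using s(2)[of n] by simp
  let ?T = "\<lambda>u n. zext \<Omega> (\<lambda>x. (zext \<Omega> u x - zext \<Omega> u (x - (0, s n))) / s n)"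
  have T: "?T w n = (\<lambda>x. complex_of_real (1 / s n) * zext \<Omega> (\<lambda>x. zext \<Omega> w x - zext \<Omega> w (x - (0, s n))) x)" for w n
    by (auto simp: zext_def indicator_def)
  have ST: "sq_int lborel (?T u n)" for n
    unfolding T by (intro sq_int_cmult difference_bound(1)[OF l v s0])
  have W2: "sq_int lborel (zext \<Omega> W2)" using L2_limD(2)[OF l2] .
  have T\<psi>: "?T (\<psi> j) n = zext \<Omega> (\<lambda>x. (\<psi> j x - \<psi> j (x - (0, s n))) / s n)" for n j
  proof -
    have "zext \<Omega> (\<lambda>x. zext \<Omega> (\<psi> j) (x - (0, s n))) = zext \<Omega> (\<lambda>x. \<psi> j (x - (0, s n)))"
      by (rule zext_shift[OF s0]) (rule vanishes_near_S_D(1)[OF v])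
    then have e: "zext \<Omega> (\<psi> j) (x - (0, s n)) = \<psi> j (x - (0, s n))" if "x \<in> \<Omega>" for x
      using that by (auto dest: fun_cong[of _ _ x])
    show ?thesis
    proof
      fix x show "?T (\<psi> j) n x = zext \<Omega> (\<lambda>x. (\<psi> j x - \<psi> j (x - (0, s n))) / s n) x"
        using e[of x] by (cases "x \<in> \<Omega>") auto
    qed
  qed
  have lc: "L2_lim lborel (\<lambda>n. ?T (\<psi> j) n) (zext \<Omega> (d2 (\<psi> j)))" for j
    unfolding T\<psi> by (rule difference_quotient_C1[OF \<psi> s])
  have bound: "sq_norm lborel (\<lambda>x. ?T u n x - zext \<Omega> W2 x) \<le>
      6 * sq_norm lborel (\<lambda>x. zext \<Omega> (d2 (\<psi> j)) x - zext \<Omega> W2 x) + 4 * sq_norm lborel (\<lambda>x. ?T (\<psi> j) n x - zext \<Omega> (d2 (\<psi> j)) x)" for n j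
  proof -
    let ?r = "\<lambda>x. u x - \<psi> j x"
    have c: "L2_lim lborel (\<lambda>i. zext \<Omega> (g (\<psi> j))) (zext \<Omega> (g (\<psi> j)))" if "continuous_on UNIV (g (\<psi> j))" for g :: "_ \<Rightarrow> _ \<Rightarrow> complex"
      by (intro L2_lim_const sq_int_zext_continuous that \<Omega>_bounded \<Omega>_sets)
    note cc = C1_continuous[OF \<psi>[of j]]
    have rl: "H1_lim \<Omega> (\<lambda>i x. \<psi> i x - \<psi> j x) ?r (\<lambda>x. W1 x - d1 (\<psi> j) x) (\<lambda>x. W2 x - d2 (\<psi> j) x)"
      unfolding H1_lim_def C1_diff(2,3)[OF \<psi> \<psi>] zext_diff
      by (intro conjI allI C1_diff(1) \<psi> L2_lim_diff lu l1 l2 c cc)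
    have rv: "vanishes_near_S (\<lambda>x. \<psi> i x - \<psi> j x)" for i
    proof -
      obtain a a' where "a > 0" "\<forall>x. snd x \<le> f (fst x) + a \<longrightarrow> \<psi> i x = 0" "a' > 0" "\<forall>x. snd x \<le> f (fst x) + a' \<longrightarrow> \<psi> j x = 0"
        using v[of i] v[of j] unfolding vanishes_near_S_def by blast
      then show ?thesis unfolding vanishes_near_S_def by (intro exI[of _ "min a a'"]) auto
    qed
    have Sr: "sq_int lborel (?T ?r n)" unfolding T by (intro sq_int_cmult difference_bound(1)[OF rl rv s0])
    have "sq_norm lborel (?T ?r n) \<le> (1 / s n)\<^sup>2 * ((s n)\<^sup>2 * sq_norm lborel (zext \<Omega> (\<lambda>x. W2 x - d2 (\<psi> j) x)))"
    proof -
      have "(cmod (complex_of_real (1 / s n)))\<^sup>2 = (1 / s n)\<^sup>2" by (simp add: norm_divide power_divide)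
      then show ?thesis unfolding T sq_norm_cmult
        using mult_left_mono[OF difference_bound(2)[OF rl rv s0[of n]], of "(1 / s n)\<^sup>2"] by simp
    qed
    also have "\<dots> = sq_norm lborel (zext \<Omega> (\<lambda>x. W2 x - d2 (\<psi> j) x))" using s(2)[of n] by (simp add: power_divide)
    also have "\<dots> = sq_norm lborel (\<lambda>x. zext \<Omega> (d2 (\<psi> j)) x - zext \<Omega> W2 x)"
      by (simp add: sq_norm_def zext_diff norm_minus_commute)
    finally have b1: "sq_norm lborel (?T ?r n) \<le> sq_norm lborel (\<lambda>x. zext \<Omega> (d2 (\<psi> j)) x - zext \<Omega> W2 x)" .
    have dl: "sq_int lborel (\<lambda>x. ?T (\<psi> j) n x - zext \<Omega> (d2 (\<psi> j)) x)" by (rule sq_int_diff(1)[OF L2_limD(1,2)[OF lc]])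
    have dw: "sq_int lborel (\<lambda>x. zext \<Omega> (d2 (\<psi> j)) x - zext \<Omega> W2 x)" by (rule sq_int_diff(1)[OF L2_limD(1,2)[OF l2]])
    have e: "(\<lambda>x. ?T u n x - zext \<Omega> W2 x) = (\<lambda>x. ?T ?r n x + ((?T (\<psi> j) n x - zext \<Omega> (d2 (\<psi> j)) x) + (zext \<Omega> (d2 (\<psi> j)) x - zext \<Omega> W2 x)))"
    proof
      fix x show "?T u n x - zext \<Omega> W2 x = ?T ?r n x + ((?T (\<psi> j) n x - zext \<Omega> (d2 (\<psi> j)) x) + (zext \<Omega> (d2 (\<psi> j)) x - zext \<Omega> W2 x))"
        by (cases "x \<in> \<Omega>"; cases "x - (0, s n) \<in> \<Omega>") (auto simp: diff_divide_distrib)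
    qed
    show ?thesis unfolding e
      using sq_int_add(2)[OF Sr sq_int_add(1)[OF dl dw]] sq_int_add(2)[OF dl dw] b1 by linarith
  qed
  have "(\<lambda>n. sq_norm lborel (\<lambda>x. ?T u n x - zext \<Omega> W2 x)) \<longlonglongrightarrow> 0"
  proof (rule LIMSEQ_I)
    fix e :: real assume e: "e > 0"
    have "\<forall>\<^sub>F j in sequentially. sq_norm lborel (\<lambda>x. zext \<Omega> (d2 (\<psi> j)) x - zext \<Omega> W2 x) < e / 12"
      using order_tendstoD(2)[OF L2_limD(3)[OF l2], of "e / 12"] e by simp
    then obtain j where j: "sq_norm lborel (\<lambda>x. zext \<Omega> (d2 (\<psi> j)) x - zext \<Omega> W2 x) < e / 12"
      by (auto simp: eventually_sequentially)
    from order_tendstoD(2)[OF L2_limD(3)[OF lc[of j]], of "e / 8"] e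
    obtain N where N: "\<And>n. n \<ge> N \<Longrightarrow> sq_norm lborel (\<lambda>x. ?T (\<psi> j) n x - zext \<Omega> (d2 (\<psi> j)) x) < e / 8"
      by (auto simp: eventually_sequentially)
    have "norm (sq_norm lborel (\<lambda>x. ?T u n x - zext \<Omega> W2 x) - 0) < e" if "n \<ge> N" for n
      using bound[of n j] N[OF that] j by simp
    then show "\<exists>N. \<forall>n\<ge>N. norm (sq_norm lborel (\<lambda>x. ?T u n x - zext \<Omega> W2 x) - 0) < e" by blast
  qed
  then show ?thesis using ST W2 by (simp add: L2_lim_def)
qed

end

locale graph_domain_top = graph_domain +
  fixes m :: real
  assumes m: "m < b" "\<And>x. x \<in> {0..\<Lambda>} \<Longrightarrow> f x < m"
begin

section \<open>The trace on the artificial boundary\<close>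

definition R :: "(real \<times> real) set" where "R = {0<..<\<Lambda>} \<times> {m<..<b}"

lemma R_sets [simp, measurable]: "R \<in> sets borel"
  unfolding R_def by (intro borel_open open_Times) auto

lemma R_subset: "R \<subseteq> \<Omega>"
proof
  fix x assume "x \<in> R"
  then show "x \<in> \<Omega>" using m(2)[of "fst x"] by (cases x) (auto simp: R_def \<Omega>_iff)
qed

lemma R_bounded: "bounded R"
  by (rule bounded_subset[OF \<Omega>_bounded R_subset])

lemma L2_lim_R: "L2_lim lborel (\<lambda>j. zext \<Omega> (F j)) (zext \<Omega> G) \<Longrightarrow> L2_lim lborel (\<lambda>j. zext R (F j)) (zext R G)"
  using L2_lim_zext[of "\<lambda>j. zext \<Omega> (F j)" "zext \<Omega> G" R] R_subset by (simp add: zext_zext Int_absorb2)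

lemma L2_lim_R_mult:
  assumes "L2_lim lborel (\<lambda>j. zext \<Omega> (F j)) (zext \<Omega> G)" "continuous_on UNIV q"
  shows "L2_lim lborel (\<lambda>j. zext R (\<lambda>x. q x * F j x)) (zext R (\<lambda>x. q x * G x))"
proof -
  have "zext R (\<lambda>x. q x * zext \<Omega> H x) = zext R (\<lambda>x. q x * H x)" for H
  proof
    fix x show "zext R (\<lambda>x. q x * zext \<Omega> H x) x = zext R (\<lambda>x. q x * H x) x"
      using R_subset by (cases "x \<in> R") auto
  qed
  then show ?thesis using L2_lim_continuous_mult[OF assms R_bounded R_sets] by simp
qed

text \<open>
  For \<open>C\<^sup>1\<close> functions this is the value at the upper end, since \<open>v + (y - m) \<partial>\<^sub>2 v\<close> is the vertical derivative
  of \<open>(y - m) v\<close>, which vanishes for \<open>y = m\<close>. In this form it is continuous with respect to \<open>v\<close> and its derivative.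
\<close>

definition top_value :: "(real \<times> real \<Rightarrow> complex) \<Rightarrow> (real \<times> real \<Rightarrow> complex) \<Rightarrow> real \<Rightarrow> complex" where
  "top_value v V2 x = of_real (1 / (b - m)) *
     (LINT y|lborel. zext R (\<lambda>z. v z + of_real (snd z - m) * V2 z) (x, y))"

lemma top_value_C1:
  assumes \<phi>: "C1 \<phi>"
  shows "top_value \<phi> (d2 \<phi>) x = zext {0<..<\<Lambda>} (\<lambda>x. \<phi> (x, b)) x"
proof (cases "x \<in> {0<..<\<Lambda>}")
  case True
  have g: "((\<lambda>t. complex_of_real (t - m)) has_vector_derivative complex_of_real 1) (at t)" for t
    by (rule has_vector_derivative_of_real) (auto intro!: derivative_eq_intros)
  note P = C1_snd[OF g continuous_on_const]
  note M = C1_mult[OF P(1) \<phi>]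
  have M3: "d2 (\<lambda>x. of_real (snd x - m) * \<phi> x) z = \<phi> z + of_real (snd z - m) * d2 \<phi> z" for z
    using fun_cong[OF M(3), of z] fun_cong[OF P(3), of z] by simp
  have cont: "continuous_on UNIV (\<lambda>z. \<phi> z + complex_of_real (snd z - m) * d2 \<phi> z)"
    by (intro continuous_intros C1_continuous[OF \<phi>])
  have ae: "AE t in lborel. t \<noteq> m \<and> t \<noteq> b"
    using AE_lborel_singleton[of m] AE_lborel_singleton[of b] by eventually_elim auto
  have e: "zext R (\<lambda>z. \<phi> z + of_real (snd z - m) * d2 \<phi> z) (x, y) = zext {m<..<b} (\<lambda>y. \<phi> (x, y) + of_real (y - m) * d2 \<phi> (x, y)) y" for y
    using True by (auto simp: zext_def R_def indicator_def)
  have sl: "continuous_on UNIV (\<lambda>y. \<phi> (x, y) + of_real (y - m) * d2 \<phi> (x, y))"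
    using continuous_slice(2)[OF cont, of UNIV x] by simp
  then have [measurable]: "(\<lambda>y. \<phi> (x, y) + of_real (y - m) * d2 \<phi> (x, y)) \<in> borel_measurable borel"
    by (rule borel_measurable_continuous_onI)
  have "(LINT y|lborel. zext R (\<lambda>z. \<phi> z + of_real (snd z - m) * d2 \<phi> z) (x, y))
    = (LINT y|lborel. indicator {m..b} y *\<^sub>R d2 (\<lambda>x. of_real (snd x - m) * \<phi> x) (x, y))"
    unfolding e M3 snd_conv
  proof (rule integral_cong_AE)
    show "AE y in lborel. zext {m<..<b} (\<lambda>y. \<phi> (x, y) + of_real (y - m) * d2 \<phi> (x, y)) y
      = indicator {m..b} y *\<^sub>R (\<phi> (x, y) + of_real (y - m) * d2 \<phi> (x, y))"
      using ae by eventually_elim (auto simp: zext_def indicator_def)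
  qed (simp_all add: zext_def del: of_real_diff)
  also have "\<dots> = of_real (b - m) * \<phi> (x, b)"
    using C1_FTC2[OF M(1), of m b x] m(1) by simp
  finally show ?thesis using True m(1) by (simp add: top_value_def)
next
  case False
  then have "zext R G (x, y) = 0" for G y by (auto simp: R_def)
  then show ?thesis using False by (simp add: top_value_def)
qed

lemma top_value_lim:
  assumes l: "H1_lim \<Omega> \<phi> v V1 V2"
  shows "L2_lim lborel (\<lambda>j. zext {0<..<\<Lambda>} (\<lambda>x. \<phi> j (x, b))) (top_value v V2)"
proof -
  have \<phi>: "\<And>j. C1 (\<phi> j)" and lu: "L2_lim lborel (\<lambda>j. zext \<Omega> (\<phi> j)) (zext \<Omega> v)"
    and l2: "L2_lim lborel (\<lambda>j. zext \<Omega> (d2 (\<phi> j))) (zext \<Omega> V2)"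
    using l unfolding H1_lim_def by blast+
  have "L2_lim lborel (\<lambda>j. zext R (\<lambda>z. \<phi> j z + of_real (snd z - m) * d2 (\<phi> j) z)) (zext R (\<lambda>z. v z + of_real (snd z - m) * V2 z))"
    unfolding zext_add by (intro L2_lim_add L2_lim_R[OF lu] L2_lim_R_mult[OF l2] continuous_intros)
  then have "L2_lim lborel (\<lambda>j x. LINT y|lborel. zext R (\<lambda>z. \<phi> j z + of_real (snd z - m) * d2 (\<phi> j) z) (x, y))
     (\<lambda>x. LINT y|lborel. zext R (\<lambda>z. v z + of_real (snd z - m) * V2 z) (x, y))"
    by (rule L2_lim_slice_fst[where a=m and b=b]) (use m(1) in \<open>auto simp: zext_def R_def indicator_def\<close>)
  from L2_lim_cmult[OF this, of "of_real (1 / (b - m))"]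
  have "L2_lim lborel (\<lambda>j. top_value (\<phi> j) (d2 (\<phi> j))) (top_value v V2)"
    unfolding top_value_def .
  then show ?thesis unfolding top_value_C1[OF \<phi>] .
qed

lemma AE_open_closed: "AE t in lborel. zext {0<..<\<Lambda>} w t = zext {0..\<Lambda>} w t"
proof -
  have "AE t in lborel. t \<noteq> 0 \<and> t \<noteq> \<Lambda>"
    using AE_lborel_singleton[of 0] AE_lborel_singleton[of \<Lambda>] by eventually_elim auto
  then show ?thesis by eventually_elim (auto simp: zext_def indicator_def)
qed

lemma has_trace_top:
  assumes v: "v \<in> H1 \<Omega>" and w: "has_trace \<Omega> (\<lambda>t. (t, b)) {0..\<Lambda>} v w"
  shows "AE t in lborel. zext {0..\<Lambda>} w t = top_value v (weak_deriv \<Omega> (0, 1) v) t"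
proof -
  have c: "continuous_on UNIV (\<lambda>t. (t, b))" by (intro continuous_intros)
  obtain \<phi> where \<phi>: "H1_lim \<Omega> \<phi> v (weak_deriv \<Omega> (1, 0) v) (weak_deriv \<Omega> (0, 1) v)"
    "L2_lim lborel (\<lambda>j. zext {0..\<Lambda>} (\<lambda>t. \<phi> j (t, b))) (zext {0..\<Lambda>} w)"
    using w unfolding has_trace_iff_H1_lim[OF \<Omega>_open \<Omega>_bounded v c bounded_closed_interval borel_closed[OF closed_atLeastAtMost]] by blast
  have "L2_lim lborel (\<lambda>j. zext {0<..<\<Lambda>} (\<lambda>t. \<phi> j (t, b))) (zext {0<..<\<Lambda>} w)"
    using L2_lim_zext[OF \<phi>(2), of "{0<..<\<Lambda>}"] by (simp add: zext_zext Int_absorb2 greaterThanLessThan_subseteq_atLeastAtMost_iff)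
  from L2_lim_unique[OF this top_value_lim[OF \<phi>(1)]] AE_open_closed[of w]
  show ?thesis by eventually_elim simp
qed

text \<open>
  Every approximating sequence yields the trace on the straight upper side, so that the chosen
  representative is one.
\<close>

lemma has_trace_top_exists:
  assumes v: "v \<in> H1 \<Omega>" and l: "H1_lim \<Omega> \<phi> v (weak_deriv \<Omega> (1, 0) v) (weak_deriv \<Omega> (0, 1) v)"
  shows "has_trace \<Omega> (\<lambda>t. (t, b)) {0..\<Lambda>} v (trace_Gamma \<Lambda> f b v)"
proof -
  have c: "continuous_on UNIV (\<lambda>t. (t, b))" by (intro continuous_intros)
  note ti = has_trace_iff_H1_lim[OF \<Omega>_open \<Omega>_bounded v c bounded_closed_interval borel_closed[OF closed_atLeastAtMost]]
  let ?w = "top_value v (weak_deriv \<Omega> (0, 1) v)"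
  note lim = top_value_lim[OF l]
  have \<phi>: "C1 (\<phi> j)" for j using l unfolding H1_lim_def by blast
  have "L2_lim lborel (\<lambda>j. zext {0..\<Lambda>} (\<lambda>x. \<phi> j (x, b))) ?w"
  proof (rule L2_lim_cong_seq[OF lim AE_open_closed])
    show "zext {0..\<Lambda>} (\<lambda>x. \<phi> j (x, b)) \<in> borel_measurable lborel" for j
      by (intro sq_int_measurable sq_int_zext_continuous continuous_slice C1_continuous(1) \<phi>) auto
  qed
  from L2_lim_zext[OF this, of "{0..\<Lambda>}"]
  have "L2_lim lborel (\<lambda>j. zext {0..\<Lambda>} (\<lambda>x. \<phi> j (x, b))) (zext {0..\<Lambda>} ?w)" by (simp add: zext_zext)
  then have "has_trace \<Omega> (\<lambda>t. (t, b)) {0..\<Lambda>} v ?w" unfolding ti using l by blast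
  then show ?thesis unfolding trace_Gamma_def trace_on_def by (rule someI[of "has_trace \<Omega> (\<lambda>t. (t, b)) {0..\<Lambda>} v"])
qed

lemma trace_Gamma_AE:
  assumes v: "v \<in> H1 \<Omega>" and w: "has_trace \<Omega> (\<lambda>t. (t, b)) {0..\<Lambda>} v w"
  shows "AE t in lborel. zext {0..\<Lambda>} (trace_Gamma \<Lambda> f b v) t = zext {0..\<Lambda>} w t"
proof -
  have "has_trace \<Omega> (\<lambda>t. (t, b)) {0..\<Lambda>} v (trace_Gamma \<Lambda> f b v)"
    unfolding trace_Gamma_def trace_on_def using w by (rule someI[of "has_trace \<Omega> (\<lambda>t. (t, b)) {0..\<Lambda>} v"])
  from has_trace_top[OF v this] has_trace_top[OF v w] show ?thesis by eventually_elim simp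
qed

lemma trace_integral_cong:
  assumes v: "v \<in> H1 \<Omega>" and w: "has_trace \<Omega> (\<lambda>t. (t, b)) {0..\<Lambda>} v w" and g: "g \<in> borel_measurable borel"
  shows "(LINT t:{0..\<Lambda>}|lborel. trace_Gamma \<Lambda> f b v t * g t) = (LINT t:{0..\<Lambda>}|lborel. w t * g t)"
    "(LINT t:{0..\<Lambda>}|lborel. g t * cnj (trace_Gamma \<Lambda> f b v t)) = (LINT t:{0..\<Lambda>}|lborel. g t * cnj (w t))"
proof -
  have T: "has_trace \<Omega> (\<lambda>t. (t, b)) {0..\<Lambda>} v (trace_Gamma \<Lambda> f b v)"
    unfolding trace_Gamma_def trace_on_def using w by (rule someI[of "has_trace \<Omega> (\<lambda>t. (t, b)) {0..\<Lambda>} v"])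
  have [measurable]: "zext {0..\<Lambda>} w \<in> borel_measurable borel" "zext {0..\<Lambda>} (trace_Gamma \<Lambda> f b v) \<in> borel_measurable borel"
    using w T sq_int_measurable[of lborel] by (auto simp: has_trace_def L2_zext)
  note [measurable] = g
  have 2: "(LINT t:{0..\<Lambda>}|lborel. g t * cnj (h t)) = (LINT t|lborel. g t * cnj (zext {0..\<Lambda>} h t))" for h
    unfolding set_lebesgue_integral_def by (intro Bochner_Integration.integral_cong refl) (auto simp: zext_def indicator_def)
  show "(LINT t:{0..\<Lambda>}|lborel. trace_Gamma \<Lambda> f b v t * g t) = (LINT t:{0..\<Lambda>}|lborel. w t * g t)"
    unfolding set_integral_zext
  proof (rule integral_cong_AE)
    show "AE x in lborel. zext {0..\<Lambda>} (trace_Gamma \<Lambda> f b v) x * g x = zext {0..\<Lambda>} w x * g x"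
      using trace_Gamma_AE[OF v w] by eventually_elim simp
  qed measurable
  show "(LINT t:{0..\<Lambda>}|lborel. g t * cnj (trace_Gamma \<Lambda> f b v t)) = (LINT t:{0..\<Lambda>}|lborel. g t * cnj (w t))"
    unfolding 2
  proof (rule integral_cong_AE)
    show "AE x in lborel. g x * cnj (zext {0..\<Lambda>} (trace_Gamma \<Lambda> f b v) x) = g x * cnj (zext {0..\<Lambda>} w x)"
      using trace_Gamma_AE[OF v w] by eventually_elim simp
  qed measurable
qed

end

section \<open>The scattering problem: energy identity and Rellich inequality\<close>

locale scattering = graph_domain_top +
  fixes k \<theta> :: real and u :: "real \<times> real \<Rightarrow> complex"
  assumes k: "k > 0" and \<theta>: "- pi / 2 < \<theta>" "\<theta> < pi / 2"
    and sol: "scattering_solution k \<theta> \<Lambda> f b u"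
begin

definition \<alpha> :: real where "\<alpha> = k * sin \<theta>"
definition \<beta> :: real where "\<beta> = k * cos \<theta>"

lemma \<beta>_pos: "\<beta> > 0"
  using k \<theta> cos_gt_zero_pi[of \<theta>] by (simp add: \<beta>_def)

lemma u_V: "u \<in> H1_S_qp \<Lambda> f b \<alpha>"
  using sol by (simp add: scattering_solution_def \<alpha>_def Let_def)

lemma u_H1: "u \<in> H1 \<Omega>" using u_V by (simp add: H1_S_qp_def)

definition U :: "real \<times> real \<Rightarrow> complex" where "U = zext \<Omega> u"
definition U1 :: "real \<times> real \<Rightarrow> complex" where "U1 = zext \<Omega> (weak_deriv \<Omega> (1, 0) u)"
definition U2 :: "real \<times> real \<Rightarrow> complex" where "U2 = zext \<Omega> (weak_deriv \<Omega> (0, 1) u)"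

lemma U_sq: "sq_int lborel U" "sq_int lborel U1" "sq_int lborel U2"
  using H1_D[OF u_H1] by (simp_all add: U_def U1_def U2_def L2_zext)

lemma U_out: "x \<notin> \<Omega> \<Longrightarrow> U x = 0" "x \<notin> \<Omega> \<Longrightarrow> U1 x = 0" "x \<notin> \<Omega> \<Longrightarrow> U2 x = 0"
  by (simp_all add: U_def U1_def U2_def)

text \<open>
  The weak formulation in terms of extensions by zero, with an arbitrary representative \<open>w\<close> of the trace of the test function.
\<close>

lemma variational:
  assumes v: "v \<in> H1_S_qp \<Lambda> f b \<alpha>" and tr: "has_trace \<Omega> (\<lambda>t. (t, b)) {0..\<Lambda>} v w"
  shows "(LINT x|lborel. U1 x * cnj (zext \<Omega> (weak_deriv \<Omega> (1, 0) v) x) + U2 x * cnj (zext \<Omega> (weak_deriv \<Omega> (0, 1) v) x))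
      - of_real (k\<^sup>2) * (LINT x|lborel. U x * cnj (zext \<Omega> v x))
      - pairing_Gamma \<Lambda> \<alpha> (T_op k \<Lambda> \<alpha> (trace_Gamma \<Lambda> f b u)) w
    = (LINT t:{0..\<Lambda>}|lborel. g_data \<alpha> \<beta> b t * cnj (w t))"
proof -
  have vH: "v \<in> H1 \<Omega>" using v by (simp add: H1_S_qp_def)
  have fc: "fourier_coeff \<Lambda> \<alpha> (trace_Gamma \<Lambda> f b v) n = fourier_coeff \<Lambda> \<alpha> w n" for n
    unfolding fourier_coeff_def
    by (subst trace_integral_cong(1)[OF vH tr]) (auto intro!: borel_measurable_continuous_onI continuous_intros)
  have pr: "pairing_Gamma \<Lambda> \<alpha> g (trace_Gamma \<Lambda> f b v) = pairing_Gamma \<Lambda> \<alpha> g w" for g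
    unfolding pairing_Gamma_def fc ..
  have gd: "(LINT t:{0..\<Lambda>}|lborel. g_data \<alpha> \<beta> b t * cnj (trace_Gamma \<Lambda> f b v t)) = (LINT t:{0..\<Lambda>}|lborel. g_data \<alpha> \<beta> b t * cnj (w t))"
    by (rule trace_integral_cong(2)[OF vH tr]) (auto simp: g_data_def intro!: borel_measurable_continuous_onI continuous_intros)
  have e1: "(LINT x:\<Omega>|lborel. a x * cnj (c x) + a' x * cnj (c' x)) = (LINT x|lborel. zext \<Omega> a x * cnj (zext \<Omega> c x) + zext \<Omega> a' x * cnj (zext \<Omega> c' x))" for a c a' c'
    unfolding set_lebesgue_integral_def by (intro Bochner_Integration.integral_cong refl) (auto simp: zext_def indicator_def)
  have e2: "(LINT x:\<Omega>|lborel. a x * cnj (c x)) = (LINT x|lborel. zext \<Omega> a x * cnj (zext \<Omega> c x))" for a c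
    unfolding set_lebesgue_integral_def by (intro Bochner_Integration.integral_cong refl) (auto simp: zext_def indicator_def)
  show ?thesis
    using sol v unfolding scattering_solution_def Let_def \<alpha>_def[symmetric] \<beta>_def[symmetric]
    unfolding e1 e2 U_def[symmetric] U1_def[symmetric] U2_def[symmetric]
    by (auto simp: pr gd)
qed

lemma C1_real_cont:
  assumes "\<And>t. (p has_real_derivative p' t) (at t)"
  shows "continuous_on UNIV (\<lambda>x::real\<times>real. complex_of_real (p (snd x)))"
proof -
  have "isCont p t" for t by (rule DERIV_isCont[OF assms])
  then have "continuous_on UNIV p" by (intro continuous_at_imp_continuous_on) auto
  then show ?thesis by (intro continuous_intros continuous_on_compose2[OF \<open>continuous_on UNIV p\<close>]) auto
qed

lemma weighted_sq:
  assumes Z: "Z \<in> {U, U1, U2}" and q: "continuous_on UNIV (\<lambda>x::real\<times>real. complex_of_real (q (snd x)))"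
  shows "sq_int lborel (\<lambda>x. complex_of_real (q (snd x)) * Z x)"
proof -
  have S: "sq_int lborel Z" using Z U_sq by auto
  have "zext \<Omega> (\<lambda>x. complex_of_real (q (snd x)) * Z x) = (\<lambda>x. complex_of_real (q (snd x)) * Z x)"
    using Z U_out by (auto simp: zext_def indicator_def)
  then show ?thesis
    using L2_limD(2)[OF L2_lim_continuous_mult[OF L2_lim_const[OF S] q \<Omega>_bounded \<Omega>_sets]] by simp
qed

text \<open>
  The variational equation for the test function \<open>p(x\<^sub>2) U(x\<^sub>1, x\<^sub>2 - h)\<close>, whose trace on \<open>\<Gamma>\<close> is zero.
\<close>

lemma shift_identity:
  assumes p: "\<And>t. (p has_real_derivative p' t) (at t)" "continuous_on UNIV p'" "p b = 0" and h: "h \<ge> 0"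
  shows "(LINT x|lborel. (of_real (p (snd x)) * U1 x) * cnj (U1 (x - (0, h))))
     + (LINT x|lborel. (of_real (p (snd x)) * U2 x) * cnj (U2 (x - (0, h))))
     + (LINT x|lborel. (of_real (p' (snd x)) * U2 x) * cnj (U (x - (0, h))))
     - of_real (k\<^sup>2) * (LINT x|lborel. (of_real (p (snd x)) * U x) * cnj (U (x - (0, h)))) = 0"
proof -
  let ?v = "\<lambda>x. complex_of_real (p (snd x)) * zext \<Omega> u (x - (0, h))"
  note t = shifted_test_function[OF u_V p h]
  have vH: "?v \<in> H1 \<Omega>" using t(1) by (simp add: H1_S_qp_def)
  note dv = H1_D[OF vH]
  have pc: "continuous_on UNIV (\<lambda>x::real\<times>real. complex_of_real (p (snd x)))" by (rule C1_real_cont[OF p(1)])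
  have pc': "continuous_on UNIV (\<lambda>x::real\<times>real. complex_of_real (p' (snd x)))"
    by (intro continuous_intros continuous_on_compose2[OF p(2)]) auto
  have S: "sq_int lborel (\<lambda>x. cnj (Z (x - (0, h))))" if "Z \<in> {U, U1, U2}" for Z
    using that U_sq by (intro sq_int_cnj sq_int_translate) auto
  note I = sq_int_mult_integrable[OF weighted_sq S]
  have z: "pairing_Gamma \<Lambda> \<alpha> g (\<lambda>_. 0) = 0" for g
    by (simp add: pairing_Gamma_def fourier_coeff_def set_lebesgue_integral_def)
  have main: "(LINT x|lborel. U1 x * cnj (zext \<Omega> (weak_deriv \<Omega> (1, 0) ?v) x) + U2 x * cnj (zext \<Omega> (weak_deriv \<Omega> (0, 1) ?v) x))
      - of_real (k\<^sup>2) * (LINT x|lborel. U x * cnj (zext \<Omega> ?v x)) = 0"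
    using variational[OF t(1,2)] by (simp add: z set_lebesgue_integral_def)
  have a: "(LINT x|lborel. U1 x * cnj (zext \<Omega> (weak_deriv \<Omega> (1, 0) ?v) x) + U2 x * cnj (zext \<Omega> (weak_deriv \<Omega> (0, 1) ?v) x))
    = (LINT x|lborel. (of_real (p (snd x)) * U1 x) * cnj (U1 (x - (0, h))) + ((of_real (p (snd x)) * U2 x) * cnj (U2 (x - (0, h)))
     + (of_real (p' (snd x)) * U2 x) * cnj (U (x - (0, h)))))"
  proof (rule integral_cong_AE)
    show "AE x in lborel. U1 x * cnj (zext \<Omega> (weak_deriv \<Omega> (1, 0) ?v) x) + U2 x * cnj (zext \<Omega> (weak_deriv \<Omega> (0, 1) ?v) x)
      = (of_real (p (snd x)) * U1 x) * cnj (U1 (x - (0, h))) + ((of_real (p (snd x)) * U2 x) * cnj (U2 (x - (0, h)))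
     + (of_real (p' (snd x)) * U2 x) * cnj (U (x - (0, h))))"
      using t(3,4)
    proof eventually_elim
      case (elim x)
      show ?case
      proof (cases "x \<in> \<Omega>")
        case True
        then show ?thesis using elim by (simp add: U_def U1_def U2_def algebra_simps)
      qed (simp add: U_out)
    qed
    have m: "U1 \<in> borel_measurable lborel" "U2 \<in> borel_measurable lborel"
      "zext \<Omega> (weak_deriv \<Omega> (1, 0) ?v) \<in> borel_measurable lborel" "zext \<Omega> (weak_deriv \<Omega> (0, 1) ?v) \<in> borel_measurable lborel"
      using U_sq dv by (auto simp: L2_zext sq_int_def)
    show "(\<lambda>x. U1 x * cnj (zext \<Omega> (weak_deriv \<Omega> (1, 0) ?v) x) + U2 x * cnj (zext \<Omega> (weak_deriv \<Omega> (0, 1) ?v) x)) \<in> borel_measurable lborel"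
      by (intro borel_measurable_add borel_measurable_times borel_measurable_cnj m)
    show "(\<lambda>x. (of_real (p (snd x)) * U1 x) * cnj (U1 (x - (0, h))) + ((of_real (p (snd x)) * U2 x) * cnj (U2 (x - (0, h)))
     + (of_real (p' (snd x)) * U2 x) * cnj (U (x - (0, h))))) \<in> borel_measurable lborel"
      by (intro borel_measurable_integrable Bochner_Integration.integrable_add I pc pc') auto
  qed
  have c: "(LINT x|lborel. U x * cnj (zext \<Omega> ?v x)) = (LINT x|lborel. (of_real (p (snd x)) * U x) * cnj (U (x - (0, h))))"
  proof (intro Bochner_Integration.integral_cong refl)
    fix x show "U x * cnj (zext \<Omega> ?v x) = (of_real (p (snd x)) * U x) * cnj (U (x - (0, h)))"
      by (cases "x \<in> \<Omega>") (simp_all add: U_out, simp_all add: U_def)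
  qed
  have split: "(LINT x|lborel. (of_real (p (snd x)) * U1 x) * cnj (U1 (x - (0, h))) + ((of_real (p (snd x)) * U2 x) * cnj (U2 (x - (0, h)))
     + (of_real (p' (snd x)) * U2 x) * cnj (U (x - (0, h)))))
    = (LINT x|lborel. (of_real (p (snd x)) * U1 x) * cnj (U1 (x - (0, h))))
     + ((LINT x|lborel. (of_real (p (snd x)) * U2 x) * cnj (U2 (x - (0, h))))
     + (LINT x|lborel. (of_real (p' (snd x)) * U2 x) * cnj (U (x - (0, h)))))"
  proof -
    have "integrable lborel (\<lambda>x. (of_real (p (snd x)) * U1 x) * cnj (U1 (x - (0, h))))"
      "integrable lborel (\<lambda>x. (of_real (p (snd x)) * U2 x) * cnj (U2 (x - (0, h))))"
      "integrable lborel (\<lambda>x. (of_real (p' (snd x)) * U2 x) * cnj (U (x - (0, h))))"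
      by (intro I pc pc'; simp)+
    then show ?thesis by simp
  qed
  show ?thesis using main unfolding a c split by (simp add: algebra_simps)
qed

definition energy :: "real \<times> real \<Rightarrow> real" where
  "energy x = (cmod (U1 x))\<^sup>2 + (cmod (U2 x))\<^sup>2 - k\<^sup>2 * (cmod (U x))\<^sup>2"

lemma weighted_integrable:
  assumes Z: "Z \<in> {U, U1, U2}" and q: "continuous_on UNIV (\<lambda>x::real\<times>real. complex_of_real (q (snd x)))"
  shows "integrable lborel (\<lambda>x. q (snd x) * (cmod (Z x))\<^sup>2)"
    "(LINT x|lborel. (of_real (q (snd x)) * Z x) * cnj (Z x)) = of_real (LINT x|lborel. q (snd x) * (cmod (Z x))\<^sup>2)"
proof -
  have S: "sq_int lborel Z" using Z U_sq by auto
  have e: "(of_real (q (snd x)) * Z x) * cnj (Z x) = complex_of_real (q (snd x) * (cmod (Z x))\<^sup>2)" for x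
    by (simp only: mult.assoc complex_norm_square of_real_mult)
  have i: "integrable lborel (\<lambda>x. complex_of_real (q (snd x) * (cmod (Z x))\<^sup>2))"
    using sq_int_mult_integrable[OF weighted_sq[OF Z q] sq_int_cnj[OF S]] unfolding e .
  show "integrable lborel (\<lambda>x. q (snd x) * (cmod (Z x))\<^sup>2)"
    using integrable_Re[OF i] by simp
  show "(LINT x|lborel. (of_real (q (snd x)) * Z x) * cnj (Z x)) = of_real (LINT x|lborel. q (snd x) * (cmod (Z x))\<^sup>2)"
    unfolding e by (rule integral_complex_of_real)
qed

lemma energy_integrable:
  assumes q: "continuous_on UNIV (\<lambda>x::real\<times>real. complex_of_real (q (snd x)))"
  shows "integrable lborel (\<lambda>x. q (snd x) * energy x)"
    "(LINT x|lborel. q (snd x) * energy x) = (LINT x|lborel. q (snd x) * (cmod (U1 x))\<^sup>2)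
      + (LINT x|lborel. q (snd x) * (cmod (U2 x))\<^sup>2) - k\<^sup>2 * (LINT x|lborel. q (snd x) * (cmod (U x))\<^sup>2)"
proof -
  have i: "integrable lborel (\<lambda>x. q (snd x) * (cmod (U x))\<^sup>2)" "integrable lborel (\<lambda>x. q (snd x) * (cmod (U1 x))\<^sup>2)"
    "integrable lborel (\<lambda>x. q (snd x) * (cmod (U2 x))\<^sup>2)"
    by (intro weighted_integrable(1) q; simp)+
  have e: "q (snd x) * energy x = q (snd x) * (cmod (U1 x))\<^sup>2 + q (snd x) * (cmod (U2 x))\<^sup>2 - k\<^sup>2 * (q (snd x) * (cmod (U x))\<^sup>2)" for x
    by (simp add: energy_def algebra_simps)
  show "integrable lborel (\<lambda>x. q (snd x) * energy x)" unfolding e using i by simp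
  show "(LINT x|lborel. q (snd x) * energy x) = (LINT x|lborel. q (snd x) * (cmod (U1 x))\<^sup>2)
      + (LINT x|lborel. q (snd x) * (cmod (U2 x))\<^sup>2) - k\<^sup>2 * (LINT x|lborel. q (snd x) * (cmod (U x))\<^sup>2)"
    unfolding e using i by simp
qed

lemma energy_identity:
  assumes p: "\<And>t. (p has_real_derivative p' t) (at t)" "continuous_on UNIV p'" "p b = 0"
  shows "of_real (LINT x|lborel. p (snd x) * energy x) + (LINT x|lborel. (of_real (p' (snd x)) * U2 x) * cnj (U x)) = 0"
proof -
  have pc: "continuous_on UNIV (\<lambda>x::real\<times>real. complex_of_real (p (snd x)))" by (rule C1_real_cont[OF p(1)])
  show ?thesis
    using shift_identity[OF p, of 0] weighted_integrable(2)[OF _ pc, of U] weighted_integrable(2)[OF _ pc, of U1]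
      weighted_integrable(2)[OF _ pc, of U2]
    unfolding energy_integrable(2)[OF pc] by (simp add: zero_prod_def[symmetric] algebra_simps)
qed

lemma approximants: "\<exists>\<psi>. H1_lim \<Omega> \<psi> u (weak_deriv \<Omega> (1, 0) u) (weak_deriv \<Omega> (0, 1) u) \<and> (\<forall>j. vanishes_near_S (\<psi> j))"
proof -
  have "has_trace \<Omega> (\<lambda>t. (t, f t)) {0..\<Lambda>} u (\<lambda>_. 0)"
    using u_V by (auto simp: H1_S_qp_def)
  then obtain \<phi> where S: "H1_lim \<Omega> \<phi> u (weak_deriv \<Omega> (1, 0) u) (weak_deriv \<Omega> (0, 1) u)"
    "L2_lim lborel (\<lambda>j. zext {0..\<Lambda>} (\<lambda>t. \<phi> j (t, f t))) (\<lambda>_. 0)"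
    by (subst (asm) has_trace_iff_H1_lim[OF \<Omega>_open \<Omega>_bounded u_H1]) (auto intro!: continuous_intros f_cont)
  obtain \<eta> where \<eta>: "\<forall>j. vanishes_near_S (\<eta> j)"
      "H1_lim \<Omega> (\<lambda>j x. \<eta> j x * \<phi> j x) u (weak_deriv \<Omega> (1, 0) u) (weak_deriv \<Omega> (0, 1) u)"
    using cutoff_lim[OF S(1) layer_Poincare[OF S]] by blast
  have "vanishes_near_S (\<lambda>x. \<eta> j x * \<phi> j x)" for j
    using \<eta>(1) unfolding vanishes_near_S_def by (metis mult_zero_left)
  with \<eta>(2) show ?thesis by blast
qed

lemma Poincare:
  assumes c: "\<And>x. x \<in> {0..\<Lambda>} \<Longrightarrow> c < f x"
  shows "sq_norm lborel U \<le> 2 * (b - c)\<^sup>2 * sq_norm lborel U2"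
proof -
  have "has_trace \<Omega> (\<lambda>t. (t, f t)) {0..\<Lambda>} u (\<lambda>_. 0)"
    using u_V by (auto simp: H1_S_qp_def)
  then obtain \<phi> where S: "H1_lim \<Omega> \<phi> u (weak_deriv \<Omega> (1, 0) u) (weak_deriv \<Omega> (0, 1) u)"
    "L2_lim lborel (\<lambda>j. zext {0..\<Lambda>} (\<lambda>t. \<phi> j (t, f t))) (\<lambda>_. 0)"
    by (subst (asm) has_trace_iff_H1_lim[OF \<Omega>_open \<Omega>_bounded u_H1]) (auto intro!: continuous_intros f_cont)
  have "snd x < f (fst x) + (b - c)" if "x \<in> \<Omega>" for x
    using that c[of "fst x"] by (auto simp: \<Omega>_iff)
  then have "layer (b - c) = \<Omega>" by (auto simp: layer_def)
  moreover have "b - c > 0" using c[of 0] below[of 0] \<Lambda> by auto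
  ultimately show ?thesis using layer_Poincare[OF S, of "b - c"] by (simp add: U_def U2_def)
qed

text \<open>
  Formally \<open>2 Re (\<partial>\<^sub>2 u cnj(\<Delta> u + k\<^sup>2 u)) = 0\<close> is integrated against \<open>p\<close>. As \<open>\<partial>\<^sub>2 u\<close> is not an admissible test function,
  difference quotients replace it: twice the real part of the shift identity is polarised, and the identity for
  \<open>h = 0\<close> is subtracted. The squares \<open>|U1 - \<tau>\<^sub>h U1|\<^sup>2\<close> and \<open>|U2 - \<tau>\<^sub>h U2|\<^sup>2\<close> enter with the sign that allows to drop them,
  while \<open>k\<^sup>2 |U - \<tau>\<^sub>h U|\<^sup>2\<close> has integral of order \<open>h\<^sup>2\<close>. Division by \<open>h \<rightarrow> 0\<close> turns the translated weights into \<open>p'\<close>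
  and the mixed term into \<open>\<integral> p' |U2|\<^sup>2\<close>.
\<close>

lemma Rellich_inequality:
  assumes p: "\<And>t. (p has_real_derivative p' t) (at t)" "continuous_on UNIV p'" "p b = 0"
    and c: "\<And>x. x \<in> {0..\<Lambda>} \<Longrightarrow> c < f x" and pos: "\<And>y. c \<le> y \<Longrightarrow> y \<le> b \<Longrightarrow> p y \<ge> 0"
  shows "2 * (LINT x|lborel. p' (snd x) * (cmod (U2 x))\<^sup>2) \<le> (LINT x|lborel. p' (snd x) * energy x)"
proof -
  obtain \<psi> where \<psi>: "H1_lim \<Omega> \<psi> u (weak_deriv \<Omega> (1, 0) u) (weak_deriv \<Omega> (0, 1) u)" "\<And>j. vanishes_near_S (\<psi> j)"
    using approximants by blast
  have pc: "continuous_on UNIV (\<lambda>x::real\<times>real. complex_of_real (p (snd x)))" by (rule C1_real_cont[OF p(1)])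
  have pc': "continuous_on UNIV (\<lambda>x::real\<times>real. complex_of_real (p' (snd x)))"
    by (intro continuous_intros continuous_on_compose2[OF p(2)]) auto
  have pcont: "continuous_on S p" for S
    by (intro continuous_at_imp_continuous_on) (auto intro: DERIV_isCont[OF p(1)])
  have cb: "c < b" using c[of 0] below[of 0] \<Lambda> by auto
  have in\<Omega>: "c < snd x \<and> snd x < b" if "x \<in> \<Omega>" for x
    using that c[of "fst x"] by (auto simp: \<Omega>_iff)
  \<comment> \<open>Outside of \<open>{c<..<b}\<close> the sign of \<open>p\<close> is unknown. As \<open>p b = 0\<close>, the truncated weight is still Lipschitz above \<open>c\<close>.\<close>
  define P where "P x = indicator {c<..<b} (snd x) * p (snd x)" for x :: "real \<times> real"
  have Pm: "P \<in> borel_measurable borel"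
  proof -
    have "(\<lambda>y. indicator {c<..<b} y * p y) \<in> borel_measurable borel"
      by (intro borel_measurable_times borel_measurable_indicator borel_measurable_continuous_onI pcont) auto
    moreover have "(snd :: real \<times> real \<Rightarrow> real) \<in> borel_measurable borel"
      by (intro borel_measurable_continuous_onI continuous_intros)
    ultimately show ?thesis unfolding P_def by (rule measurable_compose[rotated])
  qed
  have bdd: "bounded (p ` {c..b})" "bounded (p' ` {c..b})"
    by (intro compact_imp_bounded compact_continuous_image pcont continuous_on_subset[OF p(2)]; simp)+
  obtain B where B: "\<And>y. y \<in> {c..b} \<Longrightarrow> \<bar>p y\<bar> \<le> B"
    using bdd(1) unfolding bounded_iff real_norm_def by blast
  obtain B' where B': "\<And>y. y \<in> {c..b} \<Longrightarrow> \<bar>p' y\<bar> \<le> B'"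
    using bdd(2) unfolding bounded_iff real_norm_def by blast
  have B0: "B \<ge> 0" "B' \<ge> 0" using B[of b] B'[of b] cb by auto
  have P0: "0 \<le> P x" "P x \<le> B" "\<bar>P x\<bar> \<le> B" for x
    using pos[of "snd x"] B[of "snd x"] B0 by (auto simp: P_def indicator_def)
  have PI: "integrable lborel (\<lambda>x. P (x + v) * (cmod (Z x))\<^sup>2)" if "sq_int lborel Z" for Z v
  proof (rule Bochner_Integration.integrable_bound[where f="\<lambda>x. B * (cmod (Z x))\<^sup>2"])
    have "(\<lambda>x. P (x + v)) \<in> borel_measurable borel"
      by (rule measurable_compose[OF _ Pm]) (auto intro!: borel_measurable_continuous_onI continuous_intros)
    then show "(\<lambda>x. P (x + v) * (cmod (Z x))\<^sup>2) \<in> borel_measurable lborel" using that by (auto simp: sq_int_def)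
    show "AE x in lborel. norm (P (x + v) * (cmod (Z x))\<^sup>2) \<le> norm (B * (cmod (Z x))\<^sup>2)"
    proof (rule AE_I2)
      fix x show "norm (P (x + v) * (cmod (Z x))\<^sup>2) \<le> norm (B * (cmod (Z x))\<^sup>2)"
        using P0(3)[of "x + v"] B0 by (simp add: abs_mult mult_right_mono)
    qed
  qed (use that in \<open>auto simp: sq_int_def\<close>)
  note PI0 = PI[where v=0, simplified]
  have S: "sq_int lborel Z" "\<And>x. x \<notin> \<Omega> \<Longrightarrow> Z x = 0" if "Z \<in> {U, U1, U2}" for Z
    using that U_sq U_out by auto
  let ?A = "\<lambda>Z h. Re (LINT x|lborel. (of_real (p (snd x)) * Z x) * cnj (Z (x - (0, h))))"
  let ?N = "\<lambda>Z. LINT x|lborel. P x * (cmod (Z x))\<^sup>2"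
  let ?T = "\<lambda>Z h. LINT x|lborel. P (x + (0, h)) * (cmod (Z x))\<^sup>2"
  let ?Q = "\<lambda>Z h. LINT x|lborel. P x * (cmod (Z x - Z (x - (0, h))))\<^sup>2"
  \<comment> \<open>The identity \<open>2 Re (z cnj w) = |z|\<^sup>2 + |w|\<^sup>2 - |z - w|\<^sup>2\<close>, followed by a translation in the second term.\<close>
  have polar: "2 * ?A Z h = ?N Z + ?T Z h - ?Q Z h" if Z: "Z \<in> {U, U1, U2}" for Z h
  proof -
    note SZ = S[OF Z]
    have Sh: "sq_int lborel (\<lambda>x. Z (x - (0, h)))" by (rule sq_int_translate(1)[OF SZ(1)])
    have i: "integrable lborel (\<lambda>x. (of_real (p (snd x)) * Z x) * cnj (Z (x - (0, h))))"
      by (rule sq_int_mult_integrable[OF weighted_sq[OF Z pc] sq_int_cnj[OF Sh]])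
    have e: "2 * Re ((of_real (p (snd x)) * Z x) * cnj (Z (x - (0, h)))) = P x * (cmod (Z x))\<^sup>2 + P x * (cmod (Z (x - (0, h))))\<^sup>2
       - P x * (cmod (Z x - Z (x - (0, h))))\<^sup>2" for x
    proof (cases "x \<in> \<Omega>")
      case True
      then have "P x = p (snd x)" using in\<Omega> by (simp add: P_def)
      then show ?thesis by (simp add: cmod_power2) (simp add: power2_eq_square algebra_simps)
    qed (use SZ(2) in simp)
    have "2 * ?A Z h = (LINT x|lborel. 2 * Re ((of_real (p (snd x)) * Z x) * cnj (Z (x - (0, h)))))"
      using integral_Re[OF i] integrable_Re[OF i] by (simp del: times_complex.sel)
    also have "\<dots> = ?N Z + (LINT x|lborel. P x * (cmod (Z (x - (0, h))))\<^sup>2) - ?Q Z h"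
      unfolding e using PI0[OF SZ(1)] PI0[OF Sh] PI0[OF sq_int_diff(1)[OF SZ(1) Sh]] by simp
    also have "(LINT x|lborel. P x * (cmod (Z (x - (0, h))))\<^sup>2) = ?T Z h"
      using integral_translate(1)[OF borel_measurable_integrable[OF PI[OF SZ(1), of "(0, h)"], simplified], of "(0, h)"] by simp
    finally show ?thesis .
  qed
  have Q0: "?Q Z h \<ge> 0" for Z h using P0 by (intro Bochner_Integration.integral_nonneg) auto
  have QU: "?Q U h \<le> B * (h\<^sup>2 * sq_norm lborel U2)" if h: "h \<ge> 0" for h
  proof -
    note d = difference_bound[OF \<psi> h]
    have "?Q U h \<le> (LINT x|lborel. B * (cmod (zext \<Omega> (\<lambda>x. zext \<Omega> u x - zext \<Omega> u (x - (0, h))) x))\<^sup>2)"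
    proof (rule integral_mono)
      show "integrable lborel (\<lambda>x. P x * (cmod (U x - U (x - (0, h))))\<^sup>2)"
        by (intro PI0 sq_int_diff(1) sq_int_translate(1) U_sq)
      show "integrable lborel (\<lambda>x. B * (cmod (zext \<Omega> (\<lambda>x. zext \<Omega> u x - zext \<Omega> u (x - (0, h))) x))\<^sup>2)"
        using d(1) by (simp add: sq_int_def)
      show "P x * (cmod (U x - U (x - (0, h))))\<^sup>2 \<le> B * (cmod (zext \<Omega> (\<lambda>x. zext \<Omega> u x - zext \<Omega> u (x - (0, h))) x))\<^sup>2" for x
      proof (cases "x \<in> \<Omega>")
        case True
        then show ?thesis using P0(2)[of x] by (simp add: U_def mult_right_mono)
      next
        case False
        have "P x = 0 \<or> U (x - (0, h)) = 0"
        proof (rule ccontr)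
          assume "\<not> ?thesis"
          then have "P x \<noteq> 0" "x - (0, h) \<in> \<Omega>" using U_out(1)[of "x - (0, h)"] by blast+
          then show False using False h by (auto simp: P_def \<Omega>_iff indicator_def split: if_splits)
        qed
        then show ?thesis using False U_out(1)[OF False] by auto
      qed
    qed
    also have "\<dots> = B * sq_norm lborel (zext \<Omega> (\<lambda>x. zext \<Omega> u x - zext \<Omega> u (x - (0, h))))"
      by (simp add: sq_norm_def)
    also have "\<dots> \<le> B * (h\<^sup>2 * sq_norm lborel U2)"
      using d(2) B0 unfolding U2_def by (intro mult_left_mono)
    finally show ?thesis .
  qed
  let ?X = "\<lambda>h. Re (LINT x|lborel. (of_real (p' (snd x)) * U2 x) * cnj (U (x - (0, h))))"
  have main: "2 * (?X 0 - ?X h) \<le> (?T U1 h - ?N U1) + (?T U2 h - ?N U2) - k\<^sup>2 * (?T U h - ?N U) + k\<^sup>2 * (B * (h\<^sup>2 * sq_norm lborel U2))"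
    if h: "h \<ge> 0" for h
  proof -
    have id: "?A U1 h + ?A U2 h + ?X h - k\<^sup>2 * ?A U h = 0" if "h \<ge> 0" for h
      using arg_cong[OF shift_identity[OF p that], of Re] by simp
    have A0: "?A Z 0 = ?N Z" if "Z \<in> {U, U1, U2}" for Z
      using polar[OF that, of 0] by (simp add: zero_prod_def[symmetric])
    have "?A U1 0 + ?A U2 0 + ?X 0 - k\<^sup>2 * ?A U 0 = 0" by (rule id) simp
    then have 0: "?N U1 + ?N U2 + ?X 0 - k\<^sup>2 * ?N U = 0" by (simp only: A0[of U1] A0[of U2] A0[of U] insert_iff simp_thms)
    have alg: "(n1 + t1 - q1) + (n2 + t2 - q2) + 2 * x - K * (n0 + t0 - q0) = 0"
      if "a1 + a2 + x - K * a0 = 0" "2 * a1 = n1 + t1 - q1" "2 * a2 = n2 + t2 - q2" "2 * a0 = n0 + t0 - q0"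
      for a1 a2 a0 x n1 n2 n0 t1 t2 t0 q1 q2 q0 K :: real
    proof -
      have "2 * (a1 + a2 + x - K * a0) = 2 * a1 + 2 * a2 + 2 * x - K * (2 * a0)" by (simp add: algebra_simps)
      then show ?thesis using that by simp
    qed
    have "(?N U1 + ?T U1 h - ?Q U1 h) + (?N U2 + ?T U2 h - ?Q U2 h) + 2 * ?X h - k\<^sup>2 * (?N U + ?T U h - ?Q U h) = 0"
      by (rule alg[OF id[OF h] polar polar polar]) auto
    moreover have "k\<^sup>2 * ?Q U h \<le> k\<^sup>2 * (B * (h\<^sup>2 * sq_norm lborel U2))" using QU[OF h] by (intro mult_left_mono) auto
    ultimately show ?thesis using 0 Q0[of U1 h] Q0[of U2 h] by (simp add: algebra_simps)
  qed
  define s where "s n = 1 / real (Suc n)" for n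
  have s: "s \<longlonglongrightarrow> 0" "\<And>n. 0 < s n" "\<And>n. s n \<le> 1"
    unfolding s_def using LIMSEQ_inverse_real_of_nat by (auto simp: inverse_eq_divide)
  have T: "(\<lambda>n. (?T Z (s n) - ?N Z) / s n) \<longlonglongrightarrow> (LINT x|lborel. p' (snd x) * (cmod (Z x))\<^sup>2)" if Z: "Z \<in> {U, U1, U2}" for Z
  proof -
    note SZ = S[OF Z]
    have e: "(?T Z (s n) - ?N Z) / s n = (LINT x|lborel. (P (x + (0, s n)) * (cmod (Z x))\<^sup>2 - P x * (cmod (Z x))\<^sup>2) / s n)" for n
      using PI[OF SZ(1), of "(0, s n)"] PI0[OF SZ(1)] by simp
    show ?thesis unfolding e
    proof (rule integral_dominated_convergence[where w="\<lambda>x. B' * (cmod (Z x))\<^sup>2"])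
      show "(\<lambda>x. p' (snd x) * (cmod (Z x))\<^sup>2) \<in> borel_measurable lborel"
        using weighted_integrable(1)[OF Z pc'] by auto
      show "(\<lambda>x. (P (x + (0, s n)) * (cmod (Z x))\<^sup>2 - P x * (cmod (Z x))\<^sup>2) / s n) \<in> borel_measurable lborel" for n
        using PI[OF SZ(1), of "(0, s n)"] PI0[OF SZ(1)] by (intro borel_measurable_integrable) auto
      show "integrable lborel (\<lambda>x. B' * (cmod (Z x))\<^sup>2)" using SZ(1) by (simp add: sq_int_def)
      show "AE x in lborel. (\<lambda>n. (P (x + (0, s n)) * (cmod (Z x))\<^sup>2 - P x * (cmod (Z x))\<^sup>2) / s n) \<longlonglongrightarrow> p' (snd x) * (cmod (Z x))\<^sup>2"
      proof (rule AE_I2)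
        fix x :: "real \<times> real"
        show "(\<lambda>n. (P (x + (0, s n)) * (cmod (Z x))\<^sup>2 - P x * (cmod (Z x))\<^sup>2) / s n) \<longlonglongrightarrow> p' (snd x) * (cmod (Z x))\<^sup>2"
        proof (cases "x \<in> \<Omega>")
          case True
          have "((\<lambda>h. (p (snd x + h) - p (snd x)) / h) \<longlongrightarrow> p' (snd x)) (at 0)" using p(1) by (simp add: DERIV_def)
          moreover have "filterlim s (at 0) sequentially"
            unfolding filterlim_at using s(1,2) by (auto intro!: always_eventually simp: less_imp_neq[THEN not_sym])
          ultimately have "(\<lambda>n. (p (snd x + s n) - p (snd x)) / s n) \<longlonglongrightarrow> p' (snd x)"
            by (rule filterlim_compose)
          from tendsto_mult_right[OF this, of "(cmod (Z x))\<^sup>2"]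
          have "(\<lambda>n. (p (snd x + s n) - p (snd x)) / s n * (cmod (Z x))\<^sup>2) \<longlonglongrightarrow> p' (snd x) * (cmod (Z x))\<^sup>2" .
          moreover have "\<forall>\<^sub>F n in sequentially. (p (snd x + s n) - p (snd x)) / s n * (cmod (Z x))\<^sup>2
             = (P (x + (0, s n)) * (cmod (Z x))\<^sup>2 - P x * (cmod (Z x))\<^sup>2) / s n"
          proof -
            have "b - snd x > 0" using in\<Omega>[OF True] by simp
            from order_tendstoD(2)[OF s(1) this] show ?thesis
            proof eventually_elim
              case (elim n)
              then have "P (x + (0, s n)) = p (snd x + s n)" "P x = p (snd x)" using in\<Omega>[OF True] s(2)[of n] by (simp_all add: P_def)
              then show ?case by (simp add: field_simps)
            qed
          qed
          ultimately show ?thesis by (rule Lim_transform_eventually)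
        qed (use SZ(2) in simp)
      qed
      show "AE x in lborel. norm ((P (x + (0, s n)) * (cmod (Z x))\<^sup>2 - P x * (cmod (Z x))\<^sup>2) / s n) \<le> B' * (cmod (Z x))\<^sup>2" for n
      proof (rule AE_I2)
        fix x :: "real \<times> real"
        show "norm ((P (x + (0, s n)) * (cmod (Z x))\<^sup>2 - P x * (cmod (Z x))\<^sup>2) / s n) \<le> B' * (cmod (Z x))\<^sup>2"
        proof (cases "x \<in> \<Omega>")
          case True
          let ?y = "snd x"
          have y: "c < ?y" "?y < b" using in\<Omega>[OF True] by auto
          have mv: "\<bar>p y' - p ?y\<bar> \<le> B' * s n" if y': "?y < y'" "y' \<le> b" "y' \<le> ?y + s n" for y'
          proof -
            obtain z where z: "?y < z" "z < y'" "p y' - p ?y = (y' - ?y) * p' z"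
              using MVT2[OF y'(1), of p p'] p(1) by auto
            have "\<bar>(y' - ?y) * p' z\<bar> \<le> s n * B'"
              unfolding abs_mult using y' y z B'[of z] s(2)[of n] by (intro mult_mono) auto
            then show ?thesis using z by (simp add: mult.commute)
          qed
          have "\<bar>P (x + (0, s n)) - P x\<bar> \<le> B' * s n"
          proof (cases "?y + s n < b")
            case True
            then have "P (x + (0, s n)) = p (?y + s n)" "P x = p ?y" using y s(2)[of n] by (auto simp: P_def)
            then show ?thesis using mv[of "?y + s n"] True s(2)[of n] by simp
          next
            case False
            then have "P (x + (0, s n)) = p b" "P x = p ?y" using y p(3) by (auto simp: P_def)
            then show ?thesis using mv[of b] False y by simp
          qed
          then have "\<bar>P (x + (0, s n)) - P x\<bar> * (cmod (Z x))\<^sup>2 \<le> B' * s n * (cmod (Z x))\<^sup>2"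
            by (intro mult_right_mono) auto
          moreover have "norm ((P (x + (0, s n)) * (cmod (Z x))\<^sup>2 - P x * (cmod (Z x))\<^sup>2) / s n) = \<bar>P (x + (0, s n)) - P x\<bar> * (cmod (Z x))\<^sup>2 / s n"
            using s(2)[of n] by (simp add: abs_mult left_diff_distrib[symmetric])
          ultimately show ?thesis using s(2)[of n] by (simp add: field_simps)
        qed (use SZ(2) in simp)
      qed
    qed
  qed
  have X: "(\<lambda>n. (?X 0 - ?X (s n)) / s n) \<longlonglongrightarrow> (LINT x|lborel. p' (snd x) * (cmod (U2 x))\<^sup>2)"
  proof -
    let ?D = "\<lambda>n. zext \<Omega> (\<lambda>x. (zext \<Omega> u x - zext \<Omega> u (x - (0, s n))) / s n)"
    have W: "sq_int lborel (\<lambda>x. cnj (of_real (p' (snd x)) * U2 x))" by (intro sq_int_cnj weighted_sq pc') simp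
    have lim: "L2_lim lborel ?D U2" unfolding U2_def by (rule difference_quotient[OF \<psi> s])
    have "(\<lambda>n. LINT x|lborel. ?D n x * cnj (of_real (p' (snd x)) * U2 x)) \<longlonglongrightarrow> (LINT x|lborel. U2 x * cnj (of_real (p' (snd x)) * U2 x))"
      by (rule L2_lim_inner[OF lim W])
    from tendsto_Re[OF this]
    have "(\<lambda>n. Re (LINT x|lborel. ?D n x * cnj (of_real (p' (snd x)) * U2 x))) \<longlonglongrightarrow> Re (LINT x|lborel. U2 x * cnj (of_real (p' (snd x)) * U2 x))" .
    moreover have "(LINT x|lborel. U2 x * cnj (of_real (p' (snd x)) * U2 x)) = of_real (LINT x|lborel. p' (snd x) * (cmod (U2 x))\<^sup>2)"
      using weighted_integrable(2)[OF _ pc', of U2] by (simp add: mult.commute mult.left_commute)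
    moreover have "Re (LINT x|lborel. ?D n x * cnj (of_real (p' (snd x)) * U2 x)) = (?X 0 - ?X (s n)) / s n" for n
    proof -
      have Sh: "sq_int lborel (\<lambda>x. cnj (U (x - (0, h))))" for h by (intro sq_int_cnj sq_int_translate(1) U_sq)
      have i: "integrable lborel (\<lambda>x. (of_real (p' (snd x)) * U2 x) * cnj (U (x - (0, h))))" for h
        by (intro sq_int_mult_integrable Sh weighted_sq pc') simp
      have i0: "integrable lborel (\<lambda>x. (of_real (p' (snd x)) * U2 x) * cnj (U x))"
        using i[of 0] by (simp add: zero_prod_def[symmetric])
      have e: "cnj (?D n x * cnj (of_real (p' (snd x)) * U2 x)) =
        ((of_real (p' (snd x)) * U2 x) * cnj (U x) - (of_real (p' (snd x)) * U2 x) * cnj (U (x - (0, s n)))) / of_real (s n)" for x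
        by (cases "x \<in> \<Omega>") (simp_all add: U_out, simp_all add: U_def field_simps)
      have "Re (LINT x|lborel. ?D n x * cnj (of_real (p' (snd x)) * U2 x)) = Re (cnj (LINT x|lborel. ?D n x * cnj (of_real (p' (snd x)) * U2 x)))"
        by simp
      also have "cnj (LINT x|lborel. ?D n x * cnj (of_real (p' (snd x)) * U2 x)) = (LINT x|lborel. cnj (?D n x * cnj (of_real (p' (snd x)) * U2 x)))"
        by (rule integral_bounded_linear[OF bounded_linear_cnj sq_int_mult_integrable[OF L2_limD(1)[OF lim] W], symmetric])
      also have "\<dots> = ((LINT x|lborel. (of_real (p' (snd x)) * U2 x) * cnj (U x)) - (LINT x|lborel. (of_real (p' (snd x)) * U2 x) * cnj (U (x - (0, s n))))) / of_real (s n)"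
        unfolding e using i0 i[of "s n"] by simp
      finally show ?thesis by (simp add: zero_prod_def[symmetric])
    qed
    ultimately show ?thesis by simp
  qed
  have "2 * (LINT x|lborel. p' (snd x) * (cmod (U2 x))\<^sup>2) \<le>
     (LINT x|lborel. p' (snd x) * (cmod (U1 x))\<^sup>2) + (LINT x|lborel. p' (snd x) * (cmod (U2 x))\<^sup>2)
      - k\<^sup>2 * (LINT x|lborel. p' (snd x) * (cmod (U x))\<^sup>2) + k\<^sup>2 * (B * (0 * sq_norm lborel U2))"
  proof (rule LIMSEQ_le)
    show "(\<lambda>n. 2 * ((?X 0 - ?X (s n)) / s n)) \<longlonglongrightarrow> 2 * (LINT x|lborel. p' (snd x) * (cmod (U2 x))\<^sup>2)"
      by (intro tendsto_intros X)
    show "(\<lambda>n. (?T U1 (s n) - ?N U1) / s n + (?T U2 (s n) - ?N U2) / s n - k\<^sup>2 * ((?T U (s n) - ?N U) / s n) + k\<^sup>2 * (B * (s n * sq_norm lborel U2)))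
      \<longlonglongrightarrow> (LINT x|lborel. p' (snd x) * (cmod (U1 x))\<^sup>2) + (LINT x|lborel. p' (snd x) * (cmod (U2 x))\<^sup>2)
      - k\<^sup>2 * (LINT x|lborel. p' (snd x) * (cmod (U x))\<^sup>2) + k\<^sup>2 * (B * (0 * sq_norm lborel U2))"
      by (intro tendsto_add tendsto_diff tendsto_mult tendsto_const T s(1)) auto
    have "2 * ((?X 0 - ?X (s n)) / s n) \<le> (?T U1 (s n) - ?N U1) / s n + (?T U2 (s n) - ?N U2) / s n - k\<^sup>2 * ((?T U (s n) - ?N U) / s n) + k\<^sup>2 * (B * (s n * sq_norm lborel U2))" for n
    proof -
      have sn: "s n > 0" using s(2) .
      have "2 * ((?X 0 - ?X (s n)) / s n) = (2 * (?X 0 - ?X (s n))) / s n" by simp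
      also have "\<dots> \<le> ((?T U1 (s n) - ?N U1) + (?T U2 (s n) - ?N U2) - k\<^sup>2 * (?T U (s n) - ?N U) + k\<^sup>2 * (B * ((s n)\<^sup>2 * sq_norm lborel U2))) / s n"
        using main[of "s n"] sn by (intro divide_right_mono) auto
      also have "\<dots> = (?T U1 (s n) - ?N U1) / s n + (?T U2 (s n) - ?N U2) / s n - k\<^sup>2 * ((?T U (s n) - ?N U) / s n) + k\<^sup>2 * (B * (s n * sq_norm lborel U2))"
        using sn by (simp add: add_divide_distrib diff_divide_distrib power2_eq_square right_diff_distrib)
      finally show ?thesis .
    qed
    then show "\<exists>N. \<forall>n\<ge>N. 2 * ((?X 0 - ?X (s n)) / s n) \<le> (?T U1 (s n) - ?N U1) / s n + (?T U2 (s n) - ?N U2) / s n - k\<^sup>2 * ((?T U (s n) - ?N U) / s n) + k\<^sup>2 * (B * (s n * sq_norm lborel U2))"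
      by blast
  qed
  then show ?thesis unfolding energy_integrable(2)[OF pc'] by simp
qed

end

section \<open>Quasi-periodic plane waves and Parseval's formula\<close>

definition wave :: "real \<Rightarrow> real \<Rightarrow> int \<Rightarrow> real \<Rightarrow> complex" where
  "wave \<Lambda> \<alpha> n t = exp (\<i> * of_real (alpha_n \<Lambda> \<alpha> n * t))"

lemma norm_wave [simp]: "cmod (wave \<Lambda> \<alpha> n t) = 1"
  by (simp add: wave_def)

lemma cnj_wave: "cnj (wave \<Lambda> \<alpha> n t) = exp (- \<i> * of_real (alpha_n \<Lambda> \<alpha> n * t))"
  by (simp add: wave_def exp_cnj)

lemma exp_line_deriv: "((\<lambda>t. exp (c * complex_of_real t)) has_vector_derivative c * exp (c * of_real t)) (at t within S)"
proof -
  have "((\<lambda>z. exp (c * z)) has_field_derivative c * exp (c * of_real t)) (at (of_real t))"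
    by (auto intro!: derivative_eq_intros)
  from has_vector_derivative_real_field[OF this] show ?thesis by (rule has_vector_derivative_at_within)
qed

lemma wave_deriv: "(wave \<Lambda> \<alpha> n has_vector_derivative \<i> * of_real (alpha_n \<Lambda> \<alpha> n) * wave \<Lambda> \<alpha> n t) (at t)"
  unfolding wave_def using exp_line_deriv[of "\<i> * of_real (alpha_n \<Lambda> \<alpha> n)" t UNIV] by (simp add: mult.assoc)

lemma wave_continuous [continuous_intros]: "continuous_on S g \<Longrightarrow> continuous_on S (\<lambda>t. wave \<Lambda> \<alpha> n (g t))"
  unfolding wave_def by (intro continuous_intros)

lemma wave_period:
  assumes "\<Lambda> \<noteq> 0" shows "wave \<Lambda> \<alpha> n \<Lambda> = exp (\<i> * of_real (\<alpha> * \<Lambda>))"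
proof -
  have "\<i> * of_real (alpha_n \<Lambda> \<alpha> n * \<Lambda>) = \<i> * of_real (\<alpha> * \<Lambda>) + \<i> * (of_int n * (of_real pi * 2))"
    using assms by (simp add: alpha_n_def field_simps)
  then show ?thesis unfolding wave_def by (simp only: exp_plus_2pin)
qed

definition waveI :: "real \<Rightarrow> real \<Rightarrow> int \<Rightarrow> real \<Rightarrow> complex" where
  "waveI \<Lambda> \<alpha> n = zext {0..\<Lambda>} (wave \<Lambda> \<alpha> n)"

lemma waveI_sq: "sq_int lborel (waveI \<Lambda> \<alpha> n)"
  unfolding waveI_def by (rule sq_int_zext_continuous) (auto intro!: continuous_intros)

lemma fourier_coeff_waveI:
  "fourier_coeff \<Lambda> \<alpha> F n = 1 / of_real \<Lambda> * (LINT t|lborel. F t * cnj (waveI \<Lambda> \<alpha> n t))"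
  unfolding fourier_coeff_def cnj_wave[symmetric] set_lebesgue_integral_def
  by (intro arg_cong2[where f="(*)"] refl Bochner_Integration.integral_cong) (auto simp: waveI_def zext_def indicator_def)

text \<open>
  The quotient of two different waves integrates to zero over a period. The waves are cut off to \<open>{0..\<Lambda>}\<close>, so that the
  coefficients become inner products on the line.
\<close>

lemma wave_orthogonal:
  assumes "\<Lambda> > 0"
  shows "(LINT t|lborel. waveI \<Lambda> \<alpha> n t * cnj (waveI \<Lambda> \<alpha> l t)) = (if n = l then of_real \<Lambda> else 0)"
proof -
  define \<omega> where "\<omega> = 2 * pi * of_int (n - l) / \<Lambda>"
  have e: "waveI \<Lambda> \<alpha> n t * cnj (waveI \<Lambda> \<alpha> l t) = indicator {0..\<Lambda>} t *\<^sub>R exp (\<i> * of_real (\<omega> * t))" for t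
  proof -
    have "wave \<Lambda> \<alpha> n t * cnj (wave \<Lambda> \<alpha> l t) = exp (\<i> * of_real (\<omega> * t))"
      unfolding cnj_wave unfolding wave_def mult_exp_exp
      by (rule arg_cong[where f=exp]) (simp add: \<omega>_def alpha_n_def algebra_simps diff_divide_distrib)
    then show ?thesis by (auto simp: waveI_def zext_def indicator_def)
  qed
  show ?thesis
  proof (cases "n = l")
    case True
    then show ?thesis unfolding e using assms by (simp add: \<omega>_def scaleR_conv_of_real)
  next
    case False
    then have \<omega>: "\<omega> \<noteq> 0" using assms by (simp add: \<omega>_def)
    have "(LINT t|lborel. indicator {0..\<Lambda>} t *\<^sub>R exp (\<i> * of_real (\<omega> * t)))
       = exp (\<i> * of_real (\<omega> * \<Lambda>)) / (\<i> * of_real \<omega>) - exp (\<i> * of_real (\<omega> * 0)) / (\<i> * of_real \<omega>)"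
    proof (rule integral_FTC_Icc)
      show "((\<lambda>t. exp (\<i> * of_real (\<omega> * t)) / (\<i> * of_real \<omega>)) has_vector_derivative exp (\<i> * of_real (\<omega> * t))) (at t within {0..\<Lambda>})" for t
        using has_vector_derivative_divide[OF exp_line_deriv[of "\<i> * of_real \<omega>" t "{0..\<Lambda>}"], of "\<i> * of_real \<omega>"] \<omega>
        by (simp add: mult.assoc)
    qed (use assms in \<open>auto intro!: continuous_intros\<close>)
    moreover have "exp (\<i> * of_real (\<omega> * \<Lambda>)) = 1"
    proof -
      have "\<i> * of_real (\<omega> * \<Lambda>) = 0 + \<i> * (of_int (n - l) * (of_real pi * 2))"
        using assms by (simp add: \<omega>_def field_simps)
      then show ?thesis by (simp only: exp_plus_2pin exp_zero)
    qed
    ultimately show ?thesis unfolding e using False by simp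
  qed
qed

lemma sq_norm_sub_cmult:
  assumes F: "sq_int M F" and e: "sq_int M e"
  shows "sq_norm M (\<lambda>x. F x - c * e x) = sq_norm M F - 2 * Re (cnj c * (LINT x|M. F x * cnj (e x))) + (cmod c)\<^sup>2 * sq_norm M e"
proof -
  have i: "integrable M (\<lambda>x. cnj c * (F x * cnj (e x)))"
    using sq_int_mult_integrable[OF F sq_int_cnj[OF e]] by simp
  have p: "(cmod (F x - c * e x))\<^sup>2 = (cmod (F x))\<^sup>2 - 2 * Re (cnj c * (F x * cnj (e x))) + (cmod c)\<^sup>2 * (cmod (e x))\<^sup>2" for x
    by (simp only: cmod_power2) (simp add: power2_eq_square algebra_simps)
  have "(LINT x|M. Re (cnj c * (F x * cnj (e x)))) = Re (cnj c * (LINT x|M. F x * cnj (e x)))"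
    using integral_Re[OF i] by (simp del: times_complex.sel)
  then show ?thesis
    unfolding sq_norm_def p using F e integrable_Re[OF i] by (simp add: sq_int_def del: times_complex.sel)
qed

text \<open>
  Pythagoras in \<open>L\<^sup>2\<close>, by induction on \<open>A\<close>: the truncated series is the best approximation. The third part, that the
  remainder keeps the coefficients outside \<open>A\<close>, is what the induction step needs.
\<close>

lemma trig_best_approximation:
  assumes \<Lambda>: "\<Lambda> > 0" and F: "sq_int lborel F" and A: "finite A"
  shows "sq_int lborel (\<lambda>t. F t - (\<Sum>n\<in>A. c n * waveI \<Lambda> \<alpha> n t))"
    "sq_norm lborel (\<lambda>t. F t - (\<Sum>n\<in>A. c n * waveI \<Lambda> \<alpha> n t)) =
     sq_norm lborel F - \<Lambda> * (\<Sum>n\<in>A. (cmod (fourier_coeff \<Lambda> \<alpha> F n))\<^sup>2) + \<Lambda> * (\<Sum>n\<in>A. (cmod (c n - fourier_coeff \<Lambda> \<alpha> F n))\<^sup>2)"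
    "\<forall>l. l \<notin> A \<longrightarrow> (LINT t|lborel. (F t - (\<Sum>n\<in>A. c n * waveI \<Lambda> \<alpha> n t)) * cnj (waveI \<Lambda> \<alpha> l t)) = of_real \<Lambda> * fourier_coeff \<Lambda> \<alpha> F l"
  using A
proof (induction A rule: finite_induct)
  case empty
  {
    case 1 then show ?case using F by simp
  next
    case 2 then show ?case by simp
  next
    case 3 then show ?case using \<Lambda> by (simp add: fourier_coeff_waveI)
  }
next
  case (insert n A)
  let ?G = "\<lambda>t. F t - (\<Sum>n\<in>A. c n * waveI \<Lambda> \<alpha> n t)"
  have e: "F t - (\<Sum>n\<in>insert n A. c n * waveI \<Lambda> \<alpha> n t) = ?G t - c n * waveI \<Lambda> \<alpha> n t" for t
    using insert(1,2) by simp
  have nn: "sq_norm lborel (waveI \<Lambda> \<alpha> n) = \<Lambda>"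
  proof -
    have "of_real (sq_norm lborel (waveI \<Lambda> \<alpha> n)) = (LINT t|lborel. waveI \<Lambda> \<alpha> n t * cnj (waveI \<Lambda> \<alpha> n t))"
      unfolding sq_norm_def by (simp add: complex_norm_square[symmetric] del: of_real_power)
    then show ?thesis using wave_orthogonal[OF \<Lambda>, of \<alpha> n n] by simp
  qed
  {
    case 1
    show ?case unfolding e by (intro sq_int_diff(1) insert.IH(1) sq_int_cmult waveI_sq)
  next
    case 2
    let ?f = "fourier_coeff \<Lambda> \<alpha> F n"
    have ip: "(LINT t|lborel. ?G t * cnj (waveI \<Lambda> \<alpha> n t)) = of_real \<Lambda> * ?f" using insert.IH(3) insert(2) by blast
    have "sq_norm lborel (\<lambda>t. ?G t - c n * waveI \<Lambda> \<alpha> n t) = sq_norm lborel ?G - 2 * Re (cnj (c n) * (of_real \<Lambda> * ?f)) + (cmod (c n))\<^sup>2 * \<Lambda>"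
      unfolding sq_norm_sub_cmult[OF insert.IH(1) waveI_sq] ip nn ..
    also have "\<dots> = sq_norm lborel ?G - \<Lambda> * (cmod ?f)\<^sup>2 + \<Lambda> * (cmod (c n - ?f))\<^sup>2"
      by (simp only: cmod_power2) (simp add: power2_eq_square algebra_simps)
    finally show ?case unfolding e insert.IH(2) using insert(1,2) by (simp add: algebra_simps)
  next
    case 3
    show ?case
    proof (intro allI impI)
      fix l assume l: "l \<notin> insert n A"
      have "(LINT t|lborel. (?G t - c n * waveI \<Lambda> \<alpha> n t) * cnj (waveI \<Lambda> \<alpha> l t)) =
        (LINT t|lborel. ?G t * cnj (waveI \<Lambda> \<alpha> l t) - c n * (waveI \<Lambda> \<alpha> n t * cnj (waveI \<Lambda> \<alpha> l t)))"
        by (simp add: algebra_simps)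
      also have "\<dots> = (LINT t|lborel. ?G t * cnj (waveI \<Lambda> \<alpha> l t)) - c n * (LINT t|lborel. waveI \<Lambda> \<alpha> n t * cnj (waveI \<Lambda> \<alpha> l t))"
        using sq_int_mult_integrable[OF insert.IH(1) sq_int_cnj[OF waveI_sq[of \<Lambda> \<alpha> l]]]
          sq_int_mult_integrable[OF waveI_sq[of \<Lambda> \<alpha> n] sq_int_cnj[OF waveI_sq[of \<Lambda> \<alpha> l]]] by simp
      also have "\<dots> = of_real \<Lambda> * fourier_coeff \<Lambda> \<alpha> F l"
        using insert.IH(3) l wave_orthogonal[OF \<Lambda>, of \<alpha> n l] by auto
      finally show "(LINT t|lborel. (F t - (\<Sum>n\<in>insert n A. c n * waveI \<Lambda> \<alpha> n t)) * cnj (waveI \<Lambda> \<alpha> l t)) = of_real \<Lambda> * fourier_coeff \<Lambda> \<alpha> F l"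
        unfolding e .
    qed
  }
qed

text \<open>
  Trigonometric polynomials with quasi-momentum \<open>\<alpha>\<close>. They are closed under products when the quasi-momenta are added.
\<close>

inductive trig :: "real \<Rightarrow> real \<Rightarrow> (real \<Rightarrow> complex) \<Rightarrow> bool" for \<Lambda> \<alpha> where
  trig_wave: "trig \<Lambda> \<alpha> (\<lambda>t. c * wave \<Lambda> \<alpha> n t)"
| trig_add: "trig \<Lambda> \<alpha> f \<Longrightarrow> trig \<Lambda> \<alpha> g \<Longrightarrow> trig \<Lambda> \<alpha> (\<lambda>t. f t + g t)"

lemma wave_mult: "wave \<Lambda> \<alpha> n t * wave \<Lambda> \<alpha>' l t = wave \<Lambda> (\<alpha> + \<alpha>') (n + l) t"
  unfolding wave_def mult_exp_exp
  by (rule arg_cong[where f=exp]) (simp add: alpha_n_def algebra_simps add_divide_distrib)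

lemma trig_mult:
  assumes "trig \<Lambda> \<alpha> f" "trig \<Lambda> \<alpha>' g" shows "trig \<Lambda> (\<alpha> + \<alpha>') (\<lambda>t. f t * g t)"
  using assms(1)
proof (induction rule: trig.induct)
  case (trig_wave c n)
  show ?case using assms(2)
  proof (induction rule: trig.induct)
    case (trig_wave c' n')
    have "(\<lambda>t. c * wave \<Lambda> \<alpha> n t * (c' * wave \<Lambda> \<alpha>' n' t)) = (\<lambda>t. (c * c') * wave \<Lambda> (\<alpha> + \<alpha>') (n + n') t)"
      by (intro ext) (subst wave_mult[symmetric, where \<alpha>=\<alpha> and n=n and \<alpha>'=\<alpha>' and l=n'], simp)
    then show ?case using trig.trig_wave by metis
  next
    case (trig_add f g)
    then show ?case using trig.trig_add[OF trig_add.IH] by (simp add: algebra_simps)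
  qed
next
  case (trig_add f1 f2)
  then show ?case using trig.trig_add[OF trig_add.IH] by (simp add: algebra_simps)
qed

lemma trig_sum: "trig \<Lambda> \<alpha> f \<Longrightarrow> \<exists>A c. finite A \<and> f = (\<lambda>t. \<Sum>n\<in>A. c n * wave \<Lambda> \<alpha> n t)"
proof (induction rule: trig.induct)
  case (trig_wave c n)
  show ?case by (intro exI[of _ "{n}"] exI[of _ "\<lambda>_. c"]) auto
next
  case (trig_add f g)
  then obtain A c B d where A: "finite A" "f = (\<lambda>t. \<Sum>n\<in>A. c n * wave \<Lambda> \<alpha> n t)"
    and B: "finite B" "g = (\<lambda>t. \<Sum>n\<in>B. d n * wave \<Lambda> \<alpha> n t)" by auto
  let ?c = "\<lambda>n. (if n \<in> A then c n else 0) + (if n \<in> B then d n else 0)"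
  have "f t + g t = (\<Sum>n\<in>A \<union> B. ?c n * wave \<Lambda> \<alpha> n t)" for t
  proof -
    have "(\<Sum>n\<in>A. c n * wave \<Lambda> \<alpha> n t) = (\<Sum>n\<in>A \<union> B. (if n \<in> A then c n else 0) * wave \<Lambda> \<alpha> n t)"
      using A B by (intro sum.mono_neutral_cong_left) auto
    moreover have "(\<Sum>n\<in>B. d n * wave \<Lambda> \<alpha> n t) = (\<Sum>n\<in>A \<union> B. (if n \<in> B then d n else 0) * wave \<Lambda> \<alpha> n t)"
      using A B by (intro sum.mono_neutral_cong_left) auto
    ultimately show ?thesis unfolding A(2) B(2) by (simp add: sum.distrib algebra_simps)
  qed
  then show ?case using A B by (intro exI[of _ "A \<union> B"] exI[of _ ?c]) auto
qed

lemma wave_0: "wave \<Lambda> 0 0 t = 1" by (simp add: wave_def alpha_n_def)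

lemma trig_const: "trig \<Lambda> 0 (\<lambda>t. c)"
  using trig.trig_wave[of \<Lambda> 0 c 0] by (simp add: wave_0)

lemma wave_cis: "wave \<Lambda> 0 n t = cis (2 * pi * of_int n * t / \<Lambda>)"
  by (simp add: wave_def alpha_n_def cis_conv_exp)

lemma trig_real_polynomial:
  assumes "real_polynomial_function (p :: complex \<Rightarrow> real)"
  shows "trig \<Lambda> 0 (\<lambda>t. of_real (p (cis (2 * pi * t / \<Lambda>))))"
  using assms
proof (induction rule: real_polynomial_function.induct)
  case (linear h)
  have w: "wave \<Lambda> 0 1 t = cis (2 * pi * t / \<Lambda>)" "wave \<Lambda> 0 (-1) t = cnj (cis (2 * pi * t / \<Lambda>))" for t
    by (simp_all add: wave_cis cis_cnj)
  have "of_real (h (cis x)) = ((of_real (h 1) - \<i> * of_real (h \<i>)) / 2) * cis x + ((of_real (h 1) + \<i> * of_real (h \<i>)) / 2) * cnj (cis x)" for x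
  proof -
    interpret bounded_linear h by fact
    have "h (cis x) = h (cos x *\<^sub>R 1 + sin x *\<^sub>R \<i>)" by (rule arg_cong[where f=h]) (simp add: complex_eq_iff)
    also have "\<dots> = cos x * h 1 + sin x * h \<i>" by (simp only: add scaleR real_scaleR_def)
    finally show ?thesis by (simp add: complex_eq_iff field_simps)
  qed
  then have "(\<lambda>t. complex_of_real (h (cis (2 * pi * t / \<Lambda>)))) = (\<lambda>t. ((of_real (h 1) - \<i> * of_real (h \<i>)) / 2) * wave \<Lambda> 0 1 t
      + ((of_real (h 1) + \<i> * of_real (h \<i>)) / 2) * wave \<Lambda> 0 (-1) t)"
    unfolding w by (intro ext)
  then show ?case by (simp only:) (intro trig.trig_add trig.trig_wave)
next
  case (const c)
  show ?case by (rule trig_const)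
next
  case (add f g)
  then show ?case using trig.trig_add[OF add.IH] by simp
next
  case (mult f g)
  then show ?case using trig_mult[OF mult.IH] by simp
qed

text \<open>
  Stone-Weierstrass on the unit circle, for the function \<open>G\<close> transplanted by the argument. It is continuous across the
  cut of the argument because \<open>G\<close> vanishes near both ends of the interval.
\<close>

lemma trig_uniform_approximation:
  assumes \<Lambda>: "\<Lambda> > 0" and G: "continuous_on UNIV (G :: real \<Rightarrow> complex)" and \<delta>: "\<delta> > 0" "\<delta> < \<Lambda> / 2"
    and z: "\<And>t. t \<le> \<delta> \<or> t \<ge> \<Lambda> - \<delta> \<Longrightarrow> G t = 0" and e: "e > 0"
  shows "\<exists>g. trig \<Lambda> 0 g \<and> (\<forall>t\<in>{0..\<Lambda>}. cmod (G t - g t) < e)"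
proof -
  define h where "h w = G (\<Lambda> * Arg2pi w / (2 * pi))" for w
  have hcis: "h (cis (2 * pi * t / \<Lambda>)) = G t" if t: "t \<in> {0..\<Lambda>}" for t
  proof (cases "t = \<Lambda>")
    case True
    then have "cis (2 * pi * t / \<Lambda>) = 1" using \<Lambda> by simp
    then have "h (cis (2 * pi * t / \<Lambda>)) = G 0" by (simp add: h_def Arg2pi_of_real[of 1, simplified])
    then show ?thesis using z[of 0] z[of t] True \<delta> by simp
  next
    case False
    then have "Arg2pi (cis (2 * pi * t / \<Lambda>)) = 2 * pi * t / \<Lambda>"
      using t \<Lambda> by (intro Arg2pi_unique[of 1]) (auto simp: cis_conv_exp field_simps)
    then show ?thesis using \<Lambda> by (simp add: h_def)
  qed
  have "continuous_on (sphere 0 1) h"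
  proof (rule continuous_at_imp_continuous_on, rule ballI)
    fix w :: complex assume w: "w \<in> sphere 0 1"
    show "isCont h w"
    proof (cases "w = 1")
      case False
      have "w \<notin> \<real>\<^sub>\<ge>\<^sub>0"
      proof
        assume "w \<in> \<real>\<^sub>\<ge>\<^sub>0"
        then obtain r where "w = of_real r" "r \<ge> 0" by (auto simp: nonneg_Reals_def)
        then show False using w False by auto
      qed
      then have "isCont Arg2pi w" by (rule continuous_at_Arg2pi)
      moreover have "isCont G s" for s using G by (simp add: continuous_on_eq_continuous_at)
      ultimately show ?thesis unfolding h_def
        by (intro isCont_o2[where g=G and f="\<lambda>w. \<Lambda> * Arg2pi w / (2 * pi)"] continuous_intros) auto
    next
      case True
      let ?\<eta> = "2 * pi * \<delta> / \<Lambda>"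
      have \<eta>: "0 < ?\<eta>" "?\<eta> < pi" using \<delta> \<Lambda> by (auto simp: field_simps)
      have hz: "h v = 0" if v: "v \<noteq> 0" "Re v > cmod v * cos ?\<eta>" for v
      proof -
        let ?t = "Arg2pi v"
        have t: "0 \<le> ?t" "?t < 2 * pi" using Arg2pi by auto
        have "cos ?t > cos ?\<eta>" using v cos_Arg2pi[of v] by (smt (verit) mult_less_cancel_left_pos zero_less_norm_iff)
        have "?t < ?\<eta> \<or> ?t > 2 * pi - ?\<eta>"
        proof (rule ccontr)
          assume n: "\<not> ?thesis"
          show False
          proof (cases "?t \<le> pi")
            case True
            then have "cos ?t \<le> cos ?\<eta>" using n \<eta> by (intro cos_monotone_0_pi_le) auto
            then show False using \<open>cos ?t > cos ?\<eta>\<close> by simp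
          next
            case False
            have "cos (2 * pi - ?t) \<le> cos ?\<eta>" using n \<eta> False t by (intro cos_monotone_0_pi_le) auto
            then show False using \<open>cos ?t > cos ?\<eta>\<close> by (simp add: cos_diff)
          qed
        qed
        then have "\<Lambda> * ?t / (2 * pi) \<le> \<delta> \<or> \<Lambda> * ?t / (2 * pi) \<ge> \<Lambda> - \<delta>"
          using \<Lambda> by (auto simp: field_simps)
        then show ?thesis unfolding h_def by (rule z)
      qed
      have c1: "cos ?\<eta> < 1" using cos_monotone_0_pi[of 0 ?\<eta>] \<eta> by simp
      let ?S = "{v. cmod v * cos ?\<eta> < Re v} \<inter> - {0}"
      have "open ?S" by (intro open_Int open_Collect_less continuous_intros)
      moreover have "w \<in> ?S" using True c1 by simp
      ultimately have "\<forall>\<^sub>F v in nhds w. h v = 0"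
        using hz by (intro eventually_mono[OF eventually_nhds_in_open[of ?S w]]) auto
      then show ?thesis
        using True hz[of w] c1 by (simp add: isCont_def tendsto_eventually eventually_nhds_conv_at)
    qed
  qed
  from Stone_Weierstrass_polynomial_function[OF compact_sphere this e]
  obtain q where q: "polynomial_function q" "\<And>w. w \<in> sphere 0 1 \<Longrightarrow> norm (h w - q w) < e" by blast
  have "real_polynomial_function (Re \<circ> q)" "real_polynomial_function (Im \<circ> q)"
    using q(1) bounded_linear_Re bounded_linear_Im unfolding polynomial_function_def by blast+
  from this[THEN trig_real_polynomial[where \<Lambda>=\<Lambda>]]
  have tr: "trig \<Lambda> 0 (\<lambda>t. of_real (Re (q (cis (2 * pi * t / \<Lambda>)))))" "trig \<Lambda> 0 (\<lambda>t. of_real (Im (q (cis (2 * pi * t / \<Lambda>)))))"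
    by simp_all
  have "trig \<Lambda> 0 (\<lambda>t. of_real (Re (q (cis (2 * pi * t / \<Lambda>)))) + \<i> * of_real (Im (q (cis (2 * pi * t / \<Lambda>)))))"
    using trig.trig_add[OF tr(1) trig_mult[OF trig_const[of \<Lambda> \<i>] tr(2), simplified]] .
  then have "trig \<Lambda> 0 (\<lambda>t. q (cis (2 * pi * t / \<Lambda>)))" by (simp flip: complex_eq)
  moreover have "cmod (G t - q (cis (2 * pi * t / \<Lambda>))) < e" if "t \<in> {0..\<Lambda>}" for t
    using q(2)[of "cis (2 * pi * t / \<Lambda>)"] hcis[OF that] by simp
  ultimately show ?thesis by blast
qed

text \<open>
  Completeness of the waves is established function by function: it suffices that it holds for continuous functions
  and passes to limits.
\<close>

definition trig_approximable :: "real \<Rightarrow> real \<Rightarrow> (real \<Rightarrow> complex) \<Rightarrow> bool" where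
  "trig_approximable \<Lambda> \<alpha> F \<longleftrightarrow> sq_int lborel F \<and>
    (\<forall>e>0. \<exists>A c. finite A \<and> sq_norm lborel (\<lambda>t. F t - (\<Sum>n\<in>A. c n * waveI \<Lambda> \<alpha> n t)) < e)"

lemma waveI_sum_sq: "finite A \<Longrightarrow> sq_int lborel (\<lambda>t. \<Sum>n\<in>A. c n * waveI \<Lambda> \<alpha> n t)"
  by (induction A rule: finite_induct) (auto intro!: sq_int_add sq_int_cmult waveI_sq)

lemma trig_approximable_lim:
  assumes F: "L2_lim lborel F f" and a: "\<And>j. trig_approximable \<Lambda> \<alpha> (F j)"
  shows "trig_approximable \<Lambda> \<alpha> f"
  unfolding trig_approximable_def
proof (intro conjI allI impI)
  show "sq_int lborel f" by (rule L2_limD(2)[OF F])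
  fix e :: real assume e: "e > 0"
  have "\<forall>\<^sub>F j in sequentially. sq_norm lborel (\<lambda>t. F j t - f t) < e / 4"
    using order_tendstoD(2)[OF L2_limD(3)[OF F], of "e / 4"] e by simp
  then obtain j where j: "sq_norm lborel (\<lambda>t. F j t - f t) < e / 4" by (auto simp: eventually_sequentially)
  obtain A c where A: "finite A" "sq_norm lborel (\<lambda>t. F j t - (\<Sum>n\<in>A. c n * waveI \<Lambda> \<alpha> n t)) < e / 4"
  proof -
    have "e / 4 > 0" using e by simp
    then show ?thesis using a[of j] that unfolding trig_approximable_def by blast
  qed
  have "sq_norm lborel (\<lambda>t. (f t - F j t) + (F j t - (\<Sum>n\<in>A. c n * waveI \<Lambda> \<alpha> n t)))
     \<le> 2 * sq_norm lborel (\<lambda>t. f t - F j t) + 2 * sq_norm lborel (\<lambda>t. F j t - (\<Sum>n\<in>A. c n * waveI \<Lambda> \<alpha> n t))"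
    by (intro sq_int_add sq_int_diff(1) waveI_sum_sq A L2_limD[OF F])
  also have "sq_norm lborel (\<lambda>t. f t - F j t) = sq_norm lborel (\<lambda>t. F j t - f t)"
    by (simp add: sq_norm_def norm_minus_commute)
  finally have "sq_norm lborel (\<lambda>t. f t - (\<Sum>n\<in>A. c n * waveI \<Lambda> \<alpha> n t)) < e" using j A(2) by simp
  then show "\<exists>A c. finite A \<and> sq_norm lborel (\<lambda>t. f t - (\<Sum>n\<in>A. c n * waveI \<Lambda> \<alpha> n t)) < e" using A(1) by blast
qed

lemma wave_twist: "wave \<Lambda> (-\<alpha>) 0 t * wave \<Lambda> \<alpha> 0 t = 1"
  by (simp add: wave_mult wave_0)

lemma bump_continuous: "continuous_on UNIV (bump a b n)"
proof -
  have "continuous_on UNIV sstep"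
    using sstep_deriv by (auto intro!: continuous_at_imp_continuous_on DERIV_isCont)
  then show ?thesis unfolding bump_def
    by (auto intro!: continuous_intros continuous_on_compose2[of UNIV sstep])
qed

text \<open>
  After multiplication by a bump, \<open>G\<close> vanishes near the ends. Multiplication by the wave with quasi-momentum
  \<open>- \<alpha>\<close> reduces the claim to periodic polynomials, and multiplying back does not change moduli.
\<close>

lemma trig_approximable_continuous:
  assumes \<Lambda>: "\<Lambda> > 0" and G: "continuous_on UNIV (G :: real \<Rightarrow> complex)"
  shows "trig_approximable \<Lambda> \<alpha> (zext {0<..<\<Lambda>} G)"
proof -
  let ?B = "\<lambda>j t. complex_of_real (bump 0 \<Lambda> j t) * G t"
  have Bc: "continuous_on UNIV (?B j)" for j by (intro continuous_intros bump_continuous G)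
  have SG: "sq_int lborel (zext {0<..<\<Lambda>} G)" by (intro sq_int_zext_continuous G) auto
  obtain N where N: "2 / \<Lambda> < real N" using reals_Archimedean2 by blast
  have lim: "L2_lim lborel (\<lambda>j. zext {0<..<\<Lambda>} (?B (j + N))) (zext {0<..<\<Lambda>} G)"
  proof (rule L2_lim_dominated[OF SG, where B=1 and g="zext {0<..<\<Lambda>} G"])
    show "zext {0<..<\<Lambda>} (?B (j + N)) \<in> borel_measurable lborel" for j
      by (intro sq_int_measurable sq_int_zext_continuous Bc) auto
    show "cmod (zext {0<..<\<Lambda>} (?B (j + N)) t) \<le> 1 * cmod (zext {0<..<\<Lambda>} G t)" for j t
      using bump_bounds[of 0 \<Lambda> "j + N" t] by (cases "t \<in> {0<..<\<Lambda>}") (auto simp: norm_mult mult_left_le_one_le)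
    show "(\<lambda>j. zext {0<..<\<Lambda>} (?B (j + N)) t) \<longlonglongrightarrow> zext {0<..<\<Lambda>} G t" for t
    proof (cases "t \<in> {0<..<\<Lambda>}")
      case True
      have "(\<lambda>j. complex_of_real (bump 0 \<Lambda> (j + N) t) * G t) \<longlonglongrightarrow> complex_of_real (indicator {0<..<\<Lambda>} t) * G t"
        by (intro tendsto_intros LIMSEQ_ignore_initial_segment[OF bump_tendsto])
      then show ?thesis using True by simp
    qed simp
  qed (rule SG)
  show ?thesis
  proof (rule trig_approximable_lim[OF lim])
    fix i
    define j where "j = i + N"
    have jN: "2 / \<Lambda> < real j" using N by (simp add: j_def)
    then have j0: "real j > 0" using \<Lambda> by (smt (verit) divide_pos_pos)
    define \<delta> where "\<delta> = 1 / (2 * real j)"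
    have \<delta>: "\<delta> > 0" "\<delta> < \<Lambda> / 2" "\<delta> < 1 / real j"
      using j0 jN \<Lambda> by (auto simp: \<delta>_def field_simps)
    let ?K = "\<lambda>t. ?B j t * wave \<Lambda> (-\<alpha>) 0 t"
    have Kc: "continuous_on UNIV ?K" by (intro continuous_intros Bc[of j])
    have Kz: "?K t = 0" if "t \<le> \<delta> \<or> t \<ge> \<Lambda> - \<delta>" for t
    proof -
      have "bump 0 \<Lambda> j t = 0" using that \<delta> j0 by (intro bump_outside) auto
      then show ?thesis by simp
    qed
    show "trig_approximable \<Lambda> \<alpha> (zext {0<..<\<Lambda>} (?B (i + N)))"
      unfolding trig_approximable_def j_def[symmetric]
    proof (intro conjI allI impI)
      show S: "sq_int lborel (zext {0<..<\<Lambda>} (?B j))" by (intro sq_int_zext_continuous Bc) auto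
      fix e :: real assume e: "e > 0"
      define e' where "e' = sqrt (e / (2 * \<Lambda>))"
      have e': "e' > 0" using e \<Lambda> by (simp add: e'_def)
      obtain g where g: "trig \<Lambda> 0 g" "\<And>t. t \<in> {0..\<Lambda>} \<Longrightarrow> cmod (?K t - g t) < e'"
        using trig_uniform_approximation[OF \<Lambda> Kc \<delta>(1,2) Kz e'] by blast
      have "trig \<Lambda> (0 + \<alpha>) (\<lambda>t. g t * (1 * wave \<Lambda> \<alpha> 0 t))" by (intro trig_mult g(1) trig.trig_wave)
      then have "trig \<Lambda> \<alpha> (\<lambda>t. g t * wave \<Lambda> \<alpha> 0 t)" by simp
      then obtain A c where A: "finite A" "(\<lambda>t. g t * wave \<Lambda> \<alpha> 0 t) = (\<lambda>t. \<Sum>n\<in>A. c n * wave \<Lambda> \<alpha> n t)"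
        using trig_sum by blast
      have sum: "(\<Sum>n\<in>A. c n * waveI \<Lambda> \<alpha> n t) = zext {0..\<Lambda>} (\<lambda>t. g t * wave \<Lambda> \<alpha> 0 t) t" for t
        unfolding A(2) by (cases "t \<in> {0..\<Lambda>}") (auto simp: waveI_def)
      have B0: "zext {0<..<\<Lambda>} (?B j) t = zext {0..\<Lambda>} (?B j) t" for t
      proof (cases "t = 0 \<or> t = \<Lambda>")
        case True
        then have "bump 0 \<Lambda> j t = 0" using j0 \<Lambda> \<delta> by (intro bump_outside) auto
        then show ?thesis by (simp add: zext_def)
      qed (auto simp: zext_def indicator_def)
      have pt: "(cmod (zext {0<..<\<Lambda>} (?B j) t - (\<Sum>n\<in>A. c n * waveI \<Lambda> \<alpha> n t)))\<^sup>2 \<le> indicator {0..\<Lambda>} t * e'\<^sup>2" for t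
      proof (cases "t \<in> {0..\<Lambda>}")
        case True
        have "?B j t - g t * wave \<Lambda> \<alpha> 0 t = (?K t - g t) * wave \<Lambda> \<alpha> 0 t"
          using wave_twist[of \<Lambda> \<alpha> t] by (simp add: algebra_simps)
        then have "cmod (?B j t - g t * wave \<Lambda> \<alpha> 0 t) = cmod (?K t - g t)" by (simp only: norm_mult norm_wave mult_1_right)
        then show ?thesis using True g(2)[OF True] unfolding sum B0 by (simp add: power_mono less_imp_le)
      qed (simp add: sum B0)
      have "sq_norm lborel (\<lambda>t. zext {0<..<\<Lambda>} (?B j) t - (\<Sum>n\<in>A. c n * waveI \<Lambda> \<alpha> n t)) \<le> (LINT t|lborel. indicator {0..\<Lambda>} t * e'\<^sup>2)"
        unfolding sq_norm_def
      proof (intro integral_mono pt)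
        show "integrable lborel (\<lambda>t. (cmod (zext {0<..<\<Lambda>} (?B j) t - (\<Sum>n\<in>A. c n * waveI \<Lambda> \<alpha> n t)))\<^sup>2)"
          using sq_int_diff(1)[OF S waveI_sum_sq[OF A(1)]] by (simp add: sq_int_def)
        show "integrable lborel (\<lambda>t. indicator {0..\<Lambda>} t * e'\<^sup>2)"
          using \<Lambda> by (intro integrable_mult_left integrable_real_indicator) auto
      qed
      also have "\<dots> = \<Lambda> * e'\<^sup>2" using \<Lambda> by simp
      also have "\<dots> < e" using e \<Lambda> by (simp add: e'_def field_simps)
      finally show "\<exists>A c. finite A \<and> sq_norm lborel (\<lambda>t. zext {0<..<\<Lambda>} (?B j) t - (\<Sum>n\<in>A. c n * waveI \<Lambda> \<alpha> n t)) < e"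
        using A(1) by blast
    qed
  qed
qed

lemma Parseval:
  assumes \<Lambda>: "\<Lambda> > 0" and F: "trig_approximable \<Lambda> \<alpha> F"
  shows "(\<lambda>N. \<Lambda> * (\<Sum>n\<in>{- int N..int N}. (cmod (fourier_coeff \<Lambda> \<alpha> F n))\<^sup>2)) \<longlonglongrightarrow> sq_norm lborel F"
proof (rule LIMSEQ_I)
  have S: "sq_int lborel F" using F by (simp add: trig_approximable_def)
  let ?s = "\<lambda>A. \<Lambda> * (\<Sum>n\<in>A. (cmod (fourier_coeff \<Lambda> \<alpha> F n))\<^sup>2)"
  fix e :: real assume "e > 0"
  then obtain A c where A: "finite A" "sq_norm lborel (\<lambda>t. F t - (\<Sum>n\<in>A. c n * waveI \<Lambda> \<alpha> n t)) < e"
    using F unfolding trig_approximable_def by blast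
  have 1: "sq_norm lborel F - ?s A < e"
  proof -
    have "0 \<le> \<Lambda> * (\<Sum>n\<in>A. (cmod (c n - fourier_coeff \<Lambda> \<alpha> F n))\<^sup>2)"
      using \<Lambda> by (intro mult_nonneg_nonneg sum_nonneg) auto
    then show ?thesis using A(2) trig_best_approximation(2)[OF \<Lambda> S A(1), of c \<alpha>] by linarith
  qed
  have 2: "?s B \<le> sq_norm lborel F" if "finite B" for B
    using trig_best_approximation(2)[OF \<Lambda> S that, of "fourier_coeff \<Lambda> \<alpha> F" \<alpha>]
      sq_norm_nonneg[of lborel "\<lambda>t. F t - (\<Sum>n\<in>B. fourier_coeff \<Lambda> \<alpha> F n * waveI \<Lambda> \<alpha> n t)"] by simp
  obtain N where N: "A \<subseteq> {- int N..int N}"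
  proof -
    let ?M = "Max (insert 0 (abs ` A))"
    have M: "\<bar>n\<bar> \<le> ?M" if "n \<in> A" for n using that A(1) by (intro Max_ge) auto
    have "A \<subseteq> {- int (nat ?M)..int (nat ?M)}"
    proof
      fix n assume "n \<in> A"
      then show "n \<in> {- int (nat ?M)..int (nat ?M)}" using M[of n] by auto
    qed
    then show ?thesis using that by blast
  qed
  have "norm (?s {- int n..int n} - sq_norm lborel F) < e" if n: "n \<ge> N" for n
  proof -
    have "?s A \<le> ?s {- int n..int n}"
      using \<Lambda> N n by (intro mult_left_mono sum_mono2) (auto intro: order_trans)
    then show ?thesis using 1 2[of "{- int n..int n}"] by simp
  qed
  then show "\<exists>N. \<forall>n\<ge>N. norm (?s {- int n..int n} - sq_norm lborel F) < e" by blast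
qed

lemma Parseval_inner:
  assumes \<Lambda>: "\<Lambda> > 0" and F: "trig_approximable \<Lambda> \<alpha> F" and G: "sq_int lborel G"
  shows "(\<lambda>N. of_real \<Lambda> * (\<Sum>n\<in>{- int N..int N}. fourier_coeff \<Lambda> \<alpha> F n * cnj (fourier_coeff \<Lambda> \<alpha> G n))) \<longlonglongrightarrow> (LINT t|lborel. F t * cnj (G t))"
proof -
  have S: "sq_int lborel F" using F by (simp add: trig_approximable_def)
  define PF where "PF N = (\<lambda>t. \<Sum>n\<in>{- int N..int N}. fourier_coeff \<Lambda> \<alpha> F n * waveI \<Lambda> \<alpha> n t)" for N
  have PS: "sq_int lborel (PF N)" for N unfolding PF_def by (rule waveI_sum_sq) simp
  have E: "sq_norm lborel (\<lambda>t. F t - PF N t) = sq_norm lborel F - \<Lambda> * (\<Sum>n\<in>{- int N..int N}. (cmod (fourier_coeff \<Lambda> \<alpha> F n))\<^sup>2)" for N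
    unfolding PF_def using trig_best_approximation(2)[OF \<Lambda> S, of "{- int N..int N}" "fourier_coeff \<Lambda> \<alpha> F" \<alpha>] by simp
  have "L2_lim lborel PF F"
    unfolding L2_lim_def
  proof (intro conjI allI PS S)
    have "(\<lambda>N. sq_norm lborel F - \<Lambda> * (\<Sum>n\<in>{- int N..int N}. (cmod (fourier_coeff \<Lambda> \<alpha> F n))\<^sup>2)) \<longlonglongrightarrow> sq_norm lborel F - sq_norm lborel F"
      by (intro tendsto_diff tendsto_const Parseval[OF \<Lambda> F])
    then have "(\<lambda>N. sq_norm lborel (\<lambda>t. F t - PF N t)) \<longlonglongrightarrow> 0" unfolding E by simp
    then show "(\<lambda>N. sq_norm lborel (\<lambda>t. PF N t - F t)) \<longlonglongrightarrow> 0" by (simp add: sq_norm_def norm_minus_commute)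
  qed
  from L2_lim_inner[OF this sq_int_cnj[OF G]]
  have "(\<lambda>N. LINT t|lborel. PF N t * cnj (G t)) \<longlonglongrightarrow> (LINT t|lborel. F t * cnj (G t))" .
  moreover have "(LINT t|lborel. PF N t * cnj (G t)) = of_real \<Lambda> * (\<Sum>n\<in>{- int N..int N}. fourier_coeff \<Lambda> \<alpha> F n * cnj (fourier_coeff \<Lambda> \<alpha> G n))" for N
  proof -
    have i: "integrable lborel (\<lambda>t. waveI \<Lambda> \<alpha> n t * cnj (G t))" for n
      by (rule sq_int_mult_integrable[OF waveI_sq sq_int_cnj[OF G]])
    have c: "(LINT t|lborel. waveI \<Lambda> \<alpha> n t * cnj (G t)) = of_real \<Lambda> * cnj (fourier_coeff \<Lambda> \<alpha> G n)" for n
      unfolding fourier_coeff_waveI using \<Lambda>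
      by (simp add: Bochner_Integration.integral_cnj[symmetric] mult.commute del: Bochner_Integration.integral_cnj)
    have "(LINT t|lborel. PF N t * cnj (G t)) = (LINT t|lborel. (\<Sum>n\<in>{- int N..int N}. fourier_coeff \<Lambda> \<alpha> F n * (waveI \<Lambda> \<alpha> n t * cnj (G t))))"
      unfolding PF_def by (simp add: sum_distrib_right mult.assoc)
    also have "\<dots> = (\<Sum>n\<in>{- int N..int N}. fourier_coeff \<Lambda> \<alpha> F n * (LINT t|lborel. waveI \<Lambda> \<alpha> n t * cnj (G t)))"
      using i by simp
    finally show ?thesis unfolding c by (simp add: sum_distrib_left algebra_simps)
  qed
  ultimately show ?thesis by simp
qed

context graph_domain_top
begin

text \<open>
  Convergence in \<open>L\<^sup>2\<close> of the rectangle implies, along a subsequence, convergence on almost every horizontal slice; the slices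
  of the approximating functions are continuous.
\<close>

lemma slice_approximable:
  assumes l: "L2_lim lborel (\<lambda>j. zext R (G j)) H" and G: "\<And>j. continuous_on UNIV (G j)"
  shows "AE y in lborel. y \<in> {m<..<b} \<longrightarrow> trig_approximable \<Lambda> \<alpha> (\<lambda>x. H (x, y))"
proof -
  let ?n = "\<lambda>j y. LINT x|lborel. (cmod (zext R (G j) (x, y) - H (x, y)))\<^sup>2"
  note d = sq_int_diff(1)[OF L2_limD(1,2)[OF l]]
  note fub = integral_plane_snd[OF sq_int_integrable[OF d]]
  have n0: "?n j y \<ge> 0" for j y by (intro Bochner_Integration.integral_nonneg) auto
  have "(\<lambda>j. LINT y|lborel. norm (?n j y)) \<longlonglongrightarrow> 0"
    using L2_limD(3)[OF l] n0 unfolding sq_norm_def fub(1) by simp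
  from tendsto_L1_AE_subseq[OF fub(2) this]
  obtain r where r: "strict_mono r" "AE y in lborel. (\<lambda>j. ?n (r j) y) \<longlonglongrightarrow> 0" by blast
  have Hm: "H \<in> borel_measurable (lborel \<Otimes>\<^sub>M lborel)" unfolding lborel_prod using sq_int_measurable[OF L2_limD(2)[OF l]] .
  have sec: "(\<lambda>x. H (x, y)) \<in> borel_measurable lborel" for y
    using measurable_Pair1[OF Hm, of y] by simp
  have "AE y in lborel. integrable lborel (\<lambda>x. (cmod (H (x, y)))\<^sup>2)"
    by (rule integral_plane_snd(3)[OF sq_int_integrable[OF L2_limD(2)[OF l]]])
  with r(2) show ?thesis
  proof eventually_elim
    case (elim y)
    show ?case
    proof
      assume y: "y \<in> {m<..<b}"
      have e: "zext R (G j) (x, y) = zext {0<..<\<Lambda>} (\<lambda>x. G j (x, y)) x" for j x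
        using y by (auto simp: zext_def R_def indicator_def)
      have "L2_lim lborel (\<lambda>j. zext {0<..<\<Lambda>} (\<lambda>x. G (r j) (x, y))) (\<lambda>x. H (x, y))"
        unfolding L2_lim_def
      proof (intro conjI allI)
        show "sq_int lborel (zext {0<..<\<Lambda>} (\<lambda>x. G (r j) (x, y)))" for j
          by (intro sq_int_zext_continuous continuous_slice(1) G) auto
        show "sq_int lborel (\<lambda>x. H (x, y))" using elim sec by (simp add: sq_int_def)
        show "(\<lambda>j. sq_norm lborel (\<lambda>x. zext {0<..<\<Lambda>} (\<lambda>x. G (r j) (x, y)) x - H (x, y))) \<longlonglongrightarrow> 0"
          using elim unfolding e sq_norm_def by simp
      qed
      then show "trig_approximable \<Lambda> \<alpha> (\<lambda>x. H (x, y))"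
        by (rule trig_approximable_lim) (intro trig_approximable_continuous \<Lambda> continuous_slice(1) G)
    qed
  qed
qed

end

section \<open>Inequalities for outgoing modes\<close>

lemma beta_n_props:
  shows "(beta_n k \<Lambda> \<alpha> n)\<^sup>2 = of_real (k\<^sup>2 - (alpha_n \<Lambda> \<alpha> n)\<^sup>2)"
    and "0 \<le> Re (beta_n k \<Lambda> \<alpha> n)" "0 \<le> Im (beta_n k \<Lambda> \<alpha> n)"
    and "(cmod (beta_n k \<Lambda> \<alpha> n))\<^sup>2 + (k\<^sup>2 - (alpha_n \<Lambda> \<alpha> n)\<^sup>2) = 2 * (Re (beta_n k \<Lambda> \<alpha> n))\<^sup>2"
    and "k \<ge> 0 \<Longrightarrow> Re (beta_n k \<Lambda> \<alpha> n) \<le> k"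
proof -
  let ?x = "k\<^sup>2 - (alpha_n \<Lambda> \<alpha> n)\<^sup>2"
  show sq: "(beta_n k \<Lambda> \<alpha> n)\<^sup>2 = of_real ?x" by (simp add: beta_n_def)
  have c: "beta_n k \<Lambda> \<alpha> n = (if ?x \<ge> 0 then of_real (sqrt ?x) else \<i> * of_real (sqrt (- ?x)))"
    unfolding beta_n_def by (auto simp del: of_real_diff of_real_power)
  show "0 \<le> Re (beta_n k \<Lambda> \<alpha> n)" "0 \<le> Im (beta_n k \<Lambda> \<alpha> n)" unfolding c by auto
  show "(cmod (beta_n k \<Lambda> \<alpha> n))\<^sup>2 + ?x = 2 * (Re (beta_n k \<Lambda> \<alpha> n))\<^sup>2"
    unfolding c by (auto simp: norm_mult)
  show "Re (beta_n k \<Lambda> \<alpha> n) \<le> k" if "k \<ge> 0"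
    unfolding c using that by (auto intro!: real_le_lsqrt)
qed

text \<open>
  Put \<open>X = \<Sum> Re \<beta>\<^sub>n |a\<^sub>n|\<^sup>2\<close>, to which only propagating modes contribute. A mode with \<open>c\<^sub>n = \<i> \<beta>\<^sub>n a\<^sub>n\<close> contributes
  \<open>Re \<beta>\<^sub>n |a\<^sub>n|\<^sup>2\<close> to the imaginary part and \<open>- Im \<beta>\<^sub>n |a\<^sub>n|\<^sup>2 \<le> 0\<close> to the real part of \<open>\<Sum> c\<^sub>n cnj a\<^sub>n\<close>, and
  \<open>(|\<beta>\<^sub>n|\<^sup>2 - \<alpha>\<^sub>n\<^sup>2 + k\<^sup>2) |a\<^sub>n|\<^sup>2 = 2 (Re \<beta>\<^sub>n)\<^sup>2 |a\<^sub>n|\<^sup>2 \<le> 2 k Re \<beta>\<^sub>n |a\<^sub>n|\<^sup>2\<close> to the last quantity. The perturbation \<open>\<zeta>\<close> of the mode \<open>n = 0\<close>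
  is absorbed by \<open>X \<ge> \<beta> |a\<^sub>0|\<^sup>2\<close> and an additive constant.
\<close>

lemma mode_inequalities:
  fixes a c d :: "int \<Rightarrow> complex"
  assumes k: "k > 0" and \<beta>: "beta_n k \<Lambda> \<alpha> 0 = of_real \<beta>" "\<beta> > 0"
    and c: "\<And>n. n \<noteq> 0 \<Longrightarrow> c n = \<i> * beta_n k \<Lambda> \<alpha> n * a n" and c0: "c 0 = \<i> * of_real \<beta> * a 0 + \<zeta>" and \<zeta>: "cmod \<zeta> = 2 * \<beta>"
    and d: "\<And>n. d n = \<i> * of_real (alpha_n \<Lambda> \<alpha> n) * a n" and A: "finite A" "0 \<in> A"
  shows "Im (\<Sum>n\<in>A. c n * cnj (a n)) \<ge> - 2 * \<beta>"
    and "Re (\<Sum>n\<in>A. c n * cnj (a n)) \<le> Im (\<Sum>n\<in>A. c n * cnj (a n)) + 4 * \<beta>"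
    and "(\<Sum>n\<in>A. (cmod (c n))\<^sup>2) - (\<Sum>n\<in>A. (cmod (d n))\<^sup>2) + k\<^sup>2 * (\<Sum>n\<in>A. (cmod (a n))\<^sup>2)
      \<le> 6 * k * (Im (\<Sum>n\<in>A. c n * cnj (a n)) + 2 * \<beta>) + 8 * k\<^sup>2"
proof -
  let ?b = "beta_n k \<Lambda> \<alpha>"
  note bp = beta_n_props[of k \<Lambda> \<alpha>]
  define X where "X = (\<Sum>n\<in>A. Re (?b n) * (cmod (a n))\<^sup>2)"
  define t where "t = cmod (a 0)"
  have t0: "t \<ge> 0" by (simp add: t_def)
  have \<beta>k: "\<beta> \<le> k" using bp(5)[of 0] \<beta> k by simp
  have Xge: "\<beta> * t\<^sup>2 \<le> X" and X0: "X \<ge> 0"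
  proof -
    have "Re (?b 0) * (cmod (a 0))\<^sup>2 \<le> X" unfolding X_def using A bp(2) by (intro member_le_sum) auto
    then show "\<beta> * t\<^sup>2 \<le> X" using \<beta> by (simp add: t_def)
    then show "X \<ge> 0" using \<beta>(2) by (smt (verit) mult_nonneg_nonneg zero_le_power2)
  qed
  have z: "\<bar>Im (\<zeta> * cnj (a 0))\<bar> \<le> X / 2 + 2 * \<beta>" "\<bar>Re (\<zeta> * cnj (a 0))\<bar> \<le> X / 2 + 2 * \<beta>"
  proof -
    have "cmod (\<zeta> * cnj (a 0)) = 2 * \<beta> * t" by (simp add: norm_mult \<zeta> t_def)
    moreover have "2 * \<beta> * t \<le> X / 2 + 2 * \<beta>"
    proof -
      have "0 \<le> (t - 2)\<^sup>2" by simp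
      then have "4 * t \<le> t\<^sup>2 + 4" by (simp add: power2_eq_square algebra_simps)
      then have "\<beta> * (4 * t) \<le> \<beta> * (t\<^sup>2 + 4)" using \<beta>(2) by (intro mult_left_mono) auto
      then show ?thesis using Xge by (simp add: algebra_simps)
    qed
    ultimately show "\<bar>Im (\<zeta> * cnj (a 0))\<bar> \<le> X / 2 + 2 * \<beta>" "\<bar>Re (\<zeta> * cnj (a 0))\<bar> \<le> X / 2 + 2 * \<beta>"
      using abs_Im_le_cmod[of "\<zeta> * cnj (a 0)"] abs_Re_le_cmod[of "\<zeta> * cnj (a 0)"] by linarith+
  qed
  have pt: "c n * cnj (a n) = \<i> * ?b n * of_real ((cmod (a n))\<^sup>2) + (if n = 0 then \<zeta> * cnj (a 0) else 0)" for n
  proof -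
    have "a n * cnj (a n) = of_real ((cmod (a n))\<^sup>2)" by (simp only: complex_norm_square)
    then show ?thesis using c[of n] c0 \<beta>(1) by (cases "n = 0") (simp_all add: algebra_simps)
  qed
  have S: "(\<Sum>n\<in>A. c n * cnj (a n)) = (\<Sum>n\<in>A. \<i> * ?b n * of_real ((cmod (a n))\<^sup>2)) + \<zeta> * cnj (a 0)"
    unfolding pt sum.distrib using A by (simp add: sum.delta)
  have Im: "Im (\<Sum>n\<in>A. c n * cnj (a n)) = X + Im (\<zeta> * cnj (a 0))"
    unfolding S X_def by (simp add: Im_sum)
  have Re: "Re (\<Sum>n\<in>A. c n * cnj (a n)) \<le> Re (\<zeta> * cnj (a 0))"
  proof -
    have "Re (\<Sum>n\<in>A. \<i> * ?b n * of_real ((cmod (a n))\<^sup>2)) = - (\<Sum>n\<in>A. Im (?b n) * (cmod (a n))\<^sup>2)"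
      by (simp add: Re_sum sum_negf)
    moreover have "0 \<le> (\<Sum>n\<in>A. Im (?b n) * (cmod (a n))\<^sup>2)" using bp(3) by (intro sum_nonneg) auto
    ultimately show ?thesis unfolding S by simp
  qed
  show 1: "Im (\<Sum>n\<in>A. c n * cnj (a n)) \<ge> - 2 * \<beta>" using Im z(1) X0 by linarith
  show "Re (\<Sum>n\<in>A. c n * cnj (a n)) \<le> Im (\<Sum>n\<in>A. c n * cnj (a n)) + 4 * \<beta>" using Im Re z by linarith
  have XI: "X \<le> 2 * Im (\<Sum>n\<in>A. c n * cnj (a n)) + 4 * \<beta>" using Im z(1) by linarith
  have e: "(cmod (c n))\<^sup>2 - (cmod (d n))\<^sup>2 + k\<^sup>2 * (cmod (a n))\<^sup>2
     \<le> 2 * k * (Re (?b n) * (cmod (a n))\<^sup>2) + (if n = 0 then 4 * \<beta>\<^sup>2 * t + 4 * \<beta>\<^sup>2 else 0)" for n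
  proof -
    have dn: "(cmod (d n))\<^sup>2 = (alpha_n \<Lambda> \<alpha> n)\<^sup>2 * (cmod (a n))\<^sup>2" by (simp add: d norm_mult power_mult_distrib)
    have r: "2 * (Re (?b n))\<^sup>2 * (cmod (a n))\<^sup>2 \<le> 2 * k * (Re (?b n) * (cmod (a n))\<^sup>2)"
      using bp(2,5)[of n] k by (simp add: power2_eq_square mult_right_mono)
    have main: "(cmod (?b n))\<^sup>2 * (cmod (a n))\<^sup>2 - (cmod (d n))\<^sup>2 + k\<^sup>2 * (cmod (a n))\<^sup>2 = 2 * (Re (?b n))\<^sup>2 * (cmod (a n))\<^sup>2"
      unfolding dn bp(4)[of n, symmetric] by (simp add: algebra_simps)
    show ?thesis
    proof (cases "n = 0")
      case False
      then have "(cmod (c n))\<^sup>2 = (cmod (?b n))\<^sup>2 * (cmod (a n))\<^sup>2" using c by (simp add: norm_mult power_mult_distrib)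
      then show ?thesis using main r False by simp
    next
      case True
      have "cmod (c 0) \<le> \<beta> * t + 2 * \<beta>"
        unfolding c0 using norm_triangle_ineq[of "\<i> * of_real \<beta> * a 0" \<zeta>] \<zeta> \<beta>(2) by (simp add: norm_mult t_def)
      then have "(cmod (c 0))\<^sup>2 \<le> (\<beta> * t + 2 * \<beta>)\<^sup>2" by (intro power_mono) auto
      also have "\<dots> = (cmod (?b 0))\<^sup>2 * (cmod (a 0))\<^sup>2 + (4 * \<beta>\<^sup>2 * t + 4 * \<beta>\<^sup>2)"
        using \<beta> by (simp add: t_def power2_eq_square algebra_simps)
      finally show ?thesis using main r True by simp
    qed
  qed
  have "(\<Sum>n\<in>A. (cmod (c n))\<^sup>2) - (\<Sum>n\<in>A. (cmod (d n))\<^sup>2) + k\<^sup>2 * (\<Sum>n\<in>A. (cmod (a n))\<^sup>2)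
    = (\<Sum>n\<in>A. (cmod (c n))\<^sup>2 - (cmod (d n))\<^sup>2 + k\<^sup>2 * (cmod (a n))\<^sup>2)"
    by (simp add: sum.distrib sum_subtractf sum_distrib_left)
  also have "\<dots> \<le> (\<Sum>n\<in>A. 2 * k * (Re (?b n) * (cmod (a n))\<^sup>2) + (if n = 0 then 4 * \<beta>\<^sup>2 * t + 4 * \<beta>\<^sup>2 else 0))"
    by (intro sum_mono e)
  also have "\<dots> = 2 * k * X + (4 * \<beta>\<^sup>2 * t + 4 * \<beta>\<^sup>2)"
    unfolding sum.distrib X_def using A by (simp add: sum_distrib_left[symmetric])
  also have "\<dots> \<le> 3 * k * X + 8 * k\<^sup>2"
  proof -
    have "0 \<le> (t - 2)\<^sup>2" by simp
    then have "4 * t \<le> t\<^sup>2 + 4" by (simp add: power2_eq_square algebra_simps)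
    then have "\<beta>\<^sup>2 * (4 * t) \<le> \<beta>\<^sup>2 * (t\<^sup>2 + 4)" by (intro mult_left_mono) auto
    moreover have "\<beta> * (\<beta> * t\<^sup>2) \<le> k * X" using \<beta>k \<beta>(2) Xge X0 by (intro mult_mono) auto
    moreover have "\<beta>\<^sup>2 \<le> k\<^sup>2" using \<beta>k \<beta>(2) by (intro power_mono) auto
    ultimately show ?thesis by (simp add: power2_eq_square algebra_simps)
  qed
  also have "\<dots> \<le> 6 * k * (Im (\<Sum>n\<in>A. c n * cnj (a n)) + 2 * \<beta>) + 8 * k\<^sup>2"
  proof -
    have "3 * k * X \<le> 3 * k * (2 * Im (\<Sum>n\<in>A. c n * cnj (a n)) + 4 * \<beta>)" using XI k by (intro mult_left_mono) auto
    then show ?thesis by (simp add: algebra_simps)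
  qed
  finally show "(\<Sum>n\<in>A. (cmod (c n))\<^sup>2) - (\<Sum>n\<in>A. (cmod (d n))\<^sup>2) + k\<^sup>2 * (\<Sum>n\<in>A. (cmod (a n))\<^sup>2)
      \<le> 6 * k * (Im (\<Sum>n\<in>A. c n * cnj (a n)) + 2 * \<beta>) + 8 * k\<^sup>2" .
qed

section \<open>The rectangle between the surface and the artificial boundary\<close>

context graph_domain_top
begin

lemma strip_FTC1:
  assumes \<chi>: "C1 h"
  shows "(LINT x|lborel. zext R (d1 h) (x, y)) = zext {m<..<b} (\<lambda>y. h (\<Lambda>, y) - h (0, y)) y"
proof (cases "y \<in> {m<..<b}")
  case True
  have ae: "AE t in lborel. t \<noteq> 0 \<and> t \<noteq> \<Lambda>"
    using AE_lborel_singleton[of 0] AE_lborel_singleton[of \<Lambda>] by eventually_elim auto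
  have [measurable]: "(\<lambda>x. d1 h (x, y)) \<in> borel_measurable borel"
    by (intro borel_measurable_continuous_onI continuous_slice C1_continuous(2)[OF \<chi>])
  have e: "zext R (d1 h) (x, y) = zext {0<..<\<Lambda>} (\<lambda>x. d1 h (x, y)) x" for x
    using True by (auto simp: zext_def R_def indicator_def)
  have "(LINT x|lborel. zext R (d1 h) (x, y)) = (LINT x|lborel. indicator {0..\<Lambda>} x *\<^sub>R d1 h (x, y))"
    unfolding e
  proof (rule integral_cong_AE)
    show "AE x in lborel. zext {0<..<\<Lambda>} (\<lambda>x. d1 h (x, y)) x = indicator {0..\<Lambda>} x *\<^sub>R d1 h (x, y)"
      using ae by eventually_elim (auto simp: zext_def indicator_def)
  qed (simp_all add: zext_def)
  then show ?thesis using C1_FTC1[OF \<chi>, of 0 \<Lambda> y] \<Lambda> True by simp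
next
  case False
  then have "zext R (d1 h) (x, y) = 0" for x by (auto simp: R_def)
  then show ?thesis using False by simp
qed

lemma strip_FTC2:
  assumes \<chi>: "C1 h"
  shows "(LINT y|lborel. zext R (d2 h) (x, y)) = zext {0<..<\<Lambda>} (\<lambda>x. h (x, b) - h (x, m)) x"
proof (cases "x \<in> {0<..<\<Lambda>}")
  case True
  have ae: "AE t in lborel. t \<noteq> m \<and> t \<noteq> b"
    using AE_lborel_singleton[of m] AE_lborel_singleton[of b] by eventually_elim auto
  have [measurable]: "(\<lambda>y. d2 h (x, y)) \<in> borel_measurable borel"
    by (intro borel_measurable_continuous_onI continuous_slice C1_continuous(3)[OF \<chi>])
  have e: "zext R (d2 h) (x, y) = zext {m<..<b} (\<lambda>y. d2 h (x, y)) y" for y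
    using True by (auto simp: zext_def R_def indicator_def)
  have "(LINT y|lborel. zext R (d2 h) (x, y)) = (LINT y|lborel. indicator {m..b} y *\<^sub>R d2 h (x, y))"
    unfolding e
  proof (rule integral_cong_AE)
    show "AE y in lborel. zext {m<..<b} (\<lambda>y. d2 h (x, y)) y = indicator {m..b} y *\<^sub>R d2 h (x, y)"
      using ae by eventually_elim (auto simp: zext_def indicator_def)
  qed (simp_all add: zext_def)
  then show ?thesis using C1_FTC2[OF \<chi>, of m b x] m(1) True by simp
next
  case False
  then have "zext R (d2 h) (x, y) = 0" for y by (auto simp: R_def)
  then show ?thesis using False by simp
qed

text \<open>
  Integrating the horizontal derivative of \<open>g v\<close> over horizontal lines expresses combinations of the two lateral boundary
  values by quantities that converge for every approximating sequence.
\<close>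

lemma side_weight_lim:
  assumes l: "H1_lim \<Omega> \<phi> v V1 V2" and g: "\<And>t. (g has_vector_derivative g' t) (at t)" "continuous_on UNIV g'"
  shows "L2_lim lborel (\<lambda>j. zext {m<..<b} (\<lambda>y. g \<Lambda> * \<phi> j (\<Lambda>, y) - g 0 * \<phi> j (0, y)))
    (\<lambda>y. LINT x|lborel. zext R (\<lambda>z. g' (fst z) * v z + g (fst z) * V1 z) (x, y))"
proof -
  have \<phi>: "\<And>j. C1 (\<phi> j)" and lu: "L2_lim lborel (\<lambda>j. zext \<Omega> (\<phi> j)) (zext \<Omega> v)"
    and l1: "L2_lim lborel (\<lambda>j. zext \<Omega> (d1 (\<phi> j))) (zext \<Omega> V1)"
    using l unfolding H1_lim_def by blast+
  note P = C1_fst[OF g]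
  note M = C1_mult[OF P(1) \<phi>]
  have e: "d1 (\<lambda>x. g (fst x) * \<phi> j x) = (\<lambda>x. g' (fst x) * \<phi> j x + g (fst x) * d1 (\<phi> j) x)" for j
    unfolding M(2)[of j] P(2)[THEN fun_cong] ..
  have c: "continuous_on UNIV (\<lambda>z::real\<times>real. g (fst z))" "continuous_on UNIV (\<lambda>z::real\<times>real. g' (fst z))"
    using C1_continuous(1)[OF P(1)] C1_continuous(2)[OF P(1)] unfolding P(2) by auto
  have "L2_lim lborel (\<lambda>j. zext R (\<lambda>z. g' (fst z) * \<phi> j z + g (fst z) * d1 (\<phi> j) z)) (zext R (\<lambda>z. g' (fst z) * v z + g (fst z) * V1 z))"
    unfolding zext_add by (intro L2_lim_add L2_lim_R_mult[OF lu] L2_lim_R_mult[OF l1] c)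
  then have "L2_lim lborel (\<lambda>j y. LINT x|lborel. zext R (\<lambda>z. g' (fst z) * \<phi> j z + g (fst z) * d1 (\<phi> j) z) (x, y))
    (\<lambda>y. LINT x|lborel. zext R (\<lambda>z. g' (fst z) * v z + g (fst z) * V1 z) (x, y))"
    by (rule L2_lim_slice_snd[where a=0 and b=\<Lambda>]) (use \<Lambda> in \<open>auto simp: zext_def R_def indicator_def\<close>)
  then show ?thesis using strip_FTC1[OF M(1)] unfolding e by simp
qed

lemma R_fubini:
  assumes Z: "sq_int lborel (zext R Z)" and q: "continuous_on UNIV q"
  shows "integrable lborel (\<lambda>z. zext R Z z * (q (snd z) * cnj (wave \<Lambda> \<alpha> n (fst z))))"
    "(LINT z|lborel. zext R Z z * (q (snd z) * cnj (wave \<Lambda> \<alpha> n (fst z)))) =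
      (LINT y|lborel. of_real \<Lambda> * (q y * fourier_coeff \<Lambda> \<alpha> (\<lambda>x. zext R Z (x, y)) n))"
    "integrable lborel (\<lambda>y. q y * fourier_coeff \<Lambda> \<alpha> (\<lambda>x. zext R Z (x, y)) n)"
proof -
  let ?w = "\<lambda>z::real\<times>real. q (snd z) * cnj (wave \<Lambda> \<alpha> n (fst z))"
  have c: "continuous_on UNIV ?w"
    by (intro continuous_intros continuous_on_compose2[OF q]) auto
  have eq: "zext R Z z * zext R ?w z = zext R Z z * ?w z" for z by (cases "z \<in> R") auto
  have "integrable lborel (\<lambda>z. zext R Z z * zext R ?w z)"
    by (intro sq_int_mult_integrable Z sq_int_zext_continuous c R_bounded R_sets)
  then show i: "integrable lborel (\<lambda>z. zext R Z z * ?w z)" unfolding eq .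
  have inner: "(LINT x|lborel. zext R Z (x, y) * ?w (x, y)) = of_real \<Lambda> * (q y * fourier_coeff \<Lambda> \<alpha> (\<lambda>x. zext R Z (x, y)) n)" for y
  proof -
    have "(LINT x|lborel. zext R Z (x, y) * ?w (x, y)) = (LINT x|lborel. q y * (zext R Z (x, y) * cnj (waveI \<Lambda> \<alpha> n x)))"
      by (intro Bochner_Integration.integral_cong refl) (auto simp: zext_def R_def waveI_def indicator_def)
    also have "\<dots> = q y * (LINT x|lborel. zext R Z (x, y) * cnj (waveI \<Lambda> \<alpha> n x))" by (rule integral_mult_right_zero)
    finally show ?thesis unfolding fourier_coeff_waveI using \<Lambda> by simp
  qed
  show "(LINT z|lborel. zext R Z z * ?w z) = (LINT y|lborel. of_real \<Lambda> * (q y * fourier_coeff \<Lambda> \<alpha> (\<lambda>x. zext R Z (x, y)) n))"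
    using integral_plane_snd(1)[OF i] unfolding inner .
  have "integrable lborel (\<lambda>y. of_real \<Lambda> * (q y * fourier_coeff \<Lambda> \<alpha> (\<lambda>x. zext R Z (x, y)) n))"
    using integral_plane_snd(2)[OF i] unfolding inner .
  from integrable_mult_right[OF this, of "1 / of_real \<Lambda>"] \<Lambda>
  show "integrable lborel (\<lambda>y. q y * fourier_coeff \<Lambda> \<alpha> (\<lambda>x. zext R Z (x, y)) n)" by simp
qed

end

lemma continuous_antiderivative:
  fixes r :: "real \<Rightarrow> complex"
  assumes r: "continuous_on UNIV r"
  shows "\<exists>P. \<forall>x. (P has_vector_derivative r x) (at x)"
proof (intro exI allI)
  fix x :: real
  have c: "continuous_on S r" for S using r continuous_on_subset by blast
  have "((\<lambda>u. LBINT y=0..u. r y) has_vector_derivative r x) (at x within {-\<bar>x\<bar> - 1..\<bar>x\<bar> + 1})"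
    using interval_integral_FTC2[of "-\<bar>x\<bar> - 1" 0 "\<bar>x\<bar> + 1" r x] c by (auto simp: zero_ereal_def)
  then show "((\<lambda>u. LBINT y=0..u. r y) has_vector_derivative r x) (at x)"
    by (subst (asm) at_within_interior) auto
qed

context scattering
begin

section \<open>Fourier modes of the solution\<close>

text \<open>
  The solution and its derivatives are restricted to the rectangle \<open>R\<close> above the surface, where separation of variables
  is possible.
\<close>

definition UR where "UR = zext R u"
definition UR1 where "UR1 = zext R (weak_deriv \<Omega> (1, 0) u)"
definition UR2 where "UR2 = zext R (weak_deriv \<Omega> (0, 1) u)"

definition mode where "mode n y = fourier_coeff \<Lambda> \<alpha> (\<lambda>x. UR (x, y)) n"
definition mode1 where "mode1 n y = fourier_coeff \<Lambda> \<alpha> (\<lambda>x. UR1 (x, y)) n"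
definition mode2 where "mode2 n y = fourier_coeff \<Lambda> \<alpha> (\<lambda>x. UR2 (x, y)) n"

lemma UR_zext: "UR = zext R U" "UR1 = zext R U1" "UR2 = zext R U2"
  unfolding UR_def UR1_def UR2_def U_def U1_def U2_def zext_zext using R_subset by (simp_all add: Int_absorb2)

lemma UR_sq: "sq_int lborel UR" "sq_int lborel UR1" "sq_int lborel UR2"
  unfolding UR_zext by (intro sq_int_zext U_sq R_sets)+

lemma UR_out: "x \<notin> {0..\<Lambda>} \<Longrightarrow> UR (x, y) = 0" "x \<notin> {0..\<Lambda>} \<Longrightarrow> UR1 (x, y) = 0" "x \<notin> {0..\<Lambda>} \<Longrightarrow> UR2 (x, y) = 0"
  by (auto simp: UR_def UR1_def UR2_def R_def zext_def indicator_def)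

lemma slices: "AE y in lborel. sq_int lborel (\<lambda>x. UR (x, y)) \<and> sq_int lborel (\<lambda>x. UR1 (x, y)) \<and> sq_int lborel (\<lambda>x. UR2 (x, y))"
proof -
  have "AE y in lborel. sq_int lborel (\<lambda>x. G (x, y)) \<and> integrable lborel (\<lambda>x. G (x, y))" if "G \<in> {UR, UR1, UR2}" for G
    by (rule slice_snd(3)[of _ 0 \<Lambda>]) (use that UR_sq UR_out \<Lambda> in auto)
  from this[of UR] this[of UR1] this[of UR2] show ?thesis by simp
qed

text \<open>
  Integration by parts against the conjugate wave; the boundary terms cancel by quasi-periodicity. The lateral traces are
  limits along two different sequences. Both are therefore expressed by integrals over horizontal lines with the weights
  \<open>x / \<Lambda>\<close> and \<open>(\<Lambda> - x) / \<Lambda>\<close>, each of which is 1 on one side and 0 on the other.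
\<close>

lemma quasiperiodic_modes: "AE y in lborel. mode1 n y = \<i> * of_real (alpha_n \<Lambda> \<alpha> n) * mode n y"
proof -
  let ?W1 = "weak_deriv \<Omega> (1, 0) u" and ?W2 = "weak_deriv \<Omega> (0, 1) u"
  let ?J = "{f 0..b}"
  define \<epsilon> where "\<epsilon> = exp (- \<i> * of_real (\<alpha> * \<Lambda>))"
  note ti = has_trace_iff_H1_lim[OF \<Omega>_open \<Omega>_bounded u_H1]
  obtain w where w: "has_trace \<Omega> (\<lambda>y. (\<Lambda>, y)) ?J u w"
    "has_trace \<Omega> (\<lambda>y. (0, y)) ?J u (\<lambda>y. w y * \<epsilon>)"
    using u_V by (auto simp: H1_S_qp_def \<epsilon>_def)
  obtain \<phi>R where Rt: "H1_lim \<Omega> \<phi>R u ?W1 ?W2" "L2_lim lborel (\<lambda>j. zext ?J (\<lambda>y. \<phi>R j (\<Lambda>, y))) (zext ?J w)"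
    using w(1) by (subst (asm) ti) (auto intro!: continuous_intros)
  obtain \<phi>L where Lf: "H1_lim \<Omega> \<phi>L u ?W1 ?W2"
    "L2_lim lborel (\<lambda>j. zext ?J (\<lambda>y. \<phi>L j (0, y))) (zext ?J (\<lambda>y. w y * \<epsilon>))"
    using w(2) by (subst (asm) ti) (auto intro!: continuous_intros)
  have sub: "?J \<inter> {m<..<b} = {m<..<b}" "{m<..<b} \<inter> ?J = {m<..<b}" using m(2)[of 0] \<Lambda> by auto
  let ?Z = "zext {m<..<b}"
  have R': "L2_lim lborel (\<lambda>j. ?Z (\<lambda>y. \<phi>R j (\<Lambda>, y))) (?Z w)"
    using L2_lim_zext[OF Rt(2), of "{m<..<b}"] by (simp add: zext_zext sub)
  have L': "L2_lim lborel (\<lambda>j. ?Z (\<lambda>y. \<phi>L j (0, y))) (?Z (\<lambda>y. w y * \<epsilon>))"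
    using L2_lim_zext[OF Lf(2), of "{m<..<b}"] by (simp add: zext_zext sub)
  define gR where "gR t = complex_of_real (t / \<Lambda>)" for t
  define gL where "gL t = complex_of_real ((\<Lambda> - t) / \<Lambda>)" for t
  define gn where "gn t = cnj (wave \<Lambda> \<alpha> n t)" for t
  define gn' where "gn' t = - \<i> * of_real (alpha_n \<Lambda> \<alpha> n) * cnj (wave \<Lambda> \<alpha> n t)" for t
  have dR: "(gR has_vector_derivative complex_of_real (1 / \<Lambda>)) (at t)" for t
    unfolding gR_def by (rule has_vector_derivative_of_real) (use \<Lambda> in \<open>auto intro!: derivative_eq_intros\<close>)
  have dL: "(gL has_vector_derivative complex_of_real (- 1 / \<Lambda>)) (at t)" for t
    unfolding gL_def by (rule has_vector_derivative_of_real) (use \<Lambda> in \<open>auto intro!: derivative_eq_intros\<close>)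
  have dn: "(gn has_vector_derivative gn' t) (at t)" for t
    using bounded_linear.has_vector_derivative[OF bounded_linear_cnj wave_deriv[of \<Lambda> \<alpha> n t]]
    unfolding gn_def gn'_def by simp
  have cn': "continuous_on UNIV gn'" unfolding gn'_def by (intro continuous_intros)
  define W where "W g g' y = (LINT x|lborel. zext R (\<lambda>z. g' (fst z) * u z + g (fst z) * ?W1 z) (x, y))" for g g' y
  have val: "gR \<Lambda> = 1" "gR 0 = 0" "gL \<Lambda> = 0" "gL 0 = 1" "gn \<Lambda> = \<epsilon>" "gn 0 = 1"
    using \<Lambda> wave_period[of \<Lambda> \<alpha> n] by (simp_all add: gR_def gL_def gn_def \<epsilon>_def exp_cnj wave_def)
  have sw: "L2_lim lborel (\<lambda>j. ?Z (\<lambda>y. g \<Lambda> * \<phi> j (\<Lambda>, y) - g 0 * \<phi> j (0, y))) (W g g')"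
    if "H1_lim \<Omega> \<phi> u ?W1 ?W2" "\<And>t. (g has_vector_derivative g' t) (at t)" "continuous_on UNIV g'" for \<phi> g g'
    using side_weight_lim[OF that] unfolding W_def[abs_def] .
  have lR: "L2_lim lborel (\<lambda>j. ?Z (\<lambda>y. \<phi>R j (\<Lambda>, y))) (W gR (\<lambda>_. complex_of_real (1 / \<Lambda>)))"
    using sw[OF Rt(1) dR continuous_on_const] unfolding val by simp
  have 1: "AE y in lborel. ?Z w y = W gR (\<lambda>_. complex_of_real (1 / \<Lambda>)) y"
    by (rule L2_lim_unique[OF R' lR])
  have L2': "L2_lim lborel (\<lambda>j. ?Z (\<lambda>y. - \<phi>L j (0, y))) (?Z (\<lambda>y. - (w y * \<epsilon>)))"
  proof -
    have "(\<lambda>x. - 1 * ?Z h x) = ?Z (\<lambda>y. - h y)" for h by (auto simp: zext_def)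
    then show ?thesis using L2_lim_cmult[OF L', of "-1"] by simp
  qed
  have lL': "L2_lim lborel (\<lambda>j. ?Z (\<lambda>y. - \<phi>L j (0, y))) (W gL (\<lambda>_. complex_of_real (- 1 / \<Lambda>)))"
    using sw[OF Lf(1) dL continuous_on_const] unfolding val by simp
  have 2: "AE y in lborel. ?Z (\<lambda>y. - (w y * \<epsilon>)) y = W gL (\<lambda>_. complex_of_real (- 1 / \<Lambda>)) y"
    by (rule L2_lim_unique[OF L2' lL'])
  have lL: "L2_lim lborel (\<lambda>j. ?Z (\<lambda>y. - \<phi>R j (0, y))) (W gL (\<lambda>_. complex_of_real (- 1 / \<Lambda>)))"
    using sw[OF Rt(1) dL continuous_on_const] unfolding val by simp
  have ln: "L2_lim lborel (\<lambda>j. ?Z (\<lambda>y. \<epsilon> * \<phi>R j (\<Lambda>, y) - \<phi>R j (0, y))) (W gn gn')"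
    using sw[OF Rt(1) dn cn'] unfolding val by simp
  have "(\<lambda>y. \<epsilon> * ?Z (\<lambda>y. \<phi>R j (\<Lambda>, y)) y + ?Z (\<lambda>y. - \<phi>R j (0, y)) y) = ?Z (\<lambda>y. \<epsilon> * \<phi>R j (\<Lambda>, y) - \<phi>R j (0, y))" for j
    by (auto simp: zext_def indicator_def)
  then have "L2_lim lborel (\<lambda>j. ?Z (\<lambda>y. \<epsilon> * \<phi>R j (\<Lambda>, y) - \<phi>R j (0, y)))
    (\<lambda>y. \<epsilon> * W gR (\<lambda>_. complex_of_real (1 / \<Lambda>)) y + W gL (\<lambda>_. complex_of_real (- 1 / \<Lambda>)) y)"
    using L2_lim_add[OF L2_lim_cmult[OF lR, of \<epsilon>] lL] by simp
  from L2_lim_unique[OF ln this] 1 2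
  have W0: "AE y in lborel. W gn gn' y = 0"
  proof eventually_elim
    case (elim y)
    have "W gn gn' y = \<epsilon> * ?Z w y + ?Z (\<lambda>y. - (w y * \<epsilon>)) y" using elim by metis
    also have "\<dots> = 0" by (simp add: zext_def)
    finally show ?case .
  qed
  have e: "zext R (\<lambda>z. gn' (fst z) * u z + gn (fst z) * ?W1 z) (x, y)
    = - \<i> * of_real (alpha_n \<Lambda> \<alpha> n) * (UR (x, y) * cnj (waveI \<Lambda> \<alpha> n x)) + UR1 (x, y) * cnj (waveI \<Lambda> \<alpha> n x)" for x y
    by (auto simp: gn_def gn'_def UR_def UR1_def zext_def indicator_def R_def waveI_def)
  show ?thesis using W0 slices
  proof eventually_elim
    case (elim y)
    have i: "integrable lborel (\<lambda>x. UR (x, y) * cnj (waveI \<Lambda> \<alpha> n x))" "integrable lborel (\<lambda>x. UR1 (x, y) * cnj (waveI \<Lambda> \<alpha> n x))"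
      using elim by (auto intro!: sq_int_mult_integrable sq_int_cnj waveI_sq)
    have "W gn gn' y = - \<i> * of_real (alpha_n \<Lambda> \<alpha> n) * (LINT x|lborel. UR (x, y) * cnj (waveI \<Lambda> \<alpha> n x))
      + (LINT x|lborel. UR1 (x, y) * cnj (waveI \<Lambda> \<alpha> n x))"
      unfolding W_def e using i by simp
    then show ?case using elim \<Lambda> unfolding mode_def mode1_def fourier_coeff_waveI by (simp add: eq_neg_iff_add_eq_0 add.commute)
  qed
qed

lemma fourier_wave: "fourier_coeff \<Lambda> \<alpha> (\<lambda>t. w * wave \<Lambda> \<alpha> n t) l = (if l = n then w else 0)"
proof -
  have "fourier_coeff \<Lambda> \<alpha> (\<lambda>t. w * wave \<Lambda> \<alpha> n t) l = 1 / of_real \<Lambda> * (LINT t|lborel. w * (waveI \<Lambda> \<alpha> n t * cnj (waveI \<Lambda> \<alpha> l t)))"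
  proof -
    have "w * wave \<Lambda> \<alpha> n t * cnj (waveI \<Lambda> \<alpha> l t) = w * (waveI \<Lambda> \<alpha> n t * cnj (waveI \<Lambda> \<alpha> l t))" for t
      by (cases "t \<in> {0..\<Lambda>}") (simp_all add: waveI_def mult.assoc)
    then show ?thesis unfolding fourier_coeff_waveI by (simp only: integral_mult_right_zero)
  qed
  also have "\<dots> = (if l = n then w else 0)"
    unfolding integral_mult_right_zero wave_orthogonal[OF \<Lambda>] using \<Lambda> by simp
  finally show ?thesis .
qed

text \<open>
  The fundamental theorem of calculus for \<open>q\<close> times a mode, with \<open>q m = 0\<close>: it rewrites the coefficients of the trace on \<open>\<Gamma>\<close>
  as integrals over the rectangle.
\<close>

lemma trace_identity:
  assumes q: "\<And>t. (q has_vector_derivative q' t) (at t)" "continuous_on UNIV q'" "q m = 0"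
  shows "of_real \<Lambda> * fourier_coeff \<Lambda> \<alpha> (trace_Gamma \<Lambda> f b u) n * q b
    = (LINT z|lborel. UR2 z * (q (snd z) * cnj (wave \<Lambda> \<alpha> n (fst z)))) + (LINT z|lborel. UR z * (q' (snd z) * cnj (wave \<Lambda> \<alpha> n (fst z))))"
proof -
  obtain \<psi> where \<psi>: "H1_lim \<Omega> \<psi> u (weak_deriv \<Omega> (1, 0) u) (weak_deriv \<Omega> (0, 1) u)" using approximants by blast
  have top: "continuous_on UNIV (\<lambda>t. (t, b))" by (intro continuous_intros)
  obtain \<phi> where \<phi>: "H1_lim \<Omega> \<phi> u (weak_deriv \<Omega> (1, 0) u) (weak_deriv \<Omega> (0, 1) u)"
    "L2_lim lborel (\<lambda>j. zext {0..\<Lambda>} (\<lambda>t. \<phi> j (t, b))) (zext {0..\<Lambda>} (trace_Gamma \<Lambda> f b u))"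
    using has_trace_top_exists[OF u_H1 \<psi>]
    unfolding has_trace_iff_H1_lim[OF \<Omega>_open \<Omega>_bounded u_H1 top bounded_closed_interval borel_closed[OF closed_atLeastAtMost]] by blast
  have C: "\<And>j. C1 (\<phi> j)" and lu: "L2_lim lborel (\<lambda>j. zext \<Omega> (\<phi> j)) (zext \<Omega> u)"
    and l2: "L2_lim lborel (\<lambda>j. zext \<Omega> (d2 (\<phi> j))) (zext \<Omega> (weak_deriv \<Omega> (0, 1) u))"
    using \<phi>(1) unfolding H1_lim_def by blast+
  let ?w = "\<lambda>t. cnj (wave \<Lambda> \<alpha> n t)"
  have wd: "(?w has_vector_derivative cnj (\<i> * of_real (alpha_n \<Lambda> \<alpha> n) * wave \<Lambda> \<alpha> n t)) (at t)" for t
    using bounded_linear.has_vector_derivative[OF bounded_linear_cnj wave_deriv[of \<Lambda> \<alpha> n t]] by simp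
  have wc: "continuous_on UNIV (\<lambda>t. cnj (\<i> * of_real (alpha_n \<Lambda> \<alpha> n) * wave \<Lambda> \<alpha> n t))" by (intro continuous_intros)
  note Cw = C1_fst[OF wd wc]
  note Cq = C1_snd[OF q(1,2)]
  note Cqw = C1_mult[OF Cq(1) Cw(1)]
  have qw2: "d2 (\<lambda>z. q (snd z) * ?w (fst z)) z = q' (snd z) * ?w (fst z)" for z
    unfolding Cqw(3)[THEN fun_cong] Cq(3)[THEN fun_cong] Cw(3)[THEN fun_cong] by simp
  note Cp = C1_mult[OF C Cqw(1)]
  let ?G = "\<lambda>z. q (snd z) * ?w (fst z)" and ?G' = "\<lambda>z. q' (snd z) * ?w (fst z)"
  have e: "d2 (\<lambda>z. \<phi> j z * ?G z) = (\<lambda>z. d2 (\<phi> j) z * ?G z + \<phi> j z * ?G' z)" for j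
    unfolding Cp(3)[of j] qw2 ..
  have Gc: "continuous_on UNIV ?G" "continuous_on UNIV ?G'"
    using C1_continuous(1)[OF Cqw(1)] C1_continuous(3)[OF Cqw(1)] unfolding qw2 by auto
  have GS: "sq_int lborel (zext R ?G)" "sq_int lborel (zext R ?G')"
    by (intro sq_int_zext_continuous Gc R_bounded R_sets)+
  have zz: "zext R h z * zext R g z = zext R h z * g z" for h g :: "real \<times> real \<Rightarrow> complex" and z by (cases "z \<in> R") auto
  have lhs: "(\<lambda>j. (LINT z|lborel. zext R (d2 (\<phi> j)) z * zext R ?G z) + (LINT z|lborel. zext R (\<phi> j) z * zext R ?G' z))
    \<longlonglongrightarrow> (LINT z|lborel. UR2 z * zext R ?G z) + (LINT z|lborel. UR z * zext R ?G' z)"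
    unfolding UR_def UR2_def by (intro tendsto_add L2_lim_inner L2_lim_R lu l2 GS)
  have rhs: "(\<lambda>j. q b * (LINT t|lborel. zext {0..\<Lambda>} (\<lambda>t. \<phi> j (t, b)) t * cnj (waveI \<Lambda> \<alpha> n t)))
    \<longlonglongrightarrow> q b * (LINT t|lborel. zext {0..\<Lambda>} (trace_Gamma \<Lambda> f b u) t * cnj (waveI \<Lambda> \<alpha> n t))"
    by (intro tendsto_mult tendsto_const L2_lim_inner \<phi>(2) sq_int_cnj waveI_sq)
  have eqj: "(LINT z|lborel. zext R (d2 (\<phi> j)) z * zext R ?G z) + (LINT z|lborel. zext R (\<phi> j) z * zext R ?G' z)
    = q b * (LINT t|lborel. zext {0..\<Lambda>} (\<lambda>t. \<phi> j (t, b)) t * cnj (waveI \<Lambda> \<alpha> n t))" for j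
  proof -
    let ?h = "\<lambda>z. \<phi> j z * ?G z"
    note cj = C1_continuous[OF C[of j]]
    have S: "sq_int lborel (zext R (d2 (\<phi> j)))" "sq_int lborel (zext R (\<phi> j))"
      by (intro sq_int_zext_continuous cj R_bounded R_sets)+
    have ch: "continuous_on UNIV (d2 ?h)" by (rule C1_continuous(3)[OF Cp(1)])
    have ih: "integrable lborel (zext R (d2 ?h))"
      by (intro sq_int_zext_integrable sq_int_zext_continuous ch R_bounded R_sets)
    have "(LINT z|lborel. zext R (d2 (\<phi> j)) z * zext R ?G z) + (LINT z|lborel. zext R (\<phi> j) z * zext R ?G' z)
      = (LINT z|lborel. zext R (d2 (\<phi> j)) z * zext R ?G z + zext R (\<phi> j) z * zext R ?G' z)"
      using sq_int_mult_integrable[OF S(1) GS(1)] sq_int_mult_integrable[OF S(2) GS(2)] by simp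
    also have "\<dots> = (LINT z|lborel. zext R (d2 ?h) z)"
      unfolding e by (intro Bochner_Integration.integral_cong refl) (auto simp: zext_def indicator_def)
    also have "\<dots> = (LINT x|lborel. zext {0<..<\<Lambda>} (\<lambda>x. ?h (x, b) - ?h (x, m)) x)"
      unfolding integral_plane_fst(1)[OF ih] strip_FTC2[OF Cp(1)] ..
    also have "\<dots> = (LINT x|lborel. q b * (zext {0..\<Lambda>} (\<lambda>t. \<phi> j (t, b)) x * cnj (waveI \<Lambda> \<alpha> n x)))"
    proof (rule integral_cong_AE)
      have "AE t in lborel. t \<noteq> 0 \<and> t \<noteq> \<Lambda>"
        using AE_lborel_singleton[of 0] AE_lborel_singleton[of \<Lambda>] by eventually_elim auto
      then show "AE x in lborel. zext {0<..<\<Lambda>} (\<lambda>x. ?h (x, b) - ?h (x, m)) x = q b * (zext {0..\<Lambda>} (\<lambda>t. \<phi> j (t, b)) x * cnj (waveI \<Lambda> \<alpha> n x))"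
        by eventually_elim (use q(3) in \<open>auto simp: zext_def waveI_def indicator_def\<close>)
      have c: "continuous_on UNIV (\<lambda>x. ?h (x, b) - ?h (x, m))"
        by (intro continuous_on_diff continuous_slice(1) C1_continuous(1)[OF Cp(1)])
      show "(\<lambda>x. zext {0<..<\<Lambda>} (\<lambda>x. ?h (x, b) - ?h (x, m)) x) \<in> borel_measurable lborel"
        by (intro sq_int_measurable sq_int_zext_continuous c) auto
      have "sq_int lborel (zext {0..\<Lambda>} (\<lambda>t. \<phi> j (t, b)))"
        by (intro sq_int_zext_continuous continuous_slice(1) cj) auto
      from sq_int_mult_integrable[OF this sq_int_cnj[OF waveI_sq[of \<Lambda> \<alpha> n]]]
      show "(\<lambda>x. q b * (zext {0..\<Lambda>} (\<lambda>t. \<phi> j (t, b)) x * cnj (waveI \<Lambda> \<alpha> n x))) \<in> borel_measurable lborel"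
        by auto
    qed
    finally show ?thesis by simp
  qed
  have "(LINT z|lborel. UR2 z * zext R ?G z) + (LINT z|lborel. UR z * zext R ?G' z)
    = q b * (LINT t|lborel. zext {0..\<Lambda>} (trace_Gamma \<Lambda> f b u) t * cnj (waveI \<Lambda> \<alpha> n t))"
    using lhs rhs unfolding eqj by (rule LIMSEQ_unique)
  moreover have "(LINT t|lborel. zext {0..\<Lambda>} (trace_Gamma \<Lambda> f b u) t * cnj (waveI \<Lambda> \<alpha> n t)) = of_real \<Lambda> * fourier_coeff \<Lambda> \<alpha> (trace_Gamma \<Lambda> f b u) n"
  proof -
    have "(LINT t|lborel. zext {0..\<Lambda>} (trace_Gamma \<Lambda> f b u) t * cnj (waveI \<Lambda> \<alpha> n t)) = (LINT t|lborel. trace_Gamma \<Lambda> f b u t * cnj (waveI \<Lambda> \<alpha> n t))"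
      by (intro Bochner_Integration.integral_cong refl) (auto simp: zext_def waveI_def indicator_def)
    then show ?thesis using \<Lambda> by (simp add: fourier_coeff_waveI)
  qed
  ultimately show ?thesis unfolding UR_def UR2_def zz by (simp add: mult_ac)
qed

text \<open>
  The variational equation for the smooth test function \<open>cnj (q x\<^sub>2)\<close> times a wave. As \<open>q\<close> vanishes below \<open>m\<close>, it
  belongs to the test space, and only the rectangle contributes.
\<close>

lemma mode_test:
  assumes q: "\<And>t. (q has_vector_derivative q' t) (at t)" "continuous_on UNIV q'"
    and q0: "\<And>t. t \<le> m \<Longrightarrow> q t = 0" "\<And>t. t \<le> m \<Longrightarrow> q' t = 0"
  shows "(LINT z|lborel. UR2 z * (q' (snd z) * cnj (wave \<Lambda> \<alpha> n (fst z))))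
      - \<i> * of_real (alpha_n \<Lambda> \<alpha> n) * (LINT z|lborel. UR1 z * (q (snd z) * cnj (wave \<Lambda> \<alpha> n (fst z))))
      - of_real (k\<^sup>2) * (LINT z|lborel. UR z * (q (snd z) * cnj (wave \<Lambda> \<alpha> n (fst z))))
      - of_real \<Lambda> * (\<i> * beta_n k \<Lambda> \<alpha> n * fourier_coeff \<Lambda> \<alpha> (trace_Gamma \<Lambda> f b u) n * q b)
    = of_real \<Lambda> * (if n = 0 then - 2 * \<i> * of_real \<beta> * exp (- \<i> * of_real (\<beta> * b)) else 0) * q b"
proof -
  let ?an = "of_real (alpha_n \<Lambda> \<alpha> n) :: complex"
  let ?q = "\<lambda>t. cnj (q t)"
  have qd: "(?q has_vector_derivative cnj (q' t)) (at t)" for t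
    by (rule bounded_linear.has_vector_derivative[OF bounded_linear_cnj q(1)])
  have qc: "continuous_on UNIV (\<lambda>t. cnj (q' t))" by (intro continuous_intros q)
  have wc: "continuous_on UNIV (\<lambda>t. \<i> * ?an * wave \<Lambda> \<alpha> n t)" by (intro continuous_intros)
  note Cq = C1_snd[OF qd qc]
  note Cw = C1_fst[OF wave_deriv[of \<Lambda> \<alpha> n] wc]
  note Cv = C1_mult[OF Cq(1) Cw(1)]
  define v where "v = (\<lambda>z. cnj (q (snd z)) * wave \<Lambda> \<alpha> n (fst z))"
  have vC: "C1 v" unfolding v_def by (rule Cv)
  have v1: "d1 v = (\<lambda>z. cnj (q (snd z)) * (\<i> * ?an * wave \<Lambda> \<alpha> n (fst z)))"
    unfolding v_def Cv(2) Cq(2)[THEN fun_cong] Cw(2)[THEN fun_cong] by simp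
  have v2: "d2 v = (\<lambda>z. cnj (q' (snd z)) * wave \<Lambda> \<alpha> n (fst z))"
    unfolding v_def Cv(3) Cq(3)[THEN fun_cong] Cw(3)[THEN fun_cong] by simp
  have lim: "H1_lim \<Omega> (\<lambda>_. v) v (d1 v) (d2 v)"
    unfolding H1_lim_def
    by (intro conjI allI vC L2_lim_const sq_int_zext_continuous C1_continuous[OF vC] \<Omega>_bounded \<Omega>_sets)
  note H = H1_lim_imp_H1[OF \<Omega>_open \<Omega>_bounded lim]
  note ti = has_trace_iff_H1_lim[OF \<Omega>_open \<Omega>_bounded H(1)]
  have tr: "has_trace \<Omega> \<gamma> I v (\<lambda>t. v (\<gamma> t))" if "continuous_on UNIV \<gamma>" "bounded I" "I \<in> sets borel" for \<gamma> I
  proof (subst ti[OF that])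
    have "L2_lim lborel (\<lambda>j. zext I (\<lambda>t. v (\<gamma> t))) (zext I (\<lambda>t. v (\<gamma> t)))"
      by (intro L2_lim_const sq_int_zext_continuous that continuous_on_compose2[OF C1_continuous(1)[OF vC] that(1)]) auto
    with H(4) show "\<exists>\<phi>. H1_lim \<Omega> \<phi> v (weak_deriv \<Omega> (1, 0) v) (weak_deriv \<Omega> (0, 1) v) \<and> L2_lim lborel (\<lambda>j. zext I (\<lambda>t. \<phi> j (\<gamma> t))) (zext I (\<lambda>t. v (\<gamma> t)))"
      by blast
  qed
  have tS: "has_trace \<Omega> (\<lambda>t. (t, f t)) {0..\<Lambda>} v (\<lambda>_. 0)"
  proof -
    have "has_trace \<Omega> (\<lambda>t. (t, f t)) {0..\<Lambda>} v (\<lambda>t. v (t, f t))"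
      by (rule tr) (auto intro!: continuous_intros f_cont)
    moreover have z: "zext {0..\<Lambda>} (\<lambda>t. v (t, f t)) = zext {0..\<Lambda>} (\<lambda>_. 0)"
    proof
      fix t show "zext {0..\<Lambda>} (\<lambda>t. v (t, f t)) t = zext {0..\<Lambda>} (\<lambda>_. 0) t"
        using q0(1)[of "f t"] m(2)[of t] by (cases "t \<in> {0..\<Lambda>}") (auto simp: v_def)
    qed
    ultimately show ?thesis
      by (subst (asm) ti, auto intro!: continuous_intros f_cont) (subst ti, auto intro!: continuous_intros f_cont simp: z)
  qed
  have tR: "has_trace \<Omega> (\<lambda>y. (\<Lambda>, y)) {f 0..b} v (\<lambda>y. v (\<Lambda>, y))"
    by (rule tr) (auto intro!: continuous_intros)
  have "v (0, y) = v (\<Lambda>, y) * exp (- \<i> * of_real (\<alpha> * \<Lambda>))" for y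
  proof -
    have "wave \<Lambda> \<alpha> n \<Lambda> * exp (- \<i> * of_real (\<alpha> * \<Lambda>)) = 1"
      using wave_period[of \<Lambda> \<alpha> n] \<Lambda> by (simp add: mult_exp_exp)
    moreover have "wave \<Lambda> \<alpha> n 0 = 1" by (simp add: wave_def)
    ultimately show ?thesis by (simp add: v_def mult.assoc)
  qed
  moreover have "has_trace \<Omega> (\<lambda>y. (0, y)) {f 0..b} v (\<lambda>y. v (0, y))"
    by (rule tr) (auto intro!: continuous_intros)
  ultimately have tL: "has_trace \<Omega> (\<lambda>y. (0, y)) {f 0..b} v (\<lambda>y. v (\<Lambda>, y) * exp (- \<i> * of_real (\<alpha> * \<Lambda>)))" by simp
  have vV: "v \<in> H1_S_qp \<Lambda> f b \<alpha>" unfolding H1_S_qp_def using H(1) tS tR tL by blast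
  have tT: "has_trace \<Omega> (\<lambda>t. (t, b)) {0..\<Lambda>} v (\<lambda>t. v (t, b))" by (rule tr) (auto intro!: continuous_intros)
  note var = variational[OF vV tT]
  have vb: "(\<lambda>t. v (t, b)) = (\<lambda>t. cnj (q b) * wave \<Lambda> \<alpha> n t)" by (simp add: v_def)
  have pair: "pairing_Gamma \<Lambda> \<alpha> (T_op k \<Lambda> \<alpha> (trace_Gamma \<Lambda> f b u)) (\<lambda>t. v (t, b))
    = of_real \<Lambda> * (\<i> * beta_n k \<Lambda> \<alpha> n * fourier_coeff \<Lambda> \<alpha> (trace_Gamma \<Lambda> f b u) n * q b)"
    unfolding pairing_Gamma_def vb fourier_wave
    by (subst infsum_cong_neutral[where T="{n}" and g="\<lambda>l. T_op k \<Lambda> \<alpha> (trace_Gamma \<Lambda> f b u) l * q b"]) (auto simp: T_op_def)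
  have gint: "(LINT t:{0..\<Lambda>}|lborel. g_data \<alpha> \<beta> b t * cnj (v (t, b)))
    = of_real \<Lambda> * (if n = 0 then - 2 * \<i> * of_real \<beta> * exp (- \<i> * of_real (\<beta> * b)) else 0) * q b"
  proof -
    let ?K = "- 2 * \<i> * of_real \<beta> * exp (- \<i> * of_real (\<beta> * b))"
    have "g_data \<alpha> \<beta> b t = ?K * wave \<Lambda> \<alpha> 0 t" for t
      unfolding g_data_def wave_def alpha_n_def by (simp add: exp_diff exp_minus field_simps)
    then have "(LINT t:{0..\<Lambda>}|lborel. g_data \<alpha> \<beta> b t * cnj (v (t, b)))
      = (LINT t|lborel. ?K * q b * (waveI \<Lambda> \<alpha> 0 t * cnj (waveI \<Lambda> \<alpha> n t)))"
      unfolding set_lebesgue_integral_def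
      by (intro Bochner_Integration.integral_cong refl) (auto simp: waveI_def zext_def indicator_def v_def)
    also have "\<dots> = ?K * q b * (LINT t|lborel. waveI \<Lambda> \<alpha> 0 t * cnj (waveI \<Lambda> \<alpha> n t))" by (rule integral_mult_right_zero)
    finally show ?thesis using wave_orthogonal[OF \<Lambda>, of \<alpha> 0 n] by (auto simp: algebra_simps)
  qed
  have strip: "zext \<Omega> g z * (p (snd z) * w) = zext R g z * (p (snd z) * w)"
    if "\<And>t. t \<le> m \<Longrightarrow> p t = 0" for g :: "real \<times> real \<Rightarrow> complex" and p :: "real \<Rightarrow> complex" and z w
  proof (cases "snd z \<le> m")
    case False
    then have "z \<in> \<Omega> \<longleftrightarrow> z \<in> R" using m(2)[of "fst z"] by (cases z) (auto simp: R_def \<Omega>_iff)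
    then show ?thesis by (cases "z \<in> R") auto
  qed (use that in simp)
  have c: "continuous_on UNIV q" using q(1) by (auto intro!: continuous_at_imp_continuous_on dest: has_vector_derivative_continuous)
  have I: "integrable lborel (\<lambda>z. UR2 z * (q' (snd z) * cnj (wave \<Lambda> \<alpha> n (fst z))))"
    "integrable lborel (\<lambda>z. UR1 z * (q (snd z) * cnj (wave \<Lambda> \<alpha> n (fst z))))"
    using R_fubini(1)[of "weak_deriv \<Omega> (0, 1) u" q' \<alpha> n] R_fubini(1)[of "weak_deriv \<Omega> (1, 0) u" q \<alpha> n] UR_sq c q(2)
    unfolding UR_def UR1_def UR2_def by auto
  have g1: "(LINT x|lborel. U1 x * cnj (zext \<Omega> (weak_deriv \<Omega> (1, 0) v) x) + U2 x * cnj (zext \<Omega> (weak_deriv \<Omega> (0, 1) v) x))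
    = (LINT z|lborel. - \<i> * ?an * (UR1 z * (q (snd z) * cnj (wave \<Lambda> \<alpha> n (fst z)))) + UR2 z * (q' (snd z) * cnj (wave \<Lambda> \<alpha> n (fst z))))"
  proof (rule integral_cong_AE)
    show "AE z in lborel. U1 z * cnj (zext \<Omega> (weak_deriv \<Omega> (1, 0) v) z) + U2 z * cnj (zext \<Omega> (weak_deriv \<Omega> (0, 1) v) z)
      = - \<i> * ?an * (UR1 z * (q (snd z) * cnj (wave \<Lambda> \<alpha> n (fst z)))) + UR2 z * (q' (snd z) * cnj (wave \<Lambda> \<alpha> n (fst z)))"
      using H(2,3)
    proof eventually_elim
      case (elim z)
      have "U1 z * cnj (zext \<Omega> (d1 v) z) = - \<i> * ?an * (U1 z * (q (snd z) * cnj (wave \<Lambda> \<alpha> n (fst z))))"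
        by (cases "z \<in> \<Omega>") (simp_all add: v1 U_out)
      also have "U1 z * (q (snd z) * cnj (wave \<Lambda> \<alpha> n (fst z))) = UR1 z * (q (snd z) * cnj (wave \<Lambda> \<alpha> n (fst z)))"
        unfolding U1_def UR1_def by (rule strip[OF q0(1)])
      finally have 1: "U1 z * cnj (zext \<Omega> (d1 v) z) = - \<i> * ?an * (UR1 z * (q (snd z) * cnj (wave \<Lambda> \<alpha> n (fst z))))" .
      have "U2 z * cnj (zext \<Omega> (d2 v) z) = U2 z * (q' (snd z) * cnj (wave \<Lambda> \<alpha> n (fst z)))"
        by (cases "z \<in> \<Omega>") (simp_all add: v2 U_out)
      also have "\<dots> = UR2 z * (q' (snd z) * cnj (wave \<Lambda> \<alpha> n (fst z)))"
        unfolding U2_def UR2_def by (rule strip[OF q0(2)])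
      finally show ?case unfolding elim 1 by (rule arg_cong)
    qed
    note dv = H1_D[OF H(1)]
    have mm: "U1 \<in> borel_measurable lborel" "U2 \<in> borel_measurable lborel"
      "zext \<Omega> (weak_deriv \<Omega> (1, 0) v) \<in> borel_measurable lborel" "zext \<Omega> (weak_deriv \<Omega> (0, 1) v) \<in> borel_measurable lborel"
      using U_sq dv by (auto simp: L2_zext sq_int_def)
    show "(\<lambda>x. U1 x * cnj (zext \<Omega> (weak_deriv \<Omega> (1, 0) v) x) + U2 x * cnj (zext \<Omega> (weak_deriv \<Omega> (0, 1) v) x)) \<in> borel_measurable lborel"
      by (intro borel_measurable_add borel_measurable_times borel_measurable_cnj mm)
    show "(\<lambda>z. - \<i> * ?an * (UR1 z * (q (snd z) * cnj (wave \<Lambda> \<alpha> n (fst z)))) + UR2 z * (q' (snd z) * cnj (wave \<Lambda> \<alpha> n (fst z)))) \<in> borel_measurable lborel"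
      by (intro borel_measurable_integrable Bochner_Integration.integrable_add integrable_mult_right I)
  qed
  have g2: "(LINT x|lborel. U x * cnj (zext \<Omega> v x)) = (LINT z|lborel. UR z * (q (snd z) * cnj (wave \<Lambda> \<alpha> n (fst z))))"
  proof (intro Bochner_Integration.integral_cong refl)
    fix z
    have "U z * cnj (zext \<Omega> v z) = U z * (q (snd z) * cnj (wave \<Lambda> \<alpha> n (fst z)))"
      by (cases "z \<in> \<Omega>") (simp_all add: v_def U_out)
    also have "\<dots> = UR z * (q (snd z) * cnj (wave \<Lambda> \<alpha> n (fst z)))"
      unfolding U_def UR_def by (rule strip[OF q0(1)])
    finally show "U z * cnj (zext \<Omega> v z) = UR z * (q (snd z) * cnj (wave \<Lambda> \<alpha> n (fst z)))" .
  qed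
  have g3: "(LINT z|lborel. - \<i> * ?an * (UR1 z * (q (snd z) * cnj (wave \<Lambda> \<alpha> n (fst z)))) + UR2 z * (q' (snd z) * cnj (wave \<Lambda> \<alpha> n (fst z))))
    = - \<i> * ?an * (LINT z|lborel. UR1 z * (q (snd z) * cnj (wave \<Lambda> \<alpha> n (fst z)))) + (LINT z|lborel. UR2 z * (q' (snd z) * cnj (wave \<Lambda> \<alpha> n (fst z))))"
    using I by simp
  show ?thesis using var unfolding g1 g2 g3 pair gint by (simp add: algebra_simps)
qed

end

context scattering
begin

section \<open>The outgoing wave relation\<close>

text \<open>
  The Fourier coefficients of \<open>g\<close>.
\<close>

definition source :: "int \<Rightarrow> complex" where
  "source n = (if n = 0 then - 2 * \<i> * of_real \<beta> * exp (- \<i> * of_real (\<beta> * b)) else 0)"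

text \<open>
  Inserting the trace identity into the equation for one mode factorises the second order operator, because
  \<open>k\<^sup>2 - \<alpha>\<^sub>n\<^sup>2 = \<beta>\<^sub>n\<^sup>2\<close>: the transposed factor \<open>\<partial> - \<i> \<beta>\<^sub>n\<close> acts on \<open>q\<close>, the other one on the mode. The radiation
  condition supplies exactly the boundary term that is needed.
\<close>

lemma mode_equation:
  assumes q: "\<And>t. (q has_vector_derivative q' t) (at t)" "continuous_on UNIV q'"
    and q0: "\<And>t. t \<le> m \<Longrightarrow> q t = 0" "\<And>t. t \<le> m \<Longrightarrow> q' t = 0"
  shows "(LINT y|lborel. (q' y - \<i> * beta_n k \<Lambda> \<alpha> n * q y) * (mode2 n y - \<i> * beta_n k \<Lambda> \<alpha> n * mode n y)) = source n * q b"
proof -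
  let ?b = "beta_n k \<Lambda> \<alpha> n" and ?an = "of_real (alpha_n \<Lambda> \<alpha> n) :: complex"
  have c: "continuous_on UNIV q" using q(1) by (auto intro!: continuous_at_imp_continuous_on dest: has_vector_derivative_continuous)
  have fub: "(LINT z|lborel. UR2 z * (r (snd z) * cnj (wave \<Lambda> \<alpha> n (fst z)))) = of_real \<Lambda> * (LINT y|lborel. r y * mode2 n y)"
    "(LINT z|lborel. UR1 z * (r (snd z) * cnj (wave \<Lambda> \<alpha> n (fst z)))) = of_real \<Lambda> * (LINT y|lborel. r y * mode1 n y)"
    "(LINT z|lborel. UR z * (r (snd z) * cnj (wave \<Lambda> \<alpha> n (fst z)))) = of_real \<Lambda> * (LINT y|lborel. r y * mode n y)"
    "integrable lborel (\<lambda>y. r y * mode2 n y)" "integrable lborel (\<lambda>y. r y * mode1 n y)" "integrable lborel (\<lambda>y. r y * mode n y)"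
    if "continuous_on UNIV r" for r
  proof -
    note F = R_fubini(2,3)[OF _ that]
    show "(LINT z|lborel. UR2 z * (r (snd z) * cnj (wave \<Lambda> \<alpha> n (fst z)))) = of_real \<Lambda> * (LINT y|lborel. r y * mode2 n y)"
      using F(1)[OF UR_sq(3)[unfolded UR2_def], of \<alpha> n] unfolding UR2_def[symmetric] mode2_def[symmetric] integral_mult_right_zero .
    show "(LINT z|lborel. UR1 z * (r (snd z) * cnj (wave \<Lambda> \<alpha> n (fst z)))) = of_real \<Lambda> * (LINT y|lborel. r y * mode1 n y)"
      using F(1)[OF UR_sq(2)[unfolded UR1_def], of \<alpha> n] unfolding UR1_def[symmetric] mode1_def[symmetric] integral_mult_right_zero .
    show "(LINT z|lborel. UR z * (r (snd z) * cnj (wave \<Lambda> \<alpha> n (fst z)))) = of_real \<Lambda> * (LINT y|lborel. r y * mode n y)"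
      using F(1)[OF UR_sq(1)[unfolded UR_def], of \<alpha> n] unfolding UR_def[symmetric] mode_def[symmetric] integral_mult_right_zero .
    show "integrable lborel (\<lambda>y. r y * mode2 n y)"
      using F(2)[OF UR_sq(3)[unfolded UR2_def], of \<alpha> n] unfolding UR2_def[symmetric] mode2_def[symmetric] .
    show "integrable lborel (\<lambda>y. r y * mode1 n y)"
      using F(2)[OF UR_sq(2)[unfolded UR1_def], of \<alpha> n] unfolding UR1_def[symmetric] mode1_def[symmetric] .
    show "integrable lborel (\<lambda>y. r y * mode n y)"
      using F(2)[OF UR_sq(1)[unfolded UR_def], of \<alpha> n] unfolding UR_def[symmetric] mode_def[symmetric] .
  qed
  note fq = fub[OF c] and fq' = fub[OF q(2)]
  have qp: "(LINT y|lborel. q y * mode1 n y) = (LINT y|lborel. \<i> * ?an * (q y * mode n y))"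
    by (rule integral_cong_AE)
      (use quasiperiodic_modes[of n] fq(5,6) in \<open>auto intro!: borel_measurable_integrable integrable_mult_right\<close>)
  define I where "I = (LINT y|lborel. q' y * mode2 n y)"
  define J where "J = (LINT y|lborel. q y * mode2 n y)"
  define M where "M = (LINT y|lborel. q' y * mode n y)"
  define N where "N = (LINT y|lborel. q y * mode n y)"
  define t where "t = fourier_coeff \<Lambda> \<alpha> (trace_Gamma \<Lambda> f b u) n * q b"
  have qm: "q m = 0" using q0(1) by simp
  have t: "t = J + M"
    using trace_identity[OF q qm, of n] \<Lambda> unfolding fq(1) fq'(3) J_def[symmetric] M_def[symmetric]
    by (simp add: t_def mult.assoc ring_distribs(1)[symmetric])
  have mt: "I - \<i> * ?an * (\<i> * ?an * N) - of_real (k\<^sup>2) * N - \<i> * ?b * t = source n * q b"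
  proof -
    have "of_real \<Lambda> * I - \<i> * ?an * (of_real \<Lambda> * (\<i> * ?an * N)) - of_real (k\<^sup>2) * (of_real \<Lambda> * N)
        - of_real \<Lambda> * (\<i> * ?b * t) = of_real \<Lambda> * (source n * q b)"
      using mode_test[OF q q0, of n] unfolding fq'(1) fq(2,3) qp integral_mult_right_zero
      by (simp add: t_def source_def I_def N_def mult.assoc)
    then have "of_real \<Lambda> * (I - \<i> * ?an * (\<i> * ?an * N) - of_real (k\<^sup>2) * N - \<i> * ?b * t) = of_real \<Lambda> * (source n * q b)"
      by (simp add: algebra_simps)
    then show ?thesis using \<Lambda> by (simp only: mult_cancel_left of_real_eq_0_iff) simp
  qed
  have b2: "?b * ?b = of_real (k\<^sup>2) - ?an * ?an"
    using beta_n_props(1)[of k \<Lambda> \<alpha> n] by (simp add: power2_eq_square)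
  have "(LINT y|lborel. (q' y - \<i> * ?b * q y) * (mode2 n y - \<i> * ?b * mode n y))
    = (LINT y|lborel. q' y * mode2 n y - \<i> * ?b * (q' y * mode n y) - \<i> * ?b * (q y * mode2 n y) - ?b * ?b * (q y * mode n y))"
    by (rule arg_cong[where f="integral\<^sup>L lborel"], rule ext) (simp add: algebra_simps)
  also have "\<dots> = I - \<i> * ?b * M - \<i> * ?b * J - ?b * ?b * N"
    unfolding I_def J_def M_def N_def
    by (subst Bochner_Integration.integral_diff, intro Bochner_Integration.integrable_diff integrable_mult_right fq fq', intro integrable_mult_right fq,
        subst Bochner_Integration.integral_diff, intro Bochner_Integration.integrable_diff integrable_mult_right fq fq', intro integrable_mult_right fq,
        subst Bochner_Integration.integral_diff, intro fq', intro integrable_mult_right fq') (simp only: integral_mult_right_zero)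
  also have "\<dots> = source n * q b" unfolding mt[symmetric] t b2 by (simp add: algebra_simps)
  finally show ?thesis .
qed

text \<open>
  In the mode equation one may take \<open>q = e\<^bsup>\<i> \<beta>\<^sub>n y\<^esup> Q\<close> with an arbitrary primitive \<open>Q\<close> that vanishes below \<open>m\<close>; then
  \<open>q' - \<i> \<beta>\<^sub>n q = e\<^bsup>\<i> \<beta>\<^sub>n y\<^esup> Q'\<close>, and \<open>Q'\<close> is an arbitrary continuous function. So \<open>e\<^bsup>\<i> \<beta>\<^sub>n y\<^esup>\<close> times the
  deviation from \<open>u\<^sub>n' = \<i> \<beta>\<^sub>n u\<^sub>n\<close> is constant.
\<close>

lemma modes_radiate:
  "AE y in lborel. y \<in> {m<..<b} \<longrightarrow> mode2 n y = \<i> * beta_n k \<Lambda> \<alpha> n * mode n y + source n * exp (\<i> * beta_n k \<Lambda> \<alpha> n * of_real (b - y))"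
proof -
  define B where "B = \<i> * beta_n k \<Lambda> \<alpha> n"
  define z where "z y = mode2 n y - B * mode n y" for y
  define E where "E y = exp (B * of_real y)" for y :: real
  have Ec: "continuous_on UNIV E" unfolding E_def by (intro continuous_intros)
  have Ed: "(E has_vector_derivative B * E t) (at t)" for t
    unfolding E_def using exp_line_deriv[of B t UNIV] by simp
  have Ez: "integrable lborel (\<lambda>y. E y * z y)"
  proof -
    have "integrable lborel (\<lambda>y. E y * mode2 n y)" "integrable lborel (\<lambda>y. E y * mode n y)"
      unfolding mode_def mode2_def UR_def UR2_def
      by (intro R_fubini(3) Ec UR_sq[unfolded UR_def UR2_def])+
    then have "integrable lborel (\<lambda>y. E y * mode2 n y - B * (E y * mode n y))" by auto
    then show ?thesis by (simp add: z_def algebra_simps)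
  qed
  have z0: "z y = 0" if "y \<notin> {m<..<b}" for y
    using that by (simp add: z_def mode_def mode2_def UR_def UR2_def R_def fourier_coeff_def zext_def)
  define W where "W = zext {m<..<b} (\<lambda>y. E y * z y - source n * E b)"
  have W_eq: "W = (\<lambda>y. E y * z y - source n * E b * indicator {m<..<b} y)"
    using z0 by (auto simp: W_def zext_def indicator_def)
  have indi: "integrable lborel (\<lambda>y. indicator {m<..<b} y :: complex)"
    by (rule integrable_real_indicator[THEN integrable_of_real, where 'a=complex, simplified of_real_indicator])
      (use m(1) in \<open>simp_all add: emeasure_lborel_Ioo\<close>)
  have Wi: "integrable lborel W" unfolding W_eq by (intro Bochner_Integration.integrable_diff Ez integrable_mult_right indi)
  have Wr: "(LINT y|lborel. W y * r y) = 0" if r: "continuous_on UNIV r" and r0: "\<And>y. y \<le> m \<Longrightarrow> r y = 0" for r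
  proof -
    obtain P where P: "\<And>x. (P has_vector_derivative r x) (at x)" using continuous_antiderivative[OF r] by blast
    define Q where "Q t = P t - P m" for t
    have Qd: "(Q has_vector_derivative r t) (at t)" for t
      unfolding Q_def using has_vector_derivative_diff[OF P[of t] has_vector_derivative_const[of "P m"]] by simp
    have Q0: "Q t = 0" if "t \<le> m" for t
    proof -
      have d: "(Q has_vector_derivative 0) (at x within {..m})" if "x \<in> {..m}" for x
        using has_vector_derivative_at_within[OF Qd[of x]] r0[of x] that by simp
      obtain c where "\<And>x. x \<in> {..m} \<Longrightarrow> Q x = c"
        using has_vector_derivative_zero_constant[OF convex_real_interval(2) d] by blast
      then have "\<And>x. x \<le> m \<Longrightarrow> Q x = c" by simp
      from this[OF that] this[of m] show ?thesis by (simp add: Q_def)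
    qed
    have Qb: "Q b = (LINT y|lborel. indicator {m<..<b} y * r y)"
    proof -
      have "AE t in lborel. t \<noteq> m \<and> t \<noteq> b"
        using AE_lborel_singleton[of m] AE_lborel_singleton[of b] by eventually_elim auto
      then have ae: "AE y in lborel. indicator {m<..<b} y * r y = indicator {m..b} y *\<^sub>R r y"
        by eventually_elim (auto simp: indicator_def)
      have [measurable]: "r \<in> borel_measurable borel" by (rule borel_measurable_continuous_onI[OF r])
      have "(LINT y|lborel. indicator {m<..<b} y * r y) = (LINT y|lborel. indicator {m..b} y *\<^sub>R r y)"
        by (rule integral_cong_AE) (use ae in simp_all)
      also have "\<dots> = Q b - Q m"
        by (rule integral_FTC_Icc) (use m(1) Qd r in \<open>auto intro: has_vector_derivative_at_within continuous_on_subset\<close>)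
      finally show ?thesis using Q0[of m] by simp
    qed
    have qd: "((\<lambda>t. E t * Q t) has_vector_derivative E t * r t + B * (E t * Q t)) (at t)" for t
      using has_vector_derivative_mult[OF Ed[of t] Qd[of t]] by (simp add: algebra_simps)
    have Qc: "continuous_on UNIV Q" using Qd by (auto intro!: continuous_at_imp_continuous_on dest: has_vector_derivative_continuous)
    have "(LINT y|lborel. ((E y * r y + B * (E y * Q y)) - B * (E y * Q y)) * z y) = source n * (E b * Q b)"
    proof -
      have "(LINT y|lborel. ((E y * r y + B * (E y * Q y)) - \<i> * beta_n k \<Lambda> \<alpha> n * (E y * Q y)) * (mode2 n y - \<i> * beta_n k \<Lambda> \<alpha> n * mode n y))
          = source n * (E b * Q b)"
        by (rule mode_equation[OF qd]) (use Q0 r0 in \<open>auto intro!: continuous_intros Ec r Qc\<close>)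
      then show ?thesis unfolding B_def z_def .
    qed
    then have 1: "(LINT y|lborel. E y * z y * r y) = source n * E b * Q b" by (simp add: mult_ac)
    obtain C where C: "\<And>y. y \<in> {m..b} \<Longrightarrow> norm (r y) \<le> C"
      using compact_imp_bounded[OF compact_continuous_image[OF continuous_on_subset[OF r] compact_Icc[of m b]]]
      unfolding bounded_iff by blast
    have [measurable]: "r \<in> borel_measurable borel" by (rule borel_measurable_continuous_onI[OF r])
    have bd: "integrable lborel (\<lambda>y. h y * r y)" if h: "integrable lborel h" "\<And>y. y \<notin> {m<..<b} \<Longrightarrow> h y = 0" for h :: "real \<Rightarrow> complex"
    proof (rule Bochner_Integration.integrable_bound)
      show "integrable lborel (\<lambda>y. C * norm (h y))" using h by auto
      show "(\<lambda>y. h y * r y) \<in> borel_measurable lborel" using borel_measurable_integrable[OF h(1)] by measurable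
      have "norm (h y * r y) \<le> norm (C * norm (h y))" for y
      proof (cases "y \<in> {m<..<b}")
        case True
        then have "norm (r y) \<le> C" by (intro C) auto
        then have "norm (h y) * norm (r y) \<le> norm (h y) * C" by (intro mult_left_mono) auto
        then show ?thesis by (simp add: norm_mult mult.commute)
      qed (simp add: h)
      then show "AE y in lborel. norm (h y * r y) \<le> norm (C * norm (h y))" by simp
    qed
    have i1: "integrable lborel (\<lambda>y. E y * z y * r y)" by (rule bd[OF Ez]) (simp add: z0)
    have i2: "integrable lborel (\<lambda>y. indicator {m<..<b} y * r y)" by (rule bd[OF indi]) simp
    have "(LINT y|lborel. W y * r y) = (LINT y|lborel. E y * z y * r y - source n * E b * (indicator {m<..<b} y * r y))"
      unfolding W_eq by (simp add: algebra_simps)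
    also have "\<dots> = source n * E b * Q b - source n * E b * (LINT y|lborel. indicator {m<..<b} y * r y)"
      using 1 i1 i2 by (simp only: Bochner_Integration.integral_diff integrable_mult_right integral_mult_right_zero)
    finally show ?thesis unfolding Qb by simp
  qed
  have "AE y in lborel. W y = 0"
  proof (rule AE_zero_if_box_integrals_zero[OF Wi])
    fix s t :: real
    \<comment> \<open>The lower end \<open>max s m\<close> makes the bumps vanish below \<open>m\<close>, where \<open>W\<close> is zero anyway.\<close>
    let ?r = "\<lambda>j y. complex_of_real (bump (max s m) t j y)"
    have lim: "(\<lambda>j. LINT y|lborel. W y * ?r (Suc j) y) \<longlonglongrightarrow> (LINT y|lborel. W y * indicator {max s m<..<t} y)"
    proof (rule integral_dominated_convergence[where w="\<lambda>y. norm (W y)"])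
      show "(\<lambda>y. W y * indicator {max s m<..<t} y) \<in> borel_measurable lborel" using borel_measurable_integrable[OF Wi] by measurable
      show "(\<lambda>y. W y * ?r (Suc j) y) \<in> borel_measurable lborel" for j
        using borel_measurable_integrable[OF Wi] borel_measurable_continuous_onI[OF bump_continuous[of "max s m" t "Suc j"]] by measurable
      have "(\<lambda>j. W y * ?r (Suc j) y) \<longlonglongrightarrow> W y * of_real (indicator {max s m<..<t} y)" for y
        by (intro tendsto_mult tendsto_const tendsto_of_real LIMSEQ_Suc bump_tendsto)
      then show "AE y in lborel. (\<lambda>j. W y * ?r (Suc j) y) \<longlonglongrightarrow> W y * indicator {max s m<..<t} y" by (simp add: of_real_indicator)
      show "AE y in lborel. norm (W y * ?r (Suc j) y) \<le> norm (W y)" for j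
        using bump_bounds[of "max s m" t "Suc j"] by (auto simp: norm_mult intro!: AE_I2 mult_left_le)
      show "integrable lborel (\<lambda>y. norm (W y))" using Wi by auto
    qed
    have zero: "(LINT y|lborel. W y * ?r (Suc j) y) = 0" for j
    proof (rule Wr)
      show "continuous_on UNIV (?r (Suc j))" by (intro continuous_intros bump_continuous)
      show "?r (Suc j) y = 0" if "y \<le> m" for y
      proof -
        have "0 < 1 / real (Suc j)" by simp
        then have "y < max s m + 1 / real (Suc j)" using that max.cobounded2[of m s] by linarith
        then have "bump (max s m) t (Suc j) y = 0" by (rule bump_outside[OF zero_less_Suc disjI1])
        then show ?thesis by (simp only: of_real_0)
      qed
    qed
    have "(LINT y|lborel. W y * indicator {max s m<..<t} y) = 0"
      using LIMSEQ_unique[OF lim[unfolded zero] tendsto_const] .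
    moreover have "W y * indicator {max s m<..<t} y = indicator (box s t) y *\<^sub>R W y" for y
      by (auto simp: W_def zext_def indicator_def)
    ultimately show "(LINT y:box s t|lborel. W y) = 0" unfolding set_lebesgue_integral_def by simp
  qed
  then show ?thesis
  proof eventually_elim
    case (elim y)
    show ?case
    proof
      assume "y \<in> {m<..<b}"
      then have "E y * z y = source n * E b" using elim by (simp add: W_def)
      moreover have "E b = E y * exp (B * of_real (b - y))" by (simp add: E_def mult_exp_exp algebra_simps)
      moreover have "E y \<noteq> 0" by (simp add: E_def)
      ultimately have "z y = source n * exp (B * of_real (b - y))" by (simp add: field_simps)
      then show "mode2 n y = \<i> * beta_n k \<Lambda> \<alpha> n * mode n y + source n * exp (\<i> * beta_n k \<Lambda> \<alpha> n * of_real (b - y))"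
        unfolding B_def[symmetric] z_def by (simp add: algebra_simps)
    qed
  qed
qed

lemma beta_n_0: "beta_n k \<Lambda> \<alpha> 0 = of_real \<beta>"
proof -
  have "k\<^sup>2 - (alpha_n \<Lambda> \<alpha> 0)\<^sup>2 = \<beta>\<^sup>2"
    by (simp add: alpha_n_def \<alpha>_def \<beta>_def power_mult_distrib sin_squared_eq algebra_simps)
  then show ?thesis unfolding beta_n_def using \<beta>_pos by simp
qed

text \<open>
  Its imaginary part is the energy flux through the horizontal line at height \<open>y\<close>.
\<close>

definition flux :: "real \<Rightarrow> complex" where "flux y = (LINT x|lborel. UR2 (x, y) * cnj (UR (x, y)))"

lemma slices_approximable:
  "AE y in lborel. y \<in> {m<..<b} \<longrightarrow> trig_approximable \<Lambda> \<alpha> (\<lambda>x. UR (x, y)) \<and>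
    trig_approximable \<Lambda> \<alpha> (\<lambda>x. UR1 (x, y)) \<and> trig_approximable \<Lambda> \<alpha> (\<lambda>x. UR2 (x, y))"
proof -
  obtain \<psi> where "H1_lim \<Omega> \<psi> u (weak_deriv \<Omega> (1, 0) u) (weak_deriv \<Omega> (0, 1) u)" using approximants by blast
  then have C: "\<And>j. C1 (\<psi> j)" and l: "L2_lim lborel (\<lambda>j. zext \<Omega> (\<psi> j)) (zext \<Omega> u)"
    "L2_lim lborel (\<lambda>j. zext \<Omega> (d1 (\<psi> j))) (zext \<Omega> (weak_deriv \<Omega> (1, 0) u))"
    "L2_lim lborel (\<lambda>j. zext \<Omega> (d2 (\<psi> j))) (zext \<Omega> (weak_deriv \<Omega> (0, 1) u))"
    unfolding H1_lim_def by blast+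
  have "AE y in lborel. y \<in> {m<..<b} \<longrightarrow> trig_approximable \<Lambda> \<alpha> (\<lambda>x. UR (x, y))"
    unfolding UR_def by (rule slice_approximable[OF L2_lim_R[OF l(1)]]) (rule C1_continuous(1)[OF C])
  moreover have "AE y in lborel. y \<in> {m<..<b} \<longrightarrow> trig_approximable \<Lambda> \<alpha> (\<lambda>x. UR1 (x, y))"
    unfolding UR1_def by (rule slice_approximable[OF L2_lim_R[OF l(2)]]) (rule C1_continuous(2)[OF C])
  moreover have "AE y in lborel. y \<in> {m<..<b} \<longrightarrow> trig_approximable \<Lambda> \<alpha> (\<lambda>x. UR2 (x, y))"
    unfolding UR2_def by (rule slice_approximable[OF L2_lim_R[OF l(3)]]) (rule C1_continuous(3)[OF C])
  ultimately show ?thesis by eventually_elim auto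
qed

text \<open>
  The inequalities for finitely many modes, with \<open>\<zeta>\<close> the contribution of the incident wave, multiplied by \<open>\<Lambda>\<close> and passed to the
  limit by Parseval's formula.
\<close>

lemma strip_inequalities:
  "AE y in lborel. y \<in> {m<..<b} \<longrightarrow>
     Im (flux y) \<ge> - 2 * \<Lambda> * \<beta> \<and> Re (flux y) \<le> Im (flux y) + 4 * \<Lambda> * \<beta> \<and>
     sq_norm lborel (\<lambda>x. UR2 (x, y)) - sq_norm lborel (\<lambda>x. UR1 (x, y)) + k\<^sup>2 * sq_norm lborel (\<lambda>x. UR (x, y))
       \<le> 6 * k * (Im (flux y) + 2 * \<Lambda> * \<beta>) + 8 * \<Lambda> * k\<^sup>2"
proof -
  have "AE y in lborel. \<forall>n. y \<in> {m<..<b} \<longrightarrow> mode2 n y = \<i> * beta_n k \<Lambda> \<alpha> n * mode n y + source n * exp (\<i> * beta_n k \<Lambda> \<alpha> n * of_real (b - y))"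
    unfolding AE_all_countable using modes_radiate by blast
  moreover have "AE y in lborel. \<forall>n. mode1 n y = \<i> * of_real (alpha_n \<Lambda> \<alpha> n) * mode n y"
    unfolding AE_all_countable using quasiperiodic_modes by blast
  ultimately show ?thesis using slices_approximable slices
  proof eventually_elim
    case (elim y)
    show ?case
    proof (rule impI)
      assume y: "y \<in> {m<..<b}"
      define \<zeta> where "\<zeta> = source 0 * exp (\<i> * beta_n k \<Lambda> \<alpha> 0 * of_real (b - y))"
      have \<zeta>: "cmod \<zeta> = 2 * \<beta>" using \<beta>_pos by (simp add: \<zeta>_def source_def norm_mult beta_n_0)
      have c: "mode2 n y = \<i> * beta_n k \<Lambda> \<alpha> n * mode n y" if "n \<noteq> 0" for n
        using elim(1) y that by (simp add: source_def)
      have c0: "mode2 0 y = \<i> * of_real \<beta> * mode 0 y + \<zeta>"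
        using elim(1) y by (simp add: \<zeta>_def beta_n_0)
      let ?A = "\<lambda>N::nat. {- int N..int N}"
      define F where "F N = (\<Sum>n\<in>?A N. mode2 n y * cnj (mode n y))" for N
      note ineq = mode_inequalities[of k \<Lambda> \<alpha> \<beta> "\<lambda>n. mode2 n y" "\<lambda>n. mode n y" \<zeta> "\<lambda>n. mode1 n y", OF k beta_n_0 \<beta>_pos c c0 \<zeta> elim(2)[rule_format]]
      have i1: "- 2 * \<beta> \<le> Im (F N)" and i2: "Re (F N) \<le> Im (F N) + 4 * \<beta>"
        and i3: "(\<Sum>n\<in>?A N. (cmod (mode2 n y))\<^sup>2) - (\<Sum>n\<in>?A N. (cmod (mode1 n y))\<^sup>2) + k\<^sup>2 * (\<Sum>n\<in>?A N. (cmod (mode n y))\<^sup>2)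
            \<le> 6 * k * (Im (F N) + 2 * \<beta>) + 8 * k\<^sup>2" for N
        using ineq[of "?A N"] unfolding F_def by auto
      have ap: "trig_approximable \<Lambda> \<alpha> (\<lambda>x. UR (x, y))" "trig_approximable \<Lambda> \<alpha> (\<lambda>x. UR1 (x, y))" "trig_approximable \<Lambda> \<alpha> (\<lambda>x. UR2 (x, y))"
        using elim(3) y by auto
      have "(\<lambda>N. of_real \<Lambda> * F N) \<longlonglongrightarrow> flux y"
        using Parseval_inner[OF \<Lambda> ap(3), of "\<lambda>x. UR (x, y)"] elim(4) unfolding F_def flux_def mode_def mode2_def by blast
      from tendsto_Re[OF this] tendsto_Im[OF this]
      have l: "(\<lambda>N. \<Lambda> * Re (F N)) \<longlonglongrightarrow> Re (flux y)" "(\<lambda>N. \<Lambda> * Im (F N)) \<longlonglongrightarrow> Im (flux y)" by simp_all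
      note P = Parseval[OF \<Lambda> ap(1), folded mode_def] Parseval[OF \<Lambda> ap(2), folded mode1_def] Parseval[OF \<Lambda> ap(3), folded mode2_def]
      have "- 2 * \<Lambda> * \<beta> \<le> Im (flux y)"
      proof (rule LIMSEQ_le_const[OF l(2)], intro exI allI impI)
        fix N show "- 2 * \<Lambda> * \<beta> \<le> \<Lambda> * Im (F N)" using mult_left_mono[OF i1[of N], of \<Lambda>] \<Lambda> by (simp add: algebra_simps)
      qed
      moreover have "Re (flux y) \<le> Im (flux y) + 4 * \<Lambda> * \<beta>"
      proof (rule LIMSEQ_le[OF l(1) tendsto_add[OF l(2) tendsto_const]], intro exI allI impI)
        fix N show "\<Lambda> * Re (F N) \<le> \<Lambda> * Im (F N) + 4 * \<Lambda> * \<beta>" using mult_left_mono[OF i2[of N], of \<Lambda>] \<Lambda> by (simp add: algebra_simps)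
      qed
      moreover have "sq_norm lborel (\<lambda>x. UR2 (x, y)) - sq_norm lborel (\<lambda>x. UR1 (x, y)) + k\<^sup>2 * sq_norm lborel (\<lambda>x. UR (x, y))
         \<le> 6 * k * (Im (flux y) + 2 * \<Lambda> * \<beta>) + 8 * \<Lambda> * k\<^sup>2"
      proof (rule LIMSEQ_le[OF tendsto_add[OF tendsto_diff[OF P(3) P(2)] tendsto_mult[OF tendsto_const P(1)]]
            tendsto_add[OF tendsto_mult[OF tendsto_const tendsto_add[OF l(2) tendsto_const]] tendsto_const]], intro exI allI impI)
        fix N
        show "\<Lambda> * (\<Sum>n\<in>?A N. (cmod (mode2 n y))\<^sup>2) - \<Lambda> * (\<Sum>n\<in>?A N. (cmod (mode1 n y))\<^sup>2) + k\<^sup>2 * (\<Lambda> * (\<Sum>n\<in>?A N. (cmod (mode n y))\<^sup>2))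
            \<le> 6 * k * (\<Lambda> * Im (F N) + 2 * \<Lambda> * \<beta>) + 8 * \<Lambda> * k\<^sup>2"
          using mult_left_mono[OF i3[of N], of \<Lambda>] \<Lambda> by (simp add: algebra_simps)
      qed
      ultimately show "Im (flux y) \<ge> - 2 * \<Lambda> * \<beta> \<and> Re (flux y) \<le> Im (flux y) + 4 * \<Lambda> * \<beta> \<and>
        sq_norm lborel (\<lambda>x. UR2 (x, y)) - sq_norm lborel (\<lambda>x. UR1 (x, y)) + k\<^sup>2 * sq_norm lborel (\<lambda>x. UR (x, y))
       \<le> 6 * k * (Im (flux y) + 2 * \<Lambda> * \<beta>) + 8 * \<Lambda> * k\<^sup>2" by blast
    qed
  qed
qed

end

context scattering
begin

section \<open>The a priori bound\<close>

lemma strip_weights: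
  assumes q: "continuous_on UNIV q" and q0: "\<And>y. y \<le> m \<Longrightarrow> q y = (0 :: real)"
  shows "(LINT z|lborel. (of_real (q (snd z)) * U2 z) * cnj (U z)) = (LINT y|lborel. of_real (q y) * flux y)"
    "integrable lborel (\<lambda>y. of_real (q y) * flux y)"
    "(LINT z|lborel. q (snd z) * (cmod (U z))\<^sup>2) = (LINT y|lborel. q y * sq_norm lborel (\<lambda>x. UR (x, y)))"
    "integrable lborel (\<lambda>y. q y * sq_norm lborel (\<lambda>x. UR (x, y)))"
    "(LINT z|lborel. q (snd z) * (cmod (U1 z))\<^sup>2) = (LINT y|lborel. q y * sq_norm lborel (\<lambda>x. UR1 (x, y)))"
    "integrable lborel (\<lambda>y. q y * sq_norm lborel (\<lambda>x. UR1 (x, y)))"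
    "(LINT z|lborel. q (snd z) * (cmod (U2 z))\<^sup>2) = (LINT y|lborel. q y * sq_norm lborel (\<lambda>x. UR2 (x, y)))"
    "integrable lborel (\<lambda>y. q y * sq_norm lborel (\<lambda>x. UR2 (x, y)))"
proof -
  have qc: "continuous_on UNIV (\<lambda>x::real\<times>real. complex_of_real (q (snd x)))"
    by (intro continuous_intros continuous_on_compose2[OF q]) auto
  have strip: "U (x, y) = UR (x, y)" "U1 (x, y) = UR1 (x, y)" "U2 (x, y) = UR2 (x, y)" if "y > m" for x y
  proof -
    have "(x, y) \<in> R \<longleftrightarrow> (x, y) \<in> \<Omega>" using that m(2)[of x] by (auto simp: R_def \<Omega>_iff)
    then show "U (x, y) = UR (x, y)" "U1 (x, y) = UR1 (x, y)" "U2 (x, y) = UR2 (x, y)"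
      unfolding UR_zext using U_out by (auto simp: zext_def indicator_def)
  qed
  have i: "integrable lborel (\<lambda>z. (of_real (q (snd z)) * U2 z) * cnj (U z))"
    by (intro sq_int_mult_integrable weighted_sq sq_int_cnj U_sq qc) simp
  have e: "(LINT x|lborel. (of_real (q (snd (x, y))) * U2 (x, y)) * cnj (U (x, y))) = of_real (q y) * flux y" for y
  proof (cases "y \<le> m")
    case False
    then show ?thesis by (simp add: strip flux_def mult.assoc)
  qed (simp add: q0)
  show "(LINT z|lborel. (of_real (q (snd z)) * U2 z) * cnj (U z)) = (LINT y|lborel. of_real (q y) * flux y)"
    using integral_plane_snd(1)[OF i] unfolding e .
  show "integrable lborel (\<lambda>y. of_real (q y) * flux y)" using integral_plane_snd(2)[OF i] unfolding e .
  have sq: "(LINT z|lborel. q (snd z) * (cmod (Z z))\<^sup>2) = (LINT y|lborel. q y * sq_norm lborel (\<lambda>x. ZR (x, y)))"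
    "integrable lborel (\<lambda>y. q y * sq_norm lborel (\<lambda>x. ZR (x, y)))"
    if Z: "Z \<in> {U, U1, U2}" and ZR: "\<And>x y. y > m \<Longrightarrow> Z (x, y) = ZR (x, y)" for Z ZR
  proof -
    note i = weighted_integrable(1)[OF Z qc]
    have e: "(LINT x|lborel. q (snd (x, y)) * (cmod (Z (x, y)))\<^sup>2) = q y * sq_norm lborel (\<lambda>x. ZR (x, y))" for y
    proof (cases "y \<le> m")
      case False
      then show ?thesis by (simp add: ZR sq_norm_def)
    qed (simp add: q0)
    show "(LINT z|lborel. q (snd z) * (cmod (Z z))\<^sup>2) = (LINT y|lborel. q y * sq_norm lborel (\<lambda>x. ZR (x, y)))"
      using integral_plane_snd(1)[OF i] unfolding e .
    show "integrable lborel (\<lambda>y. q y * sq_norm lborel (\<lambda>x. ZR (x, y)))" using integral_plane_snd(2)[OF i] unfolding e .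
  qed
  show "(LINT z|lborel. q (snd z) * (cmod (U z))\<^sup>2) = (LINT y|lborel. q y * sq_norm lborel (\<lambda>x. UR (x, y)))"
    "integrable lborel (\<lambda>y. q y * sq_norm lborel (\<lambda>x. UR (x, y)))"
    by (rule sq[of U]; simp add: strip)+
  show "(LINT z|lborel. q (snd z) * (cmod (U1 z))\<^sup>2) = (LINT y|lborel. q y * sq_norm lborel (\<lambda>x. UR1 (x, y)))"
    "integrable lborel (\<lambda>y. q y * sq_norm lborel (\<lambda>x. UR1 (x, y)))"
    by (rule sq[of U1]; simp add: strip)+
  show "(LINT z|lborel. q (snd z) * (cmod (U2 z))\<^sup>2) = (LINT y|lborel. q y * sq_norm lborel (\<lambda>x. UR2 (x, y)))"
    "integrable lborel (\<lambda>y. q y * sq_norm lborel (\<lambda>x. UR2 (x, y)))"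
    by (rule sq[of U2]; simp add: strip)+
qed

lemma strip_zero: "y \<notin> {m<..<b} \<Longrightarrow> UR (x, y) = 0" "y \<notin> {m<..<b} \<Longrightarrow> UR1 (x, y) = 0" "y \<notin> {m<..<b} \<Longrightarrow> UR2 (x, y) = 0"
  by (auto simp: UR_def UR1_def UR2_def R_def zext_def indicator_def)

text \<open>
  The profile \<open>p\<close>: it is 1 below \<open>t\<close> and falls to 0 at \<open>b\<close>; \<open>slope\<close> is its negative derivative, a probability density
  on \<open>{t..b}\<close>.
\<close>

definition ramp :: "real \<Rightarrow> real \<Rightarrow> real" where "ramp t y = 1 - pos2 ((y - t) / (b - t))"

definition slope :: "real \<Rightarrow> real \<Rightarrow> real" where "slope t y = 2 * max 0 ((y - t) / (b - t)) / (b - t)"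

lemma ramp_deriv: "t < b \<Longrightarrow> (ramp t has_real_derivative - slope t y) (at y)"
  unfolding ramp_def[abs_def] slope_def by (auto intro!: derivative_eq_intros)

lemma slope_continuous: "t < b \<Longrightarrow> continuous_on S (slope t)"
  unfolding slope_def[abs_def] by (intro continuous_intros) auto

lemma slope_nonneg: "t < b \<Longrightarrow> 0 \<le> slope t y" by (simp add: slope_def)

lemma slope_below: "t < b \<Longrightarrow> y \<le> t \<Longrightarrow> slope t y = 0" by (simp add: slope_def divide_nonpos_pos)

lemma ramp_end: "t < b \<Longrightarrow> ramp t b = 0" by (simp add: ramp_def)

lemma ramp_below: "t < b \<Longrightarrow> y \<le> t \<Longrightarrow> ramp t y = 1" by (simp add: ramp_def divide_nonpos_pos)

lemma ramp_bounds:
  assumes "t < b" "y \<le> b" shows "0 \<le> ramp t y" "ramp t y \<le> 1"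
proof -
  have "max 0 ((y - t) / (b - t)) \<le> 1" using assms by (simp add: divide_le_eq_1)
  then have "(max 0 ((y - t) / (b - t)))\<^sup>2 \<le> 1" by (intro power_le_one) auto
  then show "0 \<le> ramp t y" "ramp t y \<le> 1" by (simp_all add: ramp_def pos2_def)
qed

lemma slope_integral:
  assumes t: "m \<le> t" "t < b"
  shows "integrable lborel (\<lambda>y. indicator {m<..<b} y * slope t y)" "(LINT y|lborel. indicator {m<..<b} y * slope t y) = 1"
proof -
  have [measurable]: "slope t \<in> borel_measurable borel" by (rule borel_measurable_continuous_onI[OF slope_continuous[OF t(2)]])
  have "AE y in lborel. y \<noteq> m \<and> y \<noteq> b"
    using AE_lborel_singleton[of m] AE_lborel_singleton[of b] by eventually_elim auto
  then have ae: "AE y in lborel. indicator {m..b} y *\<^sub>R slope t y = indicator {m<..<b} y * slope t y"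
    by eventually_elim (auto simp: indicator_def)
  have d: "((\<lambda>y. - ramp t y) has_vector_derivative slope t y) (at y within {m..b})" for y
    using DERIV_minus[OF ramp_deriv[OF t(2), of y]]
    by (auto simp: has_real_derivative_iff_has_vector_derivative intro: has_vector_derivative_at_within)
  have "integrable lborel (\<lambda>y. indicator {m..b} y *\<^sub>R slope t y)"
    using borel_integrable_atLeastAtMost'[OF slope_continuous[OF t(2)], of m b] by (simp add: set_integrable_def)
  then show "integrable lborel (\<lambda>y. indicator {m<..<b} y * slope t y)"
    by (rule integrable_cong_AE_imp) (use ae in auto)
  have "(LINT y|lborel. indicator {m<..<b} y * slope t y) = (LINT y|lborel. indicator {m..b} y *\<^sub>R slope t y)"
    by (rule integral_cong_AE) (use ae in auto)
  also have "\<dots> = - ramp t b - - ramp t m"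
    by (rule integral_FTC_Icc) (use m(1) d slope_continuous[OF t(2)] in auto)
  also have "\<dots> = 1" using t ramp_end ramp_below by simp
  finally show "(LINT y|lborel. indicator {m<..<b} y * slope t y) = 1" .
qed

lemma beta_le_k: "\<beta> \<le> k" using k cos_le_one[of \<theta>] by (simp add: \<beta>_def mult_left_le)

text \<open>
  The averages of \<open>Im (flux y)\<close> against the slope vanish by the imaginary part of the energy identity, so the inequalities on
  almost every horizontal line integrate to bounds by the data. For the second estimate the Rellich inequality is used with the
  weight \<open>(y - c) p(y)\<close>, whose derivative is \<open>p\<close> minus a multiple of the slope.
\<close>

lemma ramp_estimates:
  assumes t: "m \<le> t" "t < b" and c: "\<And>x. x \<in> {0..\<Lambda>} \<Longrightarrow> c < f x"
  shows "(LINT z|lborel. ramp t (snd z) * energy z) \<le> 4 * \<Lambda> * \<beta>"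
    and "2 * (LINT z|lborel. ramp t (snd z) * (cmod (U2 z))\<^sup>2) \<le> 4 * \<Lambda> * \<beta> + 20 * \<Lambda> * k\<^sup>2 * (b - c)"
proof -
  note tb = t(2)
  let ?p = "ramp t" and ?q = "slope t"
  let ?qs = "\<lambda>y. indicator {m<..<b} y * ?q y"
  have cb: "c < b" using c[of 0] below[of 0] \<Lambda> by simp
  have q0: "?q y = 0" if "y \<le> m" for y using slope_below[OF tb] that t by simp
  note qc = slope_continuous[OF tb]
  note qI = slope_integral[OF t]
  note W = strip_weights[OF qc q0]
  have cq: "continuous_on UNIV (\<lambda>y. (y - c) * ?q y)" by (intro continuous_intros qc)
  note V = strip_weights[OF cq]
  have V0: "(y - c) * ?q y = 0" if "y \<le> m" for y using q0[OF that] by simp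
  note V = strip_weights[OF cq V0]
  define Fl where "Fl = (LINT y|lborel. of_real (?q y) * flux y)"
  have E: "of_real (LINT z|lborel. ?p (snd z) * energy z) = Fl"
  proof -
    have "of_real (LINT z|lborel. ?p (snd z) * energy z) + (LINT z|lborel. (of_real (- ?q (snd z)) * U2 z) * cnj (U z)) = 0"
      by (rule energy_identity) (use ramp_deriv[OF tb] ramp_end[OF tb] in \<open>auto intro!: continuous_intros qc\<close>)
    moreover have "(LINT z|lborel. (of_real (- ?q (snd z)) * U2 z) * cnj (U z)) = - Fl"
      using W(1) by (simp add: Fl_def)
    ultimately show ?thesis by simp
  qed
  have Fi: "integrable lborel (\<lambda>y. ?q y * Re (flux y))" "(LINT y|lborel. ?q y * Re (flux y)) = Re Fl"
    "integrable lborel (\<lambda>y. ?q y * Im (flux y))" "(LINT y|lborel. ?q y * Im (flux y)) = Im Fl"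
    using integrable_Re[OF W(2)] integral_Re[OF W(2)] integrable_Im[OF W(2)] integral_Im[OF W(2)] by (simp_all add: Fl_def)
  have Im0: "Im Fl = 0" and ReF: "Re Fl = (LINT z|lborel. ?p (snd z) * energy z)" unfolding E[symmetric] by simp_all
  have fz: "flux y = 0" if "y \<notin> {m<..<b}" for y unfolding flux_def using strip_zero[OF that] by simp
  have "Re Fl \<le> (LINT y|lborel. ?q y * Im (flux y) + 4 * \<Lambda> * \<beta> * ?qs y)"
    unfolding Fi(2)[symmetric]
  proof (rule integral_mono_AE)
    show "AE y in lborel. ?q y * Re (flux y) \<le> ?q y * Im (flux y) + 4 * \<Lambda> * \<beta> * ?qs y"
      using strip_inequalities
    proof eventually_elim
      case (elim y)
      show ?case
      proof (cases "y \<in> {m<..<b}")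
        case True
        then have "?q y * Re (flux y) \<le> ?q y * (Im (flux y) + 4 * \<Lambda> * \<beta>)"
          using elim slope_nonneg[OF tb, of y] by (intro mult_left_mono) auto
        then show ?thesis using True by (simp add: algebra_simps)
      qed (simp add: fz)
    qed
  qed (intro Bochner_Integration.integrable_add integrable_mult_right Fi qI)+
  also have "\<dots> = 4 * \<Lambda> * \<beta>"
  proof -
    have "integrable lborel (\<lambda>y. 4 * \<Lambda> * \<beta> * ?qs y)" by (intro integrable_mult_right qI)
    then show ?thesis by (simp only: Bochner_Integration.integral_add[OF Fi(3)] Fi(4) Im0 integral_mult_right_zero qI(2))
  qed
  finally show 1: "(LINT z|lborel. ?p (snd z) * energy z) \<le> 4 * \<Lambda> * \<beta>" unfolding ReF .
  have pc: "continuous_on UNIV (\<lambda>x::real\<times>real. complex_of_real (?p (snd x)))" by (rule C1_real_cont[OF ramp_deriv[OF tb]])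
  have vc: "continuous_on UNIV (\<lambda>x::real\<times>real. complex_of_real ((snd x - c) * ?q (snd x)))"
    by (intro continuous_intros continuous_on_compose2[OF cq]) auto
  have R: "2 * (LINT z|lborel. (?p (snd z) - (snd z - c) * ?q (snd z)) * (cmod (U2 z))\<^sup>2)
      \<le> (LINT z|lborel. (?p (snd z) - (snd z - c) * ?q (snd z)) * energy z)"
  proof (rule Rellich_inequality[where p="\<lambda>y. (y - c) * ?p y" and c=c])
    show "((\<lambda>y. (y - c) * ?p y) has_real_derivative ?p y - (y - c) * ?q y) (at y)" for y
      by (auto intro!: derivative_eq_intros ramp_deriv[OF tb])
    have "continuous_on UNIV ?p" using ramp_deriv[OF tb] by (auto intro!: continuous_at_imp_continuous_on DERIV_isCont)
    then show "continuous_on UNIV (\<lambda>y. ?p y - (y - c) * ?q y)" by (intro continuous_intros qc)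
    show "0 \<le> (y - c) * ?p y" if "c \<le> y" "y \<le> b" for y using ramp_bounds(1)[OF tb that(2)] that by simp
  qed (use c ramp_end[OF tb] in auto)
  define A where "A = (LINT z|lborel. ?p (snd z) * (cmod (U2 z))\<^sup>2)"
  define B0 where "B0 = (LINT z|lborel. (snd z - c) * ?q (snd z) * (cmod (U z))\<^sup>2)"
  define B1 where "B1 = (LINT z|lborel. (snd z - c) * ?q (snd z) * (cmod (U1 z))\<^sup>2)"
  define B2 where "B2 = (LINT z|lborel. (snd z - c) * ?q (snd z) * (cmod (U2 z))\<^sup>2)"
  have l: "(LINT z|lborel. (?p (snd z) - (snd z - c) * ?q (snd z)) * (cmod (U2 z))\<^sup>2) = A - B2"
    unfolding A_def B2_def left_diff_distrib[of "?p _"]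
    by (rule Bochner_Integration.integral_diff; rule weighted_integrable(1); (rule pc vc | simp))
  have r: "(LINT z|lborel. (?p (snd z) - (snd z - c) * ?q (snd z)) * energy z) = (LINT z|lborel. ?p (snd z) * energy z) - (B1 + B2 - k\<^sup>2 * B0)"
    unfolding B0_def B1_def B2_def energy_integrable(2)[OF vc, symmetric] left_diff_distrib[of "?p _"]
    by (rule Bochner_Integration.integral_diff) (rule energy_integrable(1)[OF pc] energy_integrable(1)[OF vc])+
  let ?J = "\<lambda>y. sq_norm lborel (\<lambda>x. UR2 (x, y)) - sq_norm lborel (\<lambda>x. UR1 (x, y)) + k\<^sup>2 * sq_norm lborel (\<lambda>x. UR (x, y))"
  have J: "(y - c) * ?q y * ?J y = (y - c) * ?q y * sq_norm lborel (\<lambda>x. UR2 (x, y)) - (y - c) * ?q y * sq_norm lborel (\<lambda>x. UR1 (x, y))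
      + k\<^sup>2 * ((y - c) * ?q y * sq_norm lborel (\<lambda>x. UR (x, y)))" for y by (simp add: algebra_simps)
  have Ji: "integrable lborel (\<lambda>y. (y - c) * ?q y * ?J y)"
    unfolding J by (intro Bochner_Integration.integrable_add Bochner_Integration.integrable_diff integrable_mult_right V)
  have "B2 - B1 + k\<^sup>2 * B0 = (LINT y|lborel. (y - c) * ?q y * ?J y)"
    unfolding J B0_def B1_def B2_def using V(3-8) by simp
  also have "\<dots> \<le> (LINT y|lborel. (b - c) * (6 * k * (?q y * Im (flux y)) + (12 * k * \<Lambda> * \<beta> + 8 * \<Lambda> * k\<^sup>2) * ?qs y))"
  proof (rule integral_mono_AE[OF Ji])
    show "integrable lborel (\<lambda>y. (b - c) * (6 * k * (?q y * Im (flux y)) + (12 * k * \<Lambda> * \<beta> + 8 * \<Lambda> * k\<^sup>2) * ?qs y))"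
      by (intro integrable_mult_right Bochner_Integration.integrable_add Fi qI)
    show "AE y in lborel. (y - c) * ?q y * ?J y \<le> (b - c) * (6 * k * (?q y * Im (flux y)) + (12 * k * \<Lambda> * \<beta> + 8 * \<Lambda> * k\<^sup>2) * ?qs y)"
      using strip_inequalities
    proof eventually_elim
      case (elim y)
      show ?case
      proof (cases "y \<in> {m<..<b}")
        case True
        \<comment> \<open>The bound is nonnegative, so the factor \<open>y - c\<close> may be replaced by \<open>b - c\<close>.\<close>
        let ?X = "6 * k * (Im (flux y) + 2 * \<Lambda> * \<beta>) + 8 * \<Lambda> * k\<^sup>2"
        have JX: "?J y \<le> ?X" and X: "0 \<le> ?X" using elim True k \<Lambda> by auto
        have "c \<le> y" using c[of 0] m(2)[of 0] \<Lambda> True by auto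
        then have "(y - c) * ?q y * ?J y \<le> (y - c) * ?q y * ?X"
          using slope_nonneg[OF tb, of y] by (intro mult_left_mono JX) auto
        also have "\<dots> \<le> (b - c) * ?q y * ?X"
          using slope_nonneg[OF tb, of y] True by (intro mult_right_mono X) auto
        finally show ?thesis using True by (simp add: algebra_simps)
      next
        case False
        then have "?J y = 0" unfolding sq_norm_def using strip_zero[OF False] by simp
        then show ?thesis using False by (simp add: fz)
      qed
    qed
  qed
  also have "\<dots> = (b - c) * (12 * k * \<Lambda> * \<beta> + 8 * \<Lambda> * k\<^sup>2)"
  proof -
    have "integrable lborel (\<lambda>y. 6 * k * (?q y * Im (flux y)))" "integrable lborel (\<lambda>y. (12 * k * \<Lambda> * \<beta> + 8 * \<Lambda> * k\<^sup>2) * ?qs y)"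
      by (intro integrable_mult_right Fi qI)+
    then show ?thesis
      by (simp only: integral_mult_right_zero Bochner_Integration.integral_add Fi(4) Im0 qI(2) mult_zero_right add_0 mult_1_right)
  qed
  also have "\<dots> \<le> (b - c) * (20 * \<Lambda> * k\<^sup>2)"
  proof -
    have "(k * \<Lambda>) * \<beta> \<le> (k * \<Lambda>) * k" using beta_le_k k \<Lambda> by (intro mult_left_mono) auto
    then show ?thesis using cb by (intro mult_left_mono) (auto simp: power2_eq_square algebra_simps)
  qed
  finally show "2 * (LINT z|lborel. ?p (snd z) * (cmod (U2 z))\<^sup>2) \<le> 4 * \<Lambda> * \<beta> + 20 * \<Lambda> * k\<^sup>2 * (b - c)"
    using R 1 unfolding l r A_def[symmetric] by (simp add: algebra_simps)
qed

lemma ramp_limit: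
  assumes Z: "Z \<in> {U, U1, U2}"
  shows "(\<lambda>j. LINT z|lborel. ramp (b - (b - m) / real (Suc j)) (snd z) * (cmod (Z z))\<^sup>2) \<longlonglongrightarrow> sq_norm lborel Z"
  unfolding sq_norm_def
proof (rule integral_dominated_convergence[where w="\<lambda>z. (cmod (Z z))\<^sup>2"])
  let ?t = "\<lambda>j. b - (b - m) / real (Suc j)"
  have t: "?t j < b" for j using m(1) by simp
  have S: "sq_int lborel Z" using Z U_sq by auto
  show "integrable lborel (\<lambda>z. (cmod (Z z))\<^sup>2)" using S by (rule sq_int_integrable)
  then show "(\<lambda>z. (cmod (Z z))\<^sup>2) \<in> borel_measurable lborel" by auto
  show "(\<lambda>z. ramp (?t j) (snd z) * (cmod (Z z))\<^sup>2) \<in> borel_measurable lborel" for j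
    by (rule borel_measurable_integrable[OF weighted_integrable(1)[OF Z C1_real_cont[OF ramp_deriv[OF t]]]])
  have out: "Z z = 0" if "\<not> snd z < b" for z using Z U_out[of z] that by (auto simp: \<Omega>_iff)
  show "AE z in lborel. norm (ramp (?t j) (snd z) * (cmod (Z z))\<^sup>2) \<le> (cmod (Z z))\<^sup>2" for j
  proof (intro AE_I2)
    fix z show "norm (ramp (?t j) (snd z) * (cmod (Z z))\<^sup>2) \<le> (cmod (Z z))\<^sup>2"
    proof (cases "snd z < b")
      case True
      then show ?thesis using ramp_bounds[OF t, of "snd z" j] by (simp add: abs_mult mult_left_le_one_le)
    qed (simp add: out)
  qed
  show "AE z in lborel. (\<lambda>j. ramp (?t j) (snd z) * (cmod (Z z))\<^sup>2) \<longlonglongrightarrow> (cmod (Z z))\<^sup>2"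
  proof (intro AE_I2)
    fix z show "(\<lambda>j. ramp (?t j) (snd z) * (cmod (Z z))\<^sup>2) \<longlonglongrightarrow> (cmod (Z z))\<^sup>2"
    proof (cases "snd z < b")
      case True
      have "?t \<longlonglongrightarrow> b - 0"
        by (intro tendsto_diff tendsto_const LIMSEQ_Suc lim_const_over_n)
      then have "\<forall>\<^sub>F j in sequentially. snd z < ?t j" using True by (intro order_tendstoD(1)[of ?t b]) auto
      then have "\<forall>\<^sub>F j in sequentially. ramp (?t j) (snd z) * (cmod (Z z))\<^sup>2 = (cmod (Z z))\<^sup>2"
        by eventually_elim (use ramp_below[OF t] in simp)
      then show ?thesis by (rule tendsto_eventually)
    qed (simp add: out)
  qed
qed

text \<open>
  Let the profile tend to 1 on the whole domain, that is \<open>t \<rightarrow> b\<close>.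
\<close>

lemma norm_bounds:
  assumes c: "\<And>x. x \<in> {0..\<Lambda>} \<Longrightarrow> c < f x"
  shows "sq_norm lborel U1 + sq_norm lborel U2 \<le> k\<^sup>2 * sq_norm lborel U + 4 * \<Lambda> * k"
    and "sq_norm lborel U2 \<le> 2 * \<Lambda> * k + 10 * \<Lambda> * k\<^sup>2 * (b - c)"
proof -
  let ?t = "\<lambda>j. b - (b - m) / real (Suc j)"
  have t: "m \<le> ?t j" "?t j < b" for j
  proof -
    have "(b - m) / real (Suc j) \<le> (b - m) / 1" using m(1) by (intro divide_left_mono) auto
    then show "m \<le> ?t j" by simp
  qed (use m(1) in simp)
  have bk: "4 * \<Lambda> * \<beta> \<le> 4 * \<Lambda> * k" using beta_le_k \<Lambda> by simp
  have rc: "continuous_on UNIV (\<lambda>x::real\<times>real. complex_of_real (ramp (?t j) (snd x)))" for j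
    by (rule C1_real_cont[OF ramp_deriv[OF t(2)]])
  have "sq_norm lborel U1 + sq_norm lborel U2 - k\<^sup>2 * sq_norm lborel U \<le> 4 * \<Lambda> * \<beta>"
  proof (rule LIMSEQ_le_const2)
    show "(\<lambda>j. LINT z|lborel. ramp (?t j) (snd z) * energy z) \<longlonglongrightarrow> sq_norm lborel U1 + sq_norm lborel U2 - k\<^sup>2 * sq_norm lborel U"
      unfolding energy_integrable(2)[OF rc] by (intro tendsto_diff tendsto_add tendsto_mult tendsto_const ramp_limit) auto
    show "\<exists>N. \<forall>j\<ge>N. (LINT z|lborel. ramp (?t j) (snd z) * energy z) \<le> 4 * \<Lambda> * \<beta>"
      using ramp_estimates(1)[OF t c] by blast
  qed
  then show "sq_norm lborel U1 + sq_norm lborel U2 \<le> k\<^sup>2 * sq_norm lborel U + 4 * \<Lambda> * k" using bk by simp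
  have "2 * sq_norm lborel U2 \<le> 4 * \<Lambda> * \<beta> + 20 * \<Lambda> * k\<^sup>2 * (b - c)"
  proof (rule LIMSEQ_le_const2)
    show "(\<lambda>j. 2 * (LINT z|lborel. ramp (?t j) (snd z) * (cmod (U2 z))\<^sup>2)) \<longlonglongrightarrow> 2 * sq_norm lborel U2"
      by (intro tendsto_mult tendsto_const ramp_limit) auto
    show "\<exists>N. \<forall>j\<ge>N. 2 * (LINT z|lborel. ramp (?t j) (snd z) * (cmod (U2 z))\<^sup>2) \<le> 4 * \<Lambda> * \<beta> + 20 * \<Lambda> * k\<^sup>2 * (b - c)"
      using ramp_estimates(2)[OF t c] by blast
  qed
  then show "sq_norm lborel U2 \<le> 2 * \<Lambda> * k + 10 * \<Lambda> * k\<^sup>2 * (b - c)" using bk by simp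
qed

text \<open>
  The energy bounds the gradient by \<open>k\<^sup>2\<close> times the norm of \<open>U\<close>, the Poincare inequality bounds the latter by \<open>U2\<close>, and \<open>U2\<close>
  has been bounded by the data. All powers of \<open>b - c\<close> are collected in \<open>b - c + 1 \<le> b (2 - c)\<close>, which holds for \<open>b \<ge> 1\<close> and \<open>c \<le> 0\<close>.
\<close>

lemma a_priori_bound:
  assumes c: "\<And>x. x \<in> {0..\<Lambda>} \<Longrightarrow> c < f x" "c \<le> 0" and k1: "1 \<le> k" and b1: "1 < b"
  shows "grad_L2norm \<Omega> u + k * L2norm \<Omega> u \<le> sqrt (88 * \<Lambda> * (2 - c) ^ 3) * k\<^sup>2 * b ^ 3"
proof (rule power2_le_imp_le)
  let ?N = "sq_norm lborel U" and ?N1 = "sq_norm lborel U1" and ?N2 = "sq_norm lborel U2"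
  define s where "s = b - c + 1"
  note nb = norm_bounds[OF c(1)]
  have g2: "(grad_L2norm \<Omega> u)\<^sup>2 = ?N1 + ?N2"
    unfolding grad_L2norm_def U1_def U2_def by (simp add: L2norm_zext[symmetric])
  have l2: "(L2norm \<Omega> u)\<^sup>2 = ?N" unfolding U_def by (rule L2norm_zext)
  have s: "1 \<le> s" "0 \<le> b - c" "b - c \<le> s" using b1 c(2) by (auto simp: s_def)
  have sb: "s \<le> b * (2 - c)"
  proof -
    have "0 \<le> (b - 1) * (1 - c)" using b1 c(2) by (intro mult_nonneg_nonneg) auto
    then show ?thesis by (simp add: s_def algebra_simps)
  qed
  have kk: "k \<le> k\<^sup>2" using k1 by (simp add: power2_eq_square)
  have "k ^ 1 \<le> k ^ 4" using k1 by (intro power_increasing) auto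
  then have k4: "k \<le> k ^ 4" by simp
  have N2: "?N2 \<le> 10 * \<Lambda> * k\<^sup>2 * s"
  proof -
    have "2 * (\<Lambda> * k) \<le> 10 * (\<Lambda> * k\<^sup>2)" using kk \<Lambda> k1 by (intro mult_mono) auto
    then show ?thesis using nb(2) by (simp add: s_def algebra_simps)
  qed
  have N0: "0 \<le> ?N2" by (simp add: sq_norm_def)
  have "?N \<le> 2 * s\<^sup>2 * ?N2"
  proof -
    have "(b - c)\<^sup>2 \<le> s\<^sup>2" using s by (intro power_mono) auto
    then have "2 * (b - c)\<^sup>2 * ?N2 \<le> 2 * s\<^sup>2 * ?N2" by (intro mult_right_mono N0) auto
    then show ?thesis using Poincare[OF c(1)] by linarith
  qed
  also have "\<dots> \<le> 2 * s\<^sup>2 * (10 * \<Lambda> * k\<^sup>2 * s)" by (intro mult_left_mono N2) auto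
  finally have N: "?N \<le> 20 * \<Lambda> * k\<^sup>2 * s ^ 3" by (simp add: power2_eq_square power3_eq_cube mult_ac)
  have "(grad_L2norm \<Omega> u + k * L2norm \<Omega> u)\<^sup>2 \<le> 2 * ((grad_L2norm \<Omega> u)\<^sup>2 + (k * L2norm \<Omega> u)\<^sup>2)"
    using sum_squares_ge_zero[of "grad_L2norm \<Omega> u - k * L2norm \<Omega> u" 0] by (simp add: power2_eq_square algebra_simps)
  also have "\<dots> = 2 * (?N1 + ?N2 + k\<^sup>2 * ?N)" by (simp add: g2 l2 power_mult_distrib)
  also have "\<dots> \<le> 4 * (k\<^sup>2 * ?N) + 8 * \<Lambda> * k" using nb(1) by simp
  also have "\<dots> \<le> 4 * (k\<^sup>2 * (20 * \<Lambda> * k\<^sup>2 * s ^ 3)) + 8 * (\<Lambda> * (k ^ 4 * s ^ 3))"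
  proof -
    have "k * 1 \<le> k ^ 4 * s ^ 3" using k4 k s(1) by (intro mult_mono one_le_power) auto
    then have "8 * (\<Lambda> * k) \<le> 8 * (\<Lambda> * (k ^ 4 * s ^ 3))" using \<Lambda> by simp
    moreover have "k\<^sup>2 * ?N \<le> k\<^sup>2 * (20 * \<Lambda> * k\<^sup>2 * s ^ 3)" by (intro mult_left_mono N) auto
    ultimately show ?thesis by simp
  qed
  also have "\<dots> = 88 * \<Lambda> * k ^ 4 * s ^ 3" by (simp add: eval_nat_numeral)
  also have "\<dots> \<le> 88 * \<Lambda> * k ^ 4 * (b * (2 - c)) ^ 3"
    using s(1) sb \<Lambda> k by (intro mult_left_mono power_mono) auto
  also have "\<dots> = (88 * \<Lambda> * (2 - c) ^ 3) * k ^ 4 * b ^ 3" by (simp add: power_mult_distrib)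
  also have "\<dots> \<le> (88 * \<Lambda> * (2 - c) ^ 3) * k ^ 4 * b ^ 6"
    using c(2) \<Lambda> b1 k by (intro mult_left_mono power_increasing mult_nonneg_nonneg) auto
  also have "\<dots> = (sqrt (88 * \<Lambda> * (2 - c) ^ 3) * k\<^sup>2 * b ^ 3)\<^sup>2"
    using c(2) \<Lambda> by (simp add: power_mult_distrib flip: power_mult)
  finally show "(grad_L2norm \<Omega> u + k * L2norm \<Omega> u)\<^sup>2 \<le> (sqrt (88 * \<Lambda> * (2 - c) ^ 3) * k\<^sup>2 * b ^ 3)\<^sup>2" .
  show "0 \<le> sqrt (88 * \<Lambda> * (2 - c) ^ 3) * k\<^sup>2 * b ^ 3" using c(2) \<Lambda> b1 by simp
qed

end

lemma g_data_norm:
  assumes "\<Lambda> > 0" "\<beta> > 0" shows "L2norm {0..\<Lambda>} (g_data \<alpha> \<beta> b) = 2 * \<beta> * sqrt \<Lambda>"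
proof -
  have "cmod (g_data \<alpha> \<beta> b t) = 2 * \<beta>" for t
    using assms by (simp add: g_data_def norm_mult norm_exp_eq_Re)
  then have "L2norm {0..\<Lambda>} (g_data \<alpha> \<beta> b) = sqrt ((2 * \<beta>)\<^sup>2 * \<Lambda>)"
    using assms by (simp add: L2norm_def set_lebesgue_integral_def mult.commute)
  then show ?thesis using assms by (simp add: real_sqrt_mult)
qed

theorem theorem2p1:
  fixes \<Lambda> \<theta> :: real and f :: "real \<Rightarrow> real"
  assumes "\<Lambda> > 0"
    and "- pi / 2 < \<theta>" and "\<theta> < pi / 2"
    and "\<forall>x. f (x + \<Lambda>) = f x"
    and "\<exists>L. L-lipschitz_on UNIV f"
  shows "\<exists>C k0 :: real. \<forall>\<epsilon> b k :: real.
    \<epsilon> > 0 \<and> b > 1 \<and> b > (SUP x\<in>{0..\<Lambda>}. f x) \<and> k > 0 \<and> k \<ge> k0 \<and>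
    (\<forall>n. \<bar>k - alpha_n \<Lambda> (k * sin \<theta>) n\<bar> \<ge> \<epsilon>) \<longrightarrow>
    (\<forall>u. scattering_solution k \<theta> \<Lambda> f b u \<longrightarrow>
       grad_L2norm (domD \<Lambda> f b) u + k * L2norm (domD \<Lambda> f b) u
       \<le> C * max (b\<^sup>2 * k\<^sup>2 / sqrt \<epsilon>) (b ^ 3 * k powr (5 / 2))
           * L2norm {0..\<Lambda>} (g_data (k * sin \<theta>) (k * cos \<theta>) b))"
proof -
  obtain L where L: "L-lipschitz_on UNIV f" using assms(5) by blast
  have cont: "continuous_on S f" for S using lipschitz_on_continuous_on[OF L] continuous_on_subset by blast
  have bd: "bounded (f ` {0..\<Lambda>})" by (intro compact_imp_bounded compact_continuous_image cont compact_Icc)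
  obtain c0 where "\<And>x. x \<in> {0..\<Lambda>} \<Longrightarrow> c0 \<le> f x"
    using bounded_imp_bdd_below[OF bd] unfolding bdd_below_def by blast
  then obtain c where c: "\<And>x. x \<in> {0..\<Lambda>} \<Longrightarrow> c < f x" "c \<le> 0"
    by (intro that[of "min 0 c0 - 1"]) (force simp: min_def)+
  have cos: "cos \<theta> > 0" using assms(2,3) cos_gt_zero_pi[of \<theta>] by simp
  define M where "M = sqrt (88 * \<Lambda> * (2 - c) ^ 3)"
  \<comment> \<open>The norm of \<open>g\<close> is \<open>2 * k * cos \<theta> * sqrt \<Lambda>\<close>; the constant divides its fixed part out.\<close>
  define C where "C = M / (2 * cos \<theta> * sqrt \<Lambda>)"
  have M: "0 \<le> M" using assms(1) c(2) by (simp add: M_def)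
  have C: "0 \<le> C" using M cos assms(1) by (simp add: C_def)
  have main: "grad_L2norm (domD \<Lambda> f b) u + k * L2norm (domD \<Lambda> f b) u
       \<le> C * max (b\<^sup>2 * k\<^sup>2 / sqrt \<epsilon>) (b ^ 3 * k powr (5 / 2)) * L2norm {0..\<Lambda>} (g_data (k * sin \<theta>) (k * cos \<theta>) b)"
    if b: "b > 1" "b > (SUP x\<in>{0..\<Lambda>}. f x)" and k1: "k \<ge> 1" and u: "scattering_solution k \<theta> \<Lambda> f b u" for \<epsilon> b k u
  proof -
    have below: "f x < b" if "x \<in> {0..\<Lambda>}" for x
      using cSUP_upper[OF that bounded_imp_bdd_above[OF bd]] b(2) by simp
    have per: "f \<Lambda> = f 0" using assms(4)[rule_format, of 0] by simp
    interpret graph_domain \<Lambda> b L f by unfold_locales (use assms(1) L per below in auto)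
    obtain m where m: "m < b" "\<And>x. x \<in> {0..\<Lambda>} \<Longrightarrow> f x < m" using f_upper by blast
    interpret scattering \<Lambda> b L f m k \<theta> u by unfold_locales (use m k1 assms(2,3) u in auto)
    have g: "L2norm {0..\<Lambda>} (g_data (k * sin \<theta>) (k * cos \<theta>) b) = 2 * (k * cos \<theta>) * sqrt \<Lambda>"
      by (rule g_data_norm) (use assms(1) cos k1 in auto)
    have "k powr 1 \<le> k powr (5 / 2)" using k1 by (intro powr_mono) auto
    then have kp: "k \<le> k powr (5 / 2)" using k1 by simp
    have "grad_L2norm (domD \<Lambda> f b) u + k * L2norm (domD \<Lambda> f b) u \<le> M * k\<^sup>2 * b ^ 3"
      unfolding M_def by (rule a_priori_bound[OF c k1 b(1)])
    also have "\<dots> = M * (b ^ 3 * k) * k" by (simp add: power2_eq_square mult_ac)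
    also have "\<dots> \<le> M * (b ^ 3 * k powr (5 / 2)) * k"
      using M k1 b(1) kp by (intro mult_right_mono mult_left_mono) auto
    also have "\<dots> = C * (b ^ 3 * k powr (5 / 2)) * (2 * (k * cos \<theta>) * sqrt \<Lambda>)"
      using cos assms(1) by (simp add: C_def)
    also have "\<dots> \<le> C * max (b\<^sup>2 * k\<^sup>2 / sqrt \<epsilon>) (b ^ 3 * k powr (5 / 2)) * (2 * (k * cos \<theta>) * sqrt \<Lambda>)"
      using C k1 cos assms(1) by (intro mult_right_mono mult_left_mono) auto
    finally show ?thesis unfolding g .
  qed
  show ?thesis
    by (intro exI[of _ C] exI[of _ 1] allI impI) (use main in blast)
qed

end
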